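(* For every integer $n \geq 1$ and every $\Lambda \geq 0$ there exists a constant $C_0 = C_0(n,\Lambda) > 0$ such that the following holds. Let $f : \mathbb{R} \to \mathbb{R}^n$ be locally Lipschitz continuous with $\| f|_{[-1,1]} \|_{\mathrm{Lip}} = \Lambda$. Let $M := \mathbb{R}^n$ or $M := \mathbb{T}_L^n = (\mathbb{R}/L\mathbb{Z})^n$ with $L \geq 1$. Let $u_0 \in L^\infty \cap \dot W^{1,1} \cap \dot H^1(M)$ satisfy $$ \| u_0 \|_{L^\infty(M)} \leq 1, \qquad \| \nabla u_0 \|_{L^1(M)} \leq 1, \qquad \| \nabla u_0 \|_{L^2(M)} \leq 1 . $$ Let $\nu > 0$ and let $u^\nu$ be the solution of the viscous scalar conservation law $$ \begin{cases} \partial_t u^\nu + \operatorname{div} f(u^\nu) = \nu \Delta u^\nu, & t > 0, \ x \in M, \\ u^\nu(0,x) = u_0(x), & x \in M . \end{cases} $$ Then $$ \| \nabla u^\nu(t,\cdot) \|_{L^2(M)}^2 \leq C_0 (1 + \nu^{-1}) \qquad \text{for all } t \geq 0 . $$ In particular, $C_0$ depends only on $\Lambda$ and $n$, and not on the choice of domain $M$ (nor on $L$), $u_0$ or $\nu$.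
   Context: Functions are real-valued. $\| f|_{[-1,1]} \|_{\mathrm{Lip}}$ denotes the Lipschitz norm (best Lipschitz constant) of $f$ restricted to $[-1,1]$. The condition $u_0 \in \dot W^{1,1}\cap \dot H^1(M)$ means that the distributional gradient $\nabla u_0$ belongs to $L^1(M)\cap L^2(M)$. The solution $u^\nu$ is the unique global solution, bounded on $(0,T)\times M$ for every $T>0$, understood in the sense of Duhamel's formula $u^\nu(t) = e^{\nu t \Delta} u_0 - \int_0^t \operatorname{div} e^{\nu (t-s)\Delta} f(u^\nu(s)) \, ds$, where $e^{\nu t\Delta}$ is the heat semigroup on $M$ (convolution with the heat kernel; in the periodic case functions on $\mathbb{T}^n_L$ are viewed as periodic functions on $\mathbb{R}^n$). *)

theory Defs
  imports "HOL-Probability.Essential_Supremum"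
begin

text \<open>
  The spatial domain \<open>M\<close> is either the whole space or the torus of side length \<open>L\<close>.
  Functions on the torus are represented by \<open>L\<close>-periodic functions on the whole space, so in both
  cases a function on \<open>M\<close> is a function on the type \<^typ>\<open>real ^ 'n\<close> satisfying \<open>lives_on M\<close>.
  The measure of the torus is Lebesgue measure on the fundamental cell \<open>[0,L)\<^sup>n\<close>.
\<close>

datatype domain = Whole_Space | Torus real

definition lives_on :: "domain \<Rightarrow> (real ^ 'n::finite \<Rightarrow> 'b) \<Rightarrow> bool" where
  "lives_on M g \<longleftrightarrow>
     (case M of Whole_Space \<Rightarrow> True | Torus L \<Rightarrow> (\<forall>x i. g (x + axis i L) = g x))"

definition domain_measure :: "domain \<Rightarrow> (real ^ 'n::finite) measure" where
  "domain_measure M =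
     (case M of Whole_Space \<Rightarrow> lborel
      | Torus L \<Rightarrow> restrict_space lborel {x. \<forall>i. 0 \<le> x $ i \<and> x $ i < L})"

definition in_Lp :: "real \<Rightarrow> 'a measure \<Rightarrow> ('a \<Rightarrow> 'b::euclidean_space) \<Rightarrow> bool" where
  "in_Lp p \<mu> g \<longleftrightarrow> g \<in> borel_measurable \<mu> \<and> integrable \<mu> (\<lambda>x. norm (g x) powr p)"

text \<open>Meaningful only together with \<^const>\<open>in_Lp\<close>.\<close>
definition Lp_norm :: "real \<Rightarrow> 'a measure \<Rightarrow> ('a \<Rightarrow> 'b::euclidean_space) \<Rightarrow> real" where
  "Lp_norm p \<mu> g = (LINT x|\<mu>. norm (g x) powr p) powr (1 / p)"

definition Linf_norm :: "'a measure \<Rightarrow> ('a \<Rightarrow> 'b::euclidean_space) \<Rightarrow> ereal" where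
  "Linf_norm \<mu> g = esssup \<mu> (\<lambda>x. ereal (norm (g x)))"

definition in_Linf :: "'a measure \<Rightarrow> ('a \<Rightarrow> 'b::euclidean_space) \<Rightarrow> bool" where
  "in_Linf \<mu> g \<longleftrightarrow> g \<in> borel_measurable \<mu> \<and> Linf_norm \<mu> g < \<infinity>"

text \<open>Best Lipschitz constant; meaningful for functions that are Lipschitz on \<open>X\<close>.\<close>
definition lip_norm :: "'a::metric_space set \<Rightarrow> ('a \<Rightarrow> 'b::metric_space) \<Rightarrow> real" where
  "lip_norm X f = Inf {C. C-lipschitz_on X f}"

text \<open>The library notion concerns families of maps; here the family is constant.\<close>
definition locally_lipschitz :: "('a::metric_space \<Rightarrow> 'b::metric_space) \<Rightarrow> bool" where
  "locally_lipschitz f \<longleftrightarrow> local_lipschitz (UNIV :: real set) UNIV (\<lambda>_. f)"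

definition partial_deriv :: "'n \<Rightarrow> (real ^ 'n::finite \<Rightarrow> real) \<Rightarrow> real ^ 'n \<Rightarrow> real" where
  "partial_deriv i \<phi> x = frechet_derivative \<phi> (at x) (axis i 1)"

definition divergence :: "(real ^ 'n::finite \<Rightarrow> real ^ 'n) \<Rightarrow> real ^ 'n \<Rightarrow> real" where
  "divergence V x = (\<Sum>i\<in>UNIV. frechet_derivative V (at x) (axis i 1) $ i)"

primrec Ck :: "nat \<Rightarrow> (real ^ 'n::finite \<Rightarrow> real) \<Rightarrow> bool" where
  "Ck 0 \<phi> \<longleftrightarrow> continuous_on UNIV \<phi>"
| "Ck (Suc k) \<phi> \<longleftrightarrow> (\<forall>x. \<phi> differentiable (at x)) \<and> (\<forall>i. Ck k (partial_deriv i \<phi>))"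

text \<open>\<open>C_c\<^sup>\<infinity>(M)\<close>; on the (compact) torus every smooth function qualifies.\<close>
definition test_function :: "domain \<Rightarrow> (real ^ 'n::finite \<Rightarrow> real) \<Rightarrow> bool" where
  "test_function M \<phi> \<longleftrightarrow> (\<forall>k. Ck k \<phi>) \<and> lives_on M \<phi> \<and>
     (M = Whole_Space \<longrightarrow> (\<exists>K. compact K \<and> (\<forall>x. x \<notin> K \<longrightarrow> \<phi> x = 0)))"

definition locally_integrable :: "(real ^ 'n::finite \<Rightarrow> 'b::euclidean_space) \<Rightarrow> bool" where
  "locally_integrable g \<longleftrightarrow> (\<forall>K. compact K \<longrightarrow> set_integrable lborel K g)"

text \<open>The distributional gradient of \<open>u\<close> on \<open>M\<close> is the locally integrable vector field \<open>g\<close>.\<close>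
definition has_weak_gradient ::
    "domain \<Rightarrow> (real ^ 'n::finite \<Rightarrow> real) \<Rightarrow> (real ^ 'n \<Rightarrow> real ^ 'n) \<Rightarrow> bool" where
  "has_weak_gradient M u g \<longleftrightarrow>
     lives_on M u \<and> lives_on M g \<and> locally_integrable u \<and> locally_integrable g \<and>
     (\<forall>\<phi> i. test_function M \<phi> \<longrightarrow>
        (LINT x|domain_measure M. u x * partial_deriv i \<phi> x)
          = - (LINT x|domain_measure M. g x $ i * \<phi> x))"

definition heat_kernel :: "real \<Rightarrow> real ^ 'n::finite \<Rightarrow> real" where
  "heat_kernel t x = exp (- (norm x)\<^sup>2 / (4 * t)) / (4 * pi * t) powr (real CARD('n) / 2)"

text \<open>\<open>e\<^bsup>t\<Delta>\<^esup> g\<close>. For periodic \<open>g\<close>, convolution on the whole space is the same as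
  convolution on the torus with the periodised kernel.\<close>
definition heat_semigroup ::
    "real \<Rightarrow> (real ^ 'n::finite \<Rightarrow> 'b::euclidean_space) \<Rightarrow> real ^ 'n \<Rightarrow> 'b" where
  "heat_semigroup t g x =
     (if t = 0 then g x else (LINT y|lborel. heat_kernel t (x - y) *\<^sub>R g y))"

text \<open>
  \<open>u\<close> is a global solution in Duhamel's sense, bounded on \<open>(0,T) \<times> M\<close> for all \<open>T > 0\<close>.
  It is jointly Borel measurable, and elements of \<open>L\<^sup>\<infinity>(M)\<close> are identified up to null sets,
  which is why the equation and the bound are required almost everywhere in space (at every time).
  The case \<open>t = 0\<close> of Duhamel's formula is the initial condition.
\<close>
definition duhamel_solution ::
    "domain \<Rightarrow> (real \<Rightarrow> real ^ 'n::finite) \<Rightarrow> real \<Rightarrow> (real ^ 'n \<Rightarrow> real)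
       \<Rightarrow> (real \<Rightarrow> real ^ 'n \<Rightarrow> real) \<Rightarrow> bool" where
  "duhamel_solution M f \<nu> u0 u \<longleftrightarrow>
     (\<forall>t\<ge>0. lives_on M (u t)) \<and>
     (\<lambda>(t, x). u t x) \<in> borel_measurable (restrict_space borel ({0..} \<times> UNIV)) \<and>
     (\<forall>T>0. \<exists>B::real. \<forall>t\<in>{0<..<T}. Linf_norm (domain_measure M) (u t) \<le> ereal B) \<and>
     (\<forall>t\<ge>0. AE x in domain_measure M.
        u t x = heat_semigroup (\<nu> * t) u0 x
          - (LINT s:{0..t}|lborel.
               divergence (heat_semigroup (\<nu> * (t - s)) (\<lambda>y. f (u s y))) x))"

end

theory Submission
  imports Defs "HOL-Probability.Distributions"
begin

text \<open>
  After the change of time \<open>t \<mapsto> \<nu> t\<close> the viscosity is 1 and the flux \<open>F = f / \<nu>\<close> has the Lipschitz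
  constant \<open>K = (\<Lambda> + 1) / \<nu>\<close>. The one-step operator \<open>v \<mapsto> e\<^bsup>h\<Delta>\<^esup> v - h div e\<^bsup>h\<Delta>\<^esup> F(v)\<close> averages
  \<open>v + z \<bullet> F(v) / 2\<close> against the heat kernel, hence is monotone up to \<open>O(h\<^sup>2)\<close>, and its iterates converge
  to the solution as \<open>h \<rightarrow> 0\<close>. This gives the maximum principle and the contraction
  \<open>\<integral>|u(t, x + a) - u(t, x)| dx \<le> \<integral>|u\<^sub>0(x + a) - u\<^sub>0(x)| dx\<close>. Let \<open>H\<close> be the dimensional constant for which
  \<open>div e\<^bsup>t\<Delta>\<^esup>\<close> has norm at most \<open>H / \<surd>t\<close>, and let \<open>\<tau>\<close> be the time scale \<open>1 / (12 H K)\<^sup>2\<close>.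
  For \<open>t \<le> \<tau>\<close>, Duhamel's formula bounds the mean square of the increment by 4 times its initial value.
  For \<open>t \<ge> \<tau>\<close>, restarting at \<open>t - \<tau>\<close> bounds the increment pointwise by \<open>2 H |a| / \<surd>\<tau> = 24 H\<^sup>2 K |a|\<close>,
  and the mean square is at most this supremum times the contracted mean. Dividing by \<open>|a|\<^sup>2\<close> and
  letting \<open>a \<rightarrow> 0\<close> along the axes gives the bound \<open>n (4 + 24 H\<^sup>2 K)\<close>.
\<close>

section \<open>The heat kernel\<close>

text \<open>A mild solution has only the regularity that Duhamel's formula gives it, so testing the
  equation with the sign of an increment would first need a smoothing argument. The steps of the
  scheme are explicit averages, and both the maximum principle and the contraction reduce to
  pointwise inequalities under one Gaussian integral. A defect O(h^2) per step is harmless over t /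
  h steps; a defect O(h) would leave a factor exp (c t). Short-time estimates alone cannot suffice:
  repeating the factor 4 over t / \<tau> windows grows exponentially. The contraction has constant 1
  and survives any number of restarts, and the pointwise bound looks back over one window only.
  Their product is linear in K, hence in 1 / \<nu>; squaring the pointwise bound would give K^2
  times the volume of M. Increments replace derivatives because they make sense for bounded
  functions, satisfy an equation of the same form, and pass to the limit by Fatou's lemma. Estimates
  are closed by absorbing half of a supremum, and this fixes the 12 in \<tau>: the singular Duhamel
  integral costs 6 H K.\<close>

lemma lborel_distr_reflect: "distr lborel borel (\<lambda>z. x - z) = (lborel :: 'a::euclidean_space measure)"
proof -
  have "(lborel :: 'a measure) = density (distr lborel borel (\<lambda>z. x + (-1) *\<^sub>R z)) (\<lambda>_. \<bar>-1::real\<bar>^DIM('a))"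
    by (rule lborel_affine) simp
  then show ?thesis by (simp add: density_1)
qed

lemma lborel_distr_shift: "distr lborel borel (\<lambda>z. z + a) = (lborel :: 'a::euclidean_space measure)"
proof -
  have "(lborel :: 'a measure) = density (distr lborel borel (\<lambda>z. a + 1 *\<^sub>R z)) (\<lambda>_. \<bar>1::real\<bar>^DIM('a))"
    by (rule lborel_affine) simp
  then show ?thesis by (simp add: density_1 add.commute)
qed

lemma integral_reflect:
  fixes h :: "'a::euclidean_space \<Rightarrow> 'b::{banach, second_countable_topology}"
  assumes [measurable]: "h \<in> borel_measurable borel"
  shows "(LINT z|lborel. h (x - z)) = integral\<^sup>L lborel h"
proof -
  have "integral\<^sup>L (distr lborel borel (\<lambda>z. x - z)) h = (LINT z|lborel. h (x - z))"
    by (rule integral_distr) auto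
  then show ?thesis by (simp add: lborel_distr_reflect)
qed

lemma integrable_reflect:
  fixes h :: "'a::euclidean_space \<Rightarrow> 'b::{banach, second_countable_topology}"
  assumes "integrable lborel h"
  shows "integrable lborel (\<lambda>z. h (x - z))"
  by (rule integrable_distr[of _ _ borel]) (auto simp: lborel_distr_reflect assms)

lemma nn_integral_shift:
  fixes h :: "'a::euclidean_space \<Rightarrow> ennreal"
  assumes [measurable]: "h \<in> borel_measurable borel"
  shows "(\<integral>\<^sup>+z. h (z + a) \<partial>lborel) = integral\<^sup>N lborel h"
proof -
  have "integral\<^sup>N (distr lborel borel (\<lambda>z. z + a)) h = (\<integral>\<^sup>+z. h (z + a) \<partial>lborel)"
    by (rule nn_integral_distr) auto
  then show ?thesis by (simp add: lborel_distr_shift)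
qed

lemma integral_shift:
  fixes h :: "'a::euclidean_space \<Rightarrow> 'b::{banach, second_countable_topology}"
  assumes [measurable]: "h \<in> borel_measurable borel"
  shows "(LINT z|lborel. h (z + a)) = integral\<^sup>L lborel h"
proof -
  have "integral\<^sup>L (distr lborel borel (\<lambda>z. z + a)) h = (LINT z|lborel. h (z + a))"
    by (rule integral_distr) auto
  then show ?thesis by (simp add: lborel_distr_shift)
qed

lemma integrable_shift:
  fixes h :: "'a::euclidean_space \<Rightarrow> 'b::{banach, second_countable_topology}"
  assumes "integrable lborel h"
  shows "integrable lborel (\<lambda>z. h (z + a))"
  by (rule integrable_distr[of _ _ borel]) (auto simp: lborel_distr_shift assms)

lemma integrable_dominated:
  fixes g :: "'a \<Rightarrow> 'b::{banach, second_countable_topology}"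
  assumes "integrable M f" "g \<in> borel_measurable M" "\<And>x. norm (g x) \<le> f x"
  shows "integrable M g"
  using assms(1,2) by (rule Bochner_Integration.integrable_bound) (auto intro!: AE_I2 order_trans[OF assms(3)])

section \<open>Positivity and total mass of the kernel\<close>

lemma heat_kernel_nonneg: "heat_kernel t z \<ge> 0"
  by (simp add: heat_kernel_def)

lemma heat_kernel_measurable2 [measurable (raw)]:
  assumes [measurable]: "f \<in> borel_measurable M" "g \<in> borel_measurable M"
  shows "(\<lambda>w. heat_kernel (f w) (g w :: real ^ 'n::finite)) \<in> borel_measurable M"
  unfolding heat_kernel_def by measurable

lemma heat_kernel_uminus: "heat_kernel t (- z) = heat_kernel t z"
  by (simp add: heat_kernel_def)

text \<open>The factors are normal densities of variance 2 t, so that the total mass follows from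
  the one-dimensional one by Tonelli over the coordinates.\<close>

lemma heat_kernel_prod:
  fixes z :: "real ^ 'n::finite"
  assumes "t > 0"
  shows "heat_kernel t z = (\<Prod>b\<in>Basis. normal_density 0 (sqrt (2 * t)) (z \<bullet> b))"
proof -
  have 1: "normal_density 0 (sqrt (2 * t)) y = (1 / sqrt (4 * pi * t)) * exp (- y\<^sup>2 / (4 * t))" for y
    using assms by (simp add: normal_density_def)
  have c: "4 * pi * t > 0" using assms by simp
  have "sqrt (4 * pi * t) ^ CARD('n) = sqrt ((4 * pi * t) ^ CARD('n))" by (rule real_sqrt_power[symmetric])
  also have "(4 * pi * t) ^ CARD('n) = (4 * pi * t) powr real CARD('n)" by (rule powr_realpow[OF c, symmetric])
  also have "sqrt \<dots> = (4 * pi * t) powr (real CARD('n) / 2)"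
    by (rule powr_half_sqrt_powr[symmetric]) (use c in linarith)
  finally have 2: "sqrt (4 * pi * t) ^ CARD('n) = (4 * pi * t) powr (real CARD('n) / 2)" .
  have 3: "(\<Sum>b\<in>Basis. (z \<bullet> b)\<^sup>2) = (norm z)\<^sup>2"
    by (subst power2_norm_eq_inner, subst euclidean_inner) (simp add: power2_eq_square)
  have "(\<Prod>b\<in>Basis. normal_density 0 (sqrt (2 * t)) (z \<bullet> b))
      = (1 / sqrt (4 * pi * t)) ^ CARD('n) * exp (\<Sum>b\<in>Basis. - (z \<bullet> b)\<^sup>2 / (4 * t))"
    unfolding 1 prod.distrib by (simp add: exp_sum)
  also have "(\<Sum>b\<in>Basis. - (z \<bullet> b)\<^sup>2 / (4 * t)) = - (norm z)\<^sup>2 / (4 * t)"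
    by (simp only: sum_divide_distrib[symmetric] sum_negf 3)
  finally show ?thesis unfolding heat_kernel_def power_divide 2 by simp
qed

lemma heat_kernel_nn_integral:
  assumes "t > 0"
  shows "(\<integral>\<^sup>+z. heat_kernel t (z :: real ^ 'n::finite) \<partial>lborel) = 1"
proof -
  have "(\<integral>\<^sup>+z. heat_kernel t (z :: real ^ 'n) \<partial>lborel)
      = (\<integral>\<^sup>+z. (\<Prod>b\<in>Basis. ennreal (normal_density 0 (sqrt (2 * t)) ((z :: real ^ 'n) \<bullet> b))) \<partial>lborel)"
    by (simp add: heat_kernel_prod[OF assms] prod_ennreal)
  also have "\<dots> = (\<Prod>b\<in>(Basis :: (real ^ 'n) set). (\<integral>\<^sup>+x. ennreal (normal_density 0 (sqrt (2 * t)) x) \<partial>lborel))"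
    by (rule nn_integral_lborel_prod) auto
  also have "(\<integral>\<^sup>+x. ennreal (normal_density 0 (sqrt (2 * t)) x) \<partial>lborel) = 1"
    using assms by (subst nn_integral_eq_integral) auto
  finally show ?thesis by simp
qed

lemma heat_kernel_integrable:
  "t > 0 \<Longrightarrow> integrable lborel (heat_kernel t :: real ^ 'n::finite \<Rightarrow> real)"
  by (rule integrableI_nonneg) (auto simp: heat_kernel_nonneg heat_kernel_nn_integral)

lemma heat_kernel_integral:
  "t > 0 \<Longrightarrow> integral\<^sup>L lborel (heat_kernel t :: real ^ 'n::finite \<Rightarrow> real) = 1"
  by (simp add: integral_eq_nn_integral heat_kernel_nonneg heat_kernel_nn_integral)

section \<open>Pointwise bounds for the gradient and the moments of the kernel\<close>

definition heat_grad :: "real \<Rightarrow> real ^ 'n::finite \<Rightarrow> real ^ 'n" where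
  "heat_grad t z = - (heat_kernel t z / (2 * t)) *\<^sub>R z"

text \<open>The single dimensional constant of the development. The power of 2 is the ratio of the
  normalising factors at times 2 t and t, and 3 is an upper bound for sqrt 8.\<close>

definition heat_const :: "'n::finite itself \<Rightarrow> real" where
  "heat_const _ = 3 * 2 powr (real CARD('n) / 2)"

lemma heat_const_pos: "heat_const TYPE('n::finite) > 0"
  by (simp add: heat_const_def)

lemma heat_grad_measurable [measurable (raw)]:
  assumes [measurable]: "f \<in> borel_measurable M" "g \<in> borel_measurable M"
  shows "(\<lambda>w. heat_grad (f w) (g w :: real ^ 'n::finite)) \<in> borel_measurable M"
  unfolding heat_grad_def by measurable

text \<open>Half of the Gaussian exponent is set aside. The spare factor absorbs polynomial weights,
  so that weighted kernels are dominated pointwise by a multiple of the kernel at time 2 t, whose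
  integral is 1; no moment has to be computed.\<close>

lemma heat_kernel_double:
  fixes z :: "real ^ 'n::finite"
  assumes "t > 0"
  shows "heat_kernel t z = 2 powr (real CARD('n) / 2) * exp (- (norm z)\<^sup>2 / (8 * t)) * heat_kernel (2 * t) z"
proof -
  have e1: "(4 * pi * (2 * t)) powr q = 2 powr q * (4 * pi * t) powr q" for q
    using powr_mult[of 2 "4 * pi * t" q] by (simp add: mult.assoc)
  have "- (norm z)\<^sup>2 / (4 * t) = - (norm z)\<^sup>2 / (8 * t) + - (norm z)\<^sup>2 / (4 * (2 * t))"
    using assms by (simp add: divide_simps)
  then have e2: "exp (- (norm z)\<^sup>2 / (4 * t)) = exp (- (norm z)\<^sup>2 / (8 * t)) * exp (- (norm z)\<^sup>2 / (4 * (2 * t)))"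
    by (simp only: exp_add)
  have D: "x * y / p = a * x * (y / (a * p))" if "a \<noteq> 0" for a x y p :: real
    using that by simp
  show ?thesis unfolding heat_kernel_def e1 e2 by (rule D) simp
qed

lemma heat_kernel_moment_aux:
  fixes z :: "real ^ 'n::finite"
  assumes t: "t > 0" and a: "a * exp (- (norm z)\<^sup>2 / (8 * t)) \<le> 3 * c"
  shows "a * heat_kernel t z \<le> heat_const TYPE('n) * c * heat_kernel (2 * t) z"
proof -
  define P where "P = 2 powr (real CARD('n) / 2) * heat_kernel (2 * t) z"
  have P: "P \<ge> 0" by (simp add: P_def heat_kernel_nonneg)
  have "a * heat_kernel t z = (a * exp (- (norm z)\<^sup>2 / (8 * t))) * P"
    unfolding heat_kernel_double[OF t] P_def by (simp only: ac_simps)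
  also have "\<dots> \<le> 3 * c * P" using a P by (rule mult_right_mono)
  also have "\<dots> = heat_const TYPE('n) * c * heat_kernel (2 * t) z"
    unfolding heat_const_def P_def by (simp only: ac_simps)
  finally show ?thesis .
qed

lemma heat_kernel_moment1:
  fixes z :: "real ^ 'n::finite"
  assumes "t > 0"
  shows "norm z * heat_kernel t z \<le> heat_const TYPE('n) * sqrt t * heat_kernel (2 * t) z"
proof (rule heat_kernel_moment_aux[OF assms])
  define y where "y = norm z / sqrt (8 * t)"
  have nz: "norm z = sqrt (8 * t) * y" using assms by (simp add: y_def)
  have "y\<^sup>2 = (norm z)\<^sup>2 / (8 * t)" using assms by (simp add: y_def power_divide)
  then have ex: "exp (- (norm z)\<^sup>2 / (8 * t)) = exp (- (y\<^sup>2))" by simp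
  have "0 \<le> (y - 1 / 2)\<^sup>2" by simp
  then have "y \<le> 1 + y\<^sup>2" by (simp add: power2_eq_square algebra_simps)
  also have "\<dots> \<le> exp (y\<^sup>2)" by simp
  finally have ye: "y * exp (- (y\<^sup>2)) \<le> 1"
    by (simp add: exp_minus divide_inverse[symmetric] pos_divide_le_eq)
  have s8: "sqrt 8 \<le> (3::real)" by (rule real_le_lsqrt) auto
  have "norm z * exp (- (norm z)\<^sup>2 / (8 * t)) = sqrt (8 * t) * (y * exp (- (y\<^sup>2)))"
    unfolding ex by (simp add: nz)
  also have "\<dots> \<le> sqrt (8 * t) * 1" by (rule mult_left_mono[OF ye]) (use assms in simp)
  also have "\<dots> = sqrt 8 * sqrt t" by (simp only: real_sqrt_mult mult_1_right)
  also have "\<dots> \<le> 3 * sqrt t" by (rule mult_right_mono[OF s8]) (use assms in simp)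
  finally show "norm z * exp (- (norm z)\<^sup>2 / (8 * t)) \<le> 3 * sqrt t" .
qed

text \<open>This moment measures how far one step of the scheme fails to be monotone. The constant
  comes from 64 * 2 = 128 \<le> 3 * 50, where the 2 is the bound for y^2 * exp (- y).\<close>

lemma heat_kernel_moment4:
  fixes z :: "real ^ 'n::finite"
  assumes "t > 0"
  shows "norm z ^ 4 * heat_kernel t z \<le> heat_const TYPE('n) * (50 * t\<^sup>2) * heat_kernel (2 * t) z"
proof (rule heat_kernel_moment_aux[OF assms])
  define y where "y = (norm z)\<^sup>2 / (8 * t)"
  have y0: "y \<ge> 0" using assms by (simp add: y_def)
  have "(norm z)\<^sup>2 = 8 * t * y" using assms by (simp add: y_def)
  then have "((norm z)\<^sup>2)\<^sup>2 = (8 * t * y)\<^sup>2" by (simp only:)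
  then have nz: "norm z ^ 4 = 64 * t\<^sup>2 * y\<^sup>2" unfolding power_mult_distrib power_mult[symmetric] by simp
  have ex: "exp (- (norm z)\<^sup>2 / (8 * t)) = exp (- y)" by (simp add: y_def)
  have "y\<^sup>2 / 2 \<le> exp y" using exp_lower_Taylor_quadratic[OF y0] y0 by linarith
  then have ye: "y\<^sup>2 * exp (- y) \<le> 2"
    by (simp add: exp_minus divide_inverse[symmetric] pos_divide_le_eq)
  have "norm z ^ 4 * exp (- (norm z)\<^sup>2 / (8 * t)) = 64 * t\<^sup>2 * (y\<^sup>2 * exp (- y))"
    unfolding ex nz by (simp only: mult.assoc)
  also have "\<dots> \<le> 64 * t\<^sup>2 * 2" by (rule mult_left_mono[OF ye]) simp
  also have "\<dots> \<le> 3 * (50 * t\<^sup>2)" by simp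
  finally show "norm z ^ 4 * exp (- (norm z)\<^sup>2 / (8 * t)) \<le> 3 * (50 * t\<^sup>2)" .
qed

text \<open>One moment divided by 2 t leaves the rate 1 / sqrt t. It is integrable at t = 0, which
  makes Duhamel's integral converge for a flux that is merely bounded.\<close>

lemma heat_grad_bound:
  fixes z :: "real ^ 'n::finite"
  assumes "t > 0"
  shows "norm (heat_grad t z) \<le> heat_const TYPE('n) / sqrt t * heat_kernel (2 * t) z"
proof -
  have "norm (heat_grad t z) = norm z * heat_kernel t z / (2 * t)"
    using assms by (simp add: heat_grad_def heat_kernel_nonneg)
  also have "\<dots> \<le> heat_const TYPE('n) * sqrt t * heat_kernel (2 * t) z / (2 * t)"
    using heat_kernel_moment1[OF assms, of z] assms by (intro divide_right_mono) auto
  also have "\<dots> = heat_const TYPE('n) / sqrt t * heat_kernel (2 * t) z / 2"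
    using sqrt_divide_self_eq[of t] assms by (simp add: field_simps)
  also have "\<dots> \<le> heat_const TYPE('n) / sqrt t * heat_kernel (2 * t) z"
    using assms heat_const_pos[where 'n='n] mult_nonneg_nonneg[of "heat_const TYPE('n) / sqrt t" "heat_kernel (2 * t) z"]
    by (simp only: heat_kernel_nonneg) simp
  finally show ?thesis .
qed

lemma heat_grad_integrable:
  assumes "t > 0"
  shows "integrable lborel (\<lambda>z :: real ^ 'n::finite. heat_grad t z)"
proof (rule integrable_dominated)
  show "integrable lborel (\<lambda>z :: real ^ 'n. heat_const TYPE('n) / sqrt t * heat_kernel (2 * t) z)"
    by (rule integrable_mult_right, rule heat_kernel_integrable) (use assms in simp)
  show "norm (heat_grad t z) \<le> heat_const TYPE('n) / sqrt t * heat_kernel (2 * t) z" for z :: "real ^ 'n"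
    by (rule heat_grad_bound[OF assms])
qed measurable

lemma heat_grad_norm_integral:
  assumes "t > 0"
  shows "(LINT z|lborel. norm (heat_grad t (z :: real ^ 'n::finite))) \<le> heat_const TYPE('n) / sqrt t"
proof -
  have "(LINT z|lborel. norm (heat_grad t (z :: real ^ 'n))) \<le> (LINT z|lborel. heat_const TYPE('n) / sqrt t * heat_kernel (2 * t) (z :: real ^ 'n))"
  proof (rule integral_mono)
    show "integrable lborel (\<lambda>z :: real ^ 'n. heat_const TYPE('n) / sqrt t * heat_kernel (2 * t) z)"
      by (rule integrable_mult_right, rule heat_kernel_integrable) (use assms in simp)
    show "integrable lborel (\<lambda>z :: real ^ 'n. norm (heat_grad t z))"
      by (rule integrable_norm[OF heat_grad_integrable[OF assms]])
  qed (rule heat_grad_bound[OF assms])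
  also have "\<dots> = heat_const TYPE('n) / sqrt t" using assms by (simp add: heat_kernel_integral)
  finally show ?thesis .
qed

lemma heat_kernel_moment1_integrable:
  assumes "t > 0"
  shows "integrable lborel (\<lambda>z :: real ^ 'n::finite. norm z * heat_kernel t z)"
proof (rule integrable_dominated)
  show "integrable lborel (\<lambda>z :: real ^ 'n. heat_const TYPE('n) * sqrt t * heat_kernel (2 * t) z)"
    by (rule integrable_mult_right, rule heat_kernel_integrable) (use assms in simp)
  show "norm (norm z * heat_kernel t z) \<le> heat_const TYPE('n) * sqrt t * heat_kernel (2 * t) z" for z :: "real ^ 'n"
    using heat_kernel_moment1[OF assms, of z] by (simp add: heat_kernel_nonneg)
qed measurable

lemma heat_kernel_moment1_integral:
  assumes "t > 0"
  shows "(LINT z|lborel. norm z * heat_kernel t (z :: real ^ 'n::finite)) \<le> heat_const TYPE('n) * sqrt t"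
proof -
  have "(LINT z|lborel. norm z * heat_kernel t (z :: real ^ 'n)) \<le> (LINT z|lborel. heat_const TYPE('n) * sqrt t * heat_kernel (2 * t) (z :: real ^ 'n))"
  proof (rule integral_mono)
    show "integrable lborel (\<lambda>z :: real ^ 'n. heat_const TYPE('n) * sqrt t * heat_kernel (2 * t) z)"
      by (rule integrable_mult_right, rule heat_kernel_integrable) (use assms in simp)
    show "integrable lborel (\<lambda>z :: real ^ 'n. norm z * heat_kernel t z)"
      by (rule heat_kernel_moment1_integrable[OF assms])
  qed (rule heat_kernel_moment1[OF assms])
  also have "\<dots> = heat_const TYPE('n) * sqrt t" using assms by (simp add: heat_kernel_integral)
  finally show ?thesis .
qed

lemma heat_kernel_moment4_integrable:
  assumes "t > 0"
  shows "integrable lborel (\<lambda>z :: real ^ 'n::finite. norm z ^ 4 * heat_kernel t z)"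
proof (rule integrable_dominated)
  show "integrable lborel (\<lambda>z :: real ^ 'n. heat_const TYPE('n) * (50 * t\<^sup>2) * heat_kernel (2 * t) z)"
    by (rule integrable_mult_right, rule heat_kernel_integrable) (use assms in simp)
  show "norm (norm z ^ 4 * heat_kernel t z) \<le> heat_const TYPE('n) * (50 * t\<^sup>2) * heat_kernel (2 * t) z" for z :: "real ^ 'n"
    using heat_kernel_moment4[OF assms, of z] by (simp add: heat_kernel_nonneg)
qed measurable

lemma heat_kernel_moment4_integral:
  assumes "t > 0"
  shows "(LINT z|lborel. norm z ^ 4 * heat_kernel t (z :: real ^ 'n::finite)) \<le> heat_const TYPE('n) * (50 * t\<^sup>2)"
proof -
  have "(LINT z|lborel. norm z ^ 4 * heat_kernel t (z :: real ^ 'n)) \<le> (LINT z|lborel. heat_const TYPE('n) * (50 * t\<^sup>2) * heat_kernel (2 * t) (z :: real ^ 'n))"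
  proof (rule integral_mono)
    show "integrable lborel (\<lambda>z :: real ^ 'n. heat_const TYPE('n) * (50 * t\<^sup>2) * heat_kernel (2 * t) z)"
      by (rule integrable_mult_right, rule heat_kernel_integrable) (use assms in simp)
    show "integrable lborel (\<lambda>z :: real ^ 'n. norm z ^ 4 * heat_kernel t z)"
      by (rule heat_kernel_moment4_integrable[OF assms])
  qed (rule heat_kernel_moment4[OF assms])
  also have "\<dots> = heat_const TYPE('n) * (50 * t\<^sup>2)" using assms by (simp add: heat_kernel_integral)
  finally show ?thesis .
qed

text \<open>Completing the square: this makes the semigroup property a consequence of normalisation alone.\<close>
lemma heat_kernel_product:
  fixes y z :: "real ^ 'n::finite"
  assumes "t > 0" "s > 0"
  shows "heat_kernel t z * heat_kernel s (y - z)
       = heat_kernel (t + s) y * heat_kernel (t * s / (t + s)) (z - (t / (t + s)) *\<^sub>R y)"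
proof -
  have ts: "t + s > 0" using assms by simp
  have e: "- (norm z)\<^sup>2 / (4 * t) + - (norm (y - z))\<^sup>2 / (4 * s)
      = - (norm y)\<^sup>2 / (4 * (t + s)) + - (norm (z - (t / (t + s)) *\<^sub>R y))\<^sup>2 / (4 * (t * s / (t + s)))"
  proof -
    define a b c where "a = z \<bullet> z" and "b = z \<bullet> y" and "c = y \<bullet> y"
    have 1: "(norm z)\<^sup>2 = a" "(norm y)\<^sup>2 = c" "(norm (y - z))\<^sup>2 = c - 2 * b + a"
      unfolding power2_norm_eq_inner a_def b_def c_def by (simp_all add: inner_diff inner_commute)
    have 2: "(norm (z - (t / (t + s)) *\<^sub>R y))\<^sup>2 = a - 2 * (t / (t + s)) * b + (t / (t + s))\<^sup>2 * c"
      unfolding power2_norm_eq_inner a_def b_def c_def by (simp add: inner_diff inner_commute power2_eq_square)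
    show ?thesis unfolding 1 2 using assms ts
      by (simp add: divide_simps power2_eq_square) (simp add: algebra_simps)
  qed
  have p: "(4 * pi * t) powr (real CARD('n) / 2) * (4 * pi * s) powr (real CARD('n) / 2)
     = (4 * pi * (t + s)) powr (real CARD('n) / 2) * (4 * pi * (t * s / (t + s))) powr (real CARD('n) / 2)"
  proof -
    have "4 * pi * t * (4 * pi * s) = 4 * pi * (t + s) * (4 * pi * (t * s / (t + s)))"
      using ts by (simp add: field_simps)
    then show ?thesis by (simp only: powr_mult[symmetric])
  qed
  show ?thesis unfolding heat_kernel_def times_divide_times_eq exp_add[symmetric] e p ..
qed

text \<open>Reflection changes the sign of the first moment. Its vanishing makes constants fixed
  points of the scheme and removes the linear flux term from the contraction estimate.\<close>

lemma heat_kernel_odd: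
  assumes "t > 0"
  shows "integrable lborel (\<lambda>z :: real ^ 'n::finite. heat_kernel t z *\<^sub>R z)"
    and "(LINT z|lborel. heat_kernel t z *\<^sub>R (z :: real ^ 'n)) = 0"
proof -
  have "integrable lborel (\<lambda>z :: real ^ 'n. (- 2 * t) *\<^sub>R heat_grad t z)"
    using heat_grad_integrable[OF assms] by (intro integrable_scaleR_right) auto
  then show "integrable lborel (\<lambda>z :: real ^ 'n. heat_kernel t z *\<^sub>R z)"
    using assms by (simp add: heat_grad_def)
  have "(LINT z|lborel. heat_kernel t (0 - z) *\<^sub>R ((0 - z) :: real ^ 'n)) = (LINT z|lborel. heat_kernel t z *\<^sub>R (z :: real ^ 'n))"
    by (rule integral_reflect) measurable
  then have "- (LINT z|lborel. heat_kernel t z *\<^sub>R (z :: real ^ 'n)) = (LINT z|lborel. heat_kernel t z *\<^sub>R (z :: real ^ 'n))"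
    by (simp add: heat_kernel_uminus)
  then have "2 *\<^sub>R (LINT z|lborel. heat_kernel t z *\<^sub>R (z :: real ^ 'n)) = 0"
    by (simp add: scaleR_2 neg_eq_iff_add_eq_0)
  then show "(LINT z|lborel. heat_kernel t z *\<^sub>R (z :: real ^ 'n)) = 0"
    by simp
qed

lemma heat_kernel_convolution:
  fixes y :: "real ^ 'n::finite"
  assumes "t > 0" "s > 0"
  shows "(LINT z|lborel. heat_kernel t z * heat_kernel s (y - z)) = heat_kernel (t + s) y"
proof -
  have "(LINT z|lborel. heat_kernel (t * s / (t + s)) (z + - ((t / (t + s)) *\<^sub>R y))) = 1"
    using assms by (subst integral_shift) (auto intro!: heat_kernel_integral)
  then show ?thesis using assms by (simp add: heat_kernel_product)
qed

text \<open>After completing the square, the factor z is split into its deviation from the centre t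
  / (t + s) * y, which integrates to 0, and the centre itself, which yields the gradient at time t +
  s.\<close>

lemma heat_grad_convolution:
  fixes y :: "real ^ 'n::finite"
  assumes "t > 0" "s > 0"
  shows "(LINT z|lborel. heat_kernel s (y - z) *\<^sub>R heat_grad t z) = heat_grad (t + s) y"
proof -
  let ?r = "t * s / (t + s)" and ?c = "(t / (t + s)) *\<^sub>R y"
  have r: "?r > 0" using assms by simp
  have I1: "integrable lborel (\<lambda>z :: real ^ 'n. heat_kernel ?r (z + - ?c) *\<^sub>R (z + - ?c))"
    by (rule integrable_shift[OF heat_kernel_odd(1)[OF r]])
  have I2: "integrable lborel (\<lambda>z :: real ^ 'n. heat_kernel ?r (z + - ?c) *\<^sub>R ?c)"
    by (intro integrable_scaleR_left integrable_shift heat_kernel_integrable r)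
  have J1: "(LINT z|lborel. heat_kernel ?r (z + - ?c) *\<^sub>R (z + - ?c)) = 0"
    by (subst integral_shift) (use heat_kernel_odd(2)[OF r] in auto)
  have J2: "(LINT z|lborel. heat_kernel ?r (z + - ?c) *\<^sub>R ?c) = ?c"
    using r by (subst integral_scaleR_left)
      (auto simp: integral_shift[where h="heat_kernel ?r"] heat_kernel_integral integrable_shift[OF heat_kernel_integrable[OF r]]
         simp del: add_uminus_conv_diff)
  have "(LINT z|lborel. heat_kernel s (y - z) *\<^sub>R heat_grad t z)
     = (LINT z|lborel. (- heat_kernel (t + s) y / (2 * t)) *\<^sub>R (heat_kernel ?r (z + - ?c) *\<^sub>R (z + - ?c) + heat_kernel ?r (z + - ?c) *\<^sub>R ?c))"
  proof (rule Bochner_Integration.integral_cong)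
    fix z :: "real ^ 'n"
    have "heat_kernel s (y - z) *\<^sub>R heat_grad t z = (- 1 / (2 * t)) *\<^sub>R ((heat_kernel t z * heat_kernel s (y - z)) *\<^sub>R z)"
      by (simp add: heat_grad_def mult_ac)
    also have "\<dots> = (- heat_kernel (t + s) y / (2 * t)) *\<^sub>R (heat_kernel ?r (z - ?c) *\<^sub>R z)"
      unfolding heat_kernel_product[OF assms] by simp
    also have "heat_kernel ?r (z - ?c) *\<^sub>R z = heat_kernel ?r (z + - ?c) *\<^sub>R (z + - ?c) + heat_kernel ?r (z + - ?c) *\<^sub>R ?c"
      by (simp only: scaleR_add_right[symmetric]) simp
    finally show "heat_kernel s (y - z) *\<^sub>R heat_grad t z
      = (- heat_kernel (t + s) y / (2 * t)) *\<^sub>R (heat_kernel ?r (z + - ?c) *\<^sub>R (z + - ?c) + heat_kernel ?r (z + - ?c) *\<^sub>R ?c)" .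
  qed simp
  also have "\<dots> = (- heat_kernel (t + s) y / (2 * t)) *\<^sub>R ?c"
    by (simp only: integral_scaleR_right Bochner_Integration.integral_add[OF I1 I2] J1 J2 add_0)
  also have "\<dots> = heat_grad (t + s) y" using assms by (simp add: heat_grad_def)
  finally show ?thesis .
qed

section \<open>The heat semigroup and its divergence on bounded functions\<close>

text \<open>The kernel carries the integration variable, so that translating the data translates the
  result by mere unfolding; the estimates of increments rest on this.\<close>

definition heat_op :: "real \<Rightarrow> (real ^ 'n::finite \<Rightarrow> 'b::euclidean_space) \<Rightarrow> real ^ 'n \<Rightarrow> 'b" where
  "heat_op t g x = (LINT z|lborel. heat_kernel t z *\<^sub>R g (x - z))"

definition grad_op :: "real \<Rightarrow> (real ^ 'n::finite \<Rightarrow> real ^ 'n) \<Rightarrow> real ^ 'n \<Rightarrow> real" where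
  "grad_op t g x = (LINT z|lborel. heat_grad t z \<bullet> g (x - z))"

definition cv :: "(real ^ 'n::finite \<Rightarrow> real) \<Rightarrow> (real ^ 'n \<Rightarrow> real) \<Rightarrow> real ^ 'n \<Rightarrow> real" where
  "cv k g x = (LINT z|lborel. k z * g (x - z))"

section \<open>Measurability, integrability and sup bounds of the convolutions\<close>

lemma borel_measurable_vec_nth [measurable (raw)]:
  fixes f :: "'a \<Rightarrow> real ^ 'n::finite"
  assumes [measurable]: "f \<in> borel_measurable M"
  shows "(\<lambda>x. f x $ i) \<in> borel_measurable M"
proof -
  have "(\<lambda>x. f x \<bullet> axis i 1) \<in> borel_measurable M" by measurable
  then show ?thesis by (simp add: inner_axis)
qed

lemma heat_semigroup_eq:
  assumes "t > 0" and [measurable]: "g \<in> borel_measurable borel"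
  shows "heat_semigroup t g x = heat_op t g x"
proof -
  have "(LINT y|lborel. (\<lambda>z. heat_kernel t z *\<^sub>R g (x - z)) (x - y)) = heat_op t g x"
    unfolding heat_op_def by (rule integral_reflect) measurable
  then show ?thesis using assms(1) by (simp add: heat_semigroup_def)
qed

lemma heat_op_measurable [measurable (raw)]:
  fixes g :: "'a \<Rightarrow> real ^ 'n::finite \<Rightarrow> 'b::euclidean_space"
  assumes [measurable]: "f \<in> borel_measurable M" "h \<in> borel_measurable M"
    "(\<lambda>p. g (fst p) (snd p)) \<in> borel_measurable (M \<Otimes>\<^sub>M borel)"
  shows "(\<lambda>w. heat_op (f w) (g w) (h w)) \<in> borel_measurable M"
proof -
  have "(\<lambda>p. (\<lambda>p. g (fst p) (snd p)) (fst p, h (fst p) - snd p)) \<in> borel_measurable (M \<Otimes>\<^sub>M lborel)"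
    by measurable
  then have [measurable]: "(\<lambda>p. g (fst p) (h (fst p) - snd p)) \<in> borel_measurable (M \<Otimes>\<^sub>M lborel)"
    by simp
  show ?thesis unfolding heat_op_def
    by (rule lborel.borel_measurable_lebesgue_integral) (simp add: case_prod_beta')
qed

lemma grad_op_measurable [measurable (raw)]:
  fixes g :: "'a \<Rightarrow> real ^ 'n::finite \<Rightarrow> real ^ 'n"
  assumes [measurable]: "f \<in> borel_measurable M" "h \<in> borel_measurable M"
    "(\<lambda>p. g (fst p) (snd p)) \<in> borel_measurable (M \<Otimes>\<^sub>M borel)"
  shows "(\<lambda>w. grad_op (f w) (g w) (h w)) \<in> borel_measurable M"
proof -
  have "(\<lambda>p. (\<lambda>p. g (fst p) (snd p)) (fst p, h (fst p) - snd p)) \<in> borel_measurable (M \<Otimes>\<^sub>M lborel)"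
    by measurable
  then have [measurable]: "(\<lambda>p. g (fst p) (h (fst p) - snd p)) \<in> borel_measurable (M \<Otimes>\<^sub>M lborel)"
    by simp
  show ?thesis unfolding grad_op_def
    by (rule lborel.borel_measurable_lebesgue_integral) (simp add: case_prod_beta')
qed

lemma integrable_scaleR_bounded:
  fixes k :: "'a::euclidean_space \<Rightarrow> real" and g :: "'a \<Rightarrow> 'b::euclidean_space"
  assumes k: "integrable lborel k" and [measurable]: "g \<in> borel_measurable borel"
    and c: "\<And>y. norm (g y) \<le> c"
  shows "integrable lborel (\<lambda>z. k z *\<^sub>R g (x - z))"
proof (rule integrable_dominated)
  have [measurable]: "k \<in> borel_measurable borel" using borel_measurable_integrable[OF k] by simp
  show "integrable lborel (\<lambda>z. c * norm (k z))" using k by (intro integrable_mult_right integrable_norm)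
  show "norm (k z *\<^sub>R g (x - z)) \<le> c * norm (k z)" for z
    using mult_left_mono[OF c[of "x - z"], of "\<bar>k z\<bar>"] by (simp add: mult.commute)
  show "(\<lambda>z. k z *\<^sub>R g (x - z)) \<in> borel_measurable lborel" by measurable
qed

lemma integrable_inner_bounded:
  fixes k :: "'a::euclidean_space \<Rightarrow> 'b::euclidean_space"
  assumes k: "integrable lborel k" and [measurable]: "g \<in> borel_measurable borel"
    and c: "\<And>y. norm (g y) \<le> c"
  shows "integrable lborel (\<lambda>z. k z \<bullet> g (x - z))"
proof (rule integrable_dominated)
  have [measurable]: "k \<in> borel_measurable borel" using borel_measurable_integrable[OF k] by simp
  show "integrable lborel (\<lambda>z. c * norm (k z))" using k by (intro integrable_mult_right integrable_norm)
  show "norm (k z \<bullet> g (x - z)) \<le> c * norm (k z)" for z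
    using Cauchy_Schwarz_ineq2[of "k z" "g (x - z)"] mult_left_mono[OF c[of "x - z"], of "norm (k z)"]
    by (simp add: mult.commute)
  show "(\<lambda>z. k z \<bullet> g (x - z)) \<in> borel_measurable lborel" by measurable
qed

lemma heat_op_integrable:
  fixes g :: "real ^ 'n::finite \<Rightarrow> 'b::euclidean_space"
  assumes "t > 0" "g \<in> borel_measurable borel" "\<And>y. norm (g y) \<le> c"
  shows "integrable lborel (\<lambda>z. heat_kernel t z *\<^sub>R g (x - z))"
  using assms by (intro integrable_scaleR_bounded heat_kernel_integrable)

lemma grad_op_integrable:
  fixes g :: "real ^ 'n::finite \<Rightarrow> real ^ 'n"
  assumes "t > 0" "g \<in> borel_measurable borel" "\<And>y. norm (g y) \<le> c"
  shows "integrable lborel (\<lambda>z. heat_grad t z \<bullet> g (x - z))"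
  using assms by (intro integrable_inner_bounded heat_grad_integrable)

lemma heat_op_bound:
  fixes g :: "real ^ 'n::finite \<Rightarrow> 'b::euclidean_space"
  assumes t: "t > 0" and [measurable]: "g \<in> borel_measurable borel" and c: "\<And>y. norm (g y) \<le> c"
  shows "norm (heat_op t g x) \<le> c"
proof -
  have "norm (heat_op t g x) \<le> (LINT z|lborel. norm (heat_kernel t z *\<^sub>R g (x - z)))"
    unfolding heat_op_def by (rule integral_norm_bound)
  also have "\<dots> \<le> (LINT z|lborel. c * heat_kernel t (z :: real ^ 'n))"
  proof (rule integral_mono)
    show "integrable lborel (\<lambda>z. norm (heat_kernel t z *\<^sub>R g (x - z)))"
      by (rule integrable_norm[OF heat_op_integrable[OF t]]) (use c in auto)
    show "integrable lborel (\<lambda>z. c * heat_kernel t (z :: real ^ 'n))"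
      by (rule integrable_mult_right, rule heat_kernel_integrable[OF t])
    show "norm (heat_kernel t z *\<^sub>R g (x - z)) \<le> c * heat_kernel t z" for z
      using mult_left_mono[OF c[of "x - z"] heat_kernel_nonneg[of t z]] by (simp add: heat_kernel_nonneg mult.commute)
  qed
  also have "\<dots> = c" by (simp add: heat_kernel_integral[OF t])
  finally show ?thesis .
qed

lemma grad_op_bound:
  fixes g :: "real ^ 'n::finite \<Rightarrow> real ^ 'n"
  assumes t: "t > 0" and [measurable]: "g \<in> borel_measurable borel" and c: "\<And>y. norm (g y) \<le> c"
  shows "\<bar>grad_op t g x\<bar> \<le> heat_const TYPE('n) / sqrt t * c"
proof -
  have c0: "c \<ge> 0" using c[of undefined] norm_ge_zero order_trans by blast
  have "\<bar>grad_op t g x\<bar> \<le> (LINT z|lborel. norm (heat_grad t z \<bullet> g (x - z)))"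
    unfolding grad_op_def real_norm_def[symmetric] by (rule integral_norm_bound)
  also have "\<dots> \<le> (LINT z|lborel. c * norm (heat_grad t (z :: real ^ 'n)))"
  proof (rule integral_mono)
    show "integrable lborel (\<lambda>z. norm (heat_grad t z \<bullet> g (x - z)))"
      by (rule integrable_norm[OF grad_op_integrable[OF t]]) (use c in auto)
    show "integrable lborel (\<lambda>z. c * norm (heat_grad t (z :: real ^ 'n)))"
      by (rule integrable_mult_right, rule integrable_norm, rule heat_grad_integrable[OF t])
    show "norm (heat_grad t z \<bullet> g (x - z)) \<le> c * norm (heat_grad t z)" for z
      using Cauchy_Schwarz_ineq2[of "heat_grad t z" "g (x - z)"] mult_left_mono[OF c[of "x - z"], of "norm (heat_grad t z)"]
      by (simp add: mult.commute)
  qed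
  also have "\<dots> = c * (LINT z|lborel. norm (heat_grad t (z :: real ^ 'n)))" by simp
  also have "\<dots> \<le> c * (heat_const TYPE('n) / sqrt t)"
    by (rule mult_left_mono[OF heat_grad_norm_integral[OF t] c0])
  finally show ?thesis by (simp add: mult.commute)
qed

lemma heat_op_translate: "heat_op t (\<lambda>y. g (y + a)) x = heat_op t g (x + a)"
  unfolding heat_op_def by (simp add: diff_add_eq)

lemma grad_op_translate: "grad_op t (\<lambda>y. g (y + a)) x = grad_op t g (x + a)"
  unfolding grad_op_def by (simp add: diff_add_eq)

lemma heat_op_diff:
  fixes g h :: "real ^ 'n::finite \<Rightarrow> 'b::euclidean_space"
  assumes "t > 0" "g \<in> borel_measurable borel" "h \<in> borel_measurable borel"
    "\<And>y. norm (g y) \<le> c" "\<And>y. norm (h y) \<le> d"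
  shows "heat_op t (\<lambda>y. g y - h y) x = heat_op t g x - heat_op t h x"
  unfolding heat_op_def scaleR_diff_right
  by (rule Bochner_Integration.integral_diff; rule heat_op_integrable) (use assms in auto)

lemma grad_op_diff:
  fixes g h :: "real ^ 'n::finite \<Rightarrow> real ^ 'n"
  assumes "t > 0" "g \<in> borel_measurable borel" "h \<in> borel_measurable borel"
    "\<And>y. norm (g y) \<le> c" "\<And>y. norm (h y) \<le> d"
  shows "grad_op t (\<lambda>y. g y - h y) x = grad_op t g x - grad_op t h x"
  unfolding grad_op_def inner_diff_right
  by (rule Bochner_Integration.integral_diff; rule grad_op_integrable) (use assms in auto)

lemma AE_reflect:
  fixes x :: "'a::euclidean_space"
  assumes "AE y in lborel. R y"
  shows "AE z in lborel. R (x - z)"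
proof -
  have "AE y in distr lborel borel (\<lambda>z. x - z). R y" using assms by (subst lborel_distr_reflect)
  moreover have "(\<lambda>z. x - z) \<in> lborel \<rightarrow>\<^sub>M borel" by measurable
  ultimately show ?thesis by (rule AE_distrD[rotated])
qed

text \<open>Convolutions do not see null sets. This is what lets an almost everywhere equation be
  replaced by one that holds at every point.\<close>

lemma grad_op_cong_AE:
  fixes g h :: "real ^ 'n::finite \<Rightarrow> real ^ 'n"
  assumes [measurable]: "g \<in> borel_measurable borel" "h \<in> borel_measurable borel"
    and "AE y in lborel. g y = h y"
  shows "grad_op t g x = grad_op t h x"
  unfolding grad_op_def
proof (rule integral_cong_AE)
  show "AE z in lborel. heat_grad t z \<bullet> g (x - z) = heat_grad t z \<bullet> h (x - z)"
    using AE_reflect[OF assms(3), of x] by eventually_elim simp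
qed measurable

lemma heat_op_cong_AE:
  fixes g h :: "real ^ 'n::finite \<Rightarrow> 'b::euclidean_space"
  assumes [measurable]: "g \<in> borel_measurable borel" "h \<in> borel_measurable borel"
    and "AE y in lborel. g y = h y"
  shows "heat_op t g x = heat_op t h x"
  unfolding heat_op_def
proof (rule integral_cong_AE)
  show "AE z in lborel. heat_kernel t z *\<^sub>R g (x - z) = heat_kernel t z *\<^sub>R h (x - z)"
    using AE_reflect[OF assms(3), of x] by eventually_elim simp
qed measurable

text \<open>Fubini, with the majorant c * |k1 z| * |k2 (y - z)|, so that boundedness of g is enough.
  The semigroup law and the commutation of heat flow and divergence thereby become identities
  between kernels.\<close>

lemma cv_assoc:
  fixes k1 k2 :: "real ^ 'n::finite \<Rightarrow> real"
  assumes k1: "integrable lborel k1" and k2: "integrable lborel k2"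
    and [measurable]: "g \<in> borel_measurable borel" and c: "\<And>y. \<bar>g y\<bar> \<le> c"
  shows "cv k1 (cv k2 g) x = cv (\<lambda>y. LINT z|lborel. k1 z * k2 (y - z)) g x"
proof -
  have [measurable]: "k1 \<in> borel_measurable borel" "k2 \<in> borel_measurable borel"
    using borel_measurable_integrable[OF k1] borel_measurable_integrable[OF k2] by simp_all
  have k2': "integrable lborel (\<lambda>y. k2 (y - z))" for z using integrable_shift[OF k2, of "- z"] by simp
  have 1: "cv k2 g (x - z) = (LINT y|lborel. k2 (y - z) * g (x - y))" for z
  proof -
    have "(LINT y|lborel. (\<lambda>w. k2 w * g (x - z - w)) (y + - z)) = cv k2 g (x - z)"
      unfolding cv_def by (rule integral_shift) measurable
    then show ?thesis by simp
  qed
  define F where "F = (\<lambda>z y. k1 z * (k2 (y - z) * g (x - y)))"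
  have [measurable]: "case_prod F \<in> borel_measurable (lborel \<Otimes>\<^sub>M lborel)" unfolding F_def by measurable
  have sec: "integrable lborel (\<lambda>y. k2 (y - z) * g (x - y))" for z
    using integrable_scaleR_bounded[OF k2', of g c z x] c by simp
  have Fi: "integrable (lborel \<Otimes>\<^sub>M lborel) (case_prod F)"
  proof (rule lborel_pair.Fubini_integrable)
    have b: "(LINT y|lborel. norm (F z y)) \<le> \<bar>k1 z\<bar> * (c * (LINT y|lborel. \<bar>k2 y\<bar>))" for z
    proof -
      have "(LINT y|lborel. norm (F z y)) = \<bar>k1 z\<bar> * (LINT y|lborel. norm (k2 (y - z) * g (x - y)))"
        by (simp add: F_def abs_mult)
      also have "\<dots> \<le> \<bar>k1 z\<bar> * (LINT y|lborel. c * \<bar>k2 (y - z)\<bar>)"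
      proof (intro mult_left_mono integral_mono)
        show "integrable lborel (\<lambda>y. norm (k2 (y - z) * g (x - y)))" by (rule integrable_norm[OF sec])
        show "integrable lborel (\<lambda>y. c * \<bar>k2 (y - z)\<bar>)"
          by (rule integrable_mult_right, rule integrable_abs[OF k2'])
        show "norm (k2 (y - z) * g (x - y)) \<le> c * \<bar>k2 (y - z)\<bar>" for y
          using mult_left_mono[OF c[of "x - y"], of "\<bar>k2 (y - z)\<bar>"] by (simp add: abs_mult mult.commute)
      qed simp
      also have "(LINT y|lborel. c * \<bar>k2 (y - z)\<bar>) = c * (LINT y|lborel. \<bar>k2 y\<bar>)"
        using integral_shift[of "\<lambda>y. \<bar>k2 y\<bar>" "- z"] by simp
      finally show ?thesis .
    qed
    show "integrable lborel (\<lambda>z. LINT y|lborel. norm (case_prod F (z, y)))"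
    proof (rule integrable_dominated)
      show "integrable lborel (\<lambda>z. \<bar>k1 z\<bar> * (c * (LINT y|lborel. \<bar>k2 y\<bar>)))"
        by (rule integrable_mult_left, rule integrable_abs[OF k1])
      show "norm (LINT y|lborel. norm (case_prod F (z, y))) \<le> \<bar>k1 z\<bar> * (c * (LINT y|lborel. \<bar>k2 y\<bar>))" for z
        using b[of z] by (simp add: integral_nonneg_AE)
    qed measurable
    show "AE z in lborel. integrable lborel (\<lambda>y. case_prod F (z, y))"
      using sec by (simp add: F_def)
  qed measurable
  have "cv k1 (cv k2 g) x = (LINT z|lborel. LINT y|lborel. F z y)"
    unfolding cv_def[of k1] 1 F_def by simp
  also have "\<dots> = (LINT y|lborel. LINT z|lborel. F z y)"
    by (rule lborel_pair.Fubini_integral[OF Fi, symmetric])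
  also have "\<dots> = (LINT y|lborel. (LINT z|lborel. k1 z * k2 (y - z)) * g (x - y))"
    unfolding F_def mult.assoc[symmetric] by simp
  finally show ?thesis by (simp add: cv_def)
qed

lemma heat_op_real: "heat_op t g x = cv (heat_kernel t) g x"
  by (simp add: heat_op_def cv_def)

lemma heat_op_nth:
  fixes g :: "real ^ 'n::finite \<Rightarrow> real ^ 'm::finite"
  assumes "t > 0" "g \<in> borel_measurable borel" "\<And>y. norm (g y) \<le> c"
  shows "heat_op t g x $ i = cv (heat_kernel t) (\<lambda>y. g y $ i) x"
proof -
  have "(LINT z|lborel. heat_kernel t z *\<^sub>R g (x - z)) \<bullet> axis i 1 = (LINT z|lborel. (heat_kernel t z *\<^sub>R g (x - z)) \<bullet> axis i 1)"
    by (rule integral_inner_left[symmetric]) (use heat_op_integrable[OF assms] in simp)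
  then show ?thesis by (simp add: heat_op_def cv_def inner_axis)
qed

lemma heat_grad_nth_integrable:
  "t > 0 \<Longrightarrow> integrable lborel (\<lambda>z :: real ^ 'n::finite. heat_grad t z $ i)"
  using integrable_inner_left[of "axis i 1" lborel "heat_grad t :: real ^ 'n \<Rightarrow> _"] heat_grad_integrable[where 'n='n]
  by (simp add: inner_axis)

lemma grad_op_sum:
  fixes g :: "real ^ 'n::finite \<Rightarrow> real ^ 'n"
  assumes t: "t > 0" and [measurable]: "g \<in> borel_measurable borel" and c: "\<And>y. norm (g y) \<le> c"
  shows "grad_op t g x = (\<Sum>i\<in>UNIV. cv (\<lambda>z. heat_grad t z $ i) (\<lambda>y. g y $ i) x)"
  unfolding grad_op_def cv_def inner_vec_def
proof (subst Bochner_Integration.integral_sum)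
  fix i
  have "integrable lborel (\<lambda>z. (heat_grad t z $ i) *\<^sub>R (g (x - z) $ i))"
  proof (rule integrable_scaleR_bounded[OF heat_grad_nth_integrable[OF t]])
    show "norm (g y $ i) \<le> c" for y using component_le_norm_cart[of "g y" i] c[of y] by simp
  qed (measurable)
  then show "integrable lborel (\<lambda>z. heat_grad t z $ i \<bullet> g (x - z) $ i)" by simp
qed simp

lemma heat_heat_op:
  fixes g :: "real ^ 'n::finite \<Rightarrow> real"
  assumes "t > 0" "s > 0" "g \<in> borel_measurable borel" "\<And>y. \<bar>g y\<bar> \<le> c"
  shows "heat_op t (heat_op s g) x = heat_op (t + s) g x"
proof -
  have "heat_op t (heat_op s g) x = cv (heat_kernel t) (cv (heat_kernel s) g) x"
    unfolding heat_op_real[abs_def] ..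
  also have "\<dots> = cv (\<lambda>y. LINT z|lborel. heat_kernel t z * heat_kernel s (y - z)) g x"
    by (rule cv_assoc) (use assms heat_kernel_integrable in auto)
  finally show ?thesis using assms by (simp add: heat_kernel_convolution heat_op_real)
qed

lemma heat_grad_nth_convolution:
  fixes y :: "real ^ 'n::finite"
  assumes "t > 0" "s > 0"
  shows "(LINT z|lborel. heat_grad t z $ i * heat_kernel s (y - z)) = heat_grad (t + s) y $ i"
proof -
  have "(LINT z|lborel. heat_kernel s (y - z) *\<^sub>R heat_grad t z) \<bullet> axis i 1
     = (LINT z|lborel. (heat_kernel s (y - z) *\<^sub>R heat_grad t z) \<bullet> axis i 1)"
  proof (rule integral_inner_left[symmetric])
    have "integrable lborel (\<lambda>z. heat_kernel s (y - z) *\<^sub>R heat_grad t z)"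
    proof (rule integrable_dominated)
      show "integrable lborel (\<lambda>z :: real ^ 'n. 1 / ((4 * pi * s) powr (real CARD('n) / 2)) * norm (heat_grad t z))"
        by (rule integrable_mult_right, rule integrable_norm, rule heat_grad_integrable[OF assms(1)])
      have "heat_kernel s w \<le> 1 / ((4 * pi * s) powr (real CARD('n) / 2))" for w :: "real ^ 'n"
        unfolding heat_kernel_def by (rule divide_right_mono) (use assms in simp_all)
      from mult_right_mono[OF this norm_ge_zero]
      show "norm (heat_kernel s (y - z) *\<^sub>R heat_grad t z)
        \<le> 1 / ((4 * pi * s) powr (real CARD('n) / 2)) * norm (heat_grad t z)" for z
        unfolding norm_scaleR real_norm_def abs_of_nonneg[OF heat_kernel_nonneg] .
    qed measurable
    then show "integrable lborel (\<lambda>z. heat_kernel s (y - z) *\<^sub>R heat_grad t z)" .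
  qed
  then show ?thesis unfolding heat_grad_convolution[OF assms]
    by (simp add: inner_axis mult.commute)
qed

lemma heat_grad_nth_convolution':
  fixes y :: "real ^ 'n::finite"
  assumes "t > 0" "s > 0"
  shows "(LINT z|lborel. heat_kernel s z * heat_grad t (y - z) $ i) = heat_grad (t + s) y $ i"
proof -
  have "(LINT z|lborel. (\<lambda>z. heat_grad t z $ i * heat_kernel s (y - z)) (y - z)) = heat_grad (t + s) y $ i"
    unfolding heat_grad_nth_convolution[OF assms, symmetric] by (rule integral_reflect) measurable
  then show ?thesis by (simp add: mult.commute)
qed

text \<open>Heat flow after divergence. It allows Duhamel's formula to be restarted at a later time,
  and its discrete form to be carried through one more step.\<close>

lemma heat_grad_op:
  fixes g :: "real ^ 'n::finite \<Rightarrow> real ^ 'n"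
  assumes t: "t > 0" and s: "s > 0" and g[measurable]: "g \<in> borel_measurable borel" and c: "\<And>y. norm (g y) \<le> c"
  shows "heat_op t (grad_op s g) x = grad_op (t + s) g x"
proof -
  have ci: "\<bar>g y $ i\<bar> \<le> c" for y i using component_le_norm_cart[of "g y" i] c[of y] by simp
  have *: "cv (heat_kernel t) (cv (\<lambda>z. heat_grad s z $ i) (\<lambda>y. g y $ i)) x
      = cv (\<lambda>z. heat_grad (t + s) z $ i) (\<lambda>y. g y $ i) x" for i
  proof -
    have "cv (heat_kernel t) (cv (\<lambda>z. heat_grad s z $ i) (\<lambda>y. g y $ i)) x
      = cv (\<lambda>y. LINT z|lborel. heat_kernel t z * heat_grad s (y - z) $ i) (\<lambda>y. g y $ i) x"
      by (rule cv_assoc[OF heat_kernel_integrable[OF t] heat_grad_nth_integrable[OF s] _ ci]) measurable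
    then show ?thesis by (simp add: heat_grad_nth_convolution'[OF s t] add.commute)
  qed
  have mc [measurable]: "cv (\<lambda>z. heat_grad s z $ i) (\<lambda>y. g y $ i) \<in> borel_measurable borel" for i
    unfolding cv_def by measurable
  have bc: "\<bar>cv (\<lambda>z. heat_grad s z $ i) (\<lambda>y. g y $ i) y\<bar> \<le> (LINT z|lborel. c * norm (heat_grad s (z :: real ^ 'n)))" for i y
  proof -
    have "\<bar>cv (\<lambda>z. heat_grad s z $ i) (\<lambda>y. g y $ i) y\<bar> \<le> (LINT z|lborel. norm (heat_grad s z $ i * g (y - z) $ i))"
      unfolding cv_def real_norm_def[symmetric] by (rule integral_norm_bound)
    also have "\<dots> \<le> (LINT z|lborel. c * norm (heat_grad s (z :: real ^ 'n)))"
    proof (rule integral_mono)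
      show "integrable lborel (\<lambda>z. c * norm (heat_grad s (z :: real ^ 'n)))"
        by (rule integrable_mult_right, rule integrable_norm, rule heat_grad_integrable[OF s])
      show "integrable lborel (\<lambda>z. norm (heat_grad s z $ i * g (y - z) $ i))"
        using integrable_scaleR_bounded[OF heat_grad_nth_integrable[OF s, of i], of "\<lambda>y. g y $ i" c y] ci
        by (intro integrable_norm) simp
      show "norm (heat_grad s z $ i * g (y - z) $ i) \<le> c * norm (heat_grad s z)" for z
        using mult_mono[OF ci[of "y - z" i] component_le_norm_cart[of "heat_grad s z" i]] c[of 0] norm_ge_zero[of "g 0"]
        by (simp add: abs_mult mult.commute)
    qed
    finally show ?thesis .
  qed
  have "heat_op t (grad_op s g) x = (LINT z|lborel. (\<Sum>i\<in>UNIV. heat_kernel t z * cv (\<lambda>z. heat_grad s z $ i) (\<lambda>y. g y $ i) (x - z)))"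
    unfolding heat_op_def grad_op_sum[OF s g c] by (simp add: sum_distrib_left)
  also have "\<dots> = (\<Sum>i\<in>UNIV. cv (heat_kernel t) (cv (\<lambda>z. heat_grad s z $ i) (\<lambda>y. g y $ i)) x)"
    unfolding cv_def[of "heat_kernel t"]
  proof (rule Bochner_Integration.integral_sum)
    fix i
    show "integrable lborel (\<lambda>z. heat_kernel t z * cv (\<lambda>z. heat_grad s z $ i) (\<lambda>y. g y $ i) (x - z))"
      using heat_op_integrable[OF t mc[of i], of "LINT z|lborel. c * norm (heat_grad s (z :: real ^ 'n))" x] bc by simp
  qed
  also have "\<dots> = grad_op (t + s) g x"
    unfolding * by (rule grad_op_sum[symmetric]) (use t s c in auto)
  finally show ?thesis .
qed

text \<open>Divergence after heat flow, needed where the flux itself has been smoothed, as in the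
  interpolation of the scheme.\<close>

lemma grad_heat_op:
  fixes g :: "real ^ 'n::finite \<Rightarrow> real ^ 'n"
  assumes t: "t > 0" and s: "s > 0" and g[measurable]: "g \<in> borel_measurable borel" and c: "\<And>y. norm (g y) \<le> c"
  shows "grad_op t (heat_op s g) x = grad_op (t + s) g x"
proof -
  have ci: "\<bar>g y $ i\<bar> \<le> c" for y i using component_le_norm_cart[of "g y" i] c[of y] by simp
  have *: "cv (\<lambda>z. heat_grad t z $ i) (cv (heat_kernel s) (\<lambda>y. g y $ i)) x
      = cv (\<lambda>z. heat_grad (t + s) z $ i) (\<lambda>y. g y $ i) x" for i
  proof -
    have "cv (\<lambda>z. heat_grad t z $ i) (cv (heat_kernel s) (\<lambda>y. g y $ i)) x
      = cv (\<lambda>y. LINT z|lborel. heat_grad t z $ i * heat_kernel s (y - z)) (\<lambda>y. g y $ i) x"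
      by (rule cv_assoc[OF heat_grad_nth_integrable[OF t] heat_kernel_integrable[OF s] _ ci]) measurable
    then show ?thesis by (simp add: heat_grad_nth_convolution[OF t s])
  qed
  have "grad_op t (heat_op s g) x = (\<Sum>i\<in>UNIV. cv (\<lambda>z. heat_grad t z $ i) (\<lambda>y. heat_op s g y $ i) x)"
    by (rule grad_op_sum[OF t]) (use heat_op_bound[OF s g c] in auto)
  also have "\<dots> = grad_op (t + s) g x"
    unfolding heat_op_nth[OF s g c] * by (rule grad_op_sum[symmetric]) (use t s c in auto)
  finally show ?thesis .
qed

section \<open>Differentiability of the heat flow of a bounded function\<close>

lemma exp_remainder_bound: "\<bar>exp q - 1 - q\<bar> \<le> q\<^sup>2 / 2 * exp \<bar>q\<bar>" for q :: real
proof -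
  obtain \<xi> where \<xi>: "\<bar>\<xi>\<bar> \<le> \<bar>q\<bar>" "exp q = (\<Sum>m<2. q ^ m / fact m) + exp \<xi> / fact 2 * q ^ 2"
    using Maclaurin_exp_le[of q 2] by blast
  have "exp q - 1 - q = exp \<xi> * (q\<^sup>2 / 2)" using \<xi>(2) by (simp add: numeral_2_eq_2)
  then have "\<bar>exp q - 1 - q\<bar> = \<bar>exp \<xi> * (q\<^sup>2 / 2)\<bar>" by (simp only:)
  also have "\<dots> = exp \<xi> * (q\<^sup>2 / 2)" by (rule abs_of_nonneg) simp
  also have "\<dots> \<le> exp \<bar>q\<bar> * (q\<^sup>2 / 2)" by (rule mult_right_mono) (use order_trans[OF abs_ge_self \<xi>(1)] in simp_all)
  finally show ?thesis by (simp add: mult.commute)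
qed

text \<open>The remainder is quadratic in h with a majorant integrable in z. Integrated against
  bounded data it gives the derivative of the heat flow at once, with an explicit error and no limit
  under the integral sign.\<close>

lemma heat_kernel_taylor:
  fixes z h :: "real ^ 'n::finite"
  assumes t: "t > 0" and h: "norm h \<le> 1"
  shows "\<bar>heat_kernel t (z + h) - heat_kernel t z - heat_grad t z \<bullet> h\<bar>
    \<le> (2 powr (real CARD('n) / 2) * (exp (3 / t) + 1 / (4 * t))) * (norm h)\<^sup>2 * heat_kernel (2 * t) z"
proof -
  define A where "A = 2 powr (real CARD('n) / 2)"
  \<comment> \<open>The increment of the exponent: the shifted kernel is \<open>G * exp q\<close>,
    and the gradient term is G times the part of q that is linear in h. For norm h \<le> 1 the
    quantity Y bounds |q|, even after multiplication by norm h.\<close>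
  define q where "q = - (2 * (z \<bullet> h) + (norm h)\<^sup>2) / (4 * t)"
  define Y where "Y = (2 * norm z + 1) / (4 * t)"
  define G where "G = heat_kernel t z"
  have G0: "G \<ge> 0" by (simp add: G_def heat_kernel_nonneg)
  have GA: "G * exp ((norm z)\<^sup>2 / (8 * t)) = A * heat_kernel (2 * t) z"
  proof -
    have "exp (- (norm z)\<^sup>2 / (8 * t)) * exp ((norm z)\<^sup>2 / (8 * t)) = 1"
      unfolding exp_add[symmetric] by simp
    then show ?thesis unfolding G_def heat_kernel_double[OF t] A_def by (simp add: algebra_simps)
  qed
  have "exp ((norm z)\<^sup>2 / (8 * t)) \<ge> 1" using t by simp
  then have GA': "G \<le> A * heat_kernel (2 * t) z"
    unfolding GA[symmetric] using G0 mult_left_mono[of 1 _ G] by simp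
  have "(norm (z + h))\<^sup>2 = (norm z)\<^sup>2 + (2 * (z \<bullet> h) + (norm h)\<^sup>2)"
    unfolding power2_norm_eq_inner by (simp add: inner_add inner_commute)
  then have "- (norm (z + h))\<^sup>2 / (4 * t) = - (norm z)\<^sup>2 / (4 * t) + q"
    unfolding q_def add_divide_distrib[symmetric] by simp
  then have "exp (- (norm (z + h))\<^sup>2 / (4 * t)) = exp (- (norm z)\<^sup>2 / (4 * t)) * exp q"
    by (simp only: exp_add)
  then have Gh: "heat_kernel t (z + h) = G * exp q" unfolding heat_kernel_def G_def by simp
  have gh: "heat_grad t z \<bullet> h = G * (q + (norm h)\<^sup>2 / (4 * t))"
    unfolding heat_grad_def G_def q_def using t by (simp add: field_simps)
  have R: "heat_kernel t (z + h) - heat_kernel t z - heat_grad t z \<bullet> h = G * ((exp q - 1 - q) - (norm h)\<^sup>2 / (4 * t))"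
    unfolding Gh gh G_def[symmetric] by (simp add: algebra_simps)
  have Y0: "Y \<ge> 0" unfolding Y_def using t by simp
  have "\<bar>2 * (z \<bullet> h) + (norm h)\<^sup>2\<bar> \<le> 2 * (norm z * norm h) + norm h * norm h"
    using Cauchy_Schwarz_ineq2[of z h] unfolding power2_eq_square
    by (intro order_trans[OF abs_triangle_ineq] add_mono) auto
  also have "\<dots> \<le> norm h * (2 * norm z + 1)" using h mult_left_mono[OF h norm_ge_zero[of h]] by (simp add: algebra_simps)
  finally have "\<bar>2 * (z \<bullet> h) + (norm h)\<^sup>2\<bar> / (4 * t) \<le> norm h * (2 * norm z + 1) / (4 * t)"
    by (rule divide_right_mono) (use t in simp)
  moreover have "\<bar>q\<bar> = \<bar>2 * (z \<bullet> h) + (norm h)\<^sup>2\<bar> / (4 * t)"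
    unfolding q_def abs_divide abs_minus_cancel using t by simp
  ultimately have q1: "\<bar>q\<bar> \<le> norm h * Y" unfolding Y_def by simp
  then have q2: "\<bar>q\<bar> \<le> Y" using mult_right_mono[OF h Y0] by simp
  have "q\<^sup>2 \<le> (norm h * Y)\<^sup>2" using q1 by (rule abs_le_square_iff[THEN iffD1, OF order_trans[OF _ abs_ge_self]])
  then have q3: "q\<^sup>2 \<le> (norm h)\<^sup>2 * Y\<^sup>2" by (simp add: power_mult_distrib)
  have "Y\<^sup>2 / 2 \<le> exp Y" using exp_lower_Taylor_quadratic[OF Y0] Y0 by linarith
  then have Y3: "Y\<^sup>2 / 2 * exp Y \<le> exp Y * exp Y" by (rule mult_right_mono) simp
  \<comment> \<open>The growth of exp (2 * Y), whose exponent is linear in norm z, is paid by the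
    spare Gaussian factor through 8 * norm z \<le> (norm z)^2 + 16. What is left over is 24 / (8 *
    t) = 3 / t, the origin of exp (3 / t).\<close>
  have Y4: "exp Y * exp Y \<le> exp (3 / t) * exp ((norm z)\<^sup>2 / (8 * t))"
  proof -
    have "0 \<le> (norm z - 4)\<^sup>2" by simp
    then have "8 * norm z \<le> (norm z)\<^sup>2 + 16" by (simp add: power2_eq_square algebra_simps)
    then have "4 * (2 * norm z + 1) \<le> (norm z)\<^sup>2 + 24" by simp
    then have "4 * (2 * norm z + 1) / (8 * t) \<le> ((norm z)\<^sup>2 + 24) / (8 * t)" by (rule divide_right_mono) (use t in simp)
    moreover have "4 * (2 * norm z + 1) / (8 * t) = Y + Y" unfolding Y_def using t by (simp add: field_simps)
    moreover have "((norm z)\<^sup>2 + 24) / (8 * t) = 3 / t + (norm z)\<^sup>2 / (8 * t)" using t by (simp add: field_simps)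
    ultimately have "Y + Y \<le> 3 / t + (norm z)\<^sup>2 / (8 * t)" by linarith
    then show ?thesis unfolding exp_add[symmetric] by simp
  qed
  have "\<bar>exp q - 1 - q\<bar> \<le> q\<^sup>2 / 2 * exp \<bar>q\<bar>" by (rule exp_remainder_bound)
  also have "\<dots> \<le> ((norm h)\<^sup>2 * Y\<^sup>2) / 2 * exp Y"
    by (rule mult_mono) (use q3 q2 in auto)
  also have "\<dots> = (norm h)\<^sup>2 * (Y\<^sup>2 / 2 * exp Y)" by simp
  also have "\<dots> \<le> (norm h)\<^sup>2 * (exp (3 / t) * exp ((norm z)\<^sup>2 / (8 * t)))"
    by (rule mult_left_mono[OF order_trans[OF Y3 Y4]]) simp
  finally have E: "\<bar>exp q - 1 - q\<bar> \<le> (norm h)\<^sup>2 * (exp (3 / t) * exp ((norm z)\<^sup>2 / (8 * t)))" .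
  have "\<bar>(exp q - 1 - q) - (norm h)\<^sup>2 / (4 * t)\<bar> \<le> \<bar>exp q - 1 - q\<bar> + (norm h)\<^sup>2 / (4 * t)"
    using t by (intro order_trans[OF abs_triangle_ineq4]) auto
  also have "\<dots> \<le> (norm h)\<^sup>2 * (exp (3 / t) * exp ((norm z)\<^sup>2 / (8 * t))) + (norm h)\<^sup>2 / (4 * t)"
    using E by simp
  finally have F: "\<bar>(exp q - 1 - q) - (norm h)\<^sup>2 / (4 * t)\<bar>
    \<le> (norm h)\<^sup>2 * (exp (3 / t) * exp ((norm z)\<^sup>2 / (8 * t))) + (norm h)\<^sup>2 / (4 * t)" .
  have "\<bar>heat_kernel t (z + h) - heat_kernel t z - heat_grad t z \<bullet> h\<bar>
      = G * \<bar>(exp q - 1 - q) - (norm h)\<^sup>2 / (4 * t)\<bar>"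
    unfolding R abs_mult abs_of_nonneg[OF G0] ..
  also have "\<dots> \<le> G * ((norm h)\<^sup>2 * (exp (3 / t) * exp ((norm z)\<^sup>2 / (8 * t))) + (norm h)\<^sup>2 / (4 * t))"
    by (rule mult_left_mono[OF F G0])
  also have "\<dots> = (norm h)\<^sup>2 * (exp (3 / t) * (G * exp ((norm z)\<^sup>2 / (8 * t)))) + (norm h)\<^sup>2 / (4 * t) * G"
    by (simp add: algebra_simps)
  also have "\<dots> \<le> (norm h)\<^sup>2 * (exp (3 / t) * (A * heat_kernel (2 * t) z)) + (norm h)\<^sup>2 / (4 * t) * (A * heat_kernel (2 * t) z)"
    unfolding GA by (rule add_left_mono[OF mult_left_mono[OF GA']]) (use t in simp)
  also have "\<dots> = (A * (exp (3 / t) + 1 / (4 * t))) * (norm h)\<^sup>2 * heat_kernel (2 * t) z"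
    by (simp add: algebra_simps)
  finally show ?thesis unfolding A_def .
qed

text \<open>Quadratic errors are o(h). Besides the heat flow this serves for the flat functions
  \<open>bump\<close> at 0.\<close>

lemma has_derivative_quadratic:
  fixes f :: "'a::real_normed_vector \<Rightarrow> 'b::real_normed_vector"
  assumes L: "bounded_linear L" and b: "\<And>h. norm h \<le> 1 \<Longrightarrow> norm (f (x + h) - f x - L h) \<le> C * (norm h)\<^sup>2"
  shows "(f has_derivative L) (at x)"
  unfolding has_derivative_at
proof (intro conjI L)
  have lim: "((\<lambda>h::'a. C * norm h) \<longlongrightarrow> 0) (at 0)"
    by (intro tendsto_mult_right_zero tendsto_norm_zero tendsto_ident_at)
  have ev: "\<forall>\<^sub>F h in at 0. norm (norm (f (x + h) - f x - L h) / norm h) \<le> C * norm h"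
    unfolding eventually_at
  proof (intro exI[of _ 1] conjI ballI impI)
    fix h :: 'a assume h: "h \<noteq> 0 \<and> dist h 0 < 1"
    then have "norm (f (x + h) - f x - L h) / norm h \<le> (C * (norm h)\<^sup>2) / norm h"
      by (intro divide_right_mono b) auto
    also have "\<dots> = C * norm h" using h by (simp add: power2_eq_square)
    finally show "norm (norm (f (x + h) - f x - L h) / norm h) \<le> C * norm h" by simp
  qed simp
  show "(\<lambda>h. norm (f (x + h) - f x - L h) / norm h) \<midarrow>0\<rightarrow> 0"
    by (rule Lim_null_comparison[OF ev lim])
qed

lemma heat_op_has_derivative:
  fixes g :: "real ^ 'n::finite \<Rightarrow> 'b::euclidean_space"
  assumes t: "t > 0" and g[measurable]: "g \<in> borel_measurable borel" and c: "\<And>y. norm (g y) \<le> c"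
  defines "L \<equiv> \<lambda>x h. (LINT z|lborel. (heat_grad t z \<bullet> h) *\<^sub>R g (x - z))"
  shows "(heat_op t g has_derivative L x) (at x)"
    and "norm (L x h) \<le> heat_const TYPE('n) / sqrt t * c * norm h"
proof -
  have c0: "c \<ge> 0" using c[of 0] norm_ge_zero order_trans by blast
  have kI: "integrable lborel (\<lambda>z. heat_grad t z \<bullet> h)" for h :: "real ^ 'n"
    by (rule integrable_inner_left) (use heat_grad_integrable[OF t] in auto)
  have I: "integrable lborel (\<lambda>z. (heat_grad t z \<bullet> h) *\<^sub>R g (x - z))" for h
    by (rule integrable_scaleR_bounded[OF kI g c])
  have bd: "norm (L x h) \<le> heat_const TYPE('n) / sqrt t * c * norm h" for h
  proof -
    have "norm (L x h) \<le> (LINT z|lborel. norm ((heat_grad t z \<bullet> h) *\<^sub>R g (x - z)))"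
      unfolding L_def by (rule integral_norm_bound)
    also have "\<dots> \<le> (LINT z|lborel. (c * norm h) * norm (heat_grad t (z :: real ^ 'n)))"
    proof (rule integral_mono)
      show "integrable lborel (\<lambda>z. norm ((heat_grad t z \<bullet> h) *\<^sub>R g (x - z)))" by (rule integrable_norm[OF I])
      show "integrable lborel (\<lambda>z. (c * norm h) * norm (heat_grad t (z :: real ^ 'n)))"
        by (rule integrable_mult_right, rule integrable_norm, rule heat_grad_integrable[OF t])
      show "norm ((heat_grad t z \<bullet> h) *\<^sub>R g (x - z)) \<le> (c * norm h) * norm (heat_grad t z)" for z
        using mult_mono[OF Cauchy_Schwarz_ineq2[of "heat_grad t z" h] c[of "x - z"]] by (simp add: ac_simps)
    qed
    also have "\<dots> = (c * norm h) * (LINT z|lborel. norm (heat_grad t (z :: real ^ 'n)))" by simp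
    also have "\<dots> \<le> (c * norm h) * (heat_const TYPE('n) / sqrt t)"
      by (rule mult_left_mono[OF heat_grad_norm_integral[OF t]]) (use c0 in simp)
    also have "\<dots> = heat_const TYPE('n) / sqrt t * c * norm h" by (simp only: ac_simps)
    finally show ?thesis .
  qed
  show "norm (L x h) \<le> heat_const TYPE('n) / sqrt t * c * norm h" by (rule bd)
  define C where "C = 2 powr (real CARD('n) / 2) * (exp (3 / t) + 1 / (4 * t))"
  show "(heat_op t g has_derivative L x) (at x)"
  proof (rule has_derivative_quadratic)
    show "bounded_linear (L x)"
    proof (rule bounded_linear_intro)
      show "L x (a + b) = L x a + L x b" for a b
        unfolding L_def inner_add_right scaleR_add_left by (rule Bochner_Integration.integral_add[OF I I])
      show "L x (r *\<^sub>R a) = r *\<^sub>R L x a" for r a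
        unfolding L_def inner_scaleR_right scaleR_scaleR[symmetric] by (rule integral_scaleR_right)
      show "norm (L x a) \<le> norm a * (heat_const TYPE('n) / sqrt t * c)" for a
        using bd[of a] by (simp only: mult.commute)
    qed
    fix h :: "real ^ 'n" assume h: "norm h \<le> 1"
    have tay: "\<bar>heat_kernel t (z + h) - heat_kernel t z - heat_grad t z \<bullet> h\<bar> \<le> C * (norm h)\<^sup>2 * heat_kernel (2 * t) z" for z
      unfolding C_def by (rule heat_kernel_taylor[OF t h])
    have sh: "integrable lborel (\<lambda>z. heat_kernel t (z + h) *\<^sub>R g (x - z))"
      by (rule integrable_scaleR_bounded[OF integrable_shift[OF heat_kernel_integrable[OF t]] g c])
    have "(LINT z|lborel. (\<lambda>w. heat_kernel t w *\<^sub>R g (x + h - w)) (z + h)) = heat_op t g (x + h)"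
      unfolding heat_op_def by (rule integral_shift) measurable
    then have "heat_op t g (x + h) = (LINT z|lborel. heat_kernel t (z + h) *\<^sub>R g (x - z))" by simp
    then have "heat_op t g (x + h) - heat_op t g x - L x h
       = (LINT z|lborel. heat_kernel t (z + h) *\<^sub>R g (x - z) - heat_kernel t z *\<^sub>R g (x - z) - (heat_grad t z \<bullet> h) *\<^sub>R g (x - z))"
      unfolding L_def heat_op_def[of t g x]
      by (subst Bochner_Integration.integral_diff[OF Bochner_Integration.integrable_diff[OF sh heat_op_integrable[OF t g c]] I],
          subst Bochner_Integration.integral_diff[OF sh heat_op_integrable[OF t g c]]) simp
    also have "\<dots> = (LINT z|lborel. (heat_kernel t (z + h) - heat_kernel t z - heat_grad t z \<bullet> h) *\<^sub>R g (x - z))"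
      by (simp only: scaleR_diff_left)
    finally have eq: "heat_op t g (x + h) - heat_op t g x - L x h
      = (LINT z|lborel. (heat_kernel t (z + h) - heat_kernel t z - heat_grad t z \<bullet> h) *\<^sub>R g (x - z))" .
    have rI: "integrable lborel (\<lambda>z. heat_kernel t (z + h) - heat_kernel t z - heat_grad t z \<bullet> h)"
      by (intro Bochner_Integration.integrable_diff integrable_shift heat_kernel_integrable kI t)
    have "norm (heat_op t g (x + h) - heat_op t g x - L x h)
      \<le> (LINT z|lborel. norm ((heat_kernel t (z + h) - heat_kernel t z - heat_grad t z \<bullet> h) *\<^sub>R g (x - z)))"
      unfolding eq by (rule integral_norm_bound)
    also have "\<dots> \<le> (LINT z|lborel. (C * (norm h)\<^sup>2 * c) * heat_kernel (2 * t) (z :: real ^ 'n))"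
    proof (rule integral_mono)
      show "integrable lborel (\<lambda>z. norm ((heat_kernel t (z + h) - heat_kernel t z - heat_grad t z \<bullet> h) *\<^sub>R g (x - z)))"
        by (rule integrable_norm[OF integrable_scaleR_bounded[OF rI g c]])
      show "integrable lborel (\<lambda>z. (C * (norm h)\<^sup>2 * c) * heat_kernel (2 * t) (z :: real ^ 'n))"
        by (rule integrable_mult_right, rule heat_kernel_integrable) (use t in simp)
      show "norm ((heat_kernel t (z + h) - heat_kernel t z - heat_grad t z \<bullet> h) *\<^sub>R g (x - z))
        \<le> (C * (norm h)\<^sup>2 * c) * heat_kernel (2 * t) z" for z
        using mult_mono[OF tay[of z] c[of "x - z"]] order_trans[OF abs_ge_zero tay[of z]] by (simp add: ac_simps)
    qed
    also have "\<dots> = (C * c) * (norm h)\<^sup>2" using t by (simp add: heat_kernel_integral)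
    finally show "norm (heat_op t g (x + h) - heat_op t g x - L x h) \<le> (C * c) * (norm h)\<^sup>2" .
  qed
qed

lemma heat_op_lipschitz:
  fixes g :: "real ^ 'n::finite \<Rightarrow> 'b::euclidean_space"
  assumes t: "t > 0" and g: "g \<in> borel_measurable borel" and c: "\<And>y. norm (g y) \<le> c"
  shows "norm (heat_op t g x - heat_op t g y) \<le> heat_const TYPE('n) / sqrt t * c * norm (x - y)"
proof (rule differentiable_bound[of UNIV])
  show "(heat_op t g has_derivative (\<lambda>h. LINT z|lborel. (heat_grad t z \<bullet> h) *\<^sub>R g (x - z))) (at x within UNIV)" for x
    using heat_op_has_derivative(1)[OF t g c] by simp
  have "c \<ge> 0" using c[of 0] norm_ge_zero order_trans by blast
  then show "onorm (\<lambda>h. LINT z|lborel. (heat_grad t z \<bullet> h) *\<^sub>R g (x - z)) \<le> heat_const TYPE('n) / sqrt t * c" for x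
    by (intro onorm_bound mult_nonneg_nonneg divide_nonneg_nonneg heat_op_has_derivative(2)[OF t g c])
      (use t heat_const_pos[where 'n='n] in auto)
qed auto

text \<open>The bridge from the trace of a Frechet derivative, as it stands in the definition of a
  solution, to an integral against the gradient of the kernel.\<close>

lemma divergence_heat_semigroup:
  fixes g :: "real ^ 'n::finite \<Rightarrow> real ^ 'n"
  assumes t: "t > 0" and g[measurable]: "g \<in> borel_measurable borel" and c: "\<And>y. norm (g y) \<le> c"
  shows "divergence (heat_semigroup t g) x = grad_op t g x"
proof -
  have hs: "heat_semigroup t g = heat_op t g" using heat_semigroup_eq[OF t g] by auto
  have fd: "frechet_derivative (heat_op t g) (at x) = (\<lambda>h. LINT z|lborel. (heat_grad t z \<bullet> h) *\<^sub>R g (x - z))"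
    by (rule frechet_derivative_at[OF heat_op_has_derivative(1)[OF t g c], symmetric])
  have "(LINT z|lborel. (heat_grad t z \<bullet> axis i 1) *\<^sub>R g (x - z)) $ i = cv (\<lambda>z. heat_grad t z $ i) (\<lambda>y. g y $ i) x" for i
  proof -
    have "(LINT z|lborel. (heat_grad t z \<bullet> axis i 1) *\<^sub>R g (x - z)) \<bullet> axis i 1
      = (LINT z|lborel. ((heat_grad t z \<bullet> axis i 1) *\<^sub>R g (x - z)) \<bullet> axis i 1)"
      by (rule integral_inner_left[symmetric])
        (intro integrable_scaleR_bounded[OF _ g c] integrable_inner_left heat_grad_integrable t)
    then show ?thesis by (simp add: inner_axis cv_def)
  qed
  then show ?thesis unfolding divergence_def hs fd grad_op_sum[OF t g c] by simp
qed

text \<open>Moving the argument by z changes a Lipschitz function by at most K * norm z, and the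
  first moment of the kernel is of order sqrt t.\<close>

lemma heat_op_approx:
  fixes g :: "real ^ 'n::finite \<Rightarrow> 'b::euclidean_space"
  assumes t: "t > 0" and g[measurable]: "g \<in> borel_measurable borel" and c: "\<And>y. norm (g y) \<le> c"
    and L: "\<And>y z. norm (g y - g z) \<le> K * norm (y - z)"
  shows "norm (heat_op t g x - g x) \<le> heat_const TYPE('n) * sqrt t * K"
proof -
  have K0: "K \<ge> 0" using order_trans[OF norm_ge_zero L[of "axis undefined 1" 0]] by simp
  have I: "integrable lborel (\<lambda>z. heat_kernel t z *\<^sub>R g (x - z))" by (rule heat_op_integrable[OF t g c])
  have J: "integrable lborel (\<lambda>z. heat_kernel t z *\<^sub>R g x)"
    by (intro integrable_scaleR_left heat_kernel_integrable t)
  have e: "(LINT z|lborel. heat_kernel t z *\<^sub>R g x) = g x"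
    by (subst integral_scaleR_left) (auto simp: heat_kernel_integral[OF t] heat_kernel_integrable[OF t])
  have eq: "heat_op t g x - g x = (LINT z|lborel. heat_kernel t z *\<^sub>R (g (x - z) - g x))"
    unfolding heat_op_def scaleR_diff_right by (subst Bochner_Integration.integral_diff[OF I J]) (simp only: e)
  have "norm (heat_op t g x - g x) \<le> (LINT z|lborel. norm (heat_kernel t z *\<^sub>R (g (x - z) - g x)))"
    unfolding eq by (rule integral_norm_bound)
  also have "\<dots> \<le> (LINT z|lborel. K * (norm z * heat_kernel t (z :: real ^ 'n)))"
  proof (rule integral_mono)
    show "integrable lborel (\<lambda>z. norm (heat_kernel t z *\<^sub>R (g (x - z) - g x)))"
      unfolding scaleR_diff_right by (rule integrable_norm[OF Bochner_Integration.integrable_diff[OF I J]])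
    show "integrable lborel (\<lambda>z. K * (norm z * heat_kernel t (z :: real ^ 'n)))"
      by (rule integrable_mult_right, rule heat_kernel_moment1_integrable[OF t])
    show "norm (heat_kernel t z *\<^sub>R (g (x - z) - g x)) \<le> K * (norm z * heat_kernel t z)" for z
      using mult_left_mono[OF L[of "x - z" x] heat_kernel_nonneg[of t z]] by (simp add: heat_kernel_nonneg ac_simps)
  qed
  also have "\<dots> = K * (LINT z|lborel. norm z * heat_kernel t (z :: real ^ 'n))" by simp
  also have "\<dots> \<le> K * (heat_const TYPE('n) * sqrt t)" by (rule mult_left_mono[OF heat_kernel_moment1_integral[OF t] K0])
  finally show ?thesis by (simp only: mult.commute)
qed

section \<open>Duhamel integrals\<close>

lemma has_bochner_integral_inverse_sqrt:
  assumes t: "t > 0"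
  shows "has_bochner_integral lborel (\<lambda>s. indicator {0<..<t} s * (1 / sqrt s)) (2 * sqrt t)"
proof (rule has_bochner_integral_nn_integral)
  have e: "t powr (-1/2 + 1) / (-1/2 + 1) = 2 * sqrt t" using t by (simp add: powr_half_sqrt)
  have h: "((\<lambda>x::real. x powr (-1/2)) has_integral (2 * sqrt t)) {0..t}"
    unfolding e[symmetric] by (rule has_integral_powr_from_0) (use t in auto)
  have "(\<integral>\<^sup>+s. ennreal (indicator {0<..<t} s * (1 / sqrt s)) \<partial>lborel)
      = (\<integral>\<^sup>+s. ennreal (s powr (-1/2)) * indicator {0..t} s \<partial>lborel)"
  proof (rule nn_integral_cong_AE)
    show "AE s in lborel. ennreal (indicator {0<..<t} s * (1 / sqrt s)) = ennreal (s powr (-1/2)) * indicator {0..t} s"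
      using AE_lborel_singleton[of 0] AE_lborel_singleton[of t]
    proof eventually_elim
      case (elim s)
      have "s > 0 \<Longrightarrow> s powr (-1/2) = 1 / sqrt s" by (simp add: powr_minus_divide powr_half_sqrt)
      then show ?case using elim by (auto simp: indicator_def)
    qed
  qed
  also have "\<dots> = ennreal (2 * sqrt t)"
    by (rule nn_integral_has_integral_lebesgue'[OF _ h]) simp
  finally show "(\<integral>\<^sup>+s. ennreal (indicator {0<..<t} s * (1 / sqrt s)) \<partial>lborel) = ennreal (2 * sqrt t)" .
  show "AE s in lborel. 0 \<le> indicator {0<..<t} s * (1 / sqrt s)"
    by (rule AE_I2) (auto simp: indicator_def)
qed (use t in auto)

lemma has_bochner_integral_inverse_sqrt_reflect:
  assumes t: "t > 0"
  shows "has_bochner_integral lborel (\<lambda>s. indicator {0<..<t} s * (1 / sqrt (t - s))) (2 * sqrt t)"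
proof -
  define f where "f = (\<lambda>s. indicator {0<..<t} s * (1 / sqrt s))"
  have f: "has_bochner_integral lborel f (2 * sqrt t)"
    unfolding f_def by (rule has_bochner_integral_inverse_sqrt[OF t])
  have "f \<in> borel_measurable borel" unfolding f_def by measurable
  then have *: "has_bochner_integral lborel (\<lambda>s. f (t - s)) (2 * sqrt t)"
    unfolding has_bochner_integral_iff
    using integrable_reflect[OF integrable.intros[OF f], of t] integral_reflect[of f t] has_bochner_integral_integral_eq[OF f] by simp
  have "indicator {0<..<t} (t - s) = (indicator {0<..<t} s :: real)" for s by (auto simp: indicator_def)
  then show ?thesis using * unfolding f_def by simp
qed

text \<open>One of s and t - s is at least t / 2, and its root can be taken out. This replaces the
  evaluation of the integral of 1 / sqrt (s * (t - s)) as a Beta integral.\<close>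

lemma inverse_sqrt_product:
  assumes "0 < s" "s < t"
  shows "1 / sqrt (t - s) * (1 / sqrt s) \<le> sqrt 2 / sqrt t * (1 / sqrt s + 1 / sqrt (t - s))"
proof -
  have *: "1 / sqrt p * (1 / sqrt q) \<le> sqrt 2 / sqrt t * (1 / sqrt q + 1 / sqrt p)" if "p > 0" "q > 0" "p + q = t" "q \<le> p" for p q
  proof -
    have "sqrt t \<le> sqrt (2 * p)" using that by simp
    then have "sqrt t \<le> sqrt 2 * sqrt p" by (simp only: real_sqrt_mult)
    then have "1 / sqrt p \<le> sqrt 2 / sqrt t" using that by (simp add: divide_simps)
    then have "1 / sqrt p * (1 / sqrt q) \<le> sqrt 2 / sqrt t * (1 / sqrt q)"
      by (rule mult_right_mono) (use that in simp)
    also have "\<dots> \<le> sqrt 2 / sqrt t * (1 / sqrt q + 1 / sqrt p)"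
      by (rule mult_left_mono) (use that in auto)
    finally show ?thesis .
  qed
  show ?thesis
  proof (cases "s \<le> t - s")
    case True then show ?thesis using *[of "t - s" s] assms by simp
  next
    case False then show ?thesis using *[of s "t - s"] assms by (simp add: mult.commute add.commute)
  qed
qed

lemma sqrt2_le: "sqrt 2 \<le> (3 / 2 :: real)"
  by (rule real_le_lsqrt) (auto simp: power2_eq_square)

text \<open>The factor 1 / sqrt (t - s) comes from the divergence, and a + b / sqrt s is the typical
  bound on a flux increment, because the Lipschitz constant of a solution blows up like 1 / sqrt s.
  The 6 is 4 * (3 / 2) \<ge> 4 * sqrt 2.\<close>

lemma duhamel_weight:
  assumes t: "t > 0" and ab: "a \<ge> 0" "b \<ge> 0"
  shows "integrable lborel (\<lambda>s. indicator {0<..<t} s * (1 / sqrt (t - s) * (a + b / sqrt s)))"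
    and "(LINT s|lborel. indicator {0<..<t} s * (1 / sqrt (t - s) * (a + b / sqrt s))) \<le> 2 * sqrt t * a + 6 * b"
proof -
  let ?w = "\<lambda>s. a * (indicator {0<..<t} s * (1 / sqrt (t - s)))
      + (b * (sqrt 2 / sqrt t)) * (indicator {0<..<t} s * (1 / sqrt s) + indicator {0<..<t} s * (1 / sqrt (t - s)))"
  have w: "has_bochner_integral lborel ?w (a * (2 * sqrt t) + (b * (sqrt 2 / sqrt t)) * (2 * sqrt t + 2 * sqrt t))"
    by (intro has_bochner_integral_add has_bochner_integral_mult_right has_bochner_integral_inverse_sqrt has_bochner_integral_inverse_sqrt_reflect t)
  have le: "indicator {0<..<t} s * (1 / sqrt (t - s) * (a + b / sqrt s)) \<le> ?w s" for s
  proof (cases "0 < s \<and> s < t")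
    case True
    have "1 / sqrt (t - s) * (a + b / sqrt s) = a * (1 / sqrt (t - s)) + b * (1 / sqrt (t - s) * (1 / sqrt s))"
      by (simp add: add_divide_distrib mult.commute)
    also have "\<dots> \<le> a * (1 / sqrt (t - s)) + b * (sqrt 2 / sqrt t * (1 / sqrt s + 1 / sqrt (t - s)))"
      using inverse_sqrt_product[of s t] True ab by (intro add_left_mono mult_left_mono) auto
    finally show ?thesis using True by (simp add: mult.assoc)
  qed simp
  have nn: "0 \<le> indicator {0<..<t} s * (1 / sqrt (t - s) * (a + b / sqrt s))" for s
    using ab by (auto simp: indicator_def)
  show I: "integrable lborel (\<lambda>s. indicator {0<..<t} s * (1 / sqrt (t - s) * (a + b / sqrt s)))"
  proof (rule integrable_dominated[OF integrable.intros])
    show "has_bochner_integral lborel ?w (a * (2 * sqrt t) + (b * (sqrt 2 / sqrt t)) * (2 * sqrt t + 2 * sqrt t))" by (rule w)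
    show "norm (indicator {0<..<t} s * (1 / sqrt (t - s) * (a + b / sqrt s))) \<le> ?w s" for s
      using le[of s] nn[of s] by (simp only: real_norm_def abs_of_nonneg)
  qed measurable
  have "(LINT s|lborel. indicator {0<..<t} s * (1 / sqrt (t - s) * (a + b / sqrt s))) \<le> (LINT s|lborel. ?w s)"
    by (rule integral_mono[OF I integrable.intros[OF w] le])
  also have "\<dots> = a * (2 * sqrt t) + (b * (sqrt 2 / sqrt t)) * (2 * sqrt t + 2 * sqrt t)"
    by (rule has_bochner_integral_integral_eq[OF w])
  also have "\<dots> = 2 * sqrt t * a + (4 * sqrt 2) * b" using t by simp
  also have "\<dots> \<le> 2 * sqrt t * a + 6 * b"
    using sqrt2_le ab by (intro add_left_mono mult_right_mono) auto
  finally show "(LINT s|lborel. indicator {0<..<t} s * (1 / sqrt (t - s) * (a + b / sqrt s))) \<le> 2 * sqrt t * a + 6 * b" .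
qed

section \<open>Duhamel integrals of time-dependent fields\<close>

definition duhamel :: "real \<Rightarrow> (real \<Rightarrow> real ^ 'n::finite \<Rightarrow> real ^ 'n) \<Rightarrow> real ^ 'n \<Rightarrow> real" where
  "duhamel t g x = (LINT s|lborel. indicator {0<..<t} s * grad_op (t - s) (g s) x)"

lemma section_measurable:
  assumes "(\<lambda>p. g (fst p) (snd p)) \<in> borel_measurable (borel \<Otimes>\<^sub>M borel)"
  shows "g s \<in> borel_measurable borel"
  using measurable_compose[OF measurable_Pair1' assms, of s] by simp

lemma joint_measurable_compose:
  assumes g: "(\<lambda>p. g (fst p) (snd p)) \<in> borel_measurable (borel \<Otimes>\<^sub>M borel)"
    and [measurable]: "f \<in> borel_measurable N" "h \<in> borel_measurable N"
  shows "(\<lambda>w. g (f w) (h w)) \<in> borel_measurable N"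
proof -
  have "(\<lambda>w. (f w, h w)) \<in> N \<rightarrow>\<^sub>M borel \<Otimes>\<^sub>M borel" by measurable
  from measurable_compose[OF this g] show ?thesis by simp
qed

lemma duhamel_measurable [measurable (raw)]:
  assumes g: "(\<lambda>p. g (fst p) (snd p)) \<in> borel_measurable (borel \<Otimes>\<^sub>M borel)"
    and [measurable]: "f \<in> borel_measurable M" "h \<in> borel_measurable M"
  shows "(\<lambda>w. duhamel (f w) g (h w :: real ^ 'n::finite)) \<in> borel_measurable M"
proof -
  note [measurable (raw)] = joint_measurable_compose[OF g]
  have "(\<lambda>w. duhamel (f w) g (h w)) = (\<lambda>w. LINT s|lborel. (if 0 < s \<and> s < f w then grad_op (f w - s) (g s) (h w) else 0))"
    unfolding duhamel_def by (intro ext Bochner_Integration.integral_cong) (auto simp: indicator_def)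
  moreover have "(\<lambda>w. LINT s|lborel. (if 0 < s \<and> s < f w then grad_op (f w - s) (g s) (h w) else 0)) \<in> borel_measurable M"
    by (rule lborel.borel_measurable_lebesgue_integral) (simp add: case_prod_beta', measurable)
  ultimately show ?thesis by simp
qed

lemma duhamel_integrand_measurable:
  assumes g: "(\<lambda>p. g (fst p) (snd p)) \<in> borel_measurable (borel \<Otimes>\<^sub>M borel)"
  shows "(\<lambda>p. indicator {0<..<t} (fst p) * grad_op (t - fst p) (g (fst p)) (snd p :: real ^ 'n::finite)) \<in> borel_measurable (borel \<Otimes>\<^sub>M borel)"
proof -
  note [measurable (raw)] = joint_measurable_compose[OF g]
  show ?thesis by measurable
qed

lemma duhamel_integrand_measurable':
  assumes [measurable]: "(\<lambda>p. g (fst p) (snd p)) \<in> borel_measurable (borel \<Otimes>\<^sub>M borel)"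
  shows "(\<lambda>s. indicator {0<..<t} s * grad_op (t - s) (g s) (x :: real ^ 'n::finite)) \<in> borel_measurable borel"
proof -
  have "(\<lambda>s. (s, x)) \<in> borel \<rightarrow>\<^sub>M borel \<Otimes>\<^sub>M borel" by measurable
  from measurable_compose[OF this duhamel_integrand_measurable[OF assms, of t]] show ?thesis by simp
qed

text \<open>The bound is asked for at almost every time only, since it will be applied to a field
  that is defined piecewise in time and carries no information at the grid times.\<close>

lemma duhamel_dominated:
  fixes g :: "real \<Rightarrow> real ^ 'n::finite \<Rightarrow> real ^ 'n"
  assumes t: "t > 0" and g[measurable]: "(\<lambda>p. g (fst p) (snd p)) \<in> borel_measurable (borel \<Otimes>\<^sub>M borel)"
    and ab: "a \<ge> 0" "b \<ge> 0"
    and bd: "AE s in lborel. 0 < s \<longrightarrow> s < t \<longrightarrow> (\<forall>y. norm (g s y) \<le> a + b / sqrt s)"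
  shows "integrable lborel (\<lambda>s. indicator {0<..<t} s * grad_op (t - s) (g s) x)"
    and "\<bar>duhamel t g x\<bar> \<le> heat_const TYPE('n) * (2 * sqrt t * a + 6 * b)"
proof -
  let ?H = "heat_const TYPE('n)"
  let ?w = "\<lambda>s. ?H * (indicator {0<..<t} s * (1 / sqrt (t - s) * (a + b / sqrt s)))"
  have m: "(\<lambda>s. indicator {0<..<t} s * grad_op (t - s) (g s) x) \<in> borel_measurable lborel"
    using duhamel_integrand_measurable'[OF g, of t x] by simp
  have le: "AE s in lborel. \<bar>indicator {0<..<t} s * grad_op (t - s) (g s) x\<bar> \<le> ?w s"
    using bd
  proof eventually_elim
    case (elim s)
    show ?case
    proof (cases "0 < s \<and> s < t")
      case True
      have "\<bar>grad_op (t - s) (g s) x\<bar> \<le> ?H / sqrt (t - s) * (a + b / sqrt s)"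
        by (rule grad_op_bound[OF _ section_measurable[OF g]]) (use True elim in auto)
      then show ?thesis using True by simp
    qed simp
  qed
  have wI: "integrable lborel ?w" by (rule integrable_mult_right, rule duhamel_weight(1)[OF t ab])
  show I: "integrable lborel (\<lambda>s. indicator {0<..<t} s * grad_op (t - s) (g s) x)"
  proof (rule Bochner_Integration.integrable_bound[OF wI m])
    show "AE s in lborel. norm (indicator {0<..<t} s * grad_op (t - s) (g s) x) \<le> norm (?w s)"
      using le
    proof eventually_elim
      case (elim s)
      then show ?case unfolding real_norm_def by (rule order_trans[OF _ abs_ge_self])
    qed
  qed
  have "\<bar>duhamel t g x\<bar> \<le> (LINT s|lborel. \<bar>indicator {0<..<t} s * grad_op (t - s) (g s) x\<bar>)"
    unfolding duhamel_def real_norm_def[symmetric] by (rule integral_norm_bound)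
  also have "\<dots> \<le> (LINT s|lborel. ?w s)"
    by (rule integral_mono_AE[OF integrable_abs[OF I] wI le])
  also have "\<dots> = ?H * (LINT s|lborel. indicator {0<..<t} s * (1 / sqrt (t - s) * (a + b / sqrt s)))" by (rule integral_mult_right_zero)
  also have "\<dots> \<le> ?H * (2 * sqrt t * a + 6 * b)"
    by (rule mult_left_mono[OF duhamel_weight(2)[OF t ab]]) (use heat_const_pos[where 'n='n] in simp)
  finally show "\<bar>duhamel t g x\<bar> \<le> ?H * (2 * sqrt t * a + 6 * b)" .
qed

lemma duhamel_bounded:
  fixes g :: "real \<Rightarrow> real ^ 'n::finite \<Rightarrow> real ^ 'n"
  assumes "t > 0" "(\<lambda>p. g (fst p) (snd p)) \<in> borel_measurable (borel \<Otimes>\<^sub>M borel)"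
    and b: "\<And>s y. norm (g s y) \<le> b"
  shows "integrable lborel (\<lambda>s. indicator {0<..<t} s * grad_op (t - s) (g s) x)"
    and "\<bar>duhamel t g x\<bar> \<le> heat_const TYPE('n) * (2 * sqrt t * b)"
proof -
  have "b \<ge> 0" using b[of 0 0] norm_ge_zero order_trans by blast
  then show "integrable lborel (\<lambda>s. indicator {0<..<t} s * grad_op (t - s) (g s) x)"
    "\<bar>duhamel t g x\<bar> \<le> heat_const TYPE('n) * (2 * sqrt t * b)"
    using duhamel_dominated[OF assms(1,2), of b 0] b by simp_all
qed

lemma duhamel_diff:
  fixes g h :: "real \<Rightarrow> real ^ 'n::finite \<Rightarrow> real ^ 'n"
  assumes t: "t > 0" and g: "(\<lambda>p. g (fst p) (snd p)) \<in> borel_measurable (borel \<Otimes>\<^sub>M borel)"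
    and h: "(\<lambda>p. h (fst p) (snd p)) \<in> borel_measurable (borel \<Otimes>\<^sub>M borel)"
    and b: "\<And>s y. norm (g s y) \<le> b" and c: "\<And>s y. norm (h s y) \<le> c"
  shows "duhamel t (\<lambda>s y. g s y - h s y) x = duhamel t g x - duhamel t h x"
proof -
  have "indicator {0<..<t} s * grad_op (t - s) (\<lambda>y. g s y - h s y) x
     = indicator {0<..<t} s * grad_op (t - s) (g s) x - indicator {0<..<t} s * grad_op (t - s) (h s) x" for s
    using grad_op_diff[OF _ section_measurable[OF g] section_measurable[OF h] b c, of "t - s" s s x]
    by (auto simp: indicator_def)
  then show ?thesis unfolding duhamel_def
    using Bochner_Integration.integral_diff[OF duhamel_bounded(1)[OF t g b] duhamel_bounded(1)[OF t h c]] by simp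
qed

lemma duhamel_translate: "duhamel t (\<lambda>s y. g s (y + a)) x = duhamel t g (x + a)"
  unfolding duhamel_def grad_op_translate ..

text \<open>The flux before time r contributes a function that is then moved by the heat flow for
  time t; the flow enters the time integral by Fubini and merges with each kernel. The flux after r
  contributes the same kind of integral with the clock reset.\<close>

lemma duhamel_split:
  fixes g :: "real \<Rightarrow> real ^ 'n::finite \<Rightarrow> real ^ 'n"
  assumes r: "r > 0" and t: "t > 0" and g: "(\<lambda>p. g (fst p) (snd p)) \<in> borel_measurable (borel \<Otimes>\<^sub>M borel)"
    and b: "\<And>s y. norm (g s y) \<le> b"
  shows "duhamel (r + t) g x = heat_op t (duhamel r g) x + duhamel t (\<lambda>s. g (r + s)) x"
proof -
  let ?H = "heat_const TYPE('n)"
  note gm[measurable] = g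
  define \<Phi> where "\<Phi> = (\<lambda>s y. indicator {0<..<r} s * grad_op (r - s) (g s) y)"
  have \<Phi>m[measurable]: "(\<lambda>p. \<Phi> (fst p) (snd p)) \<in> borel_measurable (borel \<Otimes>\<^sub>M borel)"
    unfolding \<Phi>_def by (rule duhamel_integrand_measurable[OF g])
  \<comment> \<open>A majorant independent of y, so that the double integrand is dominated by the
    product of the kernel and an integrable function of time.\<close>
  let ?w = "\<lambda>s. (?H * b) * (indicator {0<..<r} s * (1 / sqrt (r - s)))"
  have wI: "integrable lborel ?w"
    by (rule integrable_mult_right, rule integrable.intros, rule has_bochner_integral_inverse_sqrt_reflect[OF r])
  have \<Phi>b: "\<bar>\<Phi> s y\<bar> \<le> ?w s" for s y
    using grad_op_bound[OF _ section_measurable[OF g] b, of "r - s" s y] by (auto simp: \<Phi>_def indicator_def)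
  have \<Phi>I: "integrable lborel (\<lambda>s. \<Phi> s y)" for y
    unfolding \<Phi>_def by (rule duhamel_bounded(1)[OF r g b])
  have m1: "(\<lambda>p. heat_kernel t (fst p) * \<Phi> (snd p) (x - fst p)) \<in> borel_measurable (borel \<Otimes>\<^sub>M borel)"
  proof -
    have "(\<lambda>p. (\<lambda>p. \<Phi> (fst p) (snd p)) (snd p, x - fst p)) \<in> borel_measurable (borel \<Otimes>\<^sub>M borel)" by measurable
    then have [measurable]: "(\<lambda>p. \<Phi> (snd p) (x - fst p)) \<in> borel_measurable (borel \<Otimes>\<^sub>M borel)" by simp
    show ?thesis by measurable
  qed
  have FI: "integrable (lborel \<Otimes>\<^sub>M lborel) (\<lambda>(z, s). heat_kernel t z * \<Phi> s (x - z))"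
  proof (rule lborel_pair.Fubini_integrable)
    show mm: "(\<lambda>(z, s). heat_kernel t z * \<Phi> s (x - z)) \<in> borel_measurable (lborel \<Otimes>\<^sub>M lborel)"
      using m1 by (simp add: case_prod_beta' cong: measurable_cong_sets sets_pair_measure_cong)
    show "AE z in lborel. integrable lborel (\<lambda>s. case (z, s) of (z, s) \<Rightarrow> heat_kernel t z * \<Phi> s (x - z))"
      using \<Phi>I by simp
    show "integrable lborel (\<lambda>z. LINT s|lborel. norm (case (z, s) of (z, s) \<Rightarrow> heat_kernel t z * \<Phi> s (x - z)))"
    proof (rule integrable_dominated)
      show "integrable lborel (\<lambda>z :: real ^ 'n. heat_kernel t z * (LINT s|lborel. ?w s))"
        by (rule integrable_mult_left, rule heat_kernel_integrable[OF t])
      show "norm (LINT s|lborel. norm (case (z, s) of (z, s) \<Rightarrow> heat_kernel t z * \<Phi> s (x - z)))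
         \<le> heat_kernel t z * (LINT s|lborel. ?w s)" for z
      proof -
        have "(LINT s|lborel. norm (heat_kernel t z * \<Phi> s (x - z))) = heat_kernel t z * (LINT s|lborel. \<bar>\<Phi> s (x - z)\<bar>)"
          by (simp add: abs_mult heat_kernel_nonneg)
        also have "\<dots> \<le> heat_kernel t z * (LINT s|lborel. ?w s)"
          by (rule mult_left_mono[OF integral_mono[OF integrable_abs[OF \<Phi>I] wI \<Phi>b] heat_kernel_nonneg])
        finally show ?thesis by (simp add: integral_nonneg_AE)
      qed
      show "(\<lambda>z. LINT s|lborel. norm (case (z, s) of (z, s) \<Rightarrow> heat_kernel t z * \<Phi> s (x - z))) \<in> borel_measurable lborel"
        using mm by (intro lborel.borel_measurable_lebesgue_integral) (simp add: case_prod_beta')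
    qed
  qed
  have "heat_op t (duhamel r g) x = (LINT z|lborel. LINT s|lborel. heat_kernel t z * \<Phi> s (x - z))"
    unfolding heat_op_def duhamel_def \<Phi>_def by simp
  also have "\<dots> = (LINT s|lborel. LINT z|lborel. heat_kernel t z * \<Phi> s (x - z))"
    by (rule lborel_pair.Fubini_integral[OF FI, symmetric])
  also have "\<dots> = (LINT s|lborel. indicator {0<..<r} s * grad_op (t + r - s) (g s) x)"
  proof (rule Bochner_Integration.integral_cong)
    fix s :: real
    show "(LINT z|lborel. heat_kernel t z * \<Phi> s (x - z)) = indicator {0<..<r} s * grad_op (t + r - s) (g s) x"
    proof (cases "0 < s \<and> s < r")
      case True
      then have "(LINT z|lborel. heat_kernel t z * \<Phi> s (x - z)) = heat_op t (grad_op (r - s) (g s)) x"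
        by (simp add: \<Phi>_def heat_op_def)
      also have "\<dots> = grad_op (t + (r - s)) (g s) x"
        by (rule heat_grad_op[OF t _ section_measurable[OF g] b]) (use True in simp)
      finally show ?thesis using True by (simp add: algebra_simps)
    qed (simp add: \<Phi>_def)
  qed simp
  finally have 1: "heat_op t (duhamel r g) x = (LINT s|lborel. indicator {0<..<r} s * grad_op (r + t - s) (g s) x)"
    by (simp add: add.commute)
  let ?f = "\<lambda>s. indicator {0<..<r + t} s * grad_op (r + t - s) (g s) x"
  have fI: "integrable lborel ?f" by (rule duhamel_bounded(1)[OF _ g b]) (use r t in simp)
  have fI1: "integrable lborel (\<lambda>s. indicator {0<..<r} s *\<^sub>R ?f s)" by (rule integrable_mult_indicator[OF _ fI]) simp
  have fI2: "integrable lborel (\<lambda>s. indicator {r<..<r + t} s *\<^sub>R ?f s)" by (rule integrable_mult_indicator[OF _ fI]) simp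
  have "duhamel (r + t) g x = (LINT s|lborel. indicator {0<..<r} s *\<^sub>R ?f s + indicator {r<..<r + t} s *\<^sub>R ?f s)"
    unfolding duhamel_def
  proof (rule integral_cong_AE)
    show "AE s in lborel. ?f s = indicator {0<..<r} s *\<^sub>R ?f s + indicator {r<..<r + t} s *\<^sub>R ?f s"
      using AE_lborel_singleton[of r] by eventually_elim (use r t in \<open>auto simp: indicator_def\<close>)
  qed (use borel_measurable_integrable[OF fI] borel_measurable_integrable[OF fI1] borel_measurable_integrable[OF fI2] in auto)
  also have "\<dots> = (LINT s|lborel. indicator {0<..<r} s *\<^sub>R ?f s) + (LINT s|lborel. indicator {r<..<r + t} s *\<^sub>R ?f s)"
    by (rule Bochner_Integration.integral_add[OF fI1 fI2])
  also have "(LINT s|lborel. indicator {0<..<r} s *\<^sub>R ?f s) = (LINT s|lborel. indicator {0<..<r} s * grad_op (r + t - s) (g s) x)"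
    by (rule Bochner_Integration.integral_cong) (use t in \<open>auto simp: indicator_def\<close>)
  also have "(LINT s|lborel. indicator {r<..<r + t} s *\<^sub>R ?f s) = (LINT s|lborel. indicator {r<..<r + t} (s + r) *\<^sub>R ?f (s + r))"
    by (rule integral_shift[symmetric]) (use borel_measurable_integrable[OF fI2] in simp)
  also have "\<dots> = duhamel t (\<lambda>s. g (r + s)) x"
    unfolding duhamel_def by (rule Bochner_Integration.integral_cong) (use r in \<open>auto simp: indicator_def algebra_simps\<close>)
  finally show ?thesis using 1 by simp
qed

text \<open>A substitute for Gronwall's inequality: k applications of the hypothesis leave 2 * A
  plus (1 / 2)^k times the a priori bound. What counts about b0 is that it is finite, so crude
  bounds may be used for it.\<close>

lemma absorb_half:
  fixes \<phi> :: "'a \<Rightarrow> real"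
  assumes fin: "\<And>x. x \<in> S \<Longrightarrow> \<phi> x \<le> b0"
    and step: "\<And>b x. b \<ge> 0 \<Longrightarrow> (\<And>y. y \<in> S \<Longrightarrow> \<phi> y \<le> b) \<Longrightarrow> x \<in> S \<Longrightarrow> \<phi> x \<le> A + b / 2"
    and A: "A \<ge> 0" and x: "x \<in> S"
  shows "\<phi> x \<le> 2 * A"
proof -
  have *: "\<forall>y\<in>S. \<phi> y \<le> 2 * A + max b0 0 * (1 / 2) ^ k" for k
  proof (induction k)
    case 0
    have "\<phi> y \<le> 2 * A + max b0 0" if "y \<in> S" for y using fin[OF that] A by linarith
    then show ?case by simp
  next
    case (Suc k)
    have nn: "0 \<le> 2 * A + max b0 0 * (1 / 2) ^ k" using A by simp
    show ?case
    proof
      fix y assume y: "y \<in> S"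
      have "\<phi> y \<le> A + (2 * A + max b0 0 * (1 / 2) ^ k) / 2"
        using Suc by (intro step[OF nn _ y]) blast
      also have "\<dots> = 2 * A + max b0 0 * (1 / 2) ^ Suc k" by (simp add: add_divide_distrib)
      finally show "\<phi> y \<le> 2 * A + max b0 0 * (1 / 2) ^ Suc k" .
    qed
  qed
  have lim: "(\<lambda>k. 2 * A + max b0 0 * (1 / 2) ^ k) \<longlonglongrightarrow> 2 * A + max b0 0 * 0"
    by (intro tendsto_add tendsto_mult tendsto_const LIMSEQ_realpow_zero) auto
  have "\<phi> x \<le> 2 * A + max b0 0 * 0"
    by (rule LIMSEQ_le_const[OF lim]) (use * x in blast)
  then show ?thesis by simp
qed

section \<open>Mild solutions\<close>

text \<open>The equation holds at every point rather than almost everywhere, as suprema and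
  difference quotients require. It is imposed at positive times only, with the datum u0 as a
  parameter, and the horizon T is excluded.\<close>

definition mild :: "(real \<Rightarrow> real ^ 'n::finite) \<Rightarrow> (real ^ 'n \<Rightarrow> real) \<Rightarrow> (real \<Rightarrow> real ^ 'n \<Rightarrow> real) \<Rightarrow> real \<Rightarrow> bool" where
  "mild F u0 U T \<longleftrightarrow>
     (\<lambda>p. U (fst p) (snd p)) \<in> borel_measurable (borel \<Otimes>\<^sub>M borel) \<and> u0 \<in> borel_measurable borel \<and>
     (\<forall>t x. 0 < t \<longrightarrow> t < T \<longrightarrow> U t x = heat_op t u0 x - duhamel t (\<lambda>s y. F (U s y)) x)"

text \<open>A globally bounded and Lipschitz flux is no loss once the values of the solution lie in
  a known interval. B serves finiteness statements and the error constant of the scheme, whereas the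
  final estimate is expressed through K.\<close>

locale flux =
  fixes F :: "real \<Rightarrow> real ^ 'n::finite" and K B :: real
  assumes F_lipschitz: "norm (F a - F b) \<le> K * \<bar>a - b\<bar>"
    and F_bounded: "norm (F a) \<le> B"
    and K_pos: "K > 0"
begin

lemma B_nonneg: "B \<ge> 0" using F_bounded[of 0] norm_ge_zero order_trans by blast

lemma F_measurable [measurable]: "F \<in> borel_measurable borel"
proof (rule borel_measurable_continuous_onI)
  have "K-lipschitz_on UNIV F"
    by (rule lipschitz_onI) (use F_lipschitz K_pos in \<open>auto simp: dist_norm\<close>)
  then show "continuous_on UNIV F" by (rule lipschitz_on_continuous_on)
qed

lemma mild_measurable:
  assumes "mild F u0 U T"
  shows "(\<lambda>p. U (fst p) (snd p)) \<in> borel_measurable (borel \<Otimes>\<^sub>M borel)"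
    and "(\<lambda>p. F (U (fst p) (snd p))) \<in> borel_measurable (borel \<Otimes>\<^sub>M borel)"
    and "U s \<in> borel_measurable borel" and "u0 \<in> borel_measurable borel"
    and "(\<lambda>p. F (U (fst p) (snd p + a))) \<in> borel_measurable (borel \<Otimes>\<^sub>M borel)"
proof -
  show 1: "(\<lambda>p. U (fst p) (snd p)) \<in> borel_measurable (borel \<Otimes>\<^sub>M borel)"
    and "u0 \<in> borel_measurable borel" using assms by (auto simp: mild_def)
  note [measurable] = 1
  show "(\<lambda>p. F (U (fst p) (snd p))) \<in> borel_measurable (borel \<Otimes>\<^sub>M borel)" by measurable
  show "U s \<in> borel_measurable borel" by (rule section_measurable[OF 1])
  note [measurable (raw)] = joint_measurable_compose[OF 1]
  show "(\<lambda>p. F (U (fst p) (snd p + a))) \<in> borel_measurable (borel \<Otimes>\<^sub>M borel)" by measurable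
qed

lemma mild_eq:
  assumes "mild F u0 U T" "0 < t" "t < T"
  shows "U t x = heat_op t u0 x - duhamel t (\<lambda>s y. F (U s y)) x"
  using assms by (auto simp: mild_def)

text \<open>This bound grows with t and depends on B; it provides the finiteness that
  \<open>absorb_half\<close> and the convolution estimates ask for until the maximum principle is
  available.\<close>

lemma mild_bounded:
  assumes M: "mild F u0 U T" and m: "\<And>y. \<bar>u0 y\<bar> \<le> m" and t: "0 < t" "t < T"
  shows "\<bar>U t x\<bar> \<le> m + heat_const TYPE('n) * (2 * sqrt t * B)"
proof -
  have "\<bar>heat_op t u0 x\<bar> \<le> m"
    using heat_op_bound[OF t(1) mild_measurable(4)[OF M], of m x] m by simp
  moreover have "\<bar>duhamel t (\<lambda>s y. F (U s y)) x\<bar> \<le> heat_const TYPE('n) * (2 * sqrt t * B)"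
    by (rule duhamel_bounded(2)[OF t(1) mild_measurable(2)[OF M] F_bounded])
  ultimately show ?thesis unfolding mild_eq[OF M t] by linarith
qed

text \<open>The heat flow is applied to Duhamel's formula at time r and compared with the formula at
  time r + t. Every short-time estimate thereby becomes available at later times, with U r in the
  role of the datum.\<close>

lemma mild_restart:
  assumes M: "mild F u0 U T" and m: "\<And>y. \<bar>u0 y\<bar> \<le> m" and r: "0 < r" "r < T"
  shows "mild F (U r) (\<lambda>s. U (r + s)) (T - r)"
  unfolding mild_def
proof (intro conjI allI impI)
  show "U r \<in> borel_measurable borel" by (rule mild_measurable(3)[OF M])
  show "(\<lambda>p. U (r + fst p) (snd p)) \<in> borel_measurable (borel \<Otimes>\<^sub>M borel)"
    by (rule joint_measurable_compose[OF mild_measurable(1)[OF M]]) measurable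
  fix t x assume t: "0 < t" "t < T - r"
  note um = mild_measurable(4)[OF M] and Fm = mild_measurable(2)[OF M]
  have dm: "duhamel r (\<lambda>s y. F (U s y)) \<in> borel_measurable borel"
    by (rule duhamel_measurable[OF Fm]) measurable
  note [measurable] = um
  have um': "heat_op r u0 \<in> borel_measurable borel" by measurable
  have "heat_op t (U r) x = heat_op t (\<lambda>y. heat_op r u0 y - duhamel r (\<lambda>s y. F (U s y)) y) x"
    using mild_eq[OF M r] by presburger
  also have "\<dots> = heat_op t (heat_op r u0) x - heat_op t (duhamel r (\<lambda>s y. F (U s y))) x"
  proof (rule heat_op_diff[OF t(1) um' dm])
    show "norm (heat_op r u0 y) \<le> m" for y by (rule heat_op_bound[OF r(1) um]) (use m in simp)
    show "norm (duhamel r (\<lambda>s y. F (U s y)) y) \<le> heat_const TYPE('n) * (2 * sqrt r * B)" for y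
      unfolding real_norm_def by (rule duhamel_bounded(2)[OF r(1) Fm F_bounded])
  qed
  also have "heat_op t (heat_op r u0) x = heat_op (t + r) u0 x"
    by (rule heat_heat_op[OF t(1) r(1) um m])
  finally have 1: "heat_op t (U r) x = heat_op (r + t) u0 x - heat_op t (duhamel r (\<lambda>s y. F (U s y))) x"
    by (simp add: add.commute)
  have "U (r + t) x = heat_op (r + t) u0 x - duhamel (r + t) (\<lambda>s y. F (U s y)) x"
    by (rule mild_eq[OF M]) (use r t in auto)
  then show "U (r + t) x = heat_op t (U r) x - duhamel t (\<lambda>s y. F (U (r + s) y)) x"
    unfolding duhamel_split[OF r(1) t(1) Fm F_bounded] 1 by simp
qed

text \<open>Translation commutes with both terms, so an increment satisfies an equation of the same
  form, whose flux is at most K times the increment.\<close>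

lemma mild_translate_diff:
  assumes M: "mild F u0 U T" and m: "\<And>y. \<bar>u0 y\<bar> \<le> m" and t: "0 < t" "t < T"
  shows "U t (x + a) - U t x = heat_op t (\<lambda>y. u0 (y + a) - u0 y) x
      - duhamel t (\<lambda>s y. F (U s (y + a)) - F (U s y)) x"
proof -
  note [measurable] = mild_measurable(4)[OF M]
  have "heat_op t (\<lambda>y. u0 (y + a) - u0 y) x = heat_op t (\<lambda>y. u0 (y + a)) x - heat_op t u0 x"
    by (rule heat_op_diff[OF t(1), of _ _ m m]) (use m in auto)
  moreover have "duhamel t (\<lambda>s y. F (U s (y + a)) - F (U s y)) x
     = duhamel t (\<lambda>s y. F (U s (y + a))) x - duhamel t (\<lambda>s y. F (U s y)) x"
    by (rule duhamel_diff[OF t(1) mild_measurable(5)[OF M] mild_measurable(2)[OF M] F_bounded F_bounded])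
  moreover have "duhamel t (\<lambda>s y. F (U s (y + a))) x = duhamel t (\<lambda>s y. F (U s y)) (x + a)"
    by (rule duhamel_translate)
  ultimately show ?thesis unfolding mild_eq[OF M t] heat_op_translate by simp
qed

text \<open>Smoothing: bounded data become Lipschitz at the rate 1 / sqrt t. The flux term
  reproduces the quantity to be bounded with the factor 6 H K sqrt t, where H is
  \<open>heat_const\<close>; the smallness assumption makes this at most 1 / 2, which is why 12
  appears.\<close>

lemma mild_lipschitz:
  assumes M: "mild F u0 U T" and m: "\<And>y. \<bar>u0 y\<bar> \<le> m" and t: "0 < t" "t < T" and small: "12 * heat_const TYPE('n) * K * sqrt t \<le> 1"
  shows "\<bar>U t x - U t y\<bar> \<le> 2 * heat_const TYPE('n) * m / sqrt t * norm (x - y)"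
proof -
  define a where "a = x - y"
  have m0: "m \<ge> 0" using m[of 0] by linarith
  \<comment> \<open>The weight sqrt s removes the initial singularity, so that a single supremum
    over all times up to t can be absorbed.\<close>
  define \<phi> where "\<phi> = (\<lambda>(s, x). sqrt s * \<bar>U s (x + a) - U s x\<bar>)"
  define S where "S = {0<..t} \<times> (UNIV :: (real ^ 'n) set)"
  have "\<phi> (t, y) \<le> 2 * (heat_const TYPE('n) * m * norm a)"
  proof (rule absorb_half[where S = S])
    show "(t, y) \<in> S" using t by (simp add: S_def)
    show "0 \<le> heat_const TYPE('n) * m * norm a" using heat_const_pos[where 'n='n] m0 by simp
    show "\<phi> p \<le> sqrt t * (2 * (m + heat_const TYPE('n) * (2 * sqrt t * B)))" if pS: "p \<in> S" for p
    proof -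
      obtain s x where p: "p = (s, x)" "0 < s" "s \<le> t" using pS by (cases p) (auto simp: S_def)
      have b: "\<bar>U s x\<bar> \<le> m + heat_const TYPE('n) * (2 * sqrt t * B)" for x
      proof -
        have "\<bar>U s x\<bar> \<le> m + heat_const TYPE('n) * (2 * sqrt s * B)" by (rule mild_bounded[OF M m]) (use p t in auto)
        also have "\<dots> \<le> m + heat_const TYPE('n) * (2 * sqrt t * B)"
          by (intro add_left_mono mult_left_mono mult_right_mono) (use p heat_const_pos[where 'n='n] B_nonneg in auto)
        finally show ?thesis .
      qed
      have "\<bar>U s (x + a) - U s x\<bar> \<le> 2 * (m + heat_const TYPE('n) * (2 * sqrt t * B))" by (rule order_trans[OF abs_triangle_ineq4 order_trans[OF add_mono[OF b b]]]) simp
      then show ?thesis unfolding \<phi>_def p using p t by (auto intro!: mult_mono)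
    qed
    fix b p assume b0: "0 \<le> b" and b: "\<And>p. p \<in> S \<Longrightarrow> \<phi> p \<le> b" and "p \<in> S"
    then obtain s x where p: "p = (s, x)" "0 < s" "s \<le> t" by (cases p) (auto simp: S_def)
    have s: "0 < s" "s < T" using p t by auto
    have "\<bar>heat_op s (\<lambda>y. u0 (y + a) - u0 y) x\<bar> \<le> heat_const TYPE('n) / sqrt s * m * norm a"
    proof -
      note [measurable] = mild_measurable(4)[OF M]
      have "heat_op s (\<lambda>y. u0 (y + a) - u0 y) x = heat_op s u0 (x + a) - heat_op s u0 x"
        unfolding heat_op_translate[symmetric] by (rule heat_op_diff[OF s(1), of _ _ m m]) (use m in auto)
      then show ?thesis
        using heat_op_lipschitz[OF s(1) mild_measurable(4)[OF M], of m "x + a" x] m by simp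
    qed
    moreover have "\<bar>duhamel s (\<lambda>r y. F (U r (y + a)) - F (U r y)) x\<bar> \<le> heat_const TYPE('n) * (2 * sqrt s * 0 + 6 * (K * b))"
    proof (rule duhamel_dominated(2)[OF s(1)])
      show "(\<lambda>p. F (U (fst p) (snd p + a)) - F (U (fst p) (snd p))) \<in> borel_measurable (borel \<Otimes>\<^sub>M borel)"
        by (intro borel_measurable_diff mild_measurable[OF M])
      show "0 \<le> K * b" using K_pos b0 by simp
      show "AE r in lborel. 0 < r \<longrightarrow> r < s \<longrightarrow> (\<forall>y. norm (F (U r (y + a)) - F (U r y)) \<le> 0 + K * b / sqrt r)"
      proof (intro AE_I2 impI allI)
        fix r y assume r: "0 < r" "r < s"
        have "sqrt r * \<bar>U r (y + a) - U r y\<bar> \<le> b" using b[of "(r, y)"] r p by (simp add: S_def \<phi>_def)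
        then have "\<bar>U r (y + a) - U r y\<bar> \<le> b / sqrt r" using r by (simp add: pos_le_divide_eq mult.commute)
        then have "K * \<bar>U r (y + a) - U r y\<bar> \<le> K * (b / sqrt r)" by (rule mult_left_mono) (use K_pos in simp)
        then show "norm (F (U r (y + a)) - F (U r y)) \<le> 0 + K * b / sqrt r"
          using F_lipschitz[of "U r (y + a)" "U r y"] by simp
      qed
    qed simp
    then have "\<bar>duhamel s (\<lambda>r y. F (U r (y + a)) - F (U r y)) x\<bar> \<le> heat_const TYPE('n) * (6 * (K * b))" by simp
    ultimately have "\<bar>U s (x + a) - U s x\<bar> \<le> heat_const TYPE('n) / sqrt s * m * norm a + heat_const TYPE('n) * (6 * (K * b))"
      unfolding mild_translate_diff[OF M m s] by (intro order_trans[OF abs_triangle_ineq4] add_mono)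
    then have "\<phi> p \<le> sqrt s * (heat_const TYPE('n) / sqrt s * m * norm a + heat_const TYPE('n) * (6 * (K * b)))"
      unfolding \<phi>_def p using s by (auto intro!: mult_left_mono)
    also have "\<dots> = heat_const TYPE('n) * m * norm a + (12 * heat_const TYPE('n) * K * sqrt s) * (b / 2)"
      using s by (simp add: algebra_simps)
    also have "\<dots> \<le> heat_const TYPE('n) * m * norm a + 1 * (b / 2)"
    proof (intro add_left_mono mult_right_mono)
      have "12 * heat_const TYPE('n) * K * sqrt s \<le> 12 * heat_const TYPE('n) * K * sqrt t" by (rule mult_left_mono) (use p heat_const_pos[where 'n='n] K_pos in auto)
      then show "12 * heat_const TYPE('n) * K * sqrt s \<le> 1" using small by linarith
    qed (use b0 in simp)
    finally show "\<phi> p \<le> heat_const TYPE('n) * m * norm a + b / 2" by simp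
  qed
  then have "sqrt t * \<bar>U t x - U t y\<bar> \<le> 2 * (heat_const TYPE('n) * m * norm a)" by (simp add: \<phi>_def a_def)
  then show ?thesis using t by (simp add: pos_le_divide_eq a_def mult_ac)
qed

text \<open>Half a derivative in time, away from the initial time: after a restart at r the heat
  flow moves a Lipschitz function by O(sqrt s), and the flux acting for time s contributes O(sqrt s)
  as well. It controls the freezing of the flux during a step of the scheme.\<close>

lemma mild_holder:
  assumes M: "mild F u0 U T" and m: "\<And>y. \<bar>u0 y\<bar> \<le> m" and r: "0 < r" and s: "0 < s" "r + s < T"
    and small: "12 * heat_const TYPE('n) * K * sqrt r \<le> 1"
  shows "\<bar>U (r + s) x - U r x\<bar> \<le> heat_const TYPE('n) * sqrt s * (2 * heat_const TYPE('n) * m / sqrt r) + heat_const TYPE('n) * (2 * sqrt s * B)"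
proof -
  have rT: "r < T" using r s by simp
  note R = mild_restart[OF M m r rT]
  have eq: "U (r + s) x = heat_op s (U r) x - duhamel s (\<lambda>q y. F (U (r + q) y)) x"
    using mild_eq[OF R s(1)] s by simp
  have 1: "norm (heat_op s (U r) x - U r x) \<le> heat_const TYPE('n) * sqrt s * (2 * heat_const TYPE('n) * m / sqrt r)"
  proof (rule heat_op_approx[OF s(1) mild_measurable(3)[OF M]])
    show "norm (U r y) \<le> m + heat_const TYPE('n) * (2 * sqrt r * B)" for y using mild_bounded[OF M m r rT] by simp
    show "norm (U r y - U r z) \<le> 2 * heat_const TYPE('n) * m / sqrt r * norm (y - z)" for y z
      using mild_lipschitz[OF M m r rT small] by simp
  qed
  have 2: "\<bar>duhamel s (\<lambda>q y. F (U (r + q) y)) x\<bar> \<le> heat_const TYPE('n) * (2 * sqrt s * B)"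
    by (rule duhamel_bounded(2)[OF s(1) _ F_bounded]) (use mild_measurable(2)[OF R] in simp)
  show ?thesis using 1 2 unfolding eq real_norm_def by linarith
qed

end

section \<open>An almost monotone time discretisation\<close>

lemma heat_op_sum:
  fixes g :: "'i \<Rightarrow> real ^ 'n::finite \<Rightarrow> real"
  assumes t: "t > 0" and "\<And>j. j \<in> J \<Longrightarrow> g j \<in> borel_measurable borel" and "\<And>j y. j \<in> J \<Longrightarrow> \<bar>g j y\<bar> \<le> c j"
  shows "heat_op t (\<lambda>y. a * (\<Sum>j\<in>J. g j y)) x = a * (\<Sum>j\<in>J. heat_op t (g j) x)"
proof -
  have "heat_op t (\<lambda>y. a * (\<Sum>j\<in>J. g j y)) x = (LINT z|lborel. a * (\<Sum>j\<in>J. heat_kernel t z * g j (x - z)))"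
    unfolding heat_op_def by (simp add: sum_distrib_left mult_ac)
  also have "\<dots> = a * (\<Sum>j\<in>J. LINT z|lborel. heat_kernel t z * g j (x - z))"
  proof (subst integral_mult_right_zero, subst Bochner_Integration.integral_sum)
    fix j assume "j \<in> J"
    then show "integrable lborel (\<lambda>z. heat_kernel t z * g j (x - z))"
      using heat_op_integrable[OF t, of "g j" "c j" x] assms(2,3) by simp
  qed simp
  finally show ?thesis by (simp add: heat_op_def)
qed

lemma grid_unique:
  fixes h s :: real
  assumes "h > 0" "s \<in> {real i * h<..<(real i + 1) * h}" "s \<in> {real j * h<..<(real j + 1) * h}"
  shows "i = j"
proof -
  have "real i * h < (real j + 1) * h" "real j * h < (real i + 1) * h"
    using assms(2,3) unfolding greaterThanLessThan_iff by linarith+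
  then have "real i < real j + 1" "real j < real i + 1" 
    using mult_less_cancel_right_pos[OF assms(1)] by blast+
  then show ?thesis by linarith
qed

lemma grid_sum:
  fixes f :: "nat \<Rightarrow> 'b::real_vector"
  assumes h: "h > 0" and s: "s \<in> {real i * h<..<(real i + 1) * h}" and i: "i < k"
  shows "(\<Sum>j<k. indicat_real {real j * h<..<(real j + 1) * h} s *\<^sub>R f j) = f i"
proof -
  have "(\<Sum>j<k. indicat_real {real j * h<..<(real j + 1) * h} s *\<^sub>R f j) = (\<Sum>j<k. if j = i then f i else 0)"
  proof (rule sum.cong)
    fix j
    show "indicat_real {real j * h<..<(real j + 1) * h} s *\<^sub>R f j = (if j = i then f i else 0)"
    proof (cases "j = i")
      case True
      then show ?thesis unfolding indicator_def using s by simp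
    next
      case False
      then have "s \<notin> {real j * h<..<(real j + 1) * h}" using grid_unique[OF h s] by blast
      then show ?thesis using False unfolding indicator_def by simp
    qed
  qed simp
  then show ?thesis using i by simp
qed

context flux
begin

text \<open>Formally the heat flow for time h applied to the Euler step v - h div F(v), with the
  divergence moved to the kernel because v is only bounded.\<close>

definition step :: "real \<Rightarrow> (real ^ 'n \<Rightarrow> real) \<Rightarrow> real ^ 'n \<Rightarrow> real" where
  "step h v x = heat_op h v x - h * grad_op h (\<lambda>y. F (v y)) x"

primrec scheme :: "real \<Rightarrow> (real ^ 'n \<Rightarrow> real) \<Rightarrow> nat \<Rightarrow> real ^ 'n \<Rightarrow> real" where
  "scheme h v 0 = v"
| "scheme h v (Suc k) = step h (scheme h v k)"

lemma step_measurable [measurable]: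
  assumes [measurable]: "v \<in> borel_measurable borel"
  shows "step h v \<in> borel_measurable borel"
  unfolding step_def by measurable

lemma scheme_measurable:
  "v \<in> borel_measurable borel \<Longrightarrow> scheme h v k \<in> borel_measurable borel"
  by (induction k) auto

lemma flux_comp_measurable: "v \<in> borel_measurable borel \<Longrightarrow> (\<lambda>y. F (v y)) \<in> borel_measurable borel"
  by measurable

lemma step_bounded:
  assumes h: "h > 0" and v[measurable]: "v \<in> borel_measurable borel" and c: "\<And>y. \<bar>v y\<bar> \<le> c"
  shows "\<bar>step h v x\<bar> \<le> c + h * (heat_const TYPE('n) / sqrt h * B)"
proof -
  have "\<bar>heat_op h v x\<bar> \<le> c" using heat_op_bound[OF h v, of c x] c by simp
  moreover have "\<bar>grad_op h (\<lambda>y. F (v y)) x\<bar> \<le> heat_const TYPE('n) / sqrt h * B"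
    by (rule grad_op_bound[OF h flux_comp_measurable[OF v] F_bounded])
  then have "\<bar>h * grad_op h (\<lambda>y. F (v y)) x\<bar> \<le> h * (heat_const TYPE('n) / sqrt h * B)"
    unfolding abs_mult abs_of_pos[OF h] by (rule mult_left_mono) (use h in simp)
  ultimately show ?thesis unfolding step_def by linarith
qed

lemma scheme_bounded:
  assumes h: "h > 0" and v: "v \<in> borel_measurable borel" and c: "\<And>y. \<bar>v y\<bar> \<le> c"
  shows "\<bar>scheme h v k y\<bar> \<le> c + real k * (h * (heat_const TYPE('n) / sqrt h * B))"
proof (induction k arbitrary: y)
  case 0 then show ?case using c by simp
next
  case (Suc k)
  have "\<bar>step h (scheme h v k) y\<bar> \<le> (c + real k * (h * (heat_const TYPE('n) / sqrt h * B))) + h * (heat_const TYPE('n) / sqrt h * B)"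
    by (rule step_bounded[OF h scheme_measurable[OF v]]) (rule Suc)
  also have "\<dots> = c + real (Suc k) * (h * (heat_const TYPE('n) / sqrt h * B))" unfolding of_nat_Suc by (simp only: distrib_right mult_1 add_ac)
  finally show ?case by simp
qed

lemma step_translate: "step h (\<lambda>y. v (y + a)) x = step h v (x + a)"
  unfolding step_def heat_op_translate[of h v] grad_op_translate[of h "\<lambda>y. F (v y)"] ..

lemma scheme_translate: "scheme h (\<lambda>y. v (y + a)) k x = scheme h v k (x + a)"
proof (induction k arbitrary: x)
  case (Suc k)
  have "scheme h (\<lambda>y. v (y + a)) k = (\<lambda>y. scheme h v k (y + a))" using Suc by auto
  then show ?case by (simp add: step_translate)
qed simp

text \<open>Since - h times the kernel gradient is the kernel times z / 2, the step size cancels and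
  a step becomes one integral, in which the flux perturbs v by z \<bullet> F(v) / 2. Monotonicity up
  to a defect is read off from this form.\<close>

lemma step_integral:
  assumes h: "h > 0" and v: "v \<in> borel_measurable borel" and c: "\<And>y. \<bar>v y\<bar> \<le> c"
  shows "integrable lborel (\<lambda>z. heat_kernel h z * (v (x - z) + z \<bullet> F (v (x - z)) / 2))"
    and "step h v x = (LINT z|lborel. heat_kernel h z * (v (x - z) + z \<bullet> F (v (x - z)) / 2))"
proof -
  have eq: "heat_kernel h z * (v (x - z) + z \<bullet> F (v (x - z)) / 2)
    = heat_kernel h z *\<^sub>R v (x - z) - h * (heat_grad h z \<bullet> F (v (x - z)))" for z
    unfolding heat_grad_def using h by (simp add: field_simps)
  have I1: "integrable lborel (\<lambda>z. heat_kernel h z *\<^sub>R v (x - z))"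
    by (rule heat_op_integrable[OF h v]) (use c in simp)
  have I2: "integrable lborel (\<lambda>z. h * (heat_grad h z \<bullet> F (v (x - z))))"
    by (rule integrable_mult_right, rule grad_op_integrable[OF h flux_comp_measurable[OF v] F_bounded])
  show "integrable lborel (\<lambda>z. heat_kernel h z * (v (x - z) + z \<bullet> F (v (x - z)) / 2))"
    unfolding eq by (rule Bochner_Integration.integrable_diff[OF I1 I2])
  show "step h v x = (LINT z|lborel. heat_kernel h z * (v (x - z) + z \<bullet> F (v (x - z)) / 2))"
    unfolding eq Bochner_Integration.integral_diff[OF I1 I2] step_def heat_op_def grad_op_def by simp
qed

text \<open>The vanishing first moment annihilates the flux of a constant. Comparison with constants
  then yields the maximum principle.\<close>

lemma step_const: "h > 0 \<Longrightarrow> step h (\<lambda>_. a) x = a"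
proof -
  assume h: "h > 0"
  have 1: "heat_op h (\<lambda>_. a) x = a"
    by (simp add: heat_op_def heat_kernel_integral[OF h])
  have "(LINT z|lborel. heat_kernel h z *\<^sub>R z) \<bullet> F a = (LINT z|lborel. (heat_kernel h z *\<^sub>R z) \<bullet> F a)"
    by (rule integral_inner_left[symmetric]) (rule heat_kernel_odd(1)[OF h])
  then have 0: "(LINT z|lborel. heat_kernel h z * (z \<bullet> F a)) = 0" unfolding heat_kernel_odd(2)[OF h] by simp
  have "grad_op h (\<lambda>_. F a) x = (LINT z|lborel. (- 1 / (2 * h)) * (heat_kernel h z * (z \<bullet> F a)))"
    unfolding grad_op_def heat_grad_def by simp
  also have "\<dots> = 0" unfolding integral_mult_right_zero 0 by simp
  finally show "step h (\<lambda>_. a) x = a" unfolding step_def 1 by simp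
qed

text \<open>The factor \<open>1 + z \<bullet> F' / 2\<close> of the kernel is negative only where \<open>K |z| / 2 > 1\<close>, and there
  \<open>K |z| / 2 - 1\<close> is at most the fourth power, whose Gaussian mean is \<open>O(h\<^sup>2)\<close>.\<close>
lemma kernel_defect:
  assumes "\<bar>w\<bar> = d" and "norm \<beta> \<le> K * d"
  shows "\<bar>z \<bullet> \<beta> / 2\<bar> \<le> d + d * (K / 2) ^ 4 * norm z ^ 4"
proof -
  have d: "d \<ge> 0" using assms(1) by auto
  define q where "q = K * norm z / 2"
  have q0: "q \<ge> 0" using K_pos by (simp add: q_def)
  have "q \<le> 1 + q ^ 4"
  proof (cases "q \<le> 1")
    case False
    then show ?thesis using self_le_power[of q 4] by simp
  qed (use q0 in \<open>simp add: add_increasing2\<close>)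
  then have "d * q \<le> d * (1 + q ^ 4)" by (rule mult_left_mono[OF _ d])
  moreover have "\<bar>z \<bullet> \<beta>\<bar> \<le> norm z * (K * d)"
    using Cauchy_Schwarz_ineq2[of z \<beta>] mult_left_mono[OF assms(2), of "norm z"] by simp
  then have "\<bar>z \<bullet> \<beta> / 2\<bar> \<le> d * q" by (simp add: q_def abs_divide mult_ac)
  moreover have "q ^ 4 = (K / 2) ^ 4 * norm z ^ 4" unfolding q_def by (simp add: power_mult_distrib power_divide)
  ultimately show ?thesis by (simp add: distrib_left mult.assoc)
qed

text \<open>The 4 is 50 / 16 rounded up, with 50 from the fourth moment and 16 from the fourth power
  of K / 2.\<close>

lemma defect_integral:
  assumes h: "h > 0" and d: "d \<ge> 0"
  shows "integrable lborel (\<lambda>z :: real ^ 'n. heat_kernel h z * (d * (K / 2) ^ 4 * norm z ^ 4))"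
    and "(LINT z|lborel. heat_kernel h (z :: real ^ 'n) * (d * (K / 2) ^ 4 * norm z ^ 4)) \<le> 4 * heat_const TYPE('n) * K ^ 4 * h\<^sup>2 * d"
proof -
  have eq: "heat_kernel h z * (d * (K / 2) ^ 4 * norm z ^ 4) = (d * (K / 2) ^ 4) * (norm z ^ 4 * heat_kernel h z)" for z :: "real ^ 'n"
    by (simp only: ac_simps)
  show "integrable lborel (\<lambda>z :: real ^ 'n. heat_kernel h z * (d * (K / 2) ^ 4 * norm z ^ 4))"
    unfolding eq by (rule integrable_mult_right, rule heat_kernel_moment4_integrable[OF h])
  have "(LINT z|lborel. heat_kernel h (z :: real ^ 'n) * (d * (K / 2) ^ 4 * norm z ^ 4))
     = (d * (K / 2) ^ 4) * (LINT z|lborel. norm z ^ 4 * heat_kernel h (z :: real ^ 'n))"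
    unfolding eq by simp
  also have "\<dots> \<le> (d * (K / 2) ^ 4) * (heat_const TYPE('n) * (50 * h\<^sup>2))"
    by (rule mult_left_mono[OF heat_kernel_moment4_integral[OF h]]) (use d in simp)
  also have "\<dots> = (50 / 16) * (heat_const TYPE('n) * K ^ 4 * h\<^sup>2 * d)" by (simp add: power_divide)
  also have "\<dots> \<le> 4 * (heat_const TYPE('n) * K ^ 4 * h\<^sup>2 * d)"
    by (rule mult_right_mono) (use d heat_const_pos[where 'n='n] K_pos in simp_all)
  finally show "(LINT z|lborel. heat_kernel h (z :: real ^ 'n) * (d * (K / 2) ^ 4 * norm z ^ 4)) \<le> 4 * heat_const TYPE('n) * K ^ 4 * h\<^sup>2 * d"
    by (simp only: mult.assoc)
qed

text \<open>Comparison with the fixed points M and - M. After subtracting one of them the integrand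
  v - a has a fixed sign and outweighs the flux term up to the defect. Differences of values are at
  most 2 * M, whence 8 = 4 * 2.\<close>

lemma step_sup_bound:
  assumes h: "h > 0" and v: "v \<in> borel_measurable borel" and c: "\<And>y. \<bar>v y\<bar> \<le> M"
  shows "\<bar>step h v x\<bar> \<le> M * (1 + 8 * heat_const TYPE('n) * K ^ 4 * h\<^sup>2)"
proof -
  have M0: "M \<ge> 0" using c[of 0] by linarith
  define D where "D = 4 * heat_const TYPE('n) * K ^ 4 * h\<^sup>2 * (2 * M)"
  define J where "J = (\<lambda>z :: real ^ 'n. heat_kernel h z * ((2 * M) * (K / 2) ^ 4 * norm z ^ 4))"
  have J: "integrable lborel J" "integral\<^sup>L lborel J \<le> D"
    unfolding J_def D_def using defect_integral[OF h, of "2 * M"] M0 by simp_all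
  have eq: "step h v x - a = (LINT z|lborel. heat_kernel h z * ((v (x - z) - a) + z \<bullet> (F (v (x - z)) - F a) / 2))"
    and I: "integrable lborel (\<lambda>z. heat_kernel h z * ((v (x - z) - a) + z \<bullet> (F (v (x - z)) - F a) / 2))" for a
  proof -
    have e: "heat_kernel h z * ((v (x - z) - a) + z \<bullet> (F (v (x - z)) - F a) / 2)
      = heat_kernel h z * (v (x - z) + z \<bullet> F (v (x - z)) / 2) - heat_kernel h z * (a + z \<bullet> F a / 2)" for z
      by (simp add: inner_diff_right algebra_simps diff_divide_distrib)
    have ca: "(\<lambda>_ :: real ^ 'n. a) \<in> borel_measurable borel" by simp
    have c2: "\<And>y :: real ^ 'n. \<bar>a\<bar> \<le> \<bar>a\<bar>" by simp
    note 1 = step_integral[OF h v c, of x] and 2 = step_integral(1)[OF h ca c2] step_integral(2)[OF h ca c2, of x]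
    show "integrable lborel (\<lambda>z. heat_kernel h z * ((v (x - z) - a) + z \<bullet> (F (v (x - z)) - F a) / 2))"
      unfolding e by (rule Bochner_Integration.integrable_diff[OF 1(1) 2(1)])
    show "step h v x - a = (LINT z|lborel. heat_kernel h z * ((v (x - z) - a) + z \<bullet> (F (v (x - z)) - F a) / 2))"
      unfolding e Bochner_Integration.integral_diff[OF 1(1) 2(1)] 1(2)[symmetric] 2(2)[symmetric] step_const[OF h] ..
  qed
  have kd: "\<bar>z \<bullet> (F b - F a) / 2\<bar> \<le> \<bar>b - a\<bar> + (2 * M) * (K / 2) ^ 4 * norm z ^ 4" if "\<bar>b - a\<bar> \<le> 2 * M" for z :: "real ^ 'n" and a b
  proof -
    have "\<bar>z \<bullet> (F b - F a) / 2\<bar> \<le> \<bar>b - a\<bar> + \<bar>b - a\<bar> * (K / 2) ^ 4 * norm z ^ 4"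
      by (rule kernel_defect[OF refl F_lipschitz])
    also have "\<dots> \<le> \<bar>b - a\<bar> + (2 * M) * (K / 2) ^ 4 * norm z ^ 4"
      by (intro add_left_mono mult_right_mono that) simp_all
    finally show ?thesis .
  qed
  have up: "step h v x - M \<le> D"
  proof -
    have "step h v x - M \<le> integral\<^sup>L lborel J"
      unfolding eq
    proof (rule integral_mono[OF I J(1)])
      fix z
      have "\<bar>v (x - z) - M\<bar> = M - v (x - z)" "\<bar>v (x - z) - M\<bar> \<le> 2 * M" using c[of "x - z"] by linarith+
      then have "(v (x - z) - M) + z \<bullet> (F (v (x - z)) - F M) / 2 \<le> (2 * M) * (K / 2) ^ 4 * norm z ^ 4"
        using kd[of "v (x - z)" M z] by linarith
      then show "heat_kernel h z * ((v (x - z) - M) + z \<bullet> (F (v (x - z)) - F M) / 2) \<le> J z"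
        unfolding J_def by (rule mult_left_mono[OF _ heat_kernel_nonneg])
    qed
    then show ?thesis using J(2) by linarith
  qed
  have lo: "- D \<le> step h v x - (- M)"
  proof -
    have "integral\<^sup>L lborel (\<lambda>z. - J z) \<le> step h v x - (- M)"
      unfolding eq
    proof (rule integral_mono[OF _ I])
      show "integrable lborel (\<lambda>z. - J z)" using J(1) by simp
      fix z
      have "\<bar>v (x - z) - - M\<bar> = v (x - z) - - M" "\<bar>v (x - z) - - M\<bar> \<le> 2 * M" using c[of "x - z"] by linarith+
      then have "- ((2 * M) * (K / 2) ^ 4 * norm z ^ 4) \<le> (v (x - z) - - M) + z \<bullet> (F (v (x - z)) - F (- M)) / 2"
        using kd[of "v (x - z)" "- M" z] by linarith
      then have "heat_kernel h z * (- ((2 * M) * (K / 2) ^ 4 * norm z ^ 4)) \<le> heat_kernel h z * ((v (x - z) - - M) + z \<bullet> (F (v (x - z)) - F (- M)) / 2)"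
        by (rule mult_left_mono[OF _ heat_kernel_nonneg])
      then show "- J z \<le> heat_kernel h z * ((v (x - z) - - M) + z \<bullet> (F (v (x - z)) - F (- M)) / 2)"
        unfolding J_def by simp
    qed
    then show ?thesis using J(2) by simp
  qed
  have "\<bar>step h v x\<bar> \<le> M + D" using up lo by linarith
  also have "M + D = M * (1 + 8 * heat_const TYPE('n) * K ^ 4 * h\<^sup>2)" unfolding D_def by (simp add: algebra_simps)
  finally show ?thesis .
qed

lemma scheme_sup_bound:
  assumes h: "h > 0" and v: "v \<in> borel_measurable borel" and c: "\<And>y. \<bar>v y\<bar> \<le> M"
  shows "\<bar>scheme h v k x\<bar> \<le> M * (1 + 8 * heat_const TYPE('n) * K ^ 4 * h\<^sup>2) ^ k"
proof (induction k arbitrary: x)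
  case (Suc k)
  have "\<bar>step h (scheme h v k) x\<bar> \<le> M * (1 + 8 * heat_const TYPE('n) * K ^ 4 * h\<^sup>2) ^ k * (1 + 8 * heat_const TYPE('n) * K ^ 4 * h\<^sup>2)"
    by (rule step_sup_bound[OF h scheme_measurable[OF v] Suc])
  then show ?case by (simp add: mult_ac)
qed (use c in simp)

text \<open>Each flux contribution is transported by the heat flow of the later steps. The
  contribution of the state j already contains its own kernel time h, so that the kernel time stays
  positive up to the last summand, where it equals h.\<close>

lemma scheme_duhamel:
  assumes h: "h > 0" and v: "v \<in> borel_measurable borel" and c: "\<And>y. \<bar>v y\<bar> \<le> c"
  shows "scheme h v (Suc k) x = heat_op (real (Suc k) * h) v x
     - h * (\<Sum>j<Suc k. grad_op ((real (Suc k) - real j) * h) (\<lambda>y. F (scheme h v j y)) x)"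
proof (induction k arbitrary: x)
  case 0
  then show ?case by (simp add: step_def)
next
  case (Suc k)
  let ?g = "\<lambda>j y. grad_op ((real (Suc k) - real j) * h) (\<lambda>y. F (scheme h v j y)) y"
  have Fm: "(\<lambda>y. F (scheme h v j y)) \<in> borel_measurable borel" for j
    by (rule flux_comp_measurable[OF scheme_measurable[OF v]])
  have gm: "?g j \<in> borel_measurable borel" for j
  proof -
    note [measurable] = Fm[of j]
    show ?thesis by measurable
  qed
  have tp: "(real (Suc k) - real j) * h > 0" if "j \<in> {..<Suc k}" for j using that h by simp
  have gb: "\<bar>?g j y\<bar> \<le> heat_const TYPE('n) / sqrt ((real (Suc k) - real j) * h) * B" if "j \<in> {..<Suc k}" for j y
    by (rule grad_op_bound[OF tp[OF that] Fm F_bounded])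
  have Th: "real (Suc k) * h > 0" using h by simp
  have hm: "heat_op (real (Suc k) * h) v \<in> borel_measurable borel"
  proof -
    note [measurable] = v
    show ?thesis by measurable
  qed
  have "heat_op h (scheme h v (Suc k)) x = heat_op h (\<lambda>y. heat_op (real (Suc k) * h) v y - h * (\<Sum>j<Suc k. ?g j y)) x"
    unfolding Suc ..
  also have "\<dots> = heat_op h (heat_op (real (Suc k) * h) v) x - heat_op h (\<lambda>y. h * (\<Sum>j<Suc k. ?g j y)) x"
  proof (rule heat_op_diff[OF h hm])
    show "(\<lambda>y. h * (\<Sum>j<Suc k. ?g j y)) \<in> borel_measurable borel"
      using gm by (intro borel_measurable_times borel_measurable_sum borel_measurable_const) auto
    show "norm (heat_op (real (Suc k) * h) v y) \<le> c" for y
      by (rule heat_op_bound[OF Th v]) (use c in simp)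
    show "norm (h * (\<Sum>j<Suc k. ?g j y)) \<le> h * (\<Sum>j<Suc k. heat_const TYPE('n) / sqrt ((real (Suc k) - real j) * h) * B)" for y
    proof -
      have "\<bar>\<Sum>j<Suc k. ?g j y\<bar> \<le> (\<Sum>j<Suc k. heat_const TYPE('n) / sqrt ((real (Suc k) - real j) * h) * B)"
        by (rule order_trans[OF sum_abs sum_mono]) (rule gb)
      then show ?thesis unfolding real_norm_def abs_mult abs_of_pos[OF h] by (rule mult_left_mono) (use h in simp)
    qed
  qed
  also have "heat_op h (heat_op (real (Suc k) * h) v) x = heat_op (h + real (Suc k) * h) v x"
    by (rule heat_heat_op[OF h Th v c])
  also have "h + real (Suc k) * h = real (Suc (Suc k)) * h" by (simp add: algebra_simps)
  also have "heat_op h (\<lambda>y. h * (\<Sum>j<Suc k. ?g j y)) x = h * (\<Sum>j<Suc k. heat_op h (?g j) x)"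
    by (rule heat_op_sum[OF h gm gb])
  also have "(\<Sum>j<Suc k. heat_op h (?g j) x) = (\<Sum>j<Suc k. grad_op ((real (Suc (Suc k)) - real j) * h) (\<lambda>y. F (scheme h v j y)) x)"
  proof (rule sum.cong)
    fix j assume j: "j \<in> {..<Suc k}"
    have "heat_op h (?g j) x = grad_op (h + (real (Suc k) - real j) * h) (\<lambda>y. F (scheme h v j y)) x"
      by (rule heat_grad_op[OF h tp[OF j] Fm F_bounded])
    then show "heat_op h (?g j) x = grad_op ((real (Suc (Suc k)) - real j) * h) (\<lambda>y. F (scheme h v j y)) x"
      by (simp add: algebra_simps)
  qed simp
  finally have 1: "heat_op h (scheme h v (Suc k)) x = heat_op (real (Suc (Suc k)) * h) v x
      - h * (\<Sum>j<Suc k. grad_op ((real (Suc (Suc k)) - real j) * h) (\<lambda>y. F (scheme h v j y)) x)" .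
  have "scheme h v (Suc (Suc k)) x = heat_op h (scheme h v (Suc k)) x - h * grad_op h (\<lambda>y. F (scheme h v (Suc k) y)) x"
    by (simp add: step_def)
  moreover have "(real (Suc (Suc k)) - real (Suc k)) * h = h" by simp
  ultimately show ?case unfolding 1 sum.lessThan_Suc[of _ "Suc k"] by (simp add: distrib_left)
qed

end

section \<open>Convergence of the scheme to the mild solution\<close>

lemma norm_triangle_three: "norm (a - b + c) \<le> norm a + norm b + norm (c :: 'a::real_normed_vector)"
  by (rule order_trans[OF norm_triangle_ineq add_right_mono[OF norm_triangle_ineq4]])

lemma error_identity1:
  "K * (p * (2 * X * m * (2 / q)) + p * (2 * G * B)) + K * (p * (2 * X * m * (2 / q))) + K * e
    = (p * (2 * K * G * B) + K * e) + p * (8 * K * X * m) / (q :: real)"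
proof -
  have "p * (8 * K * X * m) / q = p * (8 * K * X * m) * (1 / q)" "2 / q = 2 * (1 / q)" by simp_all
  then show ?thesis by (simp only:) (simp only: distrib_left, simp)
qed

lemma error_identity2:
  "G * (2 * w * (p * (2 * K * G * B) + K * e) + 6 * (p * Z)) = p * (G * (4 * w * G * K * B + 6 * Z)) + (12 * G * K * w) * (e / 6)"
  for G :: real
  by (simp add: distrib_left)

context flux
begin

text \<open>The flux of the scheme in continuous time. On the j-th interval it is smoothed for time
  s - j h, which the Duhamel kernel at time k h - s completes to (k - j) h, independently of s; the
  Duhamel integral is then exactly the discrete sum, with no quadrature error.\<close>

definition interpolant :: "real \<Rightarrow> (real ^ 'n \<Rightarrow> real) \<Rightarrow> nat \<Rightarrow> real \<Rightarrow> real ^ 'n \<Rightarrow> real ^ 'n" where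
  "interpolant h v k s y = (\<Sum>j<k. indicat_real {real j * h<..<(real j + 1) * h} s *\<^sub>R
      heat_op (s - real j * h) (\<lambda>w. F (scheme h v j w)) y)"

lemma interpolant_measurable:
  assumes "v \<in> borel_measurable borel"
  shows "(\<lambda>p. interpolant h v k (fst p) (snd p)) \<in> borel_measurable (borel \<Otimes>\<^sub>M borel)"
proof -
  note [measurable] = flux_comp_measurable[OF scheme_measurable[OF assms]]
  show ?thesis unfolding interpolant_def by measurable
qed

lemma interpolant_inside:
  assumes "h > 0" "s \<in> {real i * h<..<(real i + 1) * h}" "i < k"
  shows "interpolant h v k s y = heat_op (s - real i * h) (\<lambda>w. F (scheme h v i w)) y"
  unfolding interpolant_def by (rule grid_sum[OF assms])

lemma interpolant_outside:
  assumes "\<And>i. i < k \<Longrightarrow> s \<notin> {real i * h<..<(real i + 1) * h}"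
  shows "interpolant h v k s y = 0"
  unfolding interpolant_def by (rule sum.neutral) (use assms in \<open>simp add: indicator_def\<close>)

lemma interpolant_bounded:
  assumes h: "h > 0" and v: "v \<in> borel_measurable borel"
  shows "norm (interpolant h v k s y) \<le> B"
proof (cases "\<exists>i<k. s \<in> {real i * h<..<(real i + 1) * h}")
  case True
  then obtain i where i: "i < k" "s \<in> {real i * h<..<(real i + 1) * h}" by blast
  have s0: "s - real i * h > 0" using i(2) by simp
  show ?thesis unfolding interpolant_inside[OF h i(2,1)]
    by (rule heat_op_bound[OF s0 flux_comp_measurable[OF scheme_measurable[OF v]] F_bounded])
next
  case False
  have "interpolant h v k s y = 0" by (rule interpolant_outside) (use False in blast)
  then show ?thesis using B_nonneg by simp
qed

lemma interpolant_duhamel: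
  assumes h: "h > 0" and v: "v \<in> borel_measurable borel"
  shows "duhamel (real k * h) (interpolant h v k) x
    = h * (\<Sum>j<k. grad_op ((real k - real j) * h) (\<lambda>y. F (scheme h v j y)) x)"
proof -
  let ?g = "\<lambda>j. grad_op ((real k - real j) * h) (\<lambda>y. F (scheme h v j y)) x"
  have eq: "indicat_real {0<..<real k * h} s * grad_op (real k * h - s) (interpolant h v k s) x
     = (\<Sum>j<k. indicat_real {real j * h<..<(real j + 1) * h} s *\<^sub>R ?g j)" for s
  proof (cases "\<exists>i<k. s \<in> {real i * h<..<(real i + 1) * h}")
    case True
    then obtain i where i: "i < k" "s \<in> {real i * h<..<(real i + 1) * h}" by blast
    have "(real i + 1) * h \<le> real k * h" by (rule mult_right_mono) (use i h in auto)
    moreover have "0 \<le> real i * h" using h by simp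
    ultimately have s: "0 < s" "s < real k * h" "s - real i * h > 0" using i(2) unfolding greaterThanLessThan_iff by linarith+
    have "interpolant h v k s = heat_op (s - real i * h) (\<lambda>w. F (scheme h v i w))"
      using interpolant_inside[OF h i(2,1)] by auto
    then have "grad_op (real k * h - s) (interpolant h v k s) x = grad_op (real k * h - s) (heat_op (s - real i * h) (\<lambda>w. F (scheme h v i w))) x"
      by simp
    also have "\<dots> = grad_op (real k * h - s + (s - real i * h)) (\<lambda>w. F (scheme h v i w)) x"
      by (rule grad_heat_op[OF _ s(3) flux_comp_measurable[OF scheme_measurable[OF v]] F_bounded]) (use s in simp)
    also have "real k * h - s + (s - real i * h) = (real k - real i) * h" by (simp add: algebra_simps)
    finally show ?thesis unfolding grid_sum[OF h i(2,1)] using s by simp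
  next
    case False
    have "interpolant h v k s = (\<lambda>_. 0)"
      by (rule ext, rule interpolant_outside) (use False in blast)
    moreover have "(\<Sum>j<k. indicat_real {real j * h<..<(real j + 1) * h} s *\<^sub>R ?g j) = 0"
      by (rule sum.neutral) (use False in \<open>simp add: indicator_def\<close>)
    ultimately show ?thesis by (simp add: grad_op_def)
  qed
  have em: "emeasure lborel {real j * h<..<(real j + 1) * h} = ennreal h" for j
  proof -
    have "real j * h \<le> (real j + 1) * h" using h by (simp add: distrib_right)
    then show ?thesis by (simp add: distrib_right)
  qed
  have m: "(LINT s|lborel. indicat_real {real j * h<..<(real j + 1) * h} s *\<^sub>R ?g j) = h * ?g j"
    and i: "integrable lborel (\<lambda>s. indicat_real {real j * h<..<(real j + 1) * h} s *\<^sub>R ?g j)" for j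
  proof -
    have 1: "integrable lborel (indicat_real {real j * h<..<(real j + 1) * h})"
      by (rule integrable_real_indicator) (simp_all add: em)
    have 2: "integral\<^sup>L lborel (indicat_real {real j * h<..<(real j + 1) * h}) = h"
      using em[of j] h by (simp add: measure_def)
    show "integrable lborel (\<lambda>s. indicat_real {real j * h<..<(real j + 1) * h} s *\<^sub>R ?g j)"
      by (rule integrable_scaleR_left, rule 1)
    show "(LINT s|lborel. indicat_real {real j * h<..<(real j + 1) * h} s *\<^sub>R ?g j) = h * ?g j"
      using 1 2 by (subst integral_scaleR_left) simp_all
  qed
  have "duhamel (real k * h) (interpolant h v k) x
      = (\<Sum>j<k. LINT s|lborel. indicat_real {real j * h<..<(real j + 1) * h} s *\<^sub>R ?g j)"
    unfolding duhamel_def eq by (rule Bochner_Integration.integral_sum) (rule i)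
  then show ?thesis unfolding m sum_distrib_left .
qed

text \<open>The error satisfies a Duhamel equation driven by a flux difference. Away from the first
  interval this splits into the time increment of U, the smoothing error of its flux, and the error
  at the grid time j h. The first two are of order sqrt h, partly with the weight 1 / sqrt s; the
  third contributes at most e / 6, because 2 H K sqrt (N h) \<le> 1 / 6.\<close>

lemma scheme_error_step:
  assumes M: "mild F u0 U T" and m: "\<And>y. \<bar>u0 y\<bar> \<le> m" and h: "h > 0" and N: "real N * h < T"
    and small: "12 * heat_const TYPE('n) * K * sqrt (real N * h) \<le> 1"
    and e: "e \<ge> 0" "\<And>k y. 1 \<le> k \<Longrightarrow> k \<le> N \<Longrightarrow> \<bar>U (real k * h) y - scheme h u0 k y\<bar> \<le> e"
    and k: "1 \<le> k" "k \<le> N"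
  shows "\<bar>U (real k * h) x - scheme h u0 k x\<bar>
    \<le> sqrt h * (heat_const TYPE('n) * (4 * sqrt (real N * h) * heat_const TYPE('n) * K * B + 6 * (8 * K * (heat_const TYPE('n))\<^sup>2 * m + 2 * B))) + e / 2"
proof -
  have m0: "m \<ge> 0" using m[of 0] by linarith
  have kh: "real k * h > 0" "real k * h \<le> real N * h" using k h by auto
  have T: "real k * h < T" using kh N by linarith
  have H0: "heat_const TYPE('n) > 0" by (rule heat_const_pos)
  note um = mild_measurable(4)[OF M] and Fm = mild_measurable(2)[OF M]
  note Sm = scheme_measurable[OF um, of h]
  \<comment> \<open>The part of the flux difference without singularity at s = 0; the constant b
    collects what carries 1 / sqrt s, including the whole first interval.\<close>
  define a where "a = sqrt h * (2 * K * heat_const TYPE('n) * B) + K * e"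
  define b where "b = sqrt h * (8 * K * (heat_const TYPE('n))\<^sup>2 * m + 2 * B)"
  have a0: "a \<ge> 0" unfolding a_def using K_pos H0 B_nonneg e(1) h by simp
  have b0: "b \<ge> 0" unfolding b_def using K_pos H0 B_nonneg m0 h by simp
  have "U (real k * h) x = heat_op (real k * h) u0 x - duhamel (real k * h) (\<lambda>s y. F (U s y)) x"
    by (rule mild_eq[OF M kh(1) T])
  moreover have "scheme h u0 k x = heat_op (real k * h) u0 x - duhamel (real k * h) (interpolant h u0 k) x"
    using scheme_duhamel[OF h um m, of "k - 1" x] k unfolding interpolant_duhamel[OF h um] by simp
  moreover have "duhamel (real k * h) (\<lambda>s y. F (U s y) - interpolant h u0 k s y) x
     = duhamel (real k * h) (\<lambda>s y. F (U s y)) x - duhamel (real k * h) (interpolant h u0 k) x"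
    by (rule duhamel_diff[OF kh(1) Fm interpolant_measurable[OF um] F_bounded interpolant_bounded[OF h um]])
  ultimately have eq: "U (real k * h) x - scheme h u0 k x = - duhamel (real k * h) (\<lambda>s y. F (U s y) - interpolant h u0 k s y) x"
    by linarith
  have "\<bar>duhamel (real k * h) (\<lambda>s y. F (U s y) - interpolant h u0 k s y) x\<bar> \<le> heat_const TYPE('n) * (2 * sqrt (real k * h) * a + 6 * b)"
  proof (rule duhamel_dominated(2)[OF kh(1) _ a0 b0])
    show "(\<lambda>p. F (U (fst p) (snd p)) - interpolant h u0 k (fst p) (snd p)) \<in> borel_measurable (borel \<Otimes>\<^sub>M borel)"
      by (intro borel_measurable_diff Fm interpolant_measurable um)
    \<comment> \<open>At grid times the open intervals leave a gap in which the interpolant is 0;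
      the comparison is made off this finite set.\<close>
    have "AE s in lborel. s \<notin> (\<lambda>j. real j * h) ` {..k}"
      by (rule AE_not_in, rule finite_imp_null_set_lborel) simp
    then show "AE s in lborel. 0 < s \<longrightarrow> s < real k * h \<longrightarrow> (\<forall>y. norm (F (U s y) - interpolant h u0 k s y) \<le> a + b / sqrt s)"
    proof eventually_elim
      case (elim s)
      show ?case
      proof (intro impI allI)
        fix y assume s: "0 < s" "s < real k * h"
        define j where "j = nat \<lfloor>s / h\<rfloor>"
        have sh: "s / h > 0" "s / h < real k" using s h by (auto simp: divide_less_eq)
        have jf: "real j = of_int \<lfloor>s / h\<rfloor>" unfolding j_def using sh(1) by simp
        have j1: "real j \<le> s / h" "s / h < real j + 1" unfolding jf by linarith+
        have jk: "j < k" using j1 sh by linarith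
        have "real j * h \<le> s" "s < (real j + 1) * h" using j1 h by (auto simp: le_divide_eq divide_less_eq)
        moreover have "real j * h \<noteq> s" using elim jk by auto
        ultimately have sj: "s \<in> {real j * h<..<(real j + 1) * h}" by simp
        have sj': "0 < s - real j * h" "s - real j * h \<le> h" using sj by (auto simp: distrib_right)
        have \<sigma>: "sqrt (s - real j * h) \<le> sqrt h" using sj' by simp
        have ss: "sqrt s > 0" using s by simp
        have sa: "sqrt h * (2 * K * heat_const TYPE('n) * B) \<ge> 0" "K * e \<ge> 0" "8 * K * (heat_const TYPE('n))\<^sup>2 * m \<ge> 0"
          using K_pos H0 B_nonneg m0 e(1) h by auto
        show "norm (F (U s y) - interpolant h u0 k s y) \<le> a + b / sqrt s"
        \<comment> \<open>On the first interval no modulus of continuity is available, so the flux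
          difference is bounded by 2 B. Since s \<le> h there, this is at most 2 B sqrt h / sqrt s
          and fits into b.\<close>
        proof (cases "j = 0")
          case True
          have "s \<le> h" using sj True by simp
          then have "sqrt s \<le> sqrt h" by simp
          then have "1 \<le> sqrt h / sqrt s" using ss by (simp add: le_divide_eq)
          then have "(2 * B) * 1 \<le> (2 * B) * (sqrt h / sqrt s)" by (rule mult_left_mono) (use B_nonneg in simp)
          also have "\<dots> \<le> (8 * K * (heat_const TYPE('n))\<^sup>2 * m + 2 * B) * (sqrt h / sqrt s)"
            by (rule mult_right_mono) (use sa ss h in auto)
          also have "\<dots> = b / sqrt s" unfolding b_def by simp
          finally have "2 * B \<le> b / sqrt s" by simp
          moreover have "norm (F (U s y) - interpolant h u0 k s y) \<le> B + B"
            by (rule order_trans[OF norm_triangle_ineq4 add_mono[OF F_bounded interpolant_bounded[OF h um]]])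
          ultimately show ?thesis using a0 by linarith
        next
          case False
          define r where "r = real j * h"
          define \<sigma> where "\<sigma> = s - r"
          have r0: "r > 0" using False h by (simp add: r_def)
          have \<sigma>0: "\<sigma> > 0" "sqrt \<sigma> \<le> sqrt h" unfolding \<sigma>_def r_def using sj' by simp_all
          have "h \<le> r" unfolding r_def using False h by simp
          \<comment> \<open>From h \<le> r one gets s \<le> r + h \<le> 2 * r; the weaker factor 4
            has a rational root.\<close>
          then have "s \<le> 4 * r" using sj'(2) r0 unfolding r_def by linarith
          then have "sqrt s \<le> sqrt (4 * r)" by simp
          then have "sqrt s \<le> 2 * sqrt r" by (simp add: real_sqrt_mult)
          then have ir: "1 / sqrt r \<le> 2 / sqrt s" 
          proof -
            have "2 / (2 * sqrt r) \<le> 2 / sqrt s"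
              by (rule divide_left_mono[OF \<open>sqrt s \<le> 2 * sqrt r\<close>]) (use r0 ss in simp_all)
            then show ?thesis by simp
          qed
          have rs: "r + \<sigma> = s" by (simp add: \<sigma>_def)
          have rT: "r + \<sigma> < T" unfolding rs using s T by linarith
          have "12 * heat_const TYPE('n) * K * sqrt r \<le> 12 * heat_const TYPE('n) * K * sqrt (real N * h)"
            by (rule mult_left_mono) (use H0 K_pos h jk k in \<open>auto simp: r_def\<close>)
          then have sr: "12 * heat_const TYPE('n) * K * sqrt r \<le> 1" using small by linarith
          have jN: "1 \<le> j" "j \<le> N" using False jk k by auto
          have FUm: "(\<lambda>w. F (U r w)) \<in> borel_measurable borel" by (rule flux_comp_measurable[OF mild_measurable(3)[OF M]])
          have FSm: "(\<lambda>w. F (scheme h u0 j w)) \<in> borel_measurable borel" by (rule flux_comp_measurable[OF Sm])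
          have 1: "norm (F (U s y) - F (U r y)) \<le> K * (sqrt h * (2 * (heat_const TYPE('n))\<^sup>2 * m * (2 / sqrt s)) + sqrt h * (2 * heat_const TYPE('n) * B))"
          proof -
            have "\<bar>U s y - U r y\<bar> \<le> heat_const TYPE('n) * sqrt \<sigma> * (2 * heat_const TYPE('n) * m / sqrt r) + heat_const TYPE('n) * (2 * sqrt \<sigma> * B)"
              using mild_holder[OF M m r0 \<sigma>0(1) rT sr, of y] unfolding rs .
            also have "\<dots> = sqrt \<sigma> * (2 * (heat_const TYPE('n))\<^sup>2 * m * (1 / sqrt r)) + sqrt \<sigma> * (2 * heat_const TYPE('n) * B)"
              by (simp add: power2_eq_square)
            also have "\<dots> \<le> sqrt h * (2 * (heat_const TYPE('n))\<^sup>2 * m * (2 / sqrt s)) + sqrt h * (2 * heat_const TYPE('n) * B)"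
              by (intro add_mono mult_mono \<sigma>0 ir order_refl mult_nonneg_nonneg) (use H0 m0 B_nonneg r0 s h \<sigma>0(1) in auto)
            finally have "K * \<bar>U s y - U r y\<bar> \<le> K * (sqrt h * (2 * (heat_const TYPE('n))\<^sup>2 * m * (2 / sqrt s)) + sqrt h * (2 * heat_const TYPE('n) * B))"
              by (rule mult_left_mono) (use K_pos in simp)
            then show ?thesis using F_lipschitz[of "U s y" "U r y"] by linarith
          qed
          have 2: "norm (heat_op \<sigma> (\<lambda>w. F (U r w)) y - F (U r y)) \<le> K * (sqrt h * (2 * (heat_const TYPE('n))\<^sup>2 * m * (2 / sqrt s)))"
          proof -
            have "norm (heat_op \<sigma> (\<lambda>w. F (U r w)) y - F (U r y)) \<le> heat_const TYPE('n) * sqrt \<sigma> * (K * (2 * heat_const TYPE('n) * m / sqrt r))"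
            proof (rule heat_op_approx[OF \<sigma>0(1) FUm F_bounded])
              fix y z
              have "K * \<bar>U r y - U r z\<bar> \<le> K * (2 * heat_const TYPE('n) * m / sqrt r * norm (y - z))"
                by (rule mult_left_mono[OF mild_lipschitz[OF M m r0 _ sr]]) (use rT \<sigma>0 K_pos in auto)
              then show "norm (F (U r y) - F (U r z)) \<le> K * (2 * heat_const TYPE('n) * m / sqrt r) * norm (y - z)"
                using F_lipschitz[of "U r y" "U r z"] by (simp only: mult.assoc)
            qed
            also have "\<dots> = K * (sqrt \<sigma> * (2 * (heat_const TYPE('n))\<^sup>2 * m * (1 / sqrt r)))" by (simp add: power2_eq_square)
            also have "\<dots> \<le> K * (sqrt h * (2 * (heat_const TYPE('n))\<^sup>2 * m * (2 / sqrt s)))"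
              by (intro mult_mono \<sigma>0 ir order_refl mult_nonneg_nonneg) (use H0 K_pos m0 r0 s h \<sigma>0(1) in auto)
            finally show ?thesis .
          qed
          have 3: "norm (heat_op \<sigma> (\<lambda>w. F (U r w)) y - heat_op \<sigma> (\<lambda>w. F (scheme h u0 j w)) y) \<le> K * e"
          proof -
            have "heat_op \<sigma> (\<lambda>w. F (U r w)) y - heat_op \<sigma> (\<lambda>w. F (scheme h u0 j w)) y
              = heat_op \<sigma> (\<lambda>w. F (U r w) - F (scheme h u0 j w)) y"
              by (rule heat_op_diff[OF \<sigma>0(1) FUm FSm F_bounded F_bounded, symmetric])
            also have "norm \<dots> \<le> K * e"
            proof (rule heat_op_bound[OF \<sigma>0(1)])
              show "(\<lambda>w. F (U r w) - F (scheme h u0 j w)) \<in> borel_measurable borel" by (intro borel_measurable_diff FUm FSm)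
              fix w
              have "K * \<bar>U r w - scheme h u0 j w\<bar> \<le> K * e"
                unfolding r_def by (rule mult_left_mono[OF e(2)[OF jN]]) (use K_pos in simp)
              then show "norm (F (U r w) - F (scheme h u0 j w)) \<le> K * e"
                using F_lipschitz[of "U r w" "scheme h u0 j w"] by linarith
            qed
            finally show ?thesis .
          qed
          have "interpolant h u0 k s y = heat_op \<sigma> (\<lambda>w. F (scheme h u0 j w)) y"
            unfolding \<sigma>_def r_def by (rule interpolant_inside[OF h sj jk])
          then have "F (U s y) - interpolant h u0 k s y = (F (U s y) - F (U r y))
             - (heat_op \<sigma> (\<lambda>w. F (U r w)) y - F (U r y))
             + (heat_op \<sigma> (\<lambda>w. F (U r w)) y - heat_op \<sigma> (\<lambda>w. F (scheme h u0 j w)) y)" by simp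
          then have "norm (F (U s y) - interpolant h u0 k s y) \<le> norm (F (U s y) - F (U r y))
             + norm (heat_op \<sigma> (\<lambda>w. F (U r w)) y - F (U r y))
             + norm (heat_op \<sigma> (\<lambda>w. F (U r w)) y - heat_op \<sigma> (\<lambda>w. F (scheme h u0 j w)) y)"
            by (simp only: norm_triangle_three)
          also have "\<dots> \<le> K * (sqrt h * (2 * (heat_const TYPE('n))\<^sup>2 * m * (2 / sqrt s)) + sqrt h * (2 * heat_const TYPE('n) * B))
             + K * (sqrt h * (2 * (heat_const TYPE('n))\<^sup>2 * m * (2 / sqrt s))) + K * e"
            by (intro add_mono 1 2 3)
          also have "\<dots> = a + sqrt h * (8 * K * (heat_const TYPE('n))\<^sup>2 * m) / sqrt s" unfolding a_def by (rule error_identity1)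
          also have "\<dots> \<le> a + b / sqrt s"
            unfolding b_def by (intro add_left_mono divide_right_mono mult_left_mono) (use B_nonneg h s in auto)
          finally show ?thesis .
        qed
      qed
    qed
  qed
  then have "\<bar>U (real k * h) x - scheme h u0 k x\<bar> \<le> heat_const TYPE('n) * (2 * sqrt (real k * h) * a + 6 * b)" unfolding eq by simp
  also have "\<dots> \<le> heat_const TYPE('n) * (2 * sqrt (real N * h) * a + 6 * b)"
    by (intro mult_left_mono add_right_mono mult_right_mono) (use kh a0 H0 in auto)
  also have "\<dots> = sqrt h * (heat_const TYPE('n) * (4 * sqrt (real N * h) * heat_const TYPE('n) * K * B + 6 * (8 * K * (heat_const TYPE('n))\<^sup>2 * m + 2 * B)))
      + (12 * heat_const TYPE('n) * K * sqrt (real N * h)) * (e / 6)"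
    unfolding a_def b_def by (rule error_identity2)
  also have "\<dots> \<le> sqrt h * (heat_const TYPE('n) * (4 * sqrt (real N * h) * heat_const TYPE('n) * K * B + 6 * (8 * K * (heat_const TYPE('n))\<^sup>2 * m + 2 * B))) + 1 * (e / 6)"
    by (intro add_left_mono mult_right_mono small) (use e in simp)
  finally show ?thesis using e(1) by linarith
qed

text \<open>The error over all grid times and all points has a finite bound by the crude estimates,
  so that half of it can be absorbed. The rate sqrt h reflects the regularity of U in time.\<close>

lemma scheme_converges:
  assumes M: "mild F u0 U T" and m: "\<And>y. \<bar>u0 y\<bar> \<le> m" and t: "0 < t" "t < T"
    and small: "12 * heat_const TYPE('n) * K * sqrt t \<le> 1"
  obtains C where "\<And>N x. N \<ge> 1 \<Longrightarrow> \<bar>U t x - scheme (t / real N) u0 N x\<bar> \<le> C * sqrt (t / real N)"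
proof
  define C where "C = heat_const TYPE('n) * (4 * sqrt t * heat_const TYPE('n) * K * B + 6 * (8 * K * (heat_const TYPE('n))\<^sup>2 * m + 2 * B))"
  have m0: "m \<ge> 0" using m[of 0] by linarith
  have H0: "heat_const TYPE('n) > 0" by (rule heat_const_pos)
  have C0: "C \<ge> 0" unfolding C_def using H0 K_pos B_nonneg m0 t by simp
  fix N :: nat and x assume N: "N \<ge> 1"
  define h where "h = t / real N"
  have h: "h > 0" using t N by (simp add: h_def)
  have Nh: "real N * h = t" using N by (simp add: h_def)
  define \<phi> where "\<phi> = (\<lambda>(k, y). \<bar>U (real k * h) y - scheme h u0 k y\<bar>)"
  have "\<phi> (N, x) \<le> 2 * (sqrt h * C)"
  proof (rule absorb_half[where S = "{1..N} \<times> (UNIV :: (real ^ 'n) set)"])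
    show "\<phi> p \<le> (m + heat_const TYPE('n) * (2 * sqrt t * B)) + (m + real N * (h * (heat_const TYPE('n) / sqrt h * B)))" if pS: "p \<in> {1..N} \<times> UNIV" for p :: "nat \<times> (real ^ 'n)"
    proof -
      obtain k y where p: "p = (k, y)" "1 \<le> k" "k \<le> N" using pS by (cases p) auto
      have kh: "0 < real k * h" "real k * h \<le> t" using p h unfolding Nh[symmetric] by auto
      have "\<bar>U (real k * h) y\<bar> \<le> m + heat_const TYPE('n) * (2 * sqrt (real k * h) * B)"
        by (rule mild_bounded[OF M m kh(1)]) (use kh t in linarith)
      also have "\<dots> \<le> m + heat_const TYPE('n) * (2 * sqrt t * B)"
        by (intro add_left_mono mult_left_mono mult_right_mono) (use kh H0 B_nonneg in auto)
      finally have 1: "\<bar>U (real k * h) y\<bar> \<le> m + heat_const TYPE('n) * (2 * sqrt t * B)" .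
      have "\<bar>scheme h u0 k y\<bar> \<le> m + real k * (h * (heat_const TYPE('n) / sqrt h * B))"
        by (rule scheme_bounded[OF h mild_measurable(4)[OF M] m])
      also have "\<dots> \<le> m + real N * (h * (heat_const TYPE('n) / sqrt h * B))"
        by (intro add_left_mono mult_right_mono) (use p h H0 B_nonneg in auto)
      finally have 2: "\<bar>scheme h u0 k y\<bar> \<le> m + real N * (h * (heat_const TYPE('n) / sqrt h * B))" .
      show ?thesis unfolding \<phi>_def p split_conv by (rule order_trans[OF abs_triangle_ineq4 add_mono[OF 1 2]])
    qed
    show "0 \<le> sqrt h * C" using C0 h by simp
    show "(N, x) \<in> {1..N} \<times> UNIV" using N by simp
    fix e and p :: "nat \<times> (real ^ 'n)" assume e: "0 \<le> e" "\<And>q. q \<in> {1..N} \<times> UNIV \<Longrightarrow> \<phi> q \<le> e" and pS: "p \<in> {1..N} \<times> UNIV"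
    obtain k y where p: "p = (k, y)" "1 \<le> k" "k \<le> N" using pS by (cases p) auto
    have e2: "\<bar>U (real k * h) y - scheme h u0 k y\<bar> \<le> e" if "1 \<le> k" "k \<le> N" for k and y :: "real ^ 'n"
      using e(2)[of "(k, y)"] that by (simp add: \<phi>_def)
    have "\<bar>U (real k * h) y - scheme h u0 k y\<bar>
       \<le> sqrt h * (heat_const TYPE('n) * (4 * sqrt (real N * h) * heat_const TYPE('n) * K * B + 6 * (8 * K * (heat_const TYPE('n))\<^sup>2 * m + 2 * B))) + e / 2"
      by (rule scheme_error_step[OF M m h _ _ e(1) e2 p(2,3)]) (use t small in \<open>simp_all add: Nh\<close>)
    then show "\<phi> p \<le> sqrt h * C + e / 2" unfolding \<phi>_def p split_conv Nh C_def .
  qed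
  then show "\<bar>U t x - scheme (t / real N) u0 N x\<bar> \<le> (2 * C) * sqrt (t / real N)"
    unfolding \<phi>_def split_conv Nh unfolding h_def by (simp add: mult_ac)
qed

text \<open>Because the defect is quadratic in the step size, N of them leave a factor that tends to
  1 as N grows.\<close>

lemma growth_factor_bound:
  assumes t: "t > 0" and c: "c \<ge> 0" and N: "N \<ge> 1"
  shows "(1 + c * (t / real N)\<^sup>2) ^ N \<le> exp (c * t\<^sup>2 / real N)"
proof -
  have "(1 + c * (t / real N)\<^sup>2) ^ N \<le> exp (c * (t / real N)\<^sup>2) ^ N"
    by (rule power_mono[OF exp_ge_add_one_self]) (use c in simp)
  also have "\<dots> = exp (real N * (c * (t / real N)\<^sup>2))" by (rule exp_of_nat_mult[symmetric])
  also have "real N * (c * (t / real N)\<^sup>2) = c * t\<^sup>2 / real N" using N by (simp add: power2_eq_square)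
  finally show ?thesis .
qed

lemma growth_factor_tendsto: "(\<lambda>N. exp (c / real N)) \<longlonglongrightarrow> 1"
proof -
  have "(\<lambda>N. exp (c / real N)) \<longlonglongrightarrow> exp 0"
    by (intro tendsto_exp lim_const_over_n)
  then show ?thesis by simp
qed

lemma sqrt_step_tendsto: "(\<lambda>N. C * sqrt (t / real N)) \<longlonglongrightarrow> 0"
proof -
  have "(\<lambda>N. C * sqrt (t / real N)) \<longlonglongrightarrow> C * sqrt 0"
    by (intro tendsto_mult tendsto_const tendsto_real_sqrt lim_const_over_n)
  then show ?thesis by simp
qed

section \<open>Maximum principle, and windows for restarting\<close>

lemma mild_sup_bound_short:
  assumes M: "mild F u0 U T" and m: "\<And>y. \<bar>u0 y\<bar> \<le> m" and t: "0 < t" "t < T"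
    and small: "12 * heat_const TYPE('n) * K * sqrt t \<le> 1"
  shows "\<bar>U t x\<bar> \<le> m"
proof -
  have m0: "m \<ge> 0" using m[of 0] by linarith
  obtain C where C: "\<And>N x. N \<ge> 1 \<Longrightarrow> \<bar>U t x - scheme (t / real N) u0 N x\<bar> \<le> C * sqrt (t / real N)"
    using scheme_converges[OF M m t small] by blast
  define c where "c = 8 * heat_const TYPE('n) * K ^ 4"
  have c0: "c \<ge> 0" unfolding c_def using heat_const_pos[where 'n='n] by simp
  have lim: "(\<lambda>N. C * sqrt (t / real N) + m * exp (c * t\<^sup>2 / real N)) \<longlonglongrightarrow> 0 + m * 1"
    by (intro tendsto_add tendsto_mult tendsto_const growth_factor_tendsto sqrt_step_tendsto)
  have "\<bar>U t x\<bar> \<le> C * sqrt (t / real N) + m * exp (c * t\<^sup>2 / real N)" if N: "N \<ge> 1" for N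
  proof -
    have "\<bar>scheme (t / real N) u0 N x\<bar> \<le> m * (1 + 8 * heat_const TYPE('n) * K ^ 4 * (t / real N)\<^sup>2) ^ N"
      by (rule scheme_sup_bound[OF _ mild_measurable(4)[OF M] m]) (use t N in simp)
    also have "\<dots> \<le> m * exp (c * t\<^sup>2 / real N)"
      unfolding c_def[symmetric] by (rule mult_left_mono[OF growth_factor_bound[OF t(1) c0 N] m0])
    finally show ?thesis using C[OF N, of x] by linarith
  qed
  then have "\<bar>U t x\<bar> \<le> 0 + m * 1" by (intro LIMSEQ_le_const[OF lim]) blast
  then show ?thesis by simp
qed

text \<open>The longest window on which the smallness assumption holds. It depends on K and the
  dimension but not on the datum, so windows of this one length can be concatenated
  indefinitely.\<close>

definition \<tau> :: real where "\<tau> = (1 / (12 * heat_const TYPE('n) * K))\<^sup>2"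

lemma \<tau>_pos: "\<tau> > 0"
  unfolding \<tau>_def using heat_const_pos[where 'n='n] K_pos by simp

lemma sqrt_\<tau>: "sqrt \<tau> = 1 / (12 * heat_const TYPE('n) * K)"
  unfolding \<tau>_def using heat_const_pos[where 'n='n] K_pos by (simp add: real_sqrt_abs)

lemma small_\<tau>:
  assumes "t \<le> \<tau>"
  shows "12 * heat_const TYPE('n) * K * sqrt t \<le> 1"
proof -
  have p: "12 * heat_const TYPE('n) * K > 0" using heat_const_pos[where 'n='n] K_pos by simp
  have "12 * heat_const TYPE('n) * K * sqrt t \<le> 12 * heat_const TYPE('n) * K * sqrt \<tau>" by (rule mult_left_mono) (use assms p in auto)
  also have "\<dots> = 1" unfolding sqrt_\<tau> using heat_const_pos[where 'n='n] K_pos by simp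
  finally show ?thesis .
qed

text \<open>Induction on the number of windows. Each inductive step advances by a full \<tau>, so
  that the window of irregular length is the first one.\<close>

lemma restart_induct:
  assumes short: "\<And>t. 0 < t \<Longrightarrow> t < T \<Longrightarrow> t \<le> \<tau> \<Longrightarrow> R t"
    and long: "\<And>t. 0 < t \<Longrightarrow> t + \<tau> < T \<Longrightarrow> R t \<Longrightarrow> R (t + \<tau>)"
    and t: "0 < t" "t < T"
  shows "R t"
proof -
  have *: "0 < t \<Longrightarrow> t < T \<Longrightarrow> t \<le> real n * \<tau> \<Longrightarrow> R t" for n t
  proof (induction n arbitrary: t)
    case (Suc n)
    show ?case
    proof (cases "t \<le> \<tau>")
      case True then show ?thesis using short Suc by blast
    next
      case False
      then have "R (t - \<tau>)" using Suc \<tau>_pos by (intro Suc.IH) (auto simp: algebra_simps)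
      then show ?thesis using long[of "t - \<tau>"] False Suc by simp
    qed
  qed auto
  obtain n where "t / \<tau> \<le> real n" using real_arch_simple by blast
  then have "t \<le> real n * \<tau>" using \<tau>_pos by (simp add: divide_le_eq)
  then show ?thesis using * t by blast
qed

lemma mild_sup_bound:
  assumes M: "mild F u0 U T" and m: "\<And>y. \<bar>u0 y\<bar> \<le> m" and t: "0 < t" "t < T"
  shows "\<bar>U t x\<bar> \<le> m"
proof -
  have "\<forall>x. \<bar>U t x\<bar> \<le> m"
  proof (rule restart_induct[OF _ _ t])
    show "\<forall>x. \<bar>U t x\<bar> \<le> m" if "0 < t" "t < T" "t \<le> \<tau>" for t
      using mild_sup_bound_short[OF M m that(1,2) small_\<tau>[OF that(3)]] by blast
    show "\<forall>x. \<bar>U (t + \<tau>) x\<bar> \<le> m" if t: "0 < t" "t + \<tau> < T" "\<forall>x. \<bar>U t x\<bar> \<le> m" for t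
    proof
      have tT: "t < T" using t \<tau>_pos by linarith
      show "\<bar>U (t + \<tau>) x\<bar> \<le> m" for x
        by (rule mild_sup_bound_short[OF mild_restart[OF M m t(1) tT] _ \<tau>_pos _ small_\<tau>[OF order_refl]]) (use t in auto)
    qed
  qed
  then show ?thesis by blast
qed

end

section \<open>Integration over the domain\<close>

definition valid_domain :: "domain \<Rightarrow> bool" where
  "valid_domain M \<longleftrightarrow> M = Whole_Space \<or> (\<exists>L\<ge>1. M = Torus L)"

definition cell :: "domain \<Rightarrow> (real ^ 'n::finite) set" where
  "cell M = (case M of Whole_Space \<Rightarrow> UNIV | Torus L \<Rightarrow> {x. \<forall>i. 0 \<le> x $ i \<and> x $ i < L})"

definition lattice_point :: "real \<Rightarrow> ('n::finite \<Rightarrow> int) \<Rightarrow> real ^ 'n" where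
  "lattice_point L k = (\<chi> i. L * of_int (k i))"

text \<open>Extended nonnegative values let Tonelli and translations be applied without
  integrability; finiteness is argued only where it is used.\<close>

definition dint :: "domain \<Rightarrow> (real ^ 'n::finite \<Rightarrow> ennreal) \<Rightarrow> ennreal" where
  "dint M g = (\<integral>\<^sup>+x. g x * indicator (cell M) x \<partial>lborel)"

lemma cell_measurable [measurable]: "cell M \<in> sets borel"
proof (cases M)
  case (Torus L)
  have "cell M = (\<Inter>i\<in>UNIV. {x :: real ^ 'a. 0 \<le> x $ i} \<inter> {x. x $ i < L})" by (auto simp: cell_def Torus)
  moreover have "\<dots> \<in> sets borel" by (intro sets.finite_INT sets.Int) auto
  ultimately show ?thesis by simp
qed (simp add: cell_def)

lemma domain_measure_eq: "domain_measure M = restrict_space lborel (cell M)"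
proof (cases M)
  case Whole_Space
  have "restrict_space lborel UNIV = (lborel :: (real ^ 'a) measure)"
    by (rule measure_eqI) (auto simp: sets_restrict_space emeasure_restrict_space)
  then show ?thesis by (simp add: Whole_Space domain_measure_def cell_def)
qed (simp add: domain_measure_def cell_def)

lemma nn_integral_domain: "integral\<^sup>N (domain_measure M) g = dint M g"
  unfolding domain_measure_eq dint_def by (rule nn_integral_restrict_space) simp

lemma AE_domain_iff: "(AE x in domain_measure M. R x) \<longleftrightarrow> (AE x in lborel. x \<in> cell M \<longrightarrow> R x)"
  unfolding domain_measure_eq by (rule AE_restrict_space_iff) simp

lemma measurable_domain: "g \<in> borel_measurable borel \<Longrightarrow> g \<in> borel_measurable (domain_measure M)"
  unfolding domain_measure_eq by (rule measurable_restrict_space1) simp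

lemma lives_on_lattice:
  assumes "lives_on (Torus L) g"
  shows "g (x + lattice_point L k) = g x"
proof -
  have p: "g (y + axis i L) = g y" for y i using assms by (simp add: lives_on_def)
  have nat: "g (y + axis i (L * real n)) = g y" for y i n
  proof (induction n)
    case (Suc n)
    have "axis i (L * real (Suc n)) = axis i (L * real n) + axis i L"
      by (simp add: vec_eq_iff axis_def distrib_left)
    then show ?case using p[of "y + axis i (L * real n)" i] Suc by (simp add: add.assoc)
  qed (simp add: axis_def vec_eq_iff[symmetric] zero_vec_def[symmetric])
  have int: "g (y + axis i (L * of_int m)) = g y" for y i m
  proof (cases "m \<ge> 0")
    case True
    then show ?thesis using nat[of y i "nat m"] by simp
  next
    case False
    have "axis i (L * of_int m) + axis i (L * real (nat (- m))) = 0"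
      using False by (simp add: vec_eq_iff axis_def)
    then show ?thesis using nat[of "y + axis i (L * of_int m)" i "nat (- m)"] by (simp add: add.assoc)
  qed
  have "g (x + (\<Sum>i\<in>A. axis i (L * of_int (k i)))) = g x" if "finite A" for A
    using that
  proof (induction A)
    case (insert j A)
    have "g (x + (\<Sum>i\<in>insert j A. axis i (L * of_int (k i))))
        = g ((x + (\<Sum>i\<in>A. axis i (L * of_int (k i)))) + axis j (L * of_int (k j)))"
      using insert by (simp add: add_ac)
    then show ?case unfolding int using insert by simp
  qed simp
  moreover have "(\<Sum>i\<in>UNIV. axis i (L * of_int (k i))) = lattice_point L k"
    by (simp add: vec_eq_iff lattice_point_def axis_def)
  ultimately show ?thesis by (metis finite_UNIV finite)
qed

text \<open>The half-open cell meets every lattice orbit exactly once, and the floor function names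
  the representative.\<close>

lemma cell_lattice_minus:
  assumes "L > 0"
  shows "x - lattice_point L k \<in> cell (Torus L) \<longleftrightarrow> k = (\<lambda>i. \<lfloor>x $ i / L\<rfloor>)"
proof -
  have "x - lattice_point L k \<in> cell (Torus L) \<longleftrightarrow> (\<forall>i. L * of_int (k i) \<le> x $ i \<and> x $ i < L * of_int (k i) + L)"
    by (simp add: cell_def lattice_point_def algebra_simps)
  also have "\<dots> \<longleftrightarrow> (\<forall>i. of_int (k i) \<le> x $ i / L \<and> x $ i / L < of_int (k i) + 1)"
    using assms by (simp add: le_divide_eq divide_less_eq algebra_simps)
  also have "\<dots> \<longleftrightarrow> (\<forall>i. \<lfloor>x $ i / L\<rfloor> = k i)" by (simp add: floor_eq_iff)
  finally show ?thesis by (auto simp: fun_eq_iff)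
qed

lemma cell_lattice_plus:
  assumes "L > 0"
  shows "x + lattice_point L k \<in> cell (Torus L) \<longleftrightarrow> k = (\<lambda>i. - \<lfloor>x $ i / L\<rfloor>)"
proof -
  have "x + lattice_point L k = x - lattice_point L (\<lambda>i. - k i)"
    by (simp add: lattice_point_def vec_eq_iff)
  then show ?thesis using cell_lattice_minus[OF assms, of x "\<lambda>i. - k i"]
    unfolding fun_eq_iff by (simp add: minus_equation_iff[of "k _"] eq_commute)
qed

lemma nn_integral_unique_indicator:
  assumes "\<And>k. k \<in> A \<longleftrightarrow> k = k0"
  shows "(\<integral>\<^sup>+k. indicator A k \<partial>count_space UNIV) = 1"
proof -
  have "A = {k0}" using assms by auto
  then show ?thesis by simp
qed

text \<open>On the torus the shifted cell is cut along the lattice translates of the original cell,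
  and by periodicity the pieces are moved back, where they tile the cell.\<close>

lemma dint_shift:
  assumes M: "valid_domain M" and g[measurable]: "g \<in> borel_measurable borel" and per: "lives_on M g"
  shows "dint M (\<lambda>x. g (x + a)) = dint M g"
proof (cases M)
  case Whole_Space
  then show ?thesis unfolding dint_def cell_def by (simp add: nn_integral_shift)
next
  case (Torus L)
  then have L: "L > 0" using M by (auto simp: valid_domain_def)
  define C :: "(real ^ 'a) set" where "C = cell (Torus L)"
  have [measurable]: "C \<in> sets borel" unfolding C_def by simp
  have per': "g (x + lattice_point L k) = g x" for x k by (rule lives_on_lattice) (use per Torus in simp)
  have one1: "(\<integral>\<^sup>+k. indicator C (x - lattice_point L k) \<partial>count_space UNIV) = 1" for x
    using nn_integral_unique_indicator[of "{k. x - lattice_point L k \<in> C}"] cell_lattice_minus[OF L, of x]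
    by (simp add: C_def indicator_def)
  have one2: "(\<integral>\<^sup>+k. indicator C (x + lattice_point L k) \<partial>count_space UNIV) = 1" for x
    using nn_integral_unique_indicator[of "{k. x + lattice_point L k \<in> C}"] cell_lattice_plus[OF L, of x]
    by (simp add: C_def indicator_def)
  have "dint M (\<lambda>x. g (x + a)) = (\<integral>\<^sup>+x. (\<lambda>x. g x * indicator C (x - a)) (x + a) \<partial>lborel)"
    by (simp add: dint_def Torus C_def)
  also have "\<dots> = (\<integral>\<^sup>+x. g x * indicator C (x - a) \<partial>lborel)" by (rule nn_integral_shift) measurable
  \<comment> \<open>A lattice sum equal to 1 is inserted. After the exchange and a shift, it is the
    other indicator that sums to 1.\<close>
  also have "\<dots> = (\<integral>\<^sup>+x. (\<integral>\<^sup>+k. g x * indicator C (x - a) * indicator C (x - lattice_point L k) \<partial>count_space UNIV) \<partial>lborel)"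
    by (simp add: nn_integral_cmult one1)
  also have "\<dots> = (\<integral>\<^sup>+k. (\<integral>\<^sup>+x. g x * indicator C (x - a) * indicator C (x - lattice_point L k) \<partial>lborel) \<partial>count_space UNIV)"
    by (rule nn_integral_count_space_nn_integral) (auto intro: countableI_type)
  also have "\<dots> = (\<integral>\<^sup>+k. (\<integral>\<^sup>+x. g x * indicator C (x - a + lattice_point L k) * indicator C x \<partial>lborel) \<partial>count_space UNIV)"
  proof (rule nn_integral_cong)
    fix k
    have "(\<integral>\<^sup>+x. g x * indicator C (x - a) * indicator C (x - lattice_point L k) \<partial>lborel)
       = (\<integral>\<^sup>+x. (\<lambda>x. g x * indicator C (x - a) * indicator C (x - lattice_point L k)) (x + lattice_point L k) \<partial>lborel)"
      by (rule nn_integral_shift[symmetric]) measurable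
    then show "(\<integral>\<^sup>+x. g x * indicator C (x - a) * indicator C (x - lattice_point L k) \<partial>lborel)
       = (\<integral>\<^sup>+x. g x * indicator C (x - a + lattice_point L k) * indicator C x \<partial>lborel)"
      by (simp add: per' diff_add_eq)
  qed
  also have "\<dots> = (\<integral>\<^sup>+x. (\<integral>\<^sup>+k. g x * indicator C (x - a + lattice_point L k) * indicator C x \<partial>count_space UNIV) \<partial>lborel)"
    by (rule nn_integral_count_space_nn_integral[symmetric]) (auto intro: countableI_type)
  also have "\<dots> = (\<integral>\<^sup>+x. g x * indicator C x \<partial>lborel)"
    by (simp add: nn_integral_cmult nn_integral_multc one2)
  finally show ?thesis by (simp add: dint_def Torus C_def)
qed

text \<open>Countably many translates of a null set are null. Statements posed on the cell can
  thereby be used under convolutions, which see the whole space.\<close>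

lemma AE_periodic:
  assumes M: "valid_domain M" and per: "lives_on M R" and ae: "AE x in domain_measure M. R x"
  shows "AE x in lborel. R x"
proof (cases M)
  case Whole_Space
  then show ?thesis using ae unfolding AE_domain_iff by (simp add: cell_def)
next
  case (Torus L)
  then have L: "L > 0" using M by (auto simp: valid_domain_def)
  have ae': "AE x in lborel. x \<in> cell (Torus L) \<longrightarrow> R x" using ae unfolding AE_domain_iff Torus .
  have per': "R (x + lattice_point L k) = R x" for x k by (rule lives_on_lattice) (use per Torus in simp)
  have "AE x in lborel. \<forall>k. x + lattice_point L k \<in> cell (Torus L) \<longrightarrow> R (x + lattice_point L k)"
    unfolding AE_all_countable
  proof
    fix k
    have 1: "AE x in distr lborel borel (\<lambda>z. z + lattice_point L k). x \<in> cell (Torus L) \<longrightarrow> R x"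
      using ae' by (subst lborel_distr_shift)
    have "(\<lambda>z. z + lattice_point L k) \<in> lborel \<rightarrow>\<^sub>M borel" by measurable
    from AE_distrD[OF this 1]
    show "AE x in lborel. x + lattice_point L k \<in> cell (Torus L) \<longrightarrow> R (x + lattice_point L k)" .
  qed
  then show ?thesis
  proof eventually_elim
    case (elim x)
    then show ?case using cell_lattice_plus[OF L, of x] per' by blast
  qed
qed

section \<open>Tonelli and convolutions under the domain integral\<close>

lemma dint_mono: "(\<And>x. f x \<le> g x) \<Longrightarrow> dint M f \<le> dint M g"
  unfolding dint_def by (intro nn_integral_mono mult_right_mono) auto

lemma dint_cmult: "g \<in> borel_measurable borel \<Longrightarrow> dint M (\<lambda>x. c * g x) = c * dint M g"
  unfolding dint_def mult.assoc by (rule nn_integral_cmult) simp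

lemma dint_add:
  "f \<in> borel_measurable borel \<Longrightarrow> g \<in> borel_measurable borel \<Longrightarrow> dint M (\<lambda>x. f x + g x) = dint M f + dint M g"
  unfolding dint_def distrib_right by (rule nn_integral_add) simp_all

lemma dint_nn_integral:
  fixes N :: "'a \<Rightarrow> real ^ 'n::finite \<Rightarrow> ennreal"
  assumes "sigma_finite_measure \<mu>" and [measurable]: "(\<lambda>p. N (fst p) (snd p)) \<in> borel_measurable (\<mu> \<Otimes>\<^sub>M borel)"
  shows "dint M (\<lambda>x. \<integral>\<^sup>+z. N z x \<partial>\<mu>) = (\<integral>\<^sup>+z. dint M (N z) \<partial>\<mu>)"
proof -
  interpret \<mu>: sigma_finite_measure \<mu> by fact
  interpret P: pair_sigma_finite \<mu> "lborel :: (real ^ 'n) measure" ..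
  have m: "(\<lambda>p. N (fst p) (snd p) * indicator (cell M) (snd p)) \<in> borel_measurable (\<mu> \<Otimes>\<^sub>M lborel)"
    by measurable
  have m2: "N z \<in> borel_measurable borel" if "z \<in> space \<mu>" for z
    using measurable_compose[OF measurable_Pair1'[OF that] assms(2)] by simp
  have m3: "(\<lambda>z. N z x) \<in> borel_measurable \<mu>" for x
    using measurable_compose[OF measurable_Pair2'[of x borel \<mu>] assms(2)] by simp
  have "dint M (\<lambda>x. \<integral>\<^sup>+z. N z x \<partial>\<mu>) = (\<integral>\<^sup>+x. \<integral>\<^sup>+z. N z x * indicator (cell M) x \<partial>\<mu> \<partial>lborel)"
    unfolding dint_def by (simp add: nn_integral_multc m3)
  also have "\<dots> = (\<integral>\<^sup>+z. \<integral>\<^sup>+x. N z x * indicator (cell M) x \<partial>lborel \<partial>\<mu>)"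
    using m by (intro P.Fubini') (simp add: case_prod_beta')
  finally show ?thesis by (simp add: dint_def)
qed

text \<open>Tonelli, with a translation by z in each slice. A bound at x by an average over the
  points x - z turns into a bound by the data at x itself, which is how kernel inequalities become
  inequalities between integrals.\<close>

lemma dint_convolution:
  fixes N :: "real ^ 'n::finite \<Rightarrow> real ^ 'n \<Rightarrow> ennreal"
  assumes M: "valid_domain M" and m[measurable]: "(\<lambda>p. N (fst p) (snd p)) \<in> borel_measurable (borel \<Otimes>\<^sub>M borel)"
    and per: "\<And>z. lives_on M (N z)"
  shows "dint M (\<lambda>x. \<integral>\<^sup>+z. N z (x - z) \<partial>lborel) = dint M (\<lambda>x. \<integral>\<^sup>+z. N z x \<partial>lborel)"
proof -
  have sf: "sigma_finite_measure (lborel :: (real ^ 'n) measure)" by (rule sigma_finite_lborel)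
  have [measurable]: "(\<lambda>p. (\<lambda>p. N (fst p) (snd p)) (fst p, snd p - fst p)) \<in> borel_measurable (borel \<Otimes>\<^sub>M borel)"
    by measurable
  have m1: "(\<lambda>p. N (fst p) (snd p - fst p)) \<in> borel_measurable (lborel \<Otimes>\<^sub>M borel)"
    using \<open>(\<lambda>p. (\<lambda>p. N (fst p) (snd p)) (fst p, snd p - fst p)) \<in> borel_measurable (borel \<Otimes>\<^sub>M borel)\<close>
    by (simp cong: measurable_cong_sets sets_pair_measure_cong)
  have m2: "(\<lambda>p. N (fst p) (snd p)) \<in> borel_measurable (lborel \<Otimes>\<^sub>M borel)"
    using m by (simp cong: measurable_cong_sets sets_pair_measure_cong)
  have m3: "N z \<in> borel_measurable borel" for z
    using measurable_compose[OF measurable_Pair1' m, of z] by simp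
  have "dint M (\<lambda>x. \<integral>\<^sup>+z. N z (x - z) \<partial>lborel) = (\<integral>\<^sup>+z. dint M (\<lambda>x. N z (x - z)) \<partial>lborel)"
    by (rule dint_nn_integral[OF sf m1])
  also have "\<dots> = (\<integral>\<^sup>+z. dint M (N z) \<partial>lborel)"
    using dint_shift[OF M m3 per, of _ "- _"] by simp
  also have "\<dots> = dint M (\<lambda>x. \<integral>\<^sup>+z. N z x \<partial>lborel)"
    by (rule dint_nn_integral[OF sf m2, symmetric])
  finally show ?thesis .
qed

lemma lives_on_comp: "lives_on M g \<Longrightarrow> lives_on M (\<lambda>x. \<phi> (g x))"
  by (cases M) (auto simp: lives_on_def)

lemma lives_on_comp2: "lives_on M g \<Longrightarrow> lives_on M h \<Longrightarrow> lives_on M (\<lambda>x. \<phi> (g x) (h x))"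
  by (cases M) (auto simp: lives_on_def)

lemma lives_on_shift: "lives_on M g \<Longrightarrow> lives_on M (\<lambda>x. g (x + a))"
proof (cases M)
  case (Torus L)
  assume "lives_on M g"
  then have "g (x + a + axis i L) = g (x + a)" for x i by (simp add: lives_on_def Torus)
  then show ?thesis by (simp add: lives_on_def Torus add_ac)
qed (simp add: lives_on_def)

section \<open>Contraction in the mean and growth in mean square\<close>

text \<open>If |q| \<le> |w|, then w + q does not change sign and |w + q| = |w| + sgn w * q exactly.
  The term linear in q will have mean 0; an excess of D over |w| costs at most 2 * D.\<close>

lemma abs_add_defect:
  fixes w q D :: real
  assumes "\<bar>q\<bar> \<le> \<bar>w\<bar> + D" "D \<ge> 0" "w = 0 \<Longrightarrow> q = 0"
  shows "\<bar>w + q\<bar> \<le> \<bar>w\<bar> + sgn w * q + 2 * D"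
  using assms by (cases w "0 :: real" rule: linorder_cases) (auto simp: abs_if split: if_splits)

lemma ennreal_le_norm_integral:
  fixes f :: "'a \<Rightarrow> real"
  assumes "integrable M f"
  shows "ennreal \<bar>integral\<^sup>L M f\<bar> \<le> (\<integral>\<^sup>+x. ennreal \<bar>f x\<bar> \<partial>M)"
  using integral_norm_bound_ennreal[OF assms] by simp

lemma weighted_Cauchy_Schwarz:
  fixes k f :: "'a \<Rightarrow> real"
  assumes [measurable]: "k \<in> borel_measurable M" "f \<in> borel_measurable M" and k: "\<And>x. k x \<ge> 0"
  shows "(\<integral>\<^sup>+x. ennreal (k x * \<bar>f x\<bar>) \<partial>M)\<^sup>2 \<le> (\<integral>\<^sup>+x. ennreal (k x) \<partial>M) * (\<integral>\<^sup>+x. ennreal (k x * (f x)\<^sup>2) \<partial>M)"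
proof -
  have "(\<integral>\<^sup>+x. ennreal (sqrt (k x)) * ennreal (sqrt (k x) * \<bar>f x\<bar>) \<partial>M)\<^sup>2
    \<le> (\<integral>\<^sup>+x. (ennreal (sqrt (k x)))\<^sup>2 \<partial>M) * (\<integral>\<^sup>+x. (ennreal (sqrt (k x) * \<bar>f x\<bar>))\<^sup>2 \<partial>M)"
    by (rule Cauchy_Schwarz_nn_integral) measurable
  moreover have "ennreal (sqrt (k x)) * ennreal (sqrt (k x) * \<bar>f x\<bar>) = ennreal (k x * \<bar>f x\<bar>)" for x
    using k[of x] by (simp add: ennreal_mult[symmetric] mult.assoc[symmetric])
  moreover have "(ennreal (sqrt (k x)))\<^sup>2 = ennreal (k x)" for x
    using k[of x] by (simp add: ennreal_power)
  moreover have "(ennreal (sqrt (k x) * \<bar>f x\<bar>))\<^sup>2 = ennreal (k x * (f x)\<^sup>2)" for x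
    using k[of x] by (simp add: ennreal_power power_mult_distrib)
  ultimately show ?thesis by simp
qed

text \<open>Jensen's inequality for the kernel as a probability density, in the form of
  Cauchy-Schwarz, followed by a translation in each slice.\<close>

lemma dint_heat_op_square:
  fixes w :: "real ^ 'n::finite \<Rightarrow> real"
  assumes M: "valid_domain M" and per: "lives_on M w" and t: "t > 0"
    and w[measurable]: "w \<in> borel_measurable borel" and c: "\<And>y. \<bar>w y\<bar> \<le> c"
  shows "dint M (\<lambda>x. ennreal ((heat_op t w x)\<^sup>2)) \<le> dint M (\<lambda>x. ennreal ((w x)\<^sup>2))"
proof -
  define N where "N = (\<lambda>(z :: real ^ 'n) y. ennreal (heat_kernel t z * (w y)\<^sup>2))"
  have [measurable]: "(\<lambda>p. N (fst p) (snd p)) \<in> borel_measurable (borel \<Otimes>\<^sub>M borel)" unfolding N_def by measurable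
  have "ennreal ((heat_op t w x)\<^sup>2) \<le> (\<integral>\<^sup>+z. N z (x - z) \<partial>lborel)" for x
  proof -
    have I: "integrable lborel (\<lambda>z. heat_kernel t z *\<^sub>R w (x - z))"
      by (rule heat_op_integrable[OF t w]) (use c in simp)
    have "ennreal \<bar>heat_op t w x\<bar> \<le> (\<integral>\<^sup>+z. ennreal (heat_kernel t z * \<bar>w (x - z)\<bar>) \<partial>lborel)"
      using ennreal_le_norm_integral[OF I] by (simp add: heat_op_def abs_mult heat_kernel_nonneg)
    then have "(ennreal \<bar>heat_op t w x\<bar>)\<^sup>2 \<le> (\<integral>\<^sup>+z. ennreal (heat_kernel t z * \<bar>w (x - z)\<bar>) \<partial>lborel)\<^sup>2"
      by (rule power_mono) simp
    also have "\<dots> \<le> (\<integral>\<^sup>+z. ennreal (heat_kernel t (z :: real ^ 'n)) \<partial>lborel) * (\<integral>\<^sup>+z. ennreal (heat_kernel t z * (w (x - z))\<^sup>2) \<partial>lborel)"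
      by (rule weighted_Cauchy_Schwarz) (auto simp: heat_kernel_nonneg)
    also have "\<dots> = (\<integral>\<^sup>+z. N z (x - z) \<partial>lborel)" by (simp add: heat_kernel_nn_integral[OF t] N_def)
    finally show ?thesis by (simp add: ennreal_power)
  qed
  then have "dint M (\<lambda>x. ennreal ((heat_op t w x)\<^sup>2)) \<le> dint M (\<lambda>x. \<integral>\<^sup>+z. N z (x - z) \<partial>lborel)" by (rule dint_mono)
  also have "\<dots> = dint M (\<lambda>x. \<integral>\<^sup>+z. N z x \<partial>lborel)"
    by (rule dint_convolution[OF M]) (measurable, use per in \<open>auto simp: N_def intro: lives_on_comp\<close>)
  also have "\<dots> = dint M (\<lambda>x. ennreal ((w x)\<^sup>2))"
    unfolding N_def by (simp add: ennreal_mult heat_kernel_nonneg nn_integral_multc heat_kernel_nn_integral[OF t])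
  finally show ?thesis .
qed

text \<open>Cauchy-Schwarz on the product of time and space, weighted by the norm of the kernel
  gradient, whose mass is at most 2 H sqrt t with H the constant \<open>heat_const\<close>. The mass
  enters twice: once from Cauchy-Schwarz and once from integrating the translated squares against
  the weight.\<close>

lemma dint_duhamel_square:
  fixes g :: "real \<Rightarrow> real ^ 'n::finite \<Rightarrow> real ^ 'n" and w :: "real \<Rightarrow> real ^ 'n \<Rightarrow> real"
  assumes M: "valid_domain M" and per: "\<And>s. 0 < s \<Longrightarrow> s < t \<Longrightarrow> lives_on M (w s)" and t: "t > 0" and K: "K \<ge> 0"
    and g: "(\<lambda>p. g (fst p) (snd p)) \<in> borel_measurable (borel \<Otimes>\<^sub>M borel)"
    and w: "(\<lambda>p. w (fst p) (snd p)) \<in> borel_measurable (borel \<Otimes>\<^sub>M borel)"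
    and gb: "\<And>s y. norm (g s y) \<le> b" and gw: "\<And>s y. norm (g s y) \<le> K * \<bar>w s y\<bar>"
    and S: "\<And>s. 0 < s \<Longrightarrow> s < t \<Longrightarrow> dint M (\<lambda>x. ennreal ((w s x)\<^sup>2)) \<le> ennreal S" and S0: "S \<ge> 0"
  shows "dint M (\<lambda>x. ennreal ((duhamel t g x)\<^sup>2)) \<le> ennreal ((2 * heat_const TYPE('n) * sqrt t * K)\<^sup>2 * S)"
proof -
  have H0: "heat_const TYPE('n) > 0" by (rule heat_const_pos)
  note [measurable (raw)] = joint_measurable_compose[OF g] joint_measurable_compose[OF w]
  define k where "k = (\<lambda>p :: real \<times> (real ^ 'n). indicat_real {0<..<t} (fst p) * norm (heat_grad (t - fst p) (snd p)))"
  let ?P = "lborel \<Otimes>\<^sub>M lborel :: (real \<times> (real ^ 'n)) measure"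
  have km[measurable]: "k \<in> borel_measurable (borel \<Otimes>\<^sub>M borel)" unfolding k_def by measurable
  have kP[measurable]: "k \<in> borel_measurable ?P" using km by (simp cong: measurable_cong_sets sets_pair_measure_cong)
  have k0: "k p \<ge> 0" for p unfolding k_def by simp
  have kI: "(\<integral>\<^sup>+p. ennreal (k p) \<partial>?P) \<le> ennreal (heat_const TYPE('n) * (2 * sqrt t))"
  proof -
    have "(\<integral>\<^sup>+p. ennreal (k p) \<partial>?P) = (\<integral>\<^sup>+s. \<integral>\<^sup>+z. ennreal (k (s, z)) \<partial>lborel \<partial>lborel)"
      by (rule lborel.nn_integral_fst[symmetric]) (use kP in measurable)
    also have "\<dots> \<le> (\<integral>\<^sup>+s. ennreal (heat_const TYPE('n) * (indicator {0<..<t} s * (1 / sqrt (t - s)))) \<partial>lborel)"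
    proof (rule nn_integral_mono)
      fix s :: real
      show "(\<integral>\<^sup>+z. ennreal (k (s, z)) \<partial>lborel) \<le> ennreal (heat_const TYPE('n) * (indicator {0<..<t} s * (1 / sqrt (t - s))))"
      proof (cases "0 < s \<and> s < t")
        case True
        have "(\<integral>\<^sup>+z. ennreal (norm (heat_grad (t - s) (z :: real ^ 'n))) \<partial>lborel) = ennreal (LINT z|lborel. norm (heat_grad (t - s) (z :: real ^ 'n)))"
          by (rule nn_integral_eq_integral) (use heat_grad_integrable[of "t - s"] True in auto)
        also have "\<dots> \<le> ennreal (heat_const TYPE('n) / sqrt (t - s))"
          by (rule ennreal_leI[OF heat_grad_norm_integral]) (use True in simp)
        finally show ?thesis using True by (simp add: k_def)
      qed (auto simp: k_def)
    qed
    also have "\<dots> = ennreal (LINT s|lborel. heat_const TYPE('n) * (indicator {0<..<t} s * (1 / sqrt (t - s))))"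
    proof (rule nn_integral_eq_integral)
      show "integrable lborel (\<lambda>s. heat_const TYPE('n) * (indicator {0<..<t} s * (1 / sqrt (t - s))))"
        by (rule integrable_mult_right, rule integrable.intros, rule has_bochner_integral_inverse_sqrt_reflect[OF t])
      show "AE s in lborel. 0 \<le> heat_const TYPE('n) * (indicator {0<..<t} s * (1 / sqrt (t - s)))"
        by (rule AE_I2) (use H0 in \<open>auto simp: indicator_def\<close>)
    qed
    also have "(LINT s|lborel. heat_const TYPE('n) * (indicator {0<..<t} s * (1 / sqrt (t - s)))) = heat_const TYPE('n) * (2 * sqrt t)"
      unfolding integral_mult_right_zero has_bochner_integral_integral_eq[OF has_bochner_integral_inverse_sqrt_reflect[OF t]] ..
    finally show ?thesis .
  qed
  define N where "N = (\<lambda>p y. ennreal (k p * (w (fst p) y)\<^sup>2))"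
  have Nm: "(\<lambda>q. N (fst q) (snd q - snd (fst q))) \<in> borel_measurable (?P \<Otimes>\<^sub>M borel)"
  proof -
    have "(\<lambda>q. N (fst q) (snd q - snd (fst q))) \<in> borel_measurable ((borel \<Otimes>\<^sub>M borel) \<Otimes>\<^sub>M borel)" unfolding N_def by measurable
    then show ?thesis by (simp cong: measurable_cong_sets sets_pair_measure_cong)
  qed
  have sf: "sigma_finite_measure ?P"
    by (rule sigma_finite_pair_measure[OF sigma_finite_lborel sigma_finite_lborel])
  have wx: "(\<lambda>p. w (fst p) (x - snd p)) \<in> borel_measurable ?P" for x
  proof -
    have "(\<lambda>p. w (fst p) (x - snd p)) \<in> borel_measurable (borel \<Otimes>\<^sub>M borel)" by measurable
    then show ?thesis by (simp cong: measurable_cong_sets sets_pair_measure_cong)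
  qed
  have pt: "ennreal ((duhamel t g x)\<^sup>2) \<le> ennreal (K\<^sup>2 * (heat_const TYPE('n) * (2 * sqrt t))) * (\<integral>\<^sup>+p. N p (x - snd p) \<partial>?P)" for x
  proof -
    have "ennreal \<bar>duhamel t g x\<bar> \<le> (\<integral>\<^sup>+s. ennreal \<bar>indicator {0<..<t} s * grad_op (t - s) (g s) x\<bar> \<partial>lborel)"
      unfolding duhamel_def by (rule ennreal_le_norm_integral[OF duhamel_bounded(1)[OF t g gb]])
    also have "\<dots> \<le> (\<integral>\<^sup>+s. \<integral>\<^sup>+z. ennreal K * ennreal (k (s, z) * \<bar>w s (x - z)\<bar>) \<partial>lborel \<partial>lborel)"
    proof (rule nn_integral_mono)
      fix s :: real
      show "ennreal \<bar>indicator {0<..<t} s * grad_op (t - s) (g s) x\<bar> \<le> (\<integral>\<^sup>+z. ennreal K * ennreal (k (s, z) * \<bar>w s (x - z)\<bar>) \<partial>lborel)"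
      proof (cases "0 < s \<and> s < t")
        case True
        have "ennreal \<bar>grad_op (t - s) (g s) x\<bar> \<le> (\<integral>\<^sup>+z. ennreal \<bar>heat_grad (t - s) z \<bullet> g s (x - z)\<bar> \<partial>lborel)"
          unfolding grad_op_def
          by (rule ennreal_le_norm_integral[OF grad_op_integrable[OF _ section_measurable[OF g] gb]]) (use True in simp)
        also have "\<dots> \<le> (\<integral>\<^sup>+z. ennreal K * ennreal (k (s, z) * \<bar>w s (x - z)\<bar>) \<partial>lborel)"
        proof (rule nn_integral_mono)
          fix z
          have "\<bar>heat_grad (t - s) z \<bullet> g s (x - z)\<bar> \<le> norm (heat_grad (t - s) z) * (K * \<bar>w s (x - z)\<bar>)"
            by (rule order_trans[OF Cauchy_Schwarz_ineq2 mult_left_mono[OF gw]]) simp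
          also have "\<dots> = K * (k (s, z) * \<bar>w s (x - z)\<bar>)" using True by (simp add: k_def)
          finally show "ennreal \<bar>heat_grad (t - s) z \<bullet> g s (x - z)\<bar> \<le> ennreal K * ennreal (k (s, z) * \<bar>w s (x - z)\<bar>)"
            using K k0[of "(s, z)"] by (simp add: ennreal_mult[symmetric] ennreal_leI)
        qed
        finally show ?thesis using True by simp
      qed simp
    qed
    also have "\<dots> = (\<integral>\<^sup>+p. ennreal K * ennreal (k p * \<bar>w (fst p) (x - snd p)\<bar>) \<partial>?P)"
    proof -
      have "(\<integral>\<^sup>+s. \<integral>\<^sup>+z. (\<lambda>p. ennreal K * ennreal (k p * \<bar>w (fst p) (x - snd p)\<bar>)) (s, z) \<partial>lborel \<partial>lborel)
          = (\<integral>\<^sup>+p. ennreal K * ennreal (k p * \<bar>w (fst p) (x - snd p)\<bar>) \<partial>?P)"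
        by (rule lborel.nn_integral_fst) (use kP wx[of x] in measurable)
      then show ?thesis by simp
    qed
    also have "\<dots> = ennreal K * (\<integral>\<^sup>+p. ennreal (k p * \<bar>w (fst p) (x - snd p)\<bar>) \<partial>?P)"
      by (rule nn_integral_cmult) (use kP wx[of x] in measurable)
    finally have "(ennreal \<bar>duhamel t g x\<bar>)\<^sup>2 \<le> (ennreal K * (\<integral>\<^sup>+p. ennreal (k p * \<bar>w (fst p) (x - snd p)\<bar>) \<partial>?P))\<^sup>2"
      by (rule power_mono) simp
    also have "\<dots> = ennreal (K\<^sup>2) * (\<integral>\<^sup>+p. ennreal (k p * \<bar>w (fst p) (x - snd p)\<bar>) \<partial>?P)\<^sup>2"
      using K by (simp add: power_mult_distrib ennreal_power)
    also have "\<dots> \<le> ennreal (K\<^sup>2) * ((\<integral>\<^sup>+p. ennreal (k p) \<partial>?P) * (\<integral>\<^sup>+p. ennreal (k p * (w (fst p) (x - snd p))\<^sup>2) \<partial>?P))"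
      by (intro mult_left_mono weighted_Cauchy_Schwarz kP wx k0) simp
    also have "\<dots> \<le> ennreal (K\<^sup>2) * (ennreal (heat_const TYPE('n) * (2 * sqrt t)) * (\<integral>\<^sup>+p. N p (x - snd p) \<partial>?P))"
      unfolding N_def by (intro mult_left_mono mult_right_mono kI) auto
    also have "\<dots> = ennreal (K\<^sup>2 * (heat_const TYPE('n) * (2 * sqrt t))) * (\<integral>\<^sup>+p. N p (x - snd p) \<partial>?P)"
      using H0 t by (simp add: ennreal_mult mult.assoc)
    finally show ?thesis by (simp add: ennreal_power)
  qed
  have "dint M (\<lambda>x. ennreal ((duhamel t g x)\<^sup>2)) \<le> dint M (\<lambda>x. ennreal (K\<^sup>2 * (heat_const TYPE('n) * (2 * sqrt t))) * (\<integral>\<^sup>+p. N p (x - snd p) \<partial>?P))"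
    by (rule dint_mono[OF pt])
  also have "\<dots> = ennreal (K\<^sup>2 * (heat_const TYPE('n) * (2 * sqrt t))) * dint M (\<lambda>x. \<integral>\<^sup>+p. N p (x - snd p) \<partial>?P)"
  proof (rule dint_cmult)
    have "(\<lambda>q. N (snd q) (fst q - snd (snd q))) \<in> borel_measurable (borel \<Otimes>\<^sub>M (borel \<Otimes>\<^sub>M borel))" unfolding N_def by measurable
    then have "(\<lambda>q. N (snd q) (fst q - snd (snd q))) \<in> borel_measurable (borel \<Otimes>\<^sub>M ?P)"
      by (simp cong: measurable_cong_sets sets_pair_measure_cong)
    then show "(\<lambda>x. \<integral>\<^sup>+p. N p (x - snd p) \<partial>?P) \<in> borel_measurable borel"
      by (intro sigma_finite_measure.borel_measurable_nn_integral[OF sf]) (simp add: case_prod_beta')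
  qed
  also have "dint M (\<lambda>x. \<integral>\<^sup>+p. N p (x - snd p) \<partial>?P) = (\<integral>\<^sup>+p. dint M (\<lambda>x. N p (x - snd p)) \<partial>?P)"
    by (rule dint_nn_integral[OF sf Nm])
  also have "\<dots> \<le> (\<integral>\<^sup>+p. ennreal S * ennreal (k p) \<partial>?P)"
  proof (rule nn_integral_mono)
    fix p :: "real \<times> (real ^ 'n)"
    show "dint M (\<lambda>x. N p (x - snd p)) \<le> ennreal S * ennreal (k p)"
    proof (cases "0 < fst p \<and> fst p < t")
      case True
      have ws[measurable]: "w (fst p) \<in> borel_measurable borel" by (rule section_measurable[OF w])
      have lv: "lives_on M (\<lambda>x. ennreal ((w (fst p) x)\<^sup>2))" using per[of "fst p"] True by (auto intro: lives_on_comp)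
      have "dint M (\<lambda>x. N p (x - snd p)) = dint M (\<lambda>x. ennreal (k p) * ennreal ((w (fst p) (x + - snd p))\<^sup>2))"
        unfolding N_def using k0[of p] by (simp add: ennreal_mult)
      also have "\<dots> = ennreal (k p) * dint M (\<lambda>x. ennreal ((w (fst p) (x + - snd p))\<^sup>2))"
        by (rule dint_cmult) measurable
      also have "dint M (\<lambda>x. ennreal ((w (fst p) (x + - snd p))\<^sup>2)) = dint M (\<lambda>x. ennreal ((w (fst p) x)\<^sup>2))"
        by (rule dint_shift[OF M _ lv]) measurable
      also have "ennreal (k p) * \<dots> \<le> ennreal (k p) * ennreal S"
        by (rule mult_left_mono[OF S]) (use True in auto)
      finally show ?thesis by (simp add: mult.commute)
    next
      case False
      then have "k p = 0" by (auto simp: k_def)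
      then show ?thesis by (simp add: N_def dint_def)
    qed
  qed
  also have "\<dots> = ennreal S * (\<integral>\<^sup>+p. ennreal (k p) \<partial>?P)" by (rule nn_integral_cmult) (use kP in measurable)
  also have "\<dots> \<le> ennreal S * ennreal (heat_const TYPE('n) * (2 * sqrt t))" by (rule mult_left_mono[OF kI]) simp
  finally have "dint M (\<lambda>x. ennreal ((duhamel t g x)\<^sup>2))
     \<le> ennreal (K\<^sup>2 * (heat_const TYPE('n) * (2 * sqrt t))) * (ennreal S * ennreal (heat_const TYPE('n) * (2 * sqrt t)))"
    by (simp add: mult_left_mono)
  also have "\<dots> = ennreal ((2 * heat_const TYPE('n) * sqrt t * K)\<^sup>2 * S)"
  proof -
    have "ennreal (K\<^sup>2 * (heat_const TYPE('n) * (2 * sqrt t))) * (ennreal S * ennreal (heat_const TYPE('n) * (2 * sqrt t)))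
        = ennreal (K\<^sup>2 * (heat_const TYPE('n) * (2 * sqrt t)) * (S * (heat_const TYPE('n) * (2 * sqrt t))))"
    proof -
      have n2: "0 \<le> heat_const TYPE('n) * (2 * sqrt t)" and n1: "0 \<le> K\<^sup>2 * (heat_const TYPE('n) * (2 * sqrt t))" using H0 t by simp_all
      show ?thesis
        by (simp only: ennreal_mult[OF n1 mult_nonneg_nonneg[OF S0 n2]] ennreal_mult[OF S0 n2])
    qed
    also have "K\<^sup>2 * (heat_const TYPE('n) * (2 * sqrt t)) * (S * (heat_const TYPE('n) * (2 * sqrt t))) = (2 * heat_const TYPE('n) * sqrt t * K)\<^sup>2 * S"
      by (simp add: power2_eq_square)
    finally show ?thesis .
  qed
  finally show ?thesis .
qed

section \<open>Contraction for the scheme and for mild solutions\<close>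

context flux
begin

text \<open>Up to the defect the modulus is linear in z with slope sgn w * \<beta> / 2, and the
  linear part integrates to 0 because the first moment vanishes. Integrated over x, this is the mean
  contraction of one step.\<close>

lemma kernel_contraction:
  fixes \<beta> :: "real ^ 'n" and w :: real
  assumes h: "h > 0" and \<beta>: "norm \<beta> \<le> K * \<bar>w\<bar>"
  shows "(\<integral>\<^sup>+z. ennreal (heat_kernel h z * \<bar>w + z \<bullet> \<beta> / 2\<bar>) \<partial>lborel) \<le> ennreal ((1 + 8 * heat_const TYPE('n) * K ^ 4 * h\<^sup>2) * \<bar>w\<bar>)"
proof -
  define D where "D = (\<lambda>z :: real ^ 'n. \<bar>w\<bar> * (K / 2) ^ 4 * norm z ^ 4)"
  have D0: "D z \<ge> 0" for z :: "real ^ 'n" by (simp add: D_def)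
  have \<beta>0: "\<beta> = 0" if "w = 0" using \<beta> that by simp
  let ?f = "\<lambda>z. \<bar>w\<bar> * heat_kernel h z + sgn w / 2 * ((heat_kernel h z *\<^sub>R z) \<bullet> \<beta>) + 2 * (heat_kernel h z * D z)"
  have DI: "integrable lborel (\<lambda>z. heat_kernel h z * D z)" "(LINT z|lborel. heat_kernel h z * D z) \<le> 4 * heat_const TYPE('n) * K ^ 4 * h\<^sup>2 * \<bar>w\<bar>"
    unfolding D_def by (rule defect_integral[OF h], simp)+
  have OI: "integrable lborel (\<lambda>z. (heat_kernel h z *\<^sub>R z) \<bullet> \<beta>)"
    by (rule integrable_inner_left) (use heat_kernel_odd(1)[OF h] in simp)
  have O0: "(LINT z|lborel. (heat_kernel h z *\<^sub>R z) \<bullet> \<beta>) = 0"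
    unfolding integral_inner_left[OF heat_kernel_odd(1)[OF h]] heat_kernel_odd(2)[OF h] by simp
  have I1: "integrable lborel (\<lambda>z :: real ^ 'n. \<bar>w\<bar> * heat_kernel h z)" by (rule integrable_mult_right, rule heat_kernel_integrable[OF h])
  have I2: "integrable lborel (\<lambda>z. sgn w / 2 * ((heat_kernel h z *\<^sub>R z) \<bullet> \<beta>))" by (rule integrable_mult_right, rule OI)
  have I3: "integrable lborel (\<lambda>z. 2 * (heat_kernel h z * D z))" by (rule integrable_mult_right, rule DI(1))
  note I12 = Bochner_Integration.integrable_add[OF I1 I2]
  have le: "heat_kernel h z * \<bar>w + z \<bullet> \<beta> / 2\<bar> \<le> ?f z" for z
  proof -
    have "\<bar>w + z \<bullet> \<beta> / 2\<bar> \<le> \<bar>w\<bar> + sgn w * (z \<bullet> \<beta> / 2) + 2 * D z"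
      by (rule abs_add_defect[OF _ D0]) (use kernel_defect[OF refl \<beta>, of z] \<beta>0 in \<open>auto simp: D_def\<close>)
    from mult_left_mono[OF this heat_kernel_nonneg[of h z]] show ?thesis
      by (simp add: distrib_left mult_ac)
  qed
  have fI: "integrable lborel ?f" by (rule Bochner_Integration.integrable_add[OF I12 I3])
  have f0: "0 \<le> ?f z" for z
    by (rule order_trans[OF _ le]) (simp add: heat_kernel_nonneg)
  have "(\<integral>\<^sup>+z. ennreal (heat_kernel h z * \<bar>w + z \<bullet> \<beta> / 2\<bar>) \<partial>lborel) \<le> (\<integral>\<^sup>+z. ennreal (?f z) \<partial>lborel)"
    by (rule nn_integral_mono, rule ennreal_leI, rule le)
  also have "\<dots> = ennreal (LINT z|lborel. ?f z)"
    by (rule nn_integral_eq_integral[OF fI]) (use f0 in simp)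
  also have "(LINT z|lborel. ?f z) = \<bar>w\<bar> + 2 * (LINT z|lborel. heat_kernel h z * D z)"
    unfolding Bochner_Integration.integral_add[OF I12 I3] Bochner_Integration.integral_add[OF I1 I2] integral_mult_right_zero O0
    by (simp add: heat_kernel_integral[OF h])
  also have "ennreal (\<bar>w\<bar> + 2 * (LINT z|lborel. heat_kernel h z * D z)) \<le> ennreal ((1 + 8 * heat_const TYPE('n) * K ^ 4 * h\<^sup>2) * \<bar>w\<bar>)"
  proof (rule ennreal_leI)
    have "\<bar>w\<bar> + 2 * (LINT z|lborel. heat_kernel h z * D z) \<le> \<bar>w\<bar> + 2 * (4 * heat_const TYPE('n) * K ^ 4 * h\<^sup>2 * \<bar>w\<bar>)"
      by (rule add_left_mono[OF mult_left_mono[OF DI(2)]]) simp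
    also have "\<dots> = (1 + 8 * heat_const TYPE('n) * K ^ 4 * h\<^sup>2) * \<bar>w\<bar>" by (simp add: distrib_right)
    finally show "\<bar>w\<bar> + 2 * (LINT z|lborel. heat_kernel h z * D z) \<le> (1 + 8 * heat_const TYPE('n) * K ^ 4 * h\<^sup>2) * \<bar>w\<bar>" .
  qed
  finally show ?thesis .
qed

lemma step_contraction:
  assumes M: "valid_domain M" and h: "h > 0"
    and v1[measurable]: "v1 \<in> borel_measurable borel" and c1: "\<And>y. \<bar>v1 y\<bar> \<le> c1" and p1: "lives_on M v1"
    and v2[measurable]: "v2 \<in> borel_measurable borel" and c2: "\<And>y. \<bar>v2 y\<bar> \<le> c2" and p2: "lives_on M v2"
  shows "dint M (\<lambda>x. ennreal \<bar>step h v1 x - step h v2 x\<bar>) \<le> ennreal (1 + 8 * heat_const TYPE('n) * K ^ 4 * h\<^sup>2) * dint M (\<lambda>x. ennreal \<bar>v1 x - v2 x\<bar>)"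
proof -
  define N where "N = (\<lambda>(z :: real ^ 'n) y. ennreal (heat_kernel h z * \<bar>(v1 y - v2 y) + z \<bullet> (F (v1 y) - F (v2 y)) / 2\<bar>))"
  have Nm: "(\<lambda>p. N (fst p) (snd p)) \<in> borel_measurable (borel \<Otimes>\<^sub>M borel)" unfolding N_def by measurable
  have "ennreal \<bar>step h v1 x - step h v2 x\<bar> \<le> (\<integral>\<^sup>+z. N z (x - z) \<partial>lborel)" for x
  proof -
    note 1 = step_integral[OF h v1 c1, of x] and 2 = step_integral[OF h v2 c2, of x]
    have I: "integrable lborel (\<lambda>z. heat_kernel h z * (v1 (x - z) + z \<bullet> F (v1 (x - z)) / 2) - heat_kernel h z * (v2 (x - z) + z \<bullet> F (v2 (x - z)) / 2))"
      by (rule Bochner_Integration.integrable_diff[OF 1(1) 2(1)])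
    have "step h v1 x - step h v2 x = (LINT z|lborel. heat_kernel h z * (v1 (x - z) + z \<bullet> F (v1 (x - z)) / 2) - heat_kernel h z * (v2 (x - z) + z \<bullet> F (v2 (x - z)) / 2))"
      unfolding 1(2) 2(2) Bochner_Integration.integral_diff[OF 1(1) 2(1)] ..
    then have "ennreal \<bar>step h v1 x - step h v2 x\<bar> \<le> (\<integral>\<^sup>+z. ennreal \<bar>heat_kernel h z * (v1 (x - z) + z \<bullet> F (v1 (x - z)) / 2) - heat_kernel h z * (v2 (x - z) + z \<bullet> F (v2 (x - z)) / 2)\<bar> \<partial>lborel)"
      using ennreal_le_norm_integral[OF I] by simp
    also have "\<dots> = (\<integral>\<^sup>+z. N z (x - z) \<partial>lborel)"
    proof (rule nn_integral_cong)
      fix z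
      have "heat_kernel h z * (v1 (x - z) + z \<bullet> F (v1 (x - z)) / 2) - heat_kernel h z * (v2 (x - z) + z \<bullet> F (v2 (x - z)) / 2)
        = heat_kernel h z * ((v1 (x - z) - v2 (x - z)) + z \<bullet> (F (v1 (x - z)) - F (v2 (x - z))) / 2)"
        by (simp add: inner_diff_right algebra_simps diff_divide_distrib)
      then show "ennreal \<bar>heat_kernel h z * (v1 (x - z) + z \<bullet> F (v1 (x - z)) / 2) - heat_kernel h z * (v2 (x - z) + z \<bullet> F (v2 (x - z)) / 2)\<bar> = N z (x - z)"
        by (simp only: N_def abs_mult abs_of_nonneg[OF heat_kernel_nonneg])
    qed
    finally show ?thesis .
  qed
  then have "dint M (\<lambda>x. ennreal \<bar>step h v1 x - step h v2 x\<bar>) \<le> dint M (\<lambda>x. \<integral>\<^sup>+z. N z (x - z) \<partial>lborel)" by (rule dint_mono)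
  also have "\<dots> = dint M (\<lambda>x. \<integral>\<^sup>+z. N z x \<partial>lborel)"
  proof (rule dint_convolution[OF M Nm])
    show "lives_on M (N z)" for z
      using lives_on_comp2[OF p1 p2, of "\<lambda>a b. ennreal (heat_kernel h z * \<bar>(a - b) + z \<bullet> (F a - F b) / 2\<bar>)"] by (simp add: N_def)
  qed
  also have "\<dots> \<le> dint M (\<lambda>x. ennreal (1 + 8 * heat_const TYPE('n) * K ^ 4 * h\<^sup>2) * ennreal \<bar>v1 x - v2 x\<bar>)"
  proof (rule dint_mono)
    fix x
    have "0 \<le> 1 + 8 * heat_const TYPE('n) * K ^ 4 * h\<^sup>2" using heat_const_pos[where 'n='n] by simp
    then show "(\<integral>\<^sup>+z. N z x \<partial>lborel) \<le> ennreal (1 + 8 * heat_const TYPE('n) * K ^ 4 * h\<^sup>2) * ennreal \<bar>v1 x - v2 x\<bar>"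
      using kernel_contraction[OF h F_lipschitz, of "v1 x" "v2 x"] by (simp add: N_def ennreal_mult)
  qed
  also have "\<dots> = ennreal (1 + 8 * heat_const TYPE('n) * K ^ 4 * h\<^sup>2) * dint M (\<lambda>x. ennreal \<bar>v1 x - v2 x\<bar>)"
    by (rule dint_cmult) measurable
  finally show ?thesis .
qed

lemma scheme_lives_on:
  assumes "lives_on M v"
  shows "lives_on M (scheme h v k)"
proof (cases M)
  case (Torus L)
  have "scheme h v k (x + axis i L) = scheme h v k x" for x i
  proof -
    have "(\<lambda>y. v (y + axis i L)) = v" using assms by (auto simp: lives_on_def Torus)
    then show ?thesis using scheme_translate[of h v "axis i L" k x] by simp
  qed
  then show ?thesis by (simp add: lives_on_def Torus)
qed (simp add: lives_on_def)

lemma scheme_contraction: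
  assumes M: "valid_domain M" and h: "h > 0"
    and v1: "v1 \<in> borel_measurable borel" and c1: "\<And>y. \<bar>v1 y\<bar> \<le> c1" and p1: "lives_on M v1"
    and v2: "v2 \<in> borel_measurable borel" and c2: "\<And>y. \<bar>v2 y\<bar> \<le> c2" and p2: "lives_on M v2"
  shows "dint M (\<lambda>x. ennreal \<bar>scheme h v1 k x - scheme h v2 k x\<bar>)
     \<le> ennreal ((1 + 8 * heat_const TYPE('n) * K ^ 4 * h\<^sup>2) ^ k) * dint M (\<lambda>x. ennreal \<bar>v1 x - v2 x\<bar>)"
proof (induction k)
  case (Suc k)
  define q where "q = 1 + 8 * heat_const TYPE('n) * K ^ 4 * h\<^sup>2"
  have q0: "q \<ge> 0" unfolding q_def using heat_const_pos[where 'n='n] by simp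
  have "dint M (\<lambda>x. ennreal \<bar>step h (scheme h v1 k) x - step h (scheme h v2 k) x\<bar>)
     \<le> ennreal q * dint M (\<lambda>x. ennreal \<bar>scheme h v1 k x - scheme h v2 k x\<bar>)"
    unfolding q_def
    by (rule step_contraction[OF M h scheme_measurable[OF v1] scheme_bounded[OF h v1 c1] scheme_lives_on[OF p1]
        scheme_measurable[OF v2] scheme_bounded[OF h v2 c2] scheme_lives_on[OF p2]])
  also have "\<dots> \<le> ennreal q * (ennreal (q ^ k) * dint M (\<lambda>x. ennreal \<bar>v1 x - v2 x\<bar>))"
    using Suc unfolding q_def by (rule mult_left_mono) simp
  finally show ?case unfolding q_def[symmetric] using q0 by (simp add: ennreal_mult mult.assoc)
qed simp

text \<open>The scheme commutes with translations, so the translate of u0 is just another datum, and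
  the contraction between two data bounds the increment. On the whole space uniform convergence does
  not control integrals, hence the passage to the limit by Fatou's lemma; the accumulated factors
  tend to 1.\<close>

lemma mild_contraction_short:
  assumes D: "valid_domain D" and M: "mild F u0 U T" and m: "\<And>y. \<bar>u0 y\<bar> \<le> m" and per: "lives_on D u0"
    and t: "0 < t" "t < T" and small: "12 * heat_const TYPE('n) * K * sqrt t \<le> 1"
  shows "dint D (\<lambda>x. ennreal \<bar>U t (x + a) - U t x\<bar>) \<le> dint D (\<lambda>x. ennreal \<bar>u0 (x + a) - u0 x\<bar>)"
proof -
  obtain C where C: "\<And>N x. N \<ge> 1 \<Longrightarrow> \<bar>U t x - scheme (t / real N) u0 N x\<bar> \<le> C * sqrt (t / real N)"
    using scheme_converges[OF M m t small] by blast
  note um = mild_measurable(4)[OF M]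
  let ?V = "\<lambda>N. scheme (t / real N) u0 N"
  let ?X = "dint D (\<lambda>x. ennreal \<bar>u0 (x + a) - u0 x\<bar>)"
  define c where "c = 8 * heat_const TYPE('n) * K ^ 4"
  have c0: "c \<ge> 0" unfolding c_def using heat_const_pos[where 'n='n] by simp
  have conv: "(\<lambda>N. ?V N x) \<longlonglongrightarrow> U t x" for x
  proof -
    have "(\<lambda>N. ?V N x - U t x) \<longlonglongrightarrow> 0"
    proof (rule Lim_null_comparison[OF _ sqrt_step_tendsto])
      show "\<forall>\<^sub>F N in sequentially. norm (?V N x - U t x) \<le> C * sqrt (t / real N)"
        using eventually_ge_at_top[of 1] by eventually_elim (use C in \<open>simp add: abs_minus_commute\<close>)
    qed
    then show ?thesis by (rule LIM_zero_cancel)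
  qed
  have Vm: "?V N \<in> borel_measurable borel" for N by (rule scheme_measurable[OF um])
  have Vm2: "(\<lambda>x. ?V N (x + a)) \<in> borel_measurable borel" for N
    using measurable_compose[OF _ Vm[of N], of "\<lambda>x. x + a" borel] by simp
  have lim: "(\<lambda>N. ennreal \<bar>?V N (x + a) - ?V N x\<bar> * indicator (cell D) x) \<longlonglongrightarrow> ennreal \<bar>U t (x + a) - U t x\<bar> * indicator (cell D) x" for x
  proof -
    have "(\<lambda>N. ennreal \<bar>?V N (x + a) - ?V N x\<bar>) \<longlonglongrightarrow> ennreal \<bar>U t (x + a) - U t x\<bar>"
      by (intro tendsto_ennrealI tendsto_rabs tendsto_diff conv)
    then show ?thesis by (cases "x \<in> cell D") simp_all
  qed
  have "dint D (\<lambda>x. ennreal \<bar>U t (x + a) - U t x\<bar>) = (\<integral>\<^sup>+x. liminf (\<lambda>N. ennreal \<bar>?V N (x + a) - ?V N x\<bar> * indicator (cell D) x) \<partial>lborel)"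
    unfolding dint_def using lim_imp_Liminf[OF _ lim] by simp
  also have "\<dots> \<le> liminf (\<lambda>N. \<integral>\<^sup>+x. ennreal \<bar>?V N (x + a) - ?V N x\<bar> * indicator (cell D) x \<partial>lborel)"
  proof (rule nn_integral_liminf)
    fix N
    note [measurable] = Vm[of N] Vm2[of N]
    show "(\<lambda>x. ennreal \<bar>?V N (x + a) - ?V N x\<bar> * indicator (cell D) x) \<in> borel_measurable lborel" by measurable
  qed
  also have "\<dots> \<le> liminf (\<lambda>N. ennreal (exp (c * t\<^sup>2 / real N)) * ?X)"
  proof (rule Liminf_mono)
    show "\<forall>\<^sub>F N in sequentially. (\<integral>\<^sup>+x. ennreal \<bar>?V N (x + a) - ?V N x\<bar> * indicator (cell D) x \<partial>lborel) \<le> ennreal (exp (c * t\<^sup>2 / real N)) * ?X"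
      using eventually_ge_at_top[of 1]
    proof eventually_elim
      case (elim N)
      have h: "t / real N > 0" using t elim by simp
      have um': "(\<lambda>y. u0 (y + a)) \<in> borel_measurable borel"
        using measurable_compose[OF _ um, of "\<lambda>x. x + a" borel] by simp
      have "dint D (\<lambda>x. ennreal \<bar>scheme (t / real N) (\<lambda>y. u0 (y + a)) N x - ?V N x\<bar>) \<le> ennreal ((1 + 8 * heat_const TYPE('n) * K ^ 4 * (t / real N)\<^sup>2) ^ N) * ?X"
        by (rule scheme_contraction[OF D h um' m lives_on_shift[OF per] um m per])
      also have "\<dots> \<le> ennreal (exp (c * t\<^sup>2 / real N)) * ?X"
        unfolding c_def[symmetric] by (rule mult_right_mono[OF ennreal_leI[OF growth_factor_bound[OF t(1) c0 elim]]]) simp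
      finally show ?case unfolding scheme_translate dint_def .
    qed
  qed
  also have "\<dots> = 1 * ?X"
  proof (rule lim_imp_Liminf)
    have "(\<lambda>N. ennreal (exp (c * t\<^sup>2 / real N))) \<longlonglongrightarrow> ennreal 1"
      by (rule tendsto_ennrealI[OF growth_factor_tendsto])
    then show "(\<lambda>N. ennreal (exp (c * t\<^sup>2 / real N)) * ?X) \<longlonglongrightarrow> 1 * ?X"
      by (intro tendsto_mult_ennreal tendsto_const) auto
  qed simp
  finally show ?thesis by simp
qed

text \<open>The constant 1 is preserved under composition of windows. Each window starts from a
  state that is again bounded by m, thanks to the maximum principle.\<close>

lemma mild_contraction:
  assumes D: "valid_domain D" and M: "mild F u0 U T" and m: "\<And>y. \<bar>u0 y\<bar> \<le> m" and per: "lives_on D u0"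
    and per': "\<And>s. 0 < s \<Longrightarrow> s < T \<Longrightarrow> lives_on D (U s)" and t: "0 < t" "t < T"
  shows "dint D (\<lambda>x. ennreal \<bar>U t (x + a) - U t x\<bar>) \<le> dint D (\<lambda>x. ennreal \<bar>u0 (x + a) - u0 x\<bar>)"
proof (rule restart_induct[OF _ _ t])
  fix t assume t: "0 < t" "t < T" "t \<le> \<tau>"
  show "dint D (\<lambda>x. ennreal \<bar>U t (x + a) - U t x\<bar>) \<le> dint D (\<lambda>x. ennreal \<bar>u0 (x + a) - u0 x\<bar>)"
    by (rule mild_contraction_short[OF D M m per t(1,2) small_\<tau>[OF t(3)]])
next
  fix t assume t: "0 < t" "t + \<tau> < T"
    and IH: "dint D (\<lambda>x. ennreal \<bar>U t (x + a) - U t x\<bar>) \<le> dint D (\<lambda>x. ennreal \<bar>u0 (x + a) - u0 x\<bar>)"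
  have tT: "t < T" "\<tau> < T - t" using t \<tau>_pos by linarith+
  have "dint D (\<lambda>x. ennreal \<bar>U (t + \<tau>) (x + a) - U (t + \<tau>) x\<bar>) \<le> dint D (\<lambda>x. ennreal \<bar>U t (x + a) - U t x\<bar>)"
    by (rule mild_contraction_short[OF D mild_restart[OF M m t(1) tT(1)] mild_sup_bound[OF M m t(1) tT(1)] per'[OF t(1) tT(1)]
          \<tau>_pos tT(2) small_\<tau>[OF order_refl]])
  then show "dint D (\<lambda>x. ennreal \<bar>U (t + \<tau>) (x + a) - U (t + \<tau>) x\<bar>) \<le> dint D (\<lambda>x. ennreal \<bar>u0 (x + a) - u0 x\<bar>)"
    using IH by (rule order_trans)
qed

text \<open>By (p - q)^2 \<le> 2 * p^2 + 2 * q^2 the datum contributes 2 * X2 and the flux at most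
  half of the supremum; absorbing the latter gives 4 * X2.\<close>

lemma mild_square_short:
  assumes D: "valid_domain D" and M: "mild F u0 U T" and m: "\<And>y. \<bar>u0 y\<bar> \<le> m" and per: "lives_on D u0"
    and per': "\<And>s. 0 < s \<Longrightarrow> s < T \<Longrightarrow> lives_on D (U s)" and t: "0 < t" "t < T" "t \<le> \<tau>"
    and fin: "dint D (\<lambda>x. ennreal \<bar>u0 (x + a) - u0 x\<bar>) \<le> ennreal X1"
    and sq: "dint D (\<lambda>x. ennreal ((u0 (x + a) - u0 x)\<^sup>2)) \<le> ennreal X2" "X2 \<ge> 0"
  shows "dint D (\<lambda>x. ennreal ((U t (x + a) - U t x)\<^sup>2)) \<le> ennreal (4 * X2)"
proof -
  have m0: "m \<ge> 0" using m[of 0] by linarith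
  have H0: "heat_const TYPE('n) > 0" by (rule heat_const_pos)
  note um[measurable] = mild_measurable(4)[OF M]
  let ?w = "\<lambda>s x. U s (x + a) - U s x"
  define \<phi> where "\<phi> = (\<lambda>s. enn2real (dint D (\<lambda>x. ennreal ((?w s x)\<^sup>2))))"
  note [measurable] = mild_measurable(3)[OF M]
  \<comment> \<open>The finiteness required for absorption: a square is at most 2 * m times the
    modulus, whose integral is controlled by the contraction.\<close>
  have ap: "dint D (\<lambda>x. ennreal ((?w s x)\<^sup>2)) \<le> ennreal (2 * m) * ennreal X1" if s: "0 < s" "s < T" for s
  proof -
    have "dint D (\<lambda>x. ennreal ((?w s x)\<^sup>2)) \<le> dint D (\<lambda>x. ennreal (2 * m) * ennreal \<bar>?w s x\<bar>)"
    proof (rule dint_mono)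
      fix x
      have "\<bar>?w s x\<bar> \<le> 2 * m" using mild_sup_bound[OF M m s, of x] mild_sup_bound[OF M m s, of "x + a"] by linarith
      then have "\<bar>?w s x\<bar> * \<bar>?w s x\<bar> \<le> 2 * m * \<bar>?w s x\<bar>" by (rule mult_right_mono) simp
      then show "ennreal ((?w s x)\<^sup>2) \<le> ennreal (2 * m) * ennreal \<bar>?w s x\<bar>"
        using m0 by (simp add: ennreal_mult[symmetric] power2_eq_square ennreal_leI)
    qed
    also have "\<dots> = ennreal (2 * m) * dint D (\<lambda>x. ennreal \<bar>?w s x\<bar>)"
      by (rule dint_cmult) measurable
    also have "\<dots> \<le> ennreal (2 * m) * ennreal X1"
      by (rule mult_left_mono[OF order_trans[OF mild_contraction[OF D M m per per' s] fin]]) simp_all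
    finally show ?thesis .
  qed
  have apf: "dint D (\<lambda>x. ennreal ((?w s x)\<^sup>2)) < \<infinity>" if s: "0 < s" "s < T" for s
    using ap[OF s] by (simp add: ennreal_mult_less_top le_less_trans)
  have \<phi>e: "dint D (\<lambda>x. ennreal ((?w s x)\<^sup>2)) = ennreal (\<phi> s)" if s: "0 < s" "s < T" for s
    unfolding \<phi>_def using apf[OF s] by simp
  have "\<phi> t \<le> 2 * (2 * X2)"
  proof (rule absorb_half[where S = "{0<..t}" and \<phi> = \<phi> and x = t])
    show "t \<in> {0<..t}" using t by simp
    show "0 \<le> 2 * X2" using sq by simp
    show "\<phi> s \<le> enn2real (ennreal (2 * m) * ennreal X1)" if "s \<in> {0<..t}" for s
      unfolding \<phi>_def by (rule enn2real_mono[OF ap]) (use that t in \<open>auto simp: ennreal_mult_less_top\<close>)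
    fix b s assume b0: "0 \<le> b" and b: "\<And>r. r \<in> {0<..t} \<Longrightarrow> \<phi> r \<le> b" and s': "s \<in> {0<..t}"
    then have s: "0 < s" "s < T" "s \<le> \<tau>" using t by auto
    let ?A = "heat_op s (\<lambda>y. u0 (y + a) - u0 y)" and ?B = "duhamel s (\<lambda>r y. F (U r (y + a)) - F (U r y))"
    have Am: "?A \<in> borel_measurable borel" by measurable
    have gm: "(\<lambda>p. F (U (fst p) (snd p + a)) - F (U (fst p) (snd p))) \<in> borel_measurable (borel \<Otimes>\<^sub>M borel)"
      by (intro borel_measurable_diff mild_measurable[OF M])
    have wm2: "(\<lambda>p. ?w (fst p) (snd p)) \<in> borel_measurable (borel \<Otimes>\<^sub>M borel)"
    proof -
      note [measurable (raw)] = joint_measurable_compose[OF mild_measurable(1)[OF M]]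
      show ?thesis by measurable
    qed
    have Bm: "?B \<in> borel_measurable borel"
      by (rule duhamel_measurable[OF gm]) measurable
    have A: "dint D (\<lambda>x. ennreal ((?A x)\<^sup>2)) \<le> ennreal X2"
    proof (rule order_trans[OF dint_heat_op_square[OF D _ s(1)] sq(1)])
      show "lives_on D (\<lambda>y. u0 (y + a) - u0 y)" by (rule lives_on_comp2[OF lives_on_shift[OF per] per])
      show "\<bar>u0 (y + a) - u0 y\<bar> \<le> m + m" for y by (rule order_trans[OF abs_triangle_ineq4 add_mono[OF m m]])
    qed measurable
    have B: "dint D (\<lambda>x. ennreal ((?B x)\<^sup>2)) \<le> ennreal ((2 * heat_const TYPE('n) * sqrt s * K)\<^sup>2 * b)"
    proof (rule dint_duhamel_square[OF D _ s(1) _ gm wm2])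
      fix r y assume r: "0 < r" "r < s"
      then have rT: "0 < r" "r < T" using s by auto
      show "lives_on D (?w r)" by (rule lives_on_comp2[OF lives_on_shift[OF per'[OF rT]] per'[OF rT]])
      show "dint D (\<lambda>x. ennreal ((?w r x)\<^sup>2)) \<le> ennreal b"
        unfolding \<phi>e[OF rT] by (rule ennreal_leI[OF b]) (use r s' in auto)
    next
      show "b \<ge> 0" by (rule b0)
      show "norm (F (U r (y + a)) - F (U r y)) \<le> B + B" for r y
        by (rule order_trans[OF norm_triangle_ineq4 add_mono[OF F_bounded F_bounded]])
      show "norm (F (U r (y + a)) - F (U r y)) \<le> K * \<bar>?w r y\<bar>" for r y by (rule F_lipschitz)
    qed (use K_pos in simp)
    \<comment> \<open>Within a window of length \<tau> the factor of the Duhamel estimate is at most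
      (1 / 6)^2, and 2 / 36 lies well below 1 / 2.\<close>
    have "12 * heat_const TYPE('n) * K * sqrt s \<le> 1" by (rule small_\<tau>[OF s(3)])
    then have "2 * heat_const TYPE('n) * sqrt s * K \<le> 1 / 6" by (simp add: mult_ac)
    then have "(2 * heat_const TYPE('n) * sqrt s * K)\<^sup>2 \<le> (1 / 6)\<^sup>2" by (rule power_mono) (use H0 K_pos s in simp)
    then have "(2 * heat_const TYPE('n) * sqrt s * K)\<^sup>2 * b \<le> (1 / 6)\<^sup>2 * b" by (rule mult_right_mono[OF _ b0])
    then have q: "2 * ((2 * heat_const TYPE('n) * sqrt s * K)\<^sup>2 * b) \<le> b / 2" using b0 by (simp add: power2_eq_square)
    have "dint D (\<lambda>x. ennreal ((?w s x)\<^sup>2)) \<le> dint D (\<lambda>x. 2 * ennreal ((?A x)\<^sup>2) + 2 * ennreal ((?B x)\<^sup>2))"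
    proof (rule dint_mono)
      fix x
      have "?w s x = ?A x - ?B x" by (rule mild_translate_diff[OF M m s(1,2)])
      moreover have "(p - q)\<^sup>2 \<le> 2 * p\<^sup>2 + 2 * q\<^sup>2" for p q :: real
        using zero_le_power2[of "p + q"] by (simp add: power2_sum power2_diff)
      ultimately have "(?w s x)\<^sup>2 \<le> 2 * (?A x)\<^sup>2 + 2 * (?B x)\<^sup>2" by simp
      then have "ennreal ((?w s x)\<^sup>2) \<le> ennreal (2 * (?A x)\<^sup>2 + 2 * (?B x)\<^sup>2)" by (rule ennreal_leI)
      also have "\<dots> = 2 * ennreal ((?A x)\<^sup>2) + 2 * ennreal ((?B x)\<^sup>2)" by (simp add: ennreal_plus ennreal_mult)
      finally show "ennreal ((?w s x)\<^sup>2) \<le> 2 * ennreal ((?A x)\<^sup>2) + 2 * ennreal ((?B x)\<^sup>2)" .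
    qed
    also have "\<dots> = 2 * dint D (\<lambda>x. ennreal ((?A x)\<^sup>2)) + 2 * dint D (\<lambda>x. ennreal ((?B x)\<^sup>2))"
      using Am Bm by (subst dint_add) (simp_all add: dint_cmult)
    also have "\<dots> \<le> 2 * ennreal X2 + 2 * ennreal ((2 * heat_const TYPE('n) * sqrt s * K)\<^sup>2 * b)"
      by (intro add_mono mult_left_mono A B) auto
    also have "\<dots> = ennreal (2 * X2 + 2 * ((2 * heat_const TYPE('n) * sqrt s * K)\<^sup>2 * b))"
      using sq(2) b0 by (simp add: ennreal_plus ennreal_mult)
    also have "\<dots> \<le> ennreal (2 * X2 + b / 2)" by (rule ennreal_leI) (use q in simp)
    finally have "ennreal (\<phi> s) \<le> ennreal (2 * X2 + b / 2)" unfolding \<phi>e[OF s(1,2)] .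
    moreover have "0 \<le> 2 * X2 + b / 2" using sq(2) b0 by simp
    ultimately show "\<phi> s \<le> 2 * X2 + b / 2" using ennreal_le_iff by blast
  qed
  then show ?thesis unfolding \<phi>e[OF t(1,2)] by (intro ennreal_leI) simp
qed

text \<open>At late times the two factors of the square are treated differently, one by the
  Lipschitz bound of the last window and the other by the contraction from time 0. Only the first
  brings in K, so the bound is linear in K.\<close>

lemma mild_square_bound:
  assumes D: "valid_domain D" and M: "mild F u0 U T" and m: "\<And>y. \<bar>u0 y\<bar> \<le> m" and per: "lives_on D u0"
    and per': "\<And>s. 0 < s \<Longrightarrow> s < T \<Longrightarrow> lives_on D (U s)" and t: "0 < t" "t < T"
    and fin: "dint D (\<lambda>x. ennreal \<bar>u0 (x + a) - u0 x\<bar>) \<le> ennreal X1" "X1 \<ge> 0"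
    and sq: "dint D (\<lambda>x. ennreal ((u0 (x + a) - u0 x)\<^sup>2)) \<le> ennreal X2" "X2 \<ge> 0"
  shows "dint D (\<lambda>x. ennreal ((U t (x + a) - U t x)\<^sup>2)) \<le> ennreal (4 * X2 + 24 * heat_const TYPE('n) * heat_const TYPE('n) * K * m * norm a * X1)"
proof (cases "t \<le> \<tau>")
  case True
  have m0: "m \<ge> 0" using m[of 0] by linarith
  have "0 \<le> 24 * heat_const TYPE('n) * heat_const TYPE('n) * K * m * norm a * X1" using m0 K_pos heat_const_pos[where 'n='n] fin(2) by simp
  then show ?thesis
    by (intro order_trans[OF mild_square_short[OF D M m per per' t True fin(1) sq] ennreal_leI]) simp_all
next
  case False
  have m0: "m \<ge> 0" using m[of 0] by linarith
  have H0: "heat_const TYPE('n) > 0" by (rule heat_const_pos)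
  define r where "r = t - \<tau>"
  have r: "0 < r" "r < T" "r + \<tau> = t" "\<tau> < T - r" using False t \<tau>_pos by (auto simp: r_def)
  let ?w = "\<lambda>x. U t (x + a) - U t x"
  \<comment> \<open>The Lipschitz constant 2 H m / sqrt \<tau> of the last window times norm a, with
    H the constant \<open>heat_const\<close> and 1 / sqrt \<tau> = 12 H K; hence the 24.\<close>
  define L where "L = 24 * heat_const TYPE('n) * heat_const TYPE('n) * K * m * norm a"
  have L0: "L \<ge> 0" unfolding L_def using H0 K_pos m0 by simp
  have wb: "\<bar>?w x\<bar> \<le> L" for x
  proof -
    have "\<bar>U (r + \<tau>) (x + a) - U (r + \<tau>) x\<bar> \<le> 2 * heat_const TYPE('n) * m / sqrt \<tau> * norm (x + a - x)"
      by (rule mild_lipschitz[OF mild_restart[OF M m r(1,2)] mild_sup_bound[OF M m r(1,2)] \<tau>_pos r(4) small_\<tau>[OF order_refl]])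
    also have "\<dots> = L" unfolding sqrt_\<tau> L_def by (simp add: mult_ac)
    finally show ?thesis unfolding r(3) .
  qed
  note [measurable] = mild_measurable(3)[OF M, of t]
  have "dint D (\<lambda>x. ennreal ((?w x)\<^sup>2)) \<le> dint D (\<lambda>x. ennreal L * ennreal \<bar>?w x\<bar>)"
  proof (rule dint_mono)
    fix x
    have "\<bar>?w x\<bar> * \<bar>?w x\<bar> \<le> L * \<bar>?w x\<bar>" by (rule mult_right_mono[OF wb]) simp
    then show "ennreal ((?w x)\<^sup>2) \<le> ennreal L * ennreal \<bar>?w x\<bar>"
      using L0 by (simp add: ennreal_mult[symmetric] power2_eq_square ennreal_leI)
  qed
  also have "\<dots> = ennreal L * dint D (\<lambda>x. ennreal \<bar>?w x\<bar>)" by (rule dint_cmult) measurable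
  also have "\<dots> \<le> ennreal L * ennreal X1"
    by (rule mult_left_mono[OF order_trans[OF mild_contraction[OF D M m per per' t] fin(1)]]) simp_all
  also have "\<dots> = ennreal (L * X1)" using L0 fin(2) by (simp add: ennreal_mult)
  also have "\<dots> \<le> ennreal (4 * X2 + 24 * heat_const TYPE('n) * heat_const TYPE('n) * K * m * norm a * X1)"
    unfolding L_def by (rule ennreal_leI) (use sq(2) in simp)
  finally show ?thesis .
qed

end

section \<open>Spatial derivatives of mild solutions\<close>

text \<open>Quotients along the fixed steps 1 / (k + 1). A limit along a sequence is measurable
  automatically, and it suffices for weak derivatives.\<close>

definition dq :: "('a::real_normed_vector \<Rightarrow> real) \<Rightarrow> 'a \<Rightarrow> nat \<Rightarrow> 'a \<Rightarrow> real" where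
  "dq f v k x = (f (x + (1 / real (Suc k)) *\<^sub>R v) - f x) * real (Suc k)"

lemma inverse_Suc_filterlim: "filterlim (\<lambda>k. 1 / real (Suc k)) (at 0) sequentially"
proof (rule filterlim_atI)
  show "(\<lambda>k. 1 / real (Suc k)) \<longlonglongrightarrow> 0" using LIMSEQ_inverse_real_of_nat by (simp add: inverse_eq_divide)
qed simp

lemma dq_tendsto:
  assumes "(f has_derivative f') (at x)"
  shows "(\<lambda>k. dq f v k x) \<longlonglongrightarrow> f' v"
proof -
  have l: "((\<lambda>h::real. x + h *\<^sub>R v) has_derivative (\<lambda>h. h *\<^sub>R v)) (at 0)"
    by (auto intro!: derivative_eq_intros)
  have "((\<lambda>h. f (x + h *\<^sub>R v)) has_derivative (\<lambda>h. f' (h *\<^sub>R v))) (at 0)"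
    by (rule has_derivative_compose[OF l]) (use assms in simp)
  moreover have "(\<lambda>h. f' (h *\<^sub>R v)) = (\<lambda>h. f' v * h)"
    using linear_scale[OF has_derivative_linear[OF assms]] by (auto simp: mult.commute)
  ultimately have "((\<lambda>h. f (x + h *\<^sub>R v)) has_field_derivative f' v) (at 0)"
    by (simp add: has_field_derivative_def)
  then have "(\<lambda>h. (f (x + (0 + h) *\<^sub>R v) - f (x + 0 *\<^sub>R v)) / h) \<midarrow>0\<rightarrow> f' v"
    by (simp only: DERIV_def)
  from filterlim_compose[OF this inverse_Suc_filterlim] show ?thesis
    by (simp add: dq_def)
qed

text \<open>Half of the time is spent on the divergence, which leaves a bounded function, and the
  other half on smoothing the latter.\<close>

lemma grad_op_dq_convergent:
  fixes g :: "real ^ 'n::finite \<Rightarrow> real ^ 'n"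
  assumes s: "s > 0" and g[measurable]: "g \<in> borel_measurable borel" and c: "\<And>y. norm (g y) \<le> c"
  shows "convergent (\<lambda>k. dq (grad_op s g) v k x)"
proof -
  have s2: "s / 2 > 0" using s by simp
  have eq: "grad_op s g = heat_op (s / 2) (grad_op (s / 2) g)"
    using heat_grad_op[OF s2 s2 g c] by (intro ext) simp
  have m: "grad_op (s / 2) g \<in> borel_measurable borel" by measurable
  have b: "norm (grad_op (s / 2) g y) \<le> heat_const TYPE('n) / sqrt (s / 2) * c" for y
    using grad_op_bound[OF s2 g c, of y] by simp
  show ?thesis unfolding eq
    by (rule convergentI, rule dq_tendsto, rule heat_op_has_derivative(1)[OF s2 m b])
qed

lemma grad_op_increment:
  fixes g :: "real ^ 'n::finite \<Rightarrow> real ^ 'n"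
  assumes s: "s > 0" and g[measurable]: "g \<in> borel_measurable borel" and c: "\<And>y. norm (g y) \<le> c"
    and d: "\<And>y. norm (g (y + a) - g y) \<le> d"
  shows "\<bar>grad_op s g (x + a) - grad_op s g x\<bar> \<le> heat_const TYPE('n) / sqrt s * d"
proof -
  have "grad_op s g (x + a) - grad_op s g x = grad_op s (\<lambda>y. g (y + a) - g y) x"
    unfolding grad_op_translate[symmetric] by (rule grad_op_diff[OF s, symmetric]) (use c in auto)
  then show ?thesis using grad_op_bound[OF s, of "\<lambda>y. g (y + a) - g y" d x] d by simp
qed

context flux
begin

text \<open>Dominated convergence in Duhamel's formula. The Lipschitz bound of the solution lets the
  increment fall on the flux, so the quotients are dominated by a multiple of 1 / (sqrt (t - s) *
  sqrt s); a second derivative of the kernel would cost the non-integrable 1 / (t - s).\<close>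

lemma mild_dq_convergent_short:
  assumes M: "mild F u0 U T" and m: "\<And>y. \<bar>u0 y\<bar> \<le> m" and t: "0 < t" "t < T" "t \<le> \<tau>"
  shows "convergent (\<lambda>k. dq (U t) v k x)"
proof -
  have m0: "m \<ge> 0" using m[of 0] by linarith
  have H0: "heat_const TYPE('n) > 0" by (rule heat_const_pos)
  note um = mild_measurable(4)[OF M] and Fm = mild_measurable(2)[OF M]
  let ?\<Phi> = "\<lambda>s y. F (U s y)"
  define f where "f = (\<lambda>k s. indicat_real {0<..<t} s * dq (grad_op (t - s) (?\<Phi> s)) v k x)"
  define g where "g = (\<lambda>s. lim (\<lambda>k. f k s))"
  have conv: "(\<lambda>k. f k s) \<longlonglongrightarrow> g s" for s
  proof -
    have "convergent (\<lambda>k. f k s)"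
    proof (cases "0 < s \<and> s < t")
      case True
      have "convergent (\<lambda>k. dq (grad_op (t - s) (?\<Phi> s)) v k x)"
        by (rule grad_op_dq_convergent[OF _ section_measurable[OF Fm] F_bounded]) (use True in simp)
      then show ?thesis using True by (simp add: f_def)
    qed (auto simp: f_def convergent_const)
    then show ?thesis unfolding g_def by (rule convergent_LIMSEQ_iff[THEN iffD1])
  qed
  have I: "integrable lborel (\<lambda>s. indicator {0<..<t} s * grad_op (t - s) (?\<Phi> s) y)" for y
    by (rule duhamel_bounded(1)[OF t(1) Fm F_bounded])
  have fe: "f k s = (indicator {0<..<t} s * grad_op (t - s) (?\<Phi> s) (x + (1 / real (Suc k)) *\<^sub>R v) - indicator {0<..<t} s * grad_op (t - s) (?\<Phi> s) x) * real (Suc k)" for k s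
    by (simp add: f_def dq_def algebra_simps)
  have fI: "integrable lborel (f k)" for k
    unfolding fe by (intro integrable_mult_left Bochner_Integration.integrable_diff I)
  have fd: "dq (duhamel t ?\<Phi>) v k x = integral\<^sup>L lborel (f k)" for k
    unfolding fe dq_def duhamel_def integral_mult_left_zero Bochner_Integration.integral_diff[OF I I] ..
  let ?b = "2 * K * heat_const TYPE('n) * m * norm v"
  let ?w = "\<lambda>s. heat_const TYPE('n) * (indicator {0<..<t} s * (1 / sqrt (t - s) * (0 + ?b / sqrt s)))"
  have b0: "?b \<ge> 0" using K_pos H0 m0 by simp
  have wI: "integrable lborel ?w" by (rule integrable_mult_right, rule duhamel_weight(1)[OF t(1) order_refl b0])
  have fb: "norm (f k s) \<le> ?w s" for k s
  proof (cases "0 < s \<and> s < t")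
    case True
    then have sT: "s < T" "s \<le> \<tau>" using t by auto
    let ?a = "(1 / real (Suc k)) *\<^sub>R v"
    have "norm (F (U s (y + ?a)) - F (U s y)) \<le> K * (2 * heat_const TYPE('n) * m / sqrt s * norm ?a)" for y
    proof -
      have "K * \<bar>U s (y + ?a) - U s y\<bar> \<le> K * (2 * heat_const TYPE('n) * m / sqrt s * norm (y + ?a - y))"
        by (rule mult_left_mono[OF mild_lipschitz[OF M m _ sT(1) small_\<tau>[OF sT(2)]]]) (use True K_pos in auto)
      then show ?thesis using F_lipschitz[of "U s (y + ?a)" "U s y"] by simp
    qed
    then have "\<bar>grad_op (t - s) (?\<Phi> s) (x + ?a) - grad_op (t - s) (?\<Phi> s) x\<bar> \<le> heat_const TYPE('n) / sqrt (t - s) * (K * (2 * heat_const TYPE('n) * m / sqrt s * norm ?a))"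
      by (intro grad_op_increment[OF _ section_measurable[OF Fm] F_bounded]) (use True in auto)
    then have "\<bar>dq (grad_op (t - s) (?\<Phi> s)) v k x\<bar> \<le> (heat_const TYPE('n) / sqrt (t - s) * (K * (2 * heat_const TYPE('n) * m / sqrt s * norm ?a))) * real (Suc k)"
      unfolding dq_def abs_mult abs_of_nat by (rule mult_right_mono) simp
    also have "\<dots> = heat_const TYPE('n) / sqrt (t - s) * (K * (2 * heat_const TYPE('n) * m / sqrt s * (norm ?a * real (Suc k))))" by (simp only: mult.assoc)
    also have "norm ?a * real (Suc k) = norm v" by (simp del: of_nat_Suc)
    also have "heat_const TYPE('n) / sqrt (t - s) * (K * (2 * heat_const TYPE('n) * m / sqrt s * norm v)) = heat_const TYPE('n) * (1 / sqrt (t - s) * (0 + ?b / sqrt s))" by simp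
    finally show ?thesis using True by (simp add: f_def)
  qed (simp add: f_def)
  have "(\<lambda>k. integral\<^sup>L lborel (f k)) \<longlonglongrightarrow> integral\<^sup>L lborel g"
  proof (rule integral_dominated_convergence[where w = ?w])
    show fm: "f k \<in> borel_measurable lborel" for k using fI[of k] by (rule borel_measurable_integrable)
    show "g \<in> borel_measurable lborel" by (rule borel_measurable_LIMSEQ_real[OF conv fm])
    show "AE s in lborel. (\<lambda>k. f k s) \<longlonglongrightarrow> g s" using conv by simp
    show "AE s in lborel. norm (f k s) \<le> ?w s" for k using fb by (intro AE_I2)
  qed (rule wI)
  moreover have "(\<lambda>k. dq (heat_op t u0) v k x) \<longlonglongrightarrow> (LINT z|lborel. (heat_grad t z \<bullet> v) *\<^sub>R u0 (x - z))"
    by (rule dq_tendsto, rule heat_op_has_derivative(1)[OF t(1) um]) (use m in simp)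
  ultimately have "(\<lambda>k. dq (heat_op t u0) v k x - integral\<^sup>L lborel (f k)) \<longlonglongrightarrow> (LINT z|lborel. (heat_grad t z \<bullet> v) *\<^sub>R u0 (x - z)) - integral\<^sup>L lborel g"
    by (intro tendsto_diff)
  moreover have "dq (U t) v k x = dq (heat_op t u0) v k x - integral\<^sup>L lborel (f k)" for k
    unfolding fd[symmetric] dq_def mild_eq[OF M t(1,2)] by (simp add: algebra_simps)
  ultimately show ?thesis by (simp only: convergentI)
qed

text \<open>Any positive time lies within a short window after some restart. The window is the
  smaller of t / 2 and \<tau>, so that the restart itself happens at a positive time.\<close>

lemma mild_late_restart:
  assumes M: "mild F u0 U T" and m: "\<And>y. \<bar>u0 y\<bar> \<le> m" and t: "0 < t" "t < T"
  obtains r s where "r + s = t" "0 < s" "s < T - r" "s \<le> \<tau>"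
    "mild F (U r) (\<lambda>s. U (r + s)) (T - r)" "\<And>y. \<bar>U r y\<bar> \<le> m"
proof
  define s where "s = min (t / 2) \<tau>"
  have s: "0 < s" "s < t" "s \<le> \<tau>" using t \<tau>_pos by (auto simp: s_def)
  have r: "0 < t - s" "t - s < T" using s t by linarith+
  show "mild F (U (t - s)) (\<lambda>s'. U (t - s + s')) (T - (t - s))" by (rule mild_restart[OF M m r])
  show "\<bar>U (t - s) y\<bar> \<le> m" for y by (rule mild_sup_bound[OF M m r])
  show "t - s + s = t" "0 < s" "s < T - (t - s)" "s \<le> \<tau>" using s t by auto
qed

lemma mild_dq_convergent:
  assumes M: "mild F u0 U T" and m: "\<And>y. \<bar>u0 y\<bar> \<le> m" and t: "0 < t" "t < T"
  shows "convergent (\<lambda>k. dq (U t) v k x)"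
proof -
  obtain r s where *: "r + s = t" "0 < s" "s < T - r" "s \<le> \<tau>"
    "mild F (U r) (\<lambda>s. U (r + s)) (T - r)" "\<And>y. \<bar>U r y\<bar> \<le> m"
    using mild_late_restart[OF M m t] by blast
  show ?thesis using mild_dq_convergent_short[OF *(5,6,2,3,4), of v x] unfolding *(1) .
qed

lemma mild_lipschitz_late:
  assumes M: "mild F u0 U T" and m: "\<And>y. \<bar>u0 y\<bar> \<le> m" and t: "0 < t" "t < T"
  obtains L where "L \<ge> 0" "\<And>x y. \<bar>U t x - U t y\<bar> \<le> L * norm (x - y)"
proof -
  have m0: "m \<ge> 0" using m[of 0] by linarith
  obtain r s where *: "r + s = t" "0 < s" "s < T - r" "s \<le> \<tau>"
    "mild F (U r) (\<lambda>s. U (r + s)) (T - r)" "\<And>y. \<bar>U r y\<bar> \<le> m"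
    using mild_late_restart[OF M m t] by blast
  show ?thesis
  proof (rule that)
    show "\<bar>U t x - U t y\<bar> \<le> 2 * heat_const TYPE('n) * m / sqrt s * norm (x - y)" for x y
      using mild_lipschitz[OF *(5,6,2,3) small_\<tau>[OF *(4)], of x y] unfolding *(1) .
    show "0 \<le> 2 * heat_const TYPE('n) * m / sqrt s" using heat_const_pos[where 'n='n] m0 *(2) by simp
  qed
qed

end

section \<open>Test functions and weak gradients\<close>

text \<open>The signed version of \<open>dint_shift\<close>, through positive and negative
  parts.\<close>

lemma dom_integral_shift:
  fixes g :: "real ^ 'n::finite \<Rightarrow> real"
  assumes M: "valid_domain M" and g[measurable]: "g \<in> borel_measurable borel" and per: "lives_on M g"
    and I: "integrable lborel (\<lambda>x. indicator (cell M) x * g x)"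
  shows "integrable lborel (\<lambda>x. indicator (cell M) x * g (x + a))"
    and "(LINT x|lborel. indicator (cell M) x * g (x + a)) = (LINT x|lborel. indicator (cell M) x * g x)"
proof -
  have e: "ennreal (indicator (cell M) x * r) = ennreal r * indicator (cell M) x" for x :: "real ^ 'n" and r
    by (auto simp: indicator_def)
  have n: "norm (indicator (cell M) x * r) = indicator (cell M) x * \<bar>r\<bar>" for x :: "real ^ 'n" and r :: real
    by (auto simp: indicator_def)
  have s1: "dint M (\<lambda>x. ennreal (\<phi> (g (x + a)))) = dint M (\<lambda>x. ennreal (\<phi> (g x)))" if [measurable]: "\<phi> \<in> borel_measurable borel" for \<phi>
    by (rule dint_shift[OF M _ lives_on_comp[OF per]]) measurable
  have "(\<integral>\<^sup>+x. ennreal (norm (indicator (cell M) x * g (x + a))) \<partial>lborel) = dint M (\<lambda>x. ennreal \<bar>g (x + a)\<bar>)"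
    unfolding n e dint_def ..
  also have "\<dots> = dint M (\<lambda>x. ennreal \<bar>g x\<bar>)" by (rule s1) measurable
  also have "\<dots> = (\<integral>\<^sup>+x. ennreal (norm (indicator (cell M) x * g x)) \<partial>lborel)"
    unfolding n e dint_def ..
  also have "\<dots> < \<infinity>" using I unfolding integrable_iff_bounded by blast
  finally show J: "integrable lborel (\<lambda>x. indicator (cell M) x * g (x + a))"
    unfolding integrable_iff_bounded by simp
  have "(\<integral>\<^sup>+x. ennreal (indicator (cell M) x * g (x + a)) \<partial>lborel) = (\<integral>\<^sup>+x. ennreal (indicator (cell M) x * g x) \<partial>lborel)"
    unfolding e using s1[of "\<lambda>r. r"] by (simp add: dint_def)
  moreover have "(\<integral>\<^sup>+x. ennreal (- (indicator (cell M) x * g (x + a))) \<partial>lborel) = (\<integral>\<^sup>+x. ennreal (- (indicator (cell M) x * g x)) \<partial>lborel)"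
    unfolding mult_minus_right[symmetric] e using s1[of "\<lambda>r. - r"] by (simp add: dint_def)
  ultimately show "(LINT x|lborel. indicator (cell M) x * g (x + a)) = (LINT x|lborel. indicator (cell M) x * g x)"
    unfolding real_lebesgue_integral_def[OF I] real_lebesgue_integral_def[OF J] by simp
qed

lemma integral_domain:
  fixes g :: "real ^ 'n::finite \<Rightarrow> real"
  shows "(LINT x|domain_measure M. g x) = (LINT x|lborel. indicator (cell M) x * g x)"
  unfolding domain_measure_eq by (subst integral_restrict_space) simp_all

lemma integrable_domain:
  fixes g :: "real ^ 'n::finite \<Rightarrow> real"
  shows "integrable (domain_measure M) g \<longleftrightarrow> integrable lborel (\<lambda>x. indicator (cell M) x * g x)"
  unfolding domain_measure_eq by (subst integrable_restrict_space) simp_all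

section \<open>Calculus of test functions\<close>

lemma Ck_differentiable: "Ck (Suc k) \<phi> \<Longrightarrow> \<phi> differentiable (at x)"
  by simp

lemma partial_deriv_line:
  assumes "\<And>x. \<phi> differentiable (at x)"
  shows "((\<lambda>s. \<phi> (x + s *\<^sub>R axis i 1)) has_real_derivative partial_deriv i \<phi> (x + s *\<^sub>R axis i 1)) (at s)"
proof -
  let ?y = "x + s *\<^sub>R axis i 1"
  have d: "(\<phi> has_derivative frechet_derivative \<phi> (at ?y)) (at ?y)"
    using assms frechet_derivative_works by blast
  have l: "((\<lambda>h::real. x + h *\<^sub>R axis i 1) has_derivative (\<lambda>h. h *\<^sub>R axis i 1)) (at s)"
    by (auto intro!: derivative_eq_intros)
  have "((\<lambda>h. \<phi> (x + h *\<^sub>R axis i 1)) has_derivative (\<lambda>h. frechet_derivative \<phi> (at ?y) (h *\<^sub>R axis i 1))) (at s)"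
    by (rule has_derivative_compose[OF l d])
  moreover have "(\<lambda>h. frechet_derivative \<phi> (at ?y) (h *\<^sub>R axis i 1)) = (\<lambda>h. partial_deriv i \<phi> ?y * h)"
    using linear_scale[OF has_derivative_linear[OF d]] by (auto simp: partial_deriv_def mult.commute)
  ultimately show ?thesis by (simp add: has_field_derivative_def)
qed

lemma partial_deriv_shift:
  assumes "\<And>x. \<phi> differentiable (at x)"
  shows "partial_deriv i (\<lambda>x. \<phi> (x + a)) = (\<lambda>x. partial_deriv i \<phi> (x + a))"
    and "(\<lambda>x. \<phi> (x + a)) differentiable (at x)"
proof -
  have d: "((\<lambda>x. \<phi> (x + a)) has_derivative frechet_derivative \<phi> (at (x + a))) (at x)" for x
  proof -
    have l: "((\<lambda>x. x + a) has_derivative (\<lambda>h. h)) (at x)" by (auto intro!: derivative_eq_intros)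
    have "(\<phi> has_derivative frechet_derivative \<phi> (at (x + a))) (at (x + a))"
      using assms frechet_derivative_works by blast
    from has_derivative_compose[OF l this] show ?thesis .
  qed
  show "partial_deriv i (\<lambda>x. \<phi> (x + a)) = (\<lambda>x. partial_deriv i \<phi> (x + a))"
    unfolding partial_deriv_def using frechet_derivative_at[OF d] by auto
  show "(\<lambda>x. \<phi> (x + a)) differentiable (at x)" using d unfolding differentiable_def by blast
qed

lemma Ck_shift: "Ck k \<phi> \<Longrightarrow> Ck k (\<lambda>x. \<phi> (x + a))"
proof (induction k arbitrary: \<phi>)
  case 0
  then show ?case by (auto intro!: continuous_intros continuous_on_compose2[of UNIV \<phi> UNIV "\<lambda>x. x + a"])
next
  case (Suc k)
  then have d: "\<And>x. \<phi> differentiable (at x)" by simp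
  show ?case using Suc partial_deriv_shift[OF d] by simp
qed

lemma test_function_shift:
  assumes "test_function M \<phi>"
  shows "test_function M (\<lambda>x. \<phi> (x + a))"
proof -
  have "\<exists>K. compact K \<and> (\<forall>x. x \<notin> K \<longrightarrow> \<phi> (x + a) = 0)" if MW: "M = Whole_Space"
  proof -
    obtain K where K: "compact K" "\<And>x. x \<notin> K \<Longrightarrow> \<phi> x = 0" using assms MW by (auto simp: test_function_def)
    have "compact ((\<lambda>x. x - a) ` K)" by (intro compact_continuous_image continuous_intros K)
    moreover have "\<phi> (x + a) = 0" if "x \<notin> (\<lambda>x. x - a) ` K" for x
    proof (rule K(2), rule notI)
      assume "x + a \<in> K"
      then have "x + a - a \<in> (\<lambda>x. x - a) ` K" by (rule imageI)
      then show False using that by simp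
    qed
    ultimately show ?thesis by blast
  qed
  then show ?thesis using assms by (auto simp: test_function_def intro: Ck_shift lives_on_shift)
qed

lemma test_function_differentiable: "test_function M \<phi> \<Longrightarrow> \<phi> differentiable (at x)"
  unfolding test_function_def using Ck_differentiable by blast

lemma test_function_continuous: "test_function M \<phi> \<Longrightarrow> continuous_on UNIV \<phi>"
  unfolding test_function_def using Ck.simps(1) by blast

lemma test_function_measurable: "test_function M \<phi> \<Longrightarrow> \<phi> \<in> borel_measurable borel"
  by (rule borel_measurable_continuous_onI, rule test_function_continuous)

lemma test_function_lives_on: "test_function M \<phi> \<Longrightarrow> lives_on M \<phi>"
  by (simp add: test_function_def)

lemma test_function_partial:
  assumes \<phi>: "test_function M \<phi>"
  shows "test_function M (partial_deriv i \<phi>)"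
  unfolding test_function_def
proof (intro conjI allI impI)
  note d = test_function_differentiable[OF \<phi>]
  show "Ck k (partial_deriv i \<phi>)" for k
    using \<phi> unfolding test_function_def by (metis Ck.simps(2))
  show "lives_on M (partial_deriv i \<phi>)"
  proof (cases M)
    case (Torus L)
    have "partial_deriv i \<phi> (x + axis j L) = partial_deriv i \<phi> x" for x j
    proof -
      have "(\<lambda>x. \<phi> (x + axis j L)) = \<phi>" using test_function_lives_on[OF \<phi>] by (auto simp: lives_on_def Torus)
      then show ?thesis using partial_deriv_shift(1)[OF d, of i "axis j L"] by metis
    qed
    then show ?thesis by (simp add: lives_on_def Torus)
  qed (simp add: lives_on_def)
  assume "M = Whole_Space"
  then obtain K where K: "compact K" "\<And>x. x \<notin> K \<Longrightarrow> \<phi> x = 0" using \<phi> by (auto simp: test_function_def)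
  have "partial_deriv i \<phi> x = 0" if "x \<notin> K" for x
  proof -
    have "(\<phi> has_derivative (\<lambda>_. 0)) (at x)"
    proof (rule has_derivative_transform_within_open)
      show "((\<lambda>_. 0) has_derivative (\<lambda>_. 0)) (at x)" by simp
      show "open (- K)" using K(1) by (simp add: compact_imp_closed open_Compl)
    qed (use that K(2) in auto)
    then have "frechet_derivative \<phi> (at x) = (\<lambda>_. 0)" by (metis frechet_derivative_at)
    then show ?thesis by (simp add: partial_deriv_def)
  qed
  then show "\<exists>K. compact K \<and> (\<forall>x. x \<notin> K \<longrightarrow> partial_deriv i \<phi> x = 0)" using K(1) by blast
qed

lemma cell_bounded:
  fixes x :: "real ^ 'n::finite"
  assumes "x \<in> cell (Torus L)"
  shows "norm x \<le> real CARD('n) * L"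
proof -
  have "norm x \<le> (\<Sum>i\<in>UNIV. \<bar>x $ i\<bar>)" by (rule norm_le_l1_cart)
  also have "\<dots> \<le> (\<Sum>i\<in>(UNIV :: 'n set). L)" by (rule sum_mono) (use assms in \<open>auto simp: cell_def abs_le_iff dest!: spec intro: less_imp_le order_trans\<close>)
  finally show ?thesis by simp
qed

lemma test_function_bounded:
  fixes \<phi> :: "real ^ 'n::finite \<Rightarrow> real"
  assumes M: "valid_domain M" and \<phi>: "test_function M \<phi>"
  obtains c where "c \<ge> 0" "\<And>x. \<bar>\<phi> x\<bar> \<le> c"
proof -
  \<comment> \<open>Every value of \<phi> is either 0 or attained on a compact set: the support on
    the whole space, and on the torus a ball that contains the cell.\<close>
  obtain K where K: "compact K" "\<And>x. \<exists>y. \<phi> x = \<phi> y \<and> (y \<in> K \<or> \<phi> y = 0)"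
  proof (cases M)
    case Whole_Space
    then obtain K where "compact K" "\<And>x. x \<notin> K \<Longrightarrow> \<phi> x = 0" using \<phi> by (auto simp: test_function_def)
    then show ?thesis using that by blast
  next
    case (Torus L)
    then have L: "L > 0" using M by (auto simp: valid_domain_def)
    have *: "\<exists>y. \<phi> x = \<phi> y \<and> y \<in> cball 0 (real CARD('n) * L)" for x
    proof -
      have "x + lattice_point L (\<lambda>i. - \<lfloor>x $ i / L\<rfloor>) \<in> cell (Torus L)" by (simp add: cell_lattice_plus[OF L])
      moreover have "\<phi> (x + lattice_point L (\<lambda>i. - \<lfloor>x $ i / L\<rfloor>)) = \<phi> x"
        by (rule lives_on_lattice) (use test_function_lives_on[OF \<phi>] Torus in simp)
      ultimately show ?thesis using cell_bounded by (metis mem_cball_0)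
    qed
    show ?thesis by (rule that[OF compact_cball]) (use * in blast)
  qed
  have "compact (\<phi> ` K)"
    by (intro compact_continuous_image K continuous_on_subset[OF test_function_continuous[OF \<phi>]]) simp
  then obtain c where c: "\<And>y. y \<in> K \<Longrightarrow> \<bar>\<phi> y\<bar> \<le> c"
    using compact_imp_bounded[of "\<phi> ` K"] unfolding bounded_iff by auto
  show ?thesis
  proof (rule that)
    show "\<bar>\<phi> x\<bar> \<le> max c 0" for x using K(2)[of x] c by (metis abs_zero max.coboundedI1 max.cobounded2)
  qed simp
qed

text \<open>One majorant for all translates along a segment, as needed for dominated convergence and
  for Fubini. Its support is bounded because of the compact support of \<phi> on the whole space,
  and because of the cell on the torus.\<close>

lemma test_function_dominated:
  fixes \<phi> :: "real ^ 'n::finite \<Rightarrow> real"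
  assumes M: "valid_domain M" and \<phi>: "test_function M \<phi>"
  obtains w where "integrable lborel w" "\<And>x s. \<bar>s\<bar> \<le> 1 \<Longrightarrow> \<bar>indicator (cell M) x * \<phi> (x + s *\<^sub>R v)\<bar> \<le> w x"
proof -
  obtain c where c: "c \<ge> 0" "\<And>x. \<bar>\<phi> x\<bar> \<le> c" using test_function_bounded[OF M \<phi>] by blast
  obtain R where R: "\<And>x s. \<bar>s\<bar> \<le> 1 \<Longrightarrow> x \<in> cell M \<Longrightarrow> x \<notin> cball 0 R \<Longrightarrow> \<phi> (x + s *\<^sub>R v) = 0"
  proof (cases M)
    case Whole_Space
    then obtain K where K: "compact K" "\<And>x. x \<notin> K \<Longrightarrow> \<phi> x = 0" using \<phi> by (auto simp: test_function_def)
    then obtain b where b: "\<And>x. x \<in> K \<Longrightarrow> norm x \<le> b" using compact_imp_bounded[OF K(1)] unfolding bounded_iff by blast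
    have "\<phi> (x + s *\<^sub>R v) = 0" if s: "\<bar>s\<bar> \<le> 1" and x: "x \<notin> cball 0 (b + norm v)" for x s
    proof (rule K(2), rule notI)
      assume "x + s *\<^sub>R v \<in> K"
      then have "norm (x + s *\<^sub>R v) \<le> b" by (rule b)
      moreover have "norm x \<le> norm (x + s *\<^sub>R v) + norm (s *\<^sub>R v)" using norm_triangle_ineq4[of "x + s *\<^sub>R v" "s *\<^sub>R v"] by simp
      moreover have "norm (s *\<^sub>R v) \<le> 1 * norm v" unfolding norm_scaleR by (rule mult_right_mono) (use s in auto)
      ultimately show False using x by simp
    qed
    then show ?thesis using that by blast
  next
    case (Torus L)
    show ?thesis by (rule that[of "real CARD('n) * L"]) (use cell_bounded Torus in force)
  qed
  show ?thesis
  proof (rule that)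
    show "integrable lborel (\<lambda>x. c * indicator (cball 0 R :: (real ^ 'n) set) x)"
      by (intro integrable_mult_right integrable_real_indicator) (use emeasure_compact_finite[OF compact_cball] in simp_all)
    show "\<bar>indicator (cell M) x * \<phi> (x + s *\<^sub>R v)\<bar> \<le> c * indicator (cball 0 R) x" if s: "\<bar>s\<bar> \<le> 1" for x s
    proof (cases "x \<in> cell M \<and> x \<in> cball 0 R")
      case True then show ?thesis using c by simp
    next
      case False
      then have 0: "indicator (cell M) x * \<phi> (x + s *\<^sub>R v) = 0" using R[OF s, of x] by (auto simp: indicator_def)
      show ?thesis unfolding 0 using c(1) by simp
    qed
  qed
qed

lemma test_function_integrable:
  assumes M: "valid_domain M" and \<phi>: "test_function M \<phi>"
  shows "integrable lborel (\<lambda>x. indicator (cell M) x * \<phi> x)"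
proof -
  note [measurable] = test_function_measurable[OF \<phi>]
  obtain w where w: "integrable lborel w" "\<And>x s. \<bar>s\<bar> \<le> 1 \<Longrightarrow> \<bar>indicator (cell M) x * \<phi> (x + s *\<^sub>R 0)\<bar> \<le> w x"
    using test_function_dominated[OF M \<phi>] by blast
  show ?thesis
    by (rule integrable_dominated[OF w(1)]) (use w(2)[of 0] in simp_all)
qed

lemma integrable_bounded_times_test:
  assumes M: "valid_domain M" and \<phi>: "test_function M \<phi>" and V[measurable]: "V \<in> borel_measurable borel" and m: "\<And>y. \<bar>V y\<bar> \<le> m"
  shows "integrable lborel (\<lambda>x. indicator (cell M) x * (V x * \<phi> x))"
proof (rule integrable_dominated)
  note [measurable] = test_function_measurable[OF \<phi>]
  show "integrable lborel (\<lambda>x. m * \<bar>indicator (cell M) x * \<phi> x\<bar>)"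
    by (intro integrable_mult_right integrable_abs test_function_integrable M \<phi>)
  show "norm (indicator (cell M) x * (V x * \<phi> x)) \<le> m * \<bar>indicator (cell M) x * \<phi> x\<bar>" for x
    using mult_right_mono[OF m[of x], of "\<bar>\<phi> x\<bar>"] by (auto simp: indicator_def abs_mult)
  show "(\<lambda>x. indicator (cell M) x * (V x * \<phi> x)) \<in> borel_measurable lborel" by measurable
qed

lemma bounded_locally_integrable:
  fixes V :: "real ^ 'n::finite \<Rightarrow> 'b::euclidean_space"
  assumes [measurable]: "V \<in> borel_measurable borel" and m: "\<And>y. norm (V y) \<le> m"
  shows "locally_integrable V"
  unfolding locally_integrable_def set_integrable_def
proof (intro allI impI)
  fix K :: "(real ^ 'n) set" assume K: "compact K"
  have [measurable]: "K \<in> sets borel" using K by (simp add: compact_imp_closed borel_closed)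
  have m0: "m \<ge> 0" using m[of 0] norm_ge_zero order_trans by blast
  show "integrable lborel (\<lambda>x. indicat_real K x *\<^sub>R V x)"
  proof (rule integrable_dominated)
    show "integrable lborel (\<lambda>x. m * indicat_real K x)"
      by (intro integrable_mult_right integrable_real_indicator) (use emeasure_compact_finite[OF K] in simp_all)
    show "norm (indicat_real K x *\<^sub>R V x) \<le> m * indicat_real K x" for x using m[of x] m0 by (auto simp: indicator_def)
  qed measurable
qed

text \<open>Summation by parts: a shift of the domain integral turns the forward quotient of V into
  a backward quotient of \<phi>. Both sides converge by dominated convergence, using the Lipschitz
  bound for V on one and the mean value theorem for \<phi> on the other.\<close>

lemma weak_derivative_dq:
  fixes V :: "real ^ 'n::finite \<Rightarrow> real"
  assumes M: "valid_domain M" and V[measurable]: "V \<in> borel_measurable borel" and m: "\<And>y. \<bar>V y\<bar> \<le> m"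
    and per: "lives_on M V" and L: "\<And>x y. \<bar>V x - V y\<bar> \<le> L * norm (x - y)"
    and G: "\<And>x. (\<lambda>k. dq V (axis i 1) k x) \<longlonglongrightarrow> G x" and \<phi>: "test_function M \<phi>"
  shows "(LINT x|lborel. indicator (cell M) x * (V x * partial_deriv i \<phi> x)) = - (LINT x|lborel. indicator (cell M) x * (G x * \<phi> x))"
proof -
  let ?C = "\<lambda>x. indicat_real (cell M) x"
  let ?e = "axis i (1::real) :: real ^ 'n"
  define h where "h = (\<lambda>k. 1 / real (Suc k))"
  note [measurable] = test_function_measurable[OF \<phi>]
  have h01: "0 < h k" "h k \<le> 1" for k by (simp_all add: h_def)
  have hS: "h k * real (Suc k) = 1" for k by (simp add: h_def del: of_nat_Suc)
  have e: "(LINT x|lborel. ?C x * (dq V ?e k x * \<phi> x)) = - (LINT x|lborel. ?C x * (V x * ((\<phi> x - \<phi> (x + (- h k) *\<^sub>R ?e)) * real (Suc k))))" for k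
  proof -
    have \<phi>s: "test_function M (\<lambda>x. \<phi> (x + - (h k *\<^sub>R ?e)))" by (rule test_function_shift[OF \<phi>])
    have I1: "integrable lborel (\<lambda>x. ?C x * (V x * \<phi> x))" by (rule integrable_bounded_times_test[OF M \<phi> V m])
    have I2: "integrable lborel (\<lambda>x. ?C x * (V x * \<phi> (x + - (h k *\<^sub>R ?e))))" by (rule integrable_bounded_times_test[OF M \<phi>s V m])
    have sh: "integrable lborel (\<lambda>x. ?C x * (V (x + h k *\<^sub>R ?e) * \<phi> (x + h k *\<^sub>R ?e + - (h k *\<^sub>R ?e))))"
      "(LINT x|lborel. ?C x * (V (x + h k *\<^sub>R ?e) * \<phi> (x + h k *\<^sub>R ?e + - (h k *\<^sub>R ?e)))) = (LINT x|lborel. ?C x * (V x * \<phi> (x + - (h k *\<^sub>R ?e))))"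
      by (rule dom_integral_shift[OF M _ lives_on_comp2[OF per test_function_lives_on[OF \<phi>s]] I2], measurable)+
    then have I3: "integrable lborel (\<lambda>x. ?C x * (V (x + h k *\<^sub>R ?e) * \<phi> x))"
      and E3: "(LINT x|lborel. ?C x * (V (x + h k *\<^sub>R ?e) * \<phi> x)) = (LINT x|lborel. ?C x * (V x * \<phi> (x + - (h k *\<^sub>R ?e))))" by simp_all
    have "(LINT x|lborel. ?C x * (dq V ?e k x * \<phi> x)) = (LINT x|lborel. (?C x * (V (x + h k *\<^sub>R ?e) * \<phi> x) - ?C x * (V x * \<phi> x)) * real (Suc k))"
      by (rule Bochner_Integration.integral_cong) (simp_all add: dq_def h_def algebra_simps)
    also have "\<dots> = ((LINT x|lborel. ?C x * (V x * \<phi> (x + - (h k *\<^sub>R ?e)))) - (LINT x|lborel. ?C x * (V x * \<phi> x))) * real (Suc k)"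
      unfolding integral_mult_left_zero Bochner_Integration.integral_diff[OF I3 I1] E3 ..
    also have "\<dots> = - (((LINT x|lborel. ?C x * (V x * \<phi> x)) - (LINT x|lborel. ?C x * (V x * \<phi> (x + - (h k *\<^sub>R ?e))))) * real (Suc k))"
      by (simp add: algebra_simps)
    also have "((LINT x|lborel. ?C x * (V x * \<phi> x)) - (LINT x|lborel. ?C x * (V x * \<phi> (x + - (h k *\<^sub>R ?e))))) * real (Suc k)
       = (LINT x|lborel. (?C x * (V x * \<phi> x) - ?C x * (V x * \<phi> (x + - (h k *\<^sub>R ?e)))) * real (Suc k))"
      unfolding integral_mult_left_zero Bochner_Integration.integral_diff[OF I1 I2] ..
    also have "\<dots> = (LINT x|lborel. ?C x * (V x * ((\<phi> x - \<phi> (x + (- h k) *\<^sub>R ?e)) * real (Suc k))))"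
      by (rule Bochner_Integration.integral_cong) (simp_all add: algebra_simps)
    finally show ?thesis .
  qed
  have dV: "\<bar>dq V ?e k x\<bar> \<le> L" for k x
  proof -
    have "\<bar>V (x + h k *\<^sub>R ?e) - V x\<bar> \<le> L * h k" using L[of "x + h k *\<^sub>R ?e" x] h01[of k] by simp
    then have "\<bar>V (x + h k *\<^sub>R ?e) - V x\<bar> * real (Suc k) \<le> L * h k * real (Suc k)" by (rule mult_right_mono) simp
    moreover have "1 / real (Suc k) = h k" by (simp add: h_def)
    ultimately show ?thesis unfolding dq_def abs_mult abs_of_nat by (simp only: mult.assoc hS mult_1_right)
  qed
  have Gm[measurable]: "G \<in> borel_measurable borel"
    by (rule borel_measurable_LIMSEQ_real[OF G]) (simp add: dq_def)
  have lim1: "(\<lambda>k. LINT x|lborel. ?C x * (dq V ?e k x * \<phi> x)) \<longlonglongrightarrow> (LINT x|lborel. ?C x * (G x * \<phi> x))"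
  proof (rule integral_dominated_convergence[where w = "\<lambda>x. L * \<bar>?C x * \<phi> x\<bar>"])
    show "integrable lborel (\<lambda>x. L * \<bar>?C x * \<phi> x\<bar>)"
      by (intro integrable_mult_right integrable_abs test_function_integrable M \<phi>)
    show "AE x in lborel. (\<lambda>k. ?C x * (dq V ?e k x * \<phi> x)) \<longlonglongrightarrow> ?C x * (G x * \<phi> x)"
      by (intro AE_I2 tendsto_mult tendsto_const G)
    show "AE x in lborel. norm (?C x * (dq V ?e k x * \<phi> x)) \<le> L * \<bar>?C x * \<phi> x\<bar>" for k
    proof (rule AE_I2)
      fix x show "norm (?C x * (dq V ?e k x * \<phi> x)) \<le> L * \<bar>?C x * \<phi> x\<bar>"
        using mult_right_mono[OF dV[of k x], of "\<bar>?C x * \<phi> x\<bar>"] by (simp add: abs_mult mult_ac)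
    qed
    show "(\<lambda>x. ?C x * (dq V ?e k x * \<phi> x)) \<in> borel_measurable lborel" for k unfolding dq_def by measurable
  qed measurable
  let ?d = "partial_deriv i \<phi>"
  note \<phi>d = test_function_partial[OF \<phi>, of i]
  note [measurable] = test_function_measurable[OF \<phi>d]
  note line = partial_deriv_line[OF test_function_differentiable[OF \<phi>], of _ i]
  obtain w where w: "integrable lborel w" "\<And>x s. \<bar>s\<bar> \<le> 1 \<Longrightarrow> \<bar>?C x * ?d (x + s *\<^sub>R ?e)\<bar> \<le> w x"
    using test_function_dominated[OF M \<phi>d, of ?e] by blast
  have mv: "\<exists>s. \<bar>s\<bar> \<le> 1 \<and> (\<phi> x - \<phi> (x + (- h k) *\<^sub>R ?e)) * real (Suc k) = ?d (x + s *\<^sub>R ?e)" for k x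
  proof -
    obtain z where z: "- h k < z" "z < 0" "\<phi> (x + 0 *\<^sub>R ?e) - \<phi> (x + (- h k) *\<^sub>R ?e) = (0 - (- h k)) * ?d (x + z *\<^sub>R ?e)"
      using MVT2[of "- h k" 0 "\<lambda>s. \<phi> (x + s *\<^sub>R ?e)" "\<lambda>s. ?d (x + s *\<^sub>R ?e)"] line h01(1)[of k] by auto
    have "(\<phi> x - \<phi> (x + (- h k) *\<^sub>R ?e)) * real (Suc k) = (h k * real (Suc k)) * ?d (x + z *\<^sub>R ?e)" using z(3) by simp
    then show ?thesis unfolding hS using z(1,2) h01(2)[of k] by (intro exI[of _ z]) auto
  qed
  have lim2: "(\<lambda>k. LINT x|lborel. ?C x * (V x * ((\<phi> x - \<phi> (x + (- h k) *\<^sub>R ?e)) * real (Suc k)))) \<longlonglongrightarrow> (LINT x|lborel. ?C x * (V x * ?d x))"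
  proof (rule integral_dominated_convergence[where w = "\<lambda>x. m * w x"])
    show "integrable lborel (\<lambda>x. m * w x)" by (rule integrable_mult_right, rule w(1))
    show "AE x in lborel. (\<lambda>k. ?C x * (V x * ((\<phi> x - \<phi> (x + (- h k) *\<^sub>R ?e)) * real (Suc k)))) \<longlonglongrightarrow> ?C x * (V x * ?d x)"
    proof (intro AE_I2 tendsto_mult tendsto_const)
      fix x
      have "(\<lambda>s. (\<phi> (x + (0 + s) *\<^sub>R ?e) - \<phi> (x + 0 *\<^sub>R ?e)) / s) \<midarrow>0\<rightarrow> ?d (x + 0 *\<^sub>R ?e)"
        using line[of x 0] by (simp only: DERIV_def)
      moreover have "filterlim (\<lambda>k. - h k) (at 0) sequentially"
      proof (rule filterlim_atI)
        have "(\<lambda>k. - h k) \<longlonglongrightarrow> - 0" unfolding h_def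
          using LIMSEQ_inverse_real_of_nat by (intro tendsto_minus) (simp add: inverse_eq_divide)
        then show "(\<lambda>k. - h k) \<longlonglongrightarrow> 0" by simp
        show "\<forall>\<^sub>F k in sequentially. - h k \<noteq> 0" by (rule always_eventually) (simp add: h_def)
      qed
      ultimately have l: "(\<lambda>k. (\<phi> (x + (0 + - h k) *\<^sub>R ?e) - \<phi> (x + 0 *\<^sub>R ?e)) / (- h k)) \<longlonglongrightarrow> ?d (x + 0 *\<^sub>R ?e)"
        by (rule filterlim_compose)
      have "(\<phi> (x + (0 + - h k) *\<^sub>R ?e) - \<phi> (x + 0 *\<^sub>R ?e)) / (- h k) = (\<phi> x - \<phi> (x + (- h k) *\<^sub>R ?e)) * real (Suc k)" for k
        by (simp add: h_def divide_simps) (simp add: algebra_simps)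
      then show "(\<lambda>k. (\<phi> x - \<phi> (x + (- h k) *\<^sub>R ?e)) * real (Suc k)) \<longlonglongrightarrow> ?d x" using l by simp
    qed
    show "AE x in lborel. norm (?C x * (V x * ((\<phi> x - \<phi> (x + (- h k) *\<^sub>R ?e)) * real (Suc k)))) \<le> m * w x" for k
    proof (rule AE_I2)
      fix x
      obtain s where s: "\<bar>s\<bar> \<le> 1" "(\<phi> x - \<phi> (x + (- h k) *\<^sub>R ?e)) * real (Suc k) = ?d (x + s *\<^sub>R ?e)" using mv[of x k] by blast
      have "norm (?C x * (V x * ((\<phi> x - \<phi> (x + (- h k) *\<^sub>R ?e)) * real (Suc k)))) = \<bar>V x\<bar> * \<bar>?C x * ?d (x + s *\<^sub>R ?e)\<bar>"
        unfolding s(2) by (simp add: abs_mult)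
      also have "\<dots> \<le> m * w x" by (rule mult_mono[OF m w(2)[OF s(1)]]) (use m[of 0] in auto)
      finally show "norm (?C x * (V x * ((\<phi> x - \<phi> (x + (- h k) *\<^sub>R ?e)) * real (Suc k)))) \<le> m * w x" .
    qed
  qed measurable
  have "(\<lambda>k. - (LINT x|lborel. ?C x * (V x * ((\<phi> x - \<phi> (x + (- h k) *\<^sub>R ?e)) * real (Suc k))))) \<longlonglongrightarrow> - (LINT x|lborel. ?C x * (V x * ?d x))"
    by (rule tendsto_minus[OF lim2])
  then have "(LINT x|lborel. ?C x * (G x * \<phi> x)) = - (LINT x|lborel. ?C x * (V x * ?d x))"
    using LIMSEQ_unique[OF lim1] unfolding e by blast
  then show ?thesis by simp
qed

text \<open>L enters qualitatively, to dominate the quotients; the quantitative bound is C, which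
  Fatou's lemma keeps for each axis. Summing over the axes gives the dimension as a factor.\<close>

lemma weak_gradient_from_dq:
  fixes V :: "real ^ 'n::finite \<Rightarrow> real"
  assumes M: "valid_domain M" and V[measurable]: "V \<in> borel_measurable borel" and m: "\<And>y. \<bar>V y\<bar> \<le> m"
    and per: "lives_on M V" and L: "\<And>x y. \<bar>V x - V y\<bar> \<le> L * norm (x - y)"
    and conv: "\<And>i x. convergent (\<lambda>k. dq V (axis i 1) k x)"
    and sq: "\<And>i k. dint M (\<lambda>x. ennreal ((dq V (axis i 1) k x)\<^sup>2)) \<le> ennreal C" and C: "C \<ge> 0"
  shows "\<exists>Du. has_weak_gradient M V Du \<and> in_Lp 2 (domain_measure M) Du \<and>
     (Lp_norm 2 (domain_measure M) Du)\<^sup>2 \<le> real CARD('n) * C"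
proof -
  define G where "G = (\<lambda>i x. lim (\<lambda>k. dq V (axis i 1) k x))"
  define Du where "Du = (\<lambda>x. \<chi> i. G i x)"
  have G: "(\<lambda>k. dq V (axis i 1) k x) \<longlonglongrightarrow> G i x" for i x
    unfolding G_def using conv convergent_LIMSEQ_iff by blast
  have dqm: "dq V (axis i 1) k \<in> borel_measurable borel" for i k unfolding dq_def by measurable
  have Gm[measurable]: "G i \<in> borel_measurable borel" for i by (rule borel_measurable_LIMSEQ_real[OF G dqm])
  have Dm[measurable]: "Du \<in> borel_measurable borel"
    unfolding Du_def by (rule borel_measurable_euclidean_space[THEN iffD2]) (auto simp: Basis_vec_def inner_axis)
  have dV: "\<bar>dq V (axis i 1) k x\<bar> \<le> L" for i k x
  proof -
    have "\<bar>V (x + (1 / real (Suc k)) *\<^sub>R axis i 1) - V x\<bar> \<le> L * (1 / real (Suc k))"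
      using L[of "x + (1 / real (Suc k)) *\<^sub>R axis i 1" x] by simp
    then have "\<bar>V (x + (1 / real (Suc k)) *\<^sub>R axis i 1) - V x\<bar> * real (Suc k) \<le> L * (1 / real (Suc k)) * real (Suc k)"
      by (rule mult_right_mono) simp
    then show ?thesis unfolding dq_def abs_mult abs_of_nat by (simp del: of_nat_Suc)
  qed
  have Gb: "\<bar>G i x\<bar> \<le> L" for i x
    by (rule LIMSEQ_le_const2[OF tendsto_rabs[OF G]]) (use dV in blast)
  have Db: "norm (Du x) \<le> real CARD('n) * L" for x
  proof -
    have "norm (Du x) \<le> (\<Sum>i\<in>UNIV. \<bar>Du x $ i\<bar>)" by (rule norm_le_l1_cart)
    also have "\<dots> \<le> (\<Sum>i\<in>(UNIV :: 'n set). L)" by (rule sum_mono) (simp add: Du_def Gb)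
    finally show ?thesis by simp
  qed
  have dqper: "lives_on M (dq V (axis i 1) k)" for i k
    using lives_on_comp2[OF lives_on_shift[OF per] per, of "\<lambda>a b. (a - b) * real (Suc k)"] by (simp add: dq_def[abs_def])
  have Dper: "lives_on M Du"
  proof (cases M)
    case (Torus L')
    then show ?thesis using dqper by (simp add: lives_on_def Du_def G_def)
  qed (simp add: lives_on_def)
  have wg: "has_weak_gradient M V Du"
    unfolding has_weak_gradient_def
  proof (intro conjI allI impI)
    show "lives_on M V" by (rule per)
    show "lives_on M Du" by (rule Dper)
    show "locally_integrable Du" by (rule bounded_locally_integrable[OF Dm Db])
    show "locally_integrable V" by (rule bounded_locally_integrable[OF V]) (use m in simp)
    fix \<phi> :: "real ^ 'n \<Rightarrow> real" and i assume \<phi>: "test_function M \<phi>"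
    have "(LINT x|domain_measure M. V x * partial_deriv i \<phi> x) = (LINT x|lborel. indicator (cell M) x * (V x * partial_deriv i \<phi> x))"
      by (rule integral_domain)
    also have "\<dots> = - (LINT x|lborel. indicator (cell M) x * (G i x * \<phi> x))"
      by (rule weak_derivative_dq[OF M V m per L G \<phi>])
    also have "\<dots> = - (LINT x|domain_measure M. Du x $ i * \<phi> x)" unfolding integral_domain by (simp add: Du_def)
    finally show "(LINT x|domain_measure M. V x * partial_deriv i \<phi> x) = - (LINT x|domain_measure M. Du x $ i * \<phi> x)" .
  qed
  have Gsq: "dint M (\<lambda>x. ennreal ((G i x)\<^sup>2)) \<le> ennreal C" for i
  proof -
    have lim: "(\<lambda>k. ennreal ((dq V (axis i 1) k x)\<^sup>2) * indicator (cell M) x) \<longlonglongrightarrow> ennreal ((G i x)\<^sup>2) * indicator (cell M) x" for x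
    proof -
      have "(\<lambda>k. ennreal ((dq V (axis i 1) k x)\<^sup>2)) \<longlonglongrightarrow> ennreal ((G i x)\<^sup>2)" by (intro tendsto_ennrealI tendsto_power G)
      then show ?thesis by (cases "x \<in> cell M") simp_all
    qed
    have "dint M (\<lambda>x. ennreal ((G i x)\<^sup>2)) = (\<integral>\<^sup>+x. liminf (\<lambda>k. ennreal ((dq V (axis i 1) k x)\<^sup>2) * indicator (cell M) x) \<partial>lborel)"
      unfolding dint_def using lim_imp_Liminf[OF _ lim] by simp
    also have "\<dots> \<le> liminf (\<lambda>k. \<integral>\<^sup>+x. ennreal ((dq V (axis i 1) k x)\<^sup>2) * indicator (cell M) x \<partial>lborel)"
      by (rule nn_integral_liminf) (use dqm in measurable)
    also have "\<dots> \<le> liminf (\<lambda>k. ennreal C)"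
      by (rule Liminf_mono) (use sq in \<open>simp add: dint_def\<close>)
    also have "\<dots> = ennreal C" by (rule Liminf_const) simp
    finally show ?thesis .
  qed
  have nsq: "(norm (Du x)) powr 2 = (\<Sum>i\<in>UNIV. (G i x)\<^sup>2)" for x
  proof -
    have "(norm (Du x)) powr 2 = (norm (Du x))\<^sup>2" by (simp add: powr_numeral)
    also have "\<dots> = (\<Sum>i\<in>UNIV. (G i x)\<^sup>2)" unfolding power2_norm_eq_inner inner_vec_def by (simp add: Du_def power2_eq_square)
    finally show ?thesis .
  qed
  have nn: "(\<integral>\<^sup>+x. ennreal ((norm (Du x)) powr 2) \<partial>domain_measure M) \<le> ennreal (real CARD('n) * C)"
  proof -
    have "(\<integral>\<^sup>+x. ennreal ((norm (Du x)) powr 2) \<partial>domain_measure M) = dint M (\<lambda>x. \<Sum>i\<in>UNIV. ennreal ((G i x)\<^sup>2))"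
      unfolding nn_integral_domain nsq by (simp add: sum_ennreal)
    also have "\<dots> = (\<Sum>i\<in>UNIV. dint M (\<lambda>x. ennreal ((G i x)\<^sup>2)))"
      unfolding dint_def sum_distrib_right by (rule nn_integral_sum) measurable
    also have "\<dots> \<le> (\<Sum>i\<in>(UNIV :: 'n set). ennreal C)" by (rule sum_mono) (rule Gsq)
    also have "\<dots> = ennreal (real CARD('n) * C)" using C by (simp add: ennreal_mult ennreal_of_nat_eq_real_of_nat)
    finally show ?thesis .
  qed
  have I: "integrable (domain_measure M) (\<lambda>x. (norm (Du x)) powr 2)"
  proof (rule integrableI_nonneg)
    show "(\<lambda>x. (norm (Du x)) powr 2) \<in> borel_measurable (domain_measure M)" by (rule measurable_domain) measurable
    show "(\<integral>\<^sup>+x. ennreal ((norm (Du x)) powr 2) \<partial>domain_measure M) < \<infinity>" using nn by (rule le_less_trans) simp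
  qed simp
  have "ennreal (LINT x|domain_measure M. (norm (Du x)) powr 2) = (\<integral>\<^sup>+x. ennreal ((norm (Du x)) powr 2) \<partial>domain_measure M)"
    by (rule nn_integral_eq_integral[OF I, symmetric]) simp
  then have "ennreal (LINT x|domain_measure M. (norm (Du x)) powr 2) \<le> ennreal (real CARD('n) * C)" using nn by simp
  then have le: "(LINT x|domain_measure M. (norm (Du x)) powr 2) \<le> real CARD('n) * C"
    using C by (subst (asm) ennreal_le_iff) auto
  have I0: "0 \<le> (LINT x|domain_measure M. (norm (Du x)) powr 2)" by (rule integral_nonneg_AE) simp
  have "(Lp_norm 2 (domain_measure M) Du)\<^sup>2 = (LINT x|domain_measure M. (norm (Du x)) powr 2)"
    unfolding Lp_norm_def using I0 by (simp add: powr_half_sqrt)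
  then have "(Lp_norm 2 (domain_measure M) Du)\<^sup>2 \<le> real CARD('n) * C" using le by simp
  moreover have "in_Lp 2 (domain_measure M) Du"
    unfolding in_Lp_def using I measurable_domain[OF Dm] by blast
  ultimately show ?thesis using wg by blast
qed

section \<open>The fundamental lemma of the calculus of variations\<close>

text \<open>The division by powers makes the family closed under differentiation up to linear
  combinations, so that smoothness at 0 is settled for all derivatives at once. For j = 0 it is the
  classical flat function.\<close>

definition bump :: "nat \<Rightarrow> real \<Rightarrow> real" where
  "bump j x = (if x > 0 then exp (- (1 / x)) / x ^ j else 0)"

lemma power_le_fact_exp:
  fixes y :: real
  assumes "y \<ge> 0"
  shows "y ^ n \<le> fact n * exp y"
proof -
  have "(\<Sum>k\<in>{n}. y ^ k /\<^sub>R fact k) \<le> (\<Sum>k. y ^ k /\<^sub>R fact k)"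
    by (rule sum_le_suminf[OF summable_exp_generic]) (use assms in auto)
  then have "y ^ n / fact n \<le> exp y" by (simp add: exp_def divide_inverse mult.commute)
  then show ?thesis by (simp add: pos_divide_le_eq mult.commute)
qed

text \<open>exp (1 / x) outgrows the power j + 2 of 1 / x. The resulting quadratic flatness gives
  the derivative 0 at the origin, for every j.\<close>

lemma bump_quadratic: "\<bar>bump j x\<bar> \<le> fact (j + 2) * x\<^sup>2"
proof (cases "x > 0")
  case True
  have "(1 / x) ^ (j + 2) \<le> fact (j + 2) * exp (1 / x)" by (rule power_le_fact_exp) (use True in simp)
  then have "1 \<le> fact (j + 2) * exp (1 / x) * x ^ (j + 2)" using True by (simp add: power_one_over pos_divide_le_eq)
  then have "exp (- (1 / x)) \<le> fact (j + 2) * x ^ (j + 2)"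
    by (simp add: exp_minus pos_divide_le_eq inverse_eq_divide mult_ac)
  then have "exp (- (1 / x)) / x ^ j \<le> fact (j + 2) * x ^ (j + 2) / x ^ j" by (rule divide_right_mono) (use True in simp)
  also have "\<dots> = fact (j + 2) * x\<^sup>2" using True by (simp add: power_add power2_eq_square)
  finally show ?thesis using True by (simp add: bump_def)
qed (simp add: bump_def)

lemma bump_derivative:
  "(bump j has_real_derivative (- real j * bump (j + 1) x + bump (j + 2) x)) (at x)"
proof (cases x "0 :: real" rule: linorder_cases)
  case less
  have "((\<lambda>_. 0) has_real_derivative 0) (at x)" by simp
  then have "(bump j has_real_derivative 0) (at x)"
    by (rule has_field_derivative_transform_within_open[where S = "{..<0}"]) (use less in \<open>auto simp: bump_def\<close>)
  then show ?thesis using less by (simp add: bump_def)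
next
  case equal
  have "(bump j has_derivative (\<lambda>_. 0)) (at 0)"
    by (rule has_derivative_quadratic[where C = "fact (j + 2)"]) (use bump_quadratic[of j] in \<open>simp_all add: bump_def\<close>)
  then show ?thesis unfolding has_field_derivative_def using equal by (simp add: bump_def lambda_zero)
next
  case greater
  have "((\<lambda>x. exp (- (1 / x)) / x ^ j) has_real_derivative (- real j * bump (j + 1) x + bump (j + 2) x)) (at x)"
  proof (cases j)
    case 0
    then show ?thesis using greater
      by (auto intro!: derivative_eq_intros simp: bump_def power2_eq_square divide_simps)
  next
    case (Suc i)
    then show ?thesis using greater
      by (auto intro!: derivative_eq_intros simp: bump_def power2_eq_square divide_simps) (simp add: algebra_simps, cases i, simp_all)
  qed
  then show ?thesis
    by (rule has_field_derivative_transform_within_open[where S = "{0<..}"]) (use greater in \<open>auto simp: bump_def\<close>)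
qed

text \<open>Closed under partial derivatives, so every member is \<open>C\<^sup>\<infinity>\<close>.\<close>
inductive_set smooth_class :: "(real ^ 'n::finite \<Rightarrow> real) set" where
  const: "(\<lambda>_. c) \<in> smooth_class"
| coord: "(\<lambda>x. x $ i) \<in> smooth_class"
| sine: "(\<lambda>x. sin (a * x $ i + b)) \<in> smooth_class"
| bump: "P \<in> smooth_class \<Longrightarrow> (\<lambda>x. bump j (P x)) \<in> smooth_class"
| add: "P \<in> smooth_class \<Longrightarrow> Q \<in> smooth_class \<Longrightarrow> (\<lambda>x. P x + Q x) \<in> smooth_class"
| mult: "P \<in> smooth_class \<Longrightarrow> Q \<in> smooth_class \<Longrightarrow> (\<lambda>x. P x * Q x) \<in> smooth_class"

lemma smooth_class_derivative:
  fixes \<phi> :: "real ^ 'n::finite \<Rightarrow> real"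
  assumes "\<phi> \<in> smooth_class"
  shows "\<exists>D. (\<forall>x. (\<phi> has_derivative (\<lambda>h. \<Sum>i\<in>UNIV. D i x * h $ i)) (at x)) \<and> (\<forall>i. D i \<in> smooth_class)"
  using assms
proof induction
  case (const c)
  show ?case by (rule exI[of _ "\<lambda>_ _. 0"]) (auto intro: smooth_class.const)
next
  case (coord i)
  have "((\<lambda>x. x $ i) has_derivative (\<lambda>h. h $ i)) (at x)" for x :: "real ^ 'n"
    by (rule bounded_linear_imp_has_derivative[OF bounded_linear_vec_nth])
  then show ?case
    by (intro exI[of _ "\<lambda>j _. if j = i then 1 else 0"]) (auto intro: smooth_class.const simp: if_distrib[of "\<lambda>r. r * _"] cong: if_cong)
next
  case (sine a i b)
  have c: "((\<lambda>x. x $ i) has_derivative (\<lambda>h. h $ i)) (at x)" for x :: "real ^ 'n"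
    by (rule bounded_linear_imp_has_derivative[OF bounded_linear_vec_nth])
  \<comment> \<open>The cosine is written as a sine with its phase shifted by pi / 2, so that the
    class stays closed with sines as the only trigonometric generators.\<close>
  have d: "((\<lambda>x. sin (a * x $ i + b)) has_derivative (\<lambda>h. a * sin (a * x $ i + (b + pi / 2)) * h $ i)) (at x)" for x :: "real ^ 'n"
  proof -
    have "((\<lambda>x. sin (a * x $ i + b)) has_derivative (\<lambda>h. cos (a * x $ i + b) * (a * h $ i))) (at x)"
      by (auto intro!: derivative_eq_intros c)
    moreover have "sin (a * x $ i + (b + pi / 2)) = cos (a * x $ i + b)"
      by (simp add: cos_sin_eq add.assoc[symmetric] sin_add)
    ultimately show ?thesis by (simp add: mult_ac)
  qed
  show ?case
  proof (intro exI[of _ "\<lambda>j x. if j = i then a * sin (a * x $ i + (b + pi / 2)) else 0"] conjI allI)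
    fix j
    show "(\<lambda>x. if j = i then a * sin (a * x $ i + (b + pi / 2)) else 0) \<in> smooth_class"
      by (cases "j = i") (auto intro: smooth_class.intros)
  qed (use d in \<open>simp add: if_distrib[of "\<lambda>r. r * _"] cong: if_cong\<close>)
next
  case (bump P j)
  then obtain D where D: "\<And>x. (P has_derivative (\<lambda>h. \<Sum>i\<in>UNIV. D i x * h $ i)) (at x)" "\<And>i. D i \<in> smooth_class" by blast
  show ?case
  proof (intro exI[of _ "\<lambda>i x. ((- real j) * bump (j + 1) (P x) + bump (j + 2) (P x)) * D i x"] conjI allI)
    show "(\<lambda>x. ((- real j) * bump (j + 1) (P x) + bump (j + 2) (P x)) * D i x) \<in> smooth_class" for i
      by (intro smooth_class.intros bump.hyps D)
    fix x
    have "((\<lambda>x. bump j (P x)) has_derivative (\<lambda>h. ((- real j) * bump (j + 1) (P x) + bump (j + 2) (P x)) * (\<Sum>i\<in>UNIV. D i x * h $ i))) (at x)"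
      by (rule has_derivative_compose[OF D(1)]) (use bump_derivative[of j "P x"] in \<open>simp add: has_field_derivative_def\<close>)
    then show "((\<lambda>x. bump j (P x)) has_derivative (\<lambda>h. \<Sum>i\<in>UNIV. ((- real j) * bump (j + 1) (P x) + bump (j + 2) (P x)) * D i x * h $ i)) (at x)"
      by (simp only: sum_distrib_left mult.assoc)
  qed
next
  case (add P Q)
  then obtain D E where D: "\<And>x. (P has_derivative (\<lambda>h. \<Sum>i\<in>UNIV. D i x * h $ i)) (at x)" "\<And>i. D i \<in> smooth_class"
    and E: "\<And>x. (Q has_derivative (\<lambda>h. \<Sum>i\<in>UNIV. E i x * h $ i)) (at x)" "\<And>i. E i \<in> smooth_class" by blast
  show ?case
  proof (intro exI[of _ "\<lambda>i x. D i x + E i x"] conjI allI)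
    show "((\<lambda>x. P x + Q x) has_derivative (\<lambda>h. \<Sum>i\<in>UNIV. (D i x + E i x) * h $ i)) (at x)" for x
      using has_derivative_add[OF D(1) E(1)] by (simp only: distrib_right sum.distrib)
    show "(\<lambda>x. D i x + E i x) \<in> smooth_class" for i by (intro smooth_class.intros D E)
  qed
next
  case (mult P Q)
  then obtain D E where D: "\<And>x. (P has_derivative (\<lambda>h. \<Sum>i\<in>UNIV. D i x * h $ i)) (at x)" "\<And>i. D i \<in> smooth_class"
    and E: "\<And>x. (Q has_derivative (\<lambda>h. \<Sum>i\<in>UNIV. E i x * h $ i)) (at x)" "\<And>i. E i \<in> smooth_class" by blast
  show ?case
  proof (intro exI[of _ "\<lambda>i x. P x * E i x + D i x * Q x"] conjI allI)
    fix x
    have "(\<lambda>h. P x * (\<Sum>i\<in>UNIV. E i x * h $ i) + (\<Sum>i\<in>UNIV. D i x * h $ i) * Q x) = (\<lambda>h. \<Sum>i\<in>UNIV. (P x * E i x + D i x * Q x) * h $ i)"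
      by (simp add: sum_distrib_left sum_distrib_right sum.distrib[symmetric] algebra_simps)
    then show "((\<lambda>x. P x * Q x) has_derivative (\<lambda>h. \<Sum>i\<in>UNIV. (P x * E i x + D i x * Q x) * h $ i)) (at x)"
      using has_derivative_mult[OF D(1)[of x] E(1)[of x]] by simp
    show "(\<lambda>x. P x * E i x + D i x * Q x) \<in> smooth_class" for i by (intro smooth_class.intros D E mult.hyps)
  qed
qed

lemma smooth_class_partial:
  fixes \<phi> :: "real ^ 'n::finite \<Rightarrow> real"
  assumes "\<phi> \<in> smooth_class"
  shows "\<phi> differentiable (at x)" "partial_deriv i \<phi> \<in> smooth_class"
proof -
  obtain D where D: "\<And>x. (\<phi> has_derivative (\<lambda>h. \<Sum>i\<in>UNIV. D i x * h $ i)) (at x)" "\<And>i. D i \<in> smooth_class"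
    using smooth_class_derivative[OF assms] by blast
  show "\<phi> differentiable (at x)" using D(1) unfolding differentiable_def by blast
  have "partial_deriv i \<phi> x = D i x" for x
    unfolding partial_deriv_def frechet_derivative_at[OF D(1), symmetric]
    by (simp add: axis_def if_distrib cong: if_cong)
  then have "partial_deriv i \<phi> = D i" by auto
  then show "partial_deriv i \<phi> \<in> smooth_class" using D(2) by simp
qed

lemma smooth_class_Ck: "\<phi> \<in> smooth_class \<Longrightarrow> Ck k \<phi>"
proof (induction k arbitrary: \<phi>)
  case 0
  then show ?case
    using differentiable_imp_continuous_within[OF smooth_class_partial(1)[OF 0]] by (simp add: continuous_on_eq_continuous_within)
next
  case (Suc k)
  show ?case using Suc.IH[OF smooth_class_partial(2)[OF Suc.prems]] smooth_class_partial(1)[OF Suc.prems] by simp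
qed

lemma smooth_class_prod: "finite A \<Longrightarrow> (\<And>i. i \<in> A \<Longrightarrow> P i \<in> smooth_class) \<Longrightarrow> (\<lambda>x. \<Prod>i\<in>A. P i x) \<in> smooth_class"
proof (induction A rule: finite_induct)
  case (insert j A)
  then show ?case by (auto intro: smooth_class.mult)
qed (auto intro: smooth_class.const)

text \<open>On the cell, \<open>wall M a b i\<close> is positive exactly between the hyperplanes \<open>x\<^sub>i = a\<^sub>i\<close> and
  \<open>x\<^sub>i = b\<^sub>i\<close>; on the torus it is a product of two sines so that it is periodic.\<close>
definition wall :: "domain \<Rightarrow> real ^ 'n \<Rightarrow> real ^ 'n \<Rightarrow> 'n::finite \<Rightarrow> real ^ 'n \<Rightarrow> real" where
  "wall M a b i x = (case M of Whole_Space \<Rightarrow> (x $ i - a $ i) * (b $ i - x $ i)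
     | Torus L \<Rightarrow> sin (pi / L * (x $ i - a $ i)) * sin (pi / L * (b $ i - x $ i)))"

text \<open>The factor k + 1 inside sends \<open>bump 0\<close> to 1 wherever the wall is positive,
  while zeros stay zeros; on the cell the products converge to the indicator of the open
  box.\<close>

definition box_test :: "domain \<Rightarrow> real ^ 'n \<Rightarrow> real ^ 'n \<Rightarrow> nat \<Rightarrow> real ^ 'n::finite \<Rightarrow> real" where
  "box_test M a b k x = (\<Prod>i\<in>UNIV. bump 0 (real (Suc k) * wall M a b i x))"

definition inner_box :: "domain \<Rightarrow> real ^ 'n::finite \<Rightarrow> real ^ 'n \<Rightarrow> bool" where
  "inner_box M a b \<longleftrightarrow> (\<forall>i. a $ i < b $ i) \<and> (case M of Whole_Space \<Rightarrow> True | Torus L \<Rightarrow> (\<forall>i. 0 \<le> a $ i \<and> b $ i \<le> L))"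

lemma wall_smooth: "wall M a b i \<in> smooth_class"
proof (cases M)
  case Whole_Space
  have "(\<lambda>x. (x $ i + - a $ i) * (b $ i + (-1) * x $ i)) \<in> smooth_class" by (intro smooth_class.intros)
  then show ?thesis by (simp add: wall_def[abs_def] Whole_Space)
next
  case (Torus L)
  have "(\<lambda>x. sin (pi / L * x $ i + - (pi / L * a $ i)) * sin (- (pi / L) * x $ i + pi / L * b $ i)) \<in> smooth_class" by (intro smooth_class.intros)
  then show ?thesis by (simp add: wall_def[abs_def] Torus algebra_simps)
qed

text \<open>On the torus both arguments, divided by pi / L, stay within [- L, L], and at most one of
  x - a and b - x can be negative, since their sum is positive. A shift by L flips the sign of each
  sine, so that only the product is periodic.\<close>

lemma wall_pos_iff:
  assumes M: "valid_domain M" and ab: "inner_box M a b" and x: "x \<in> cell M"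
  shows "wall M a b i x > 0 \<longleftrightarrow> a $ i < x $ i \<and> x $ i < b $ i"
proof (cases M)
  case Whole_Space
  then show ?thesis using ab by (auto simp: wall_def zero_less_mult_iff inner_box_def dest: spec[of _ i])
next
  case (Torus L)
  then have L: "L > 0" using M by (auto simp: valid_domain_def)
  have h: "a $ i < b $ i" "0 \<le> a $ i" "b $ i \<le> L" "0 \<le> x $ i" "x $ i < L"
    using ab x by (auto simp: inner_box_def cell_def Torus)
  have pos: "sin (pi / L * y) > 0" if "0 < y" "y < L" for y
    using that L by (intro sin_gt_zero) (auto simp: divide_simps)
  have nonneg: "sin (pi / L * y) \<ge> 0" if "0 \<le> y" "y \<le> L" for y
    using that L by (intro sin_ge_zero) (auto simp: divide_simps)
  have nonpos: "sin (pi / L * y) \<le> 0" if "- L \<le> y" "y \<le> 0" for y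
    using nonneg[of "- y"] that by simp
  have w: "wall M a b i x = sin (pi / L * (x $ i - a $ i)) * sin (pi / L * (b $ i - x $ i))" by (simp add: wall_def Torus)
  consider "x $ i \<le> a $ i" | "a $ i < x $ i" "x $ i < b $ i" | "b $ i \<le> x $ i" by linarith
  then show ?thesis
  proof cases
    case 1
    have "wall M a b i x \<le> 0" unfolding w by (rule mult_nonpos_nonneg[OF nonpos nonneg]) (use 1 h in auto)
    then show ?thesis using 1 by auto
  next
    case 2
    have "wall M a b i x > 0" unfolding w by (rule mult_pos_pos[OF pos pos]) (use 2 h in auto)
    then show ?thesis using 2 by auto
  next
    case 3
    have "wall M a b i x \<le> 0" unfolding w by (rule mult_nonneg_nonpos[OF nonneg nonpos]) (use 3 h in auto)
    then show ?thesis using 3 by auto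
  qed
qed

lemma bump0_range: "0 \<le> bump 0 y" "bump 0 y \<le> 1"
  by (auto simp: bump_def)

lemma box_test_range: "0 \<le> box_test M a b k x" "box_test M a b k x \<le> 1"
  unfolding box_test_def by (auto intro!: prod_nonneg prod_le_1 simp: bump0_range)

lemma box_test_outside:
  assumes M: "valid_domain M" and ab: "inner_box M a b" and x: "x \<in> cell M" "x \<notin> box a b"
  shows "box_test M a b k x = 0"
proof -
  obtain i where "\<not> (a $ i < x $ i \<and> x $ i < b $ i)" using x(2) by (auto simp: mem_box_cart)
  then have "wall M a b i x \<le> 0" using wall_pos_iff[OF M ab x(1), of i] by linarith
  then have "bump 0 (real (Suc k) * wall M a b i x) = 0" by (simp add: bump_def zero_less_mult_iff not_less)
  then show ?thesis unfolding box_test_def by (rule prod_zero[rotated, OF bexI]) simp_all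
qed

lemma box_test_tendsto:
  assumes M: "valid_domain M" and ab: "inner_box M a b" and x: "x \<in> cell M"
  shows "(\<lambda>k. box_test M a b k x) \<longlonglongrightarrow> indicator (box a b) x"
proof (cases "x \<in> box a b")
  case True
  have "(\<lambda>k. bump 0 (real (Suc k) * wall M a b i x)) \<longlonglongrightarrow> 1" for i
  proof -
    have w: "wall M a b i x > 0" using wall_pos_iff[OF M ab x, of i] True by (simp add: mem_box_cart)
    have "(\<lambda>k. exp (- ((1 / wall M a b i x) * (1 / real (Suc k))))) \<longlonglongrightarrow> exp (- ((1 / wall M a b i x) * 0))"
      using LIMSEQ_inverse_real_of_nat by (intro tendsto_exp tendsto_minus tendsto_mult tendsto_const) (simp add: inverse_eq_divide)
    moreover have "bump 0 (real (Suc k) * wall M a b i x) = exp (- ((1 / wall M a b i x) * (1 / real (Suc k))))" for k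
      using w by (simp add: bump_def mult.commute)
    ultimately show ?thesis by simp
  qed
  then have "(\<lambda>k. box_test M a b k x) \<longlonglongrightarrow> (\<Prod>i\<in>(UNIV :: 'a set). 1)" unfolding box_test_def by (rule tendsto_prod)
  then show ?thesis using True by simp
next
  case False
  then show ?thesis using box_test_outside[OF M ab x False] by simp
qed

lemma box_test_test_function:
  assumes M: "valid_domain M" and ab: "inner_box M a b"
  shows "test_function M (box_test M a b k)"
  unfolding test_function_def
proof (intro conjI allI impI)
  have "(\<lambda>x. \<Prod>i\<in>UNIV. bump 0 (real (Suc k) * wall M a b i x)) \<in> smooth_class"
    by (rule smooth_class_prod) (auto intro!: smooth_class.bump smooth_class.mult smooth_class.const wall_smooth simp del: of_nat_Suc)
  then show "Ck j (box_test M a b k)" for j unfolding box_test_def[abs_def] by (rule smooth_class_Ck)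
  show "lives_on M (box_test M a b k)"
  proof (cases M)
    case (Torus L)
    then have L: "L > 0" using M by (auto simp: valid_domain_def)
    have "wall M a b i (x + axis j L) = wall M a b i x" for i j x
    proof (cases "i = j")
      case True
      have "pi / L * ((x + axis j L) $ i - a $ i) = pi / L * (x $ i - a $ i) + pi"
        using True L by (simp add: axis_def algebra_simps)
      moreover have "pi / L * (b $ i - (x + axis j L) $ i) = pi / L * (b $ i - x $ i) - pi"
        using True L by (simp add: axis_def algebra_simps)
      ultimately show ?thesis unfolding wall_def Torus by (simp add: sin_diff)
    next
      case False
      then have e: "(x + axis j L) $ i = x $ i" by (simp add: axis_def)
      show ?thesis unfolding wall_def e ..
    qed
    then show ?thesis unfolding lives_on_def box_test_def Torus by simp
  qed (simp add: lives_on_def)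
  assume W: "M = Whole_Space"
  have "box_test M a b k x = 0" if "x \<notin> cbox a b" for x
    by (rule box_test_outside[OF M ab]) (use that box_subset_cbox in \<open>auto simp: W cell_def\<close>)
  then show "\<exists>K. compact K \<and> (\<forall>x. x \<notin> K \<longrightarrow> box_test M a b k x = 0)" using compact_cbox by blast
qed

text \<open>The positive and negative parts of q on the reference box are densities of two finite
  measures. They agree on boxes, a generator stable under intersection, hence everywhere, and
  uniqueness of densities forces q to vanish.\<close>

lemma ae_zero_from_boxes:
  fixes q :: "real ^ 'n::finite \<Rightarrow> real"
  assumes q[measurable]: "q \<in> borel_measurable borel"
    and I: "integrable lborel (\<lambda>x. indicat_real (box c d) x * q x)"
    and z: "\<And>a b. (\<And>i. a $ i < b $ i) \<Longrightarrow> (\<And>i. c $ i \<le> a $ i) \<Longrightarrow> (\<And>i. b $ i \<le> d $ i) \<Longrightarrow>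
       (LINT x|lborel. indicat_real (box a b) x * q x) = 0"
  shows "AE x in lborel. x \<in> box c d \<longrightarrow> q x = 0"
proof -
  define p where "p = (\<lambda>x. indicat_real (box c d) x * q x)"
  have [measurable]: "p \<in> borel_measurable borel" unfolding p_def by measurable
  have pI: "integrable lborel p" unfolding p_def by (rule I)
  have zX: "(LINT x|lborel. indicat_real (box a b) x * p x) = 0" for a b
  proof -
    \<comment> \<open>A box that leaves the reference box is intersected with it, so that the
      hypothesis on inner boxes covers all boxes.\<close>
    define a' where "a' = (\<chi> i. max (a $ i) (c $ i))"
    define b' where "b' = (\<chi> i. min (b $ i) (d $ i))"
    have bx: "x \<in> box a b \<and> x \<in> box c d \<longleftrightarrow> x \<in> box a' b'" for x
      by (auto simp: mem_box_cart a'_def b'_def)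
    have e: "indicat_real (box a b) x * p x = indicat_real (box a' b') x * q x" for x
      using bx[of x] by (auto simp: p_def indicator_def)
    show ?thesis
    proof (cases "\<forall>i. a' $ i < b' $ i")
      case True
      show ?thesis unfolding e by (rule z) (use True in \<open>auto simp: a'_def b'_def\<close>)
    next
      case False
      then obtain i where "b' $ i \<le> a' $ i" by (auto simp: not_less)
      then have "x \<notin> box a' b'" for x using less_trans[of "a' $ i" "x $ i" "b' $ i"] unfolding mem_box_cart by (meson leD)
      then show ?thesis unfolding e by simp
    qed
  qed
  have "density lborel (\<lambda>x. ennreal (p x)) = density lborel (\<lambda>x. ennreal (- p x))" (is "?D1 = ?D2")
  proof (rule measure_eqI_generator_eq)
    let ?E = "range (\<lambda>(a, b). box a b :: (real ^ 'n) set)"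
    show "Int_stable ?E" by (auto simp: Int_stable_def box_Int_box)
    show "?E \<subseteq> Pow UNIV" by simp
    show "sets ?D1 = sigma_sets UNIV ?E" "sets ?D2 = sigma_sets UNIV ?E" by (simp_all add: borel_eq_box)
    let ?A = "\<lambda>n::nat. box (- (real n *\<^sub>R One)) (real n *\<^sub>R One) :: (real ^ 'n) set"
    show "range ?A \<subseteq> ?E" "(\<Union>i. ?A i) = UNIV" unfolding UN_box_eq_UNIV by auto
    have fin: "(\<integral>\<^sup>+x. ennreal (p x) \<partial>lborel) < \<infinity>"
    proof -
      have "(\<integral>\<^sup>+x. ennreal (p x) \<partial>lborel) \<le> (\<integral>\<^sup>+x. ennreal (norm (p x)) \<partial>lborel)"
        by (rule nn_integral_mono) (auto intro: ennreal_leI)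
      also have "\<dots> < \<infinity>" using pI unfolding integrable_iff_bounded by blast
      finally show ?thesis .
    qed
    show "emeasure ?D1 (?A i) \<noteq> \<infinity>" for i
    proof -
      have "emeasure ?D1 (?A i) \<le> (\<integral>\<^sup>+x. ennreal (p x) \<partial>lborel)"
        by (simp add: emeasure_density) (rule nn_integral_mono, auto simp: indicator_def)
      then show ?thesis using fin by auto
    qed
    fix X assume "X \<in> ?E"
    then obtain a b where X: "X = box a b" by auto
    let ?r = "\<lambda>x. indicat_real (box a b) x * p x"
    have rI: "integrable lborel ?r"
      using integrable_mult_indicator[OF _ pI, of "box a b"] by simp
    have f1: "(\<integral>\<^sup>+x. ennreal (?r x) \<partial>lborel) < \<infinity>" "(\<integral>\<^sup>+x. ennreal (- ?r x) \<partial>lborel) < \<infinity>"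
    proof -
      have b: "(\<integral>\<^sup>+x. ennreal (norm (?r x)) \<partial>lborel) < \<infinity>" using rI unfolding integrable_iff_bounded by blast
      have "(\<integral>\<^sup>+x. ennreal (?r x) \<partial>lborel) \<le> (\<integral>\<^sup>+x. ennreal (norm (?r x)) \<partial>lborel)"
        by (rule nn_integral_mono, rule ennreal_leI) simp
      then show "(\<integral>\<^sup>+x. ennreal (?r x) \<partial>lborel) < \<infinity>" using b by (rule le_less_trans)
      have "(\<integral>\<^sup>+x. ennreal (- ?r x) \<partial>lborel) \<le> (\<integral>\<^sup>+x. ennreal (norm (?r x)) \<partial>lborel)"
        by (rule nn_integral_mono, rule ennreal_leI) simp
      then show "(\<integral>\<^sup>+x. ennreal (- ?r x) \<partial>lborel) < \<infinity>" using b by (rule le_less_trans)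
    qed
    have "enn2real (\<integral>\<^sup>+x. ennreal (?r x) \<partial>lborel) = enn2real (\<integral>\<^sup>+x. ennreal (- ?r x) \<partial>lborel)"
      using zX[of a b] unfolding real_lebesgue_integral_def[OF rI] by simp
    then have "(\<integral>\<^sup>+x. ennreal (?r x) \<partial>lborel) = (\<integral>\<^sup>+x. ennreal (- ?r x) \<partial>lborel)"
      using f1 by (metis ennreal_enn2real infinity_ennreal_def)
    moreover have "emeasure ?D1 X = (\<integral>\<^sup>+x. ennreal (?r x) \<partial>lborel)"
      unfolding X by (simp add: emeasure_density) (rule nn_integral_cong, auto simp: indicator_def)
    moreover have "emeasure ?D2 X = (\<integral>\<^sup>+x. ennreal (- ?r x) \<partial>lborel)"
      unfolding X by (simp add: emeasure_density) (rule nn_integral_cong, auto simp: indicator_def)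
    ultimately show "emeasure ?D1 X = emeasure ?D2 X" by simp
  qed
  then have "AE x in lborel. ennreal (p x) = ennreal (- p x)"
    by (intro sigma_finite_measure.density_unique[OF sigma_finite_lborel]) measurable
  then show ?thesis
  proof eventually_elim
    case (elim x)
    have "p x = 0"
    proof (cases "p x \<ge> 0")
      case True
      then have "ennreal (p x) = 0" using elim by (simp add: ennreal_neg)
      then show ?thesis using True by (simp only: ennreal_eq_0_iff)
    next
      case False
      then have "ennreal (- p x) = 0" using elim[symmetric] by (simp add: ennreal_neg)
      then show ?thesis using False by (simp only: ennreal_eq_0_iff)
    qed
    then show ?case by (auto simp: p_def indicator_def)
  qed
qed

text \<open>The half-open cell and the open box differ only in faces, which lie in such
  hyperplanes.\<close>

lemma AE_coordinate_nonzero: "AE x in lborel. (x :: real ^ 'n::finite) $ i \<noteq> c"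
proof -
  have m: "{x :: real ^ 'n. x $ i = c} \<in> sets borel"
  proof -
    have "(\<lambda>x :: real ^ 'n. x $ i) -` {c} \<inter> space borel \<in> sets borel" by (rule measurable_sets) measurable
    then show ?thesis by (simp add: vimage_def)
  qed
  have "negligible {x :: real ^ 'n. x \<bullet> axis i 1 = c}"
    by (rule negligible_standard_hyperplane) (simp add: axis_in_Basis_iff)
  then have "{x :: real ^ 'n. x $ i = c} \<in> null_sets lebesgue"
    by (simp add: inner_axis negligible_iff_null_sets)
  then have "{x :: real ^ 'n. x $ i = c} \<in> null_sets lborel"
    using m by (simp add: null_sets_completion_iff)
  from AE_not_in[OF this] show ?thesis by simp
qed

text \<open>Test functions with values in [0, 1] that converge to the indicator of a box reduce the
  claim to boxes. Integrability is asked for on balls only, since on the whole space increments of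
  the datum are at first merely known to be bounded.\<close>

lemma fundamental_lemma:
  fixes q :: "real ^ 'n::finite \<Rightarrow> real"
  assumes M: "valid_domain M" and q[measurable]: "q \<in> borel_measurable borel"
    and I: "\<And>R. integrable lborel (\<lambda>x. indicat_real (cell M \<inter> cball 0 R) x * q x)"
    and z: "\<And>\<phi>. test_function M \<phi> \<Longrightarrow> (LINT x|lborel. indicat_real (cell M) x * (q x * \<phi> x)) = 0"
  shows "AE x in lborel. x \<in> cell M \<longrightarrow> q x = 0"
proof -
  have ib: "box a b \<subseteq> cell M" if "inner_box M a b" for a b
    using that by (cases M) (auto simp: inner_box_def cell_def mem_box_cart intro: less_imp_le dest: le_less_trans less_le_trans;
      meson less_imp_le le_less_trans less_le_trans)+
  have box0: "(LINT x|lborel. indicat_real (box a b) x * q x) = 0" if ab: "inner_box M a b" for a b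
  proof -
    obtain R where R: "box a b \<subseteq> cball 0 R" using bounded_subset_ballD[OF bounded_box, of _ _ 0] ball_subset_cball by (metis subset_trans)
    let ?w = "\<lambda>x. \<bar>indicat_real (cell M \<inter> cball 0 R) x * q x\<bar>"
    have "(\<lambda>k. LINT x|lborel. indicat_real (cell M) x * (q x * box_test M a b k x)) \<longlonglongrightarrow> (LINT x|lborel. indicat_real (box a b) x * q x)"
    proof (rule integral_dominated_convergence[where w = ?w])
      show "integrable lborel ?w" by (rule integrable_abs[OF I])
      show "AE x in lborel. (\<lambda>k. indicat_real (cell M) x * (q x * box_test M a b k x)) \<longlonglongrightarrow> indicat_real (box a b) x * q x"
      proof (rule AE_I2)
        fix x
        show "(\<lambda>k. indicat_real (cell M) x * (q x * box_test M a b k x)) \<longlonglongrightarrow> indicat_real (box a b) x * q x"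
        proof (cases "x \<in> cell M")
          case True
          have "(\<lambda>k. indicat_real (cell M) x * (q x * box_test M a b k x)) \<longlonglongrightarrow> indicat_real (cell M) x * (q x * indicat_real (box a b) x)"
            by (intro tendsto_mult tendsto_const box_test_tendsto M ab True)
          then show ?thesis using True by (simp add: mult.commute)
        next
          case False
          then have "x \<notin> box a b" using ib[OF ab] by blast
          then show ?thesis using False by simp
        qed
      qed
      show "AE x in lborel. norm (indicat_real (cell M) x * (q x * box_test M a b k x)) \<le> ?w x" for k
      proof (rule AE_I2)
        fix x
        show "norm (indicat_real (cell M) x * (q x * box_test M a b k x)) \<le> ?w x"
        proof (cases "x \<in> cell M \<and> x \<in> box a b")
          case True
          then have "x \<in> cball 0 R" using R by blast
          then show ?thesis using True mult_left_mono[OF box_test_range(2)[of M a b k x], of "\<bar>q x\<bar>"] box_test_range(1)[of M a b k x]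
            by (simp add: abs_mult)
        next
          case False
          then have "indicat_real (cell M) x * (q x * box_test M a b k x) = 0"
            using box_test_outside[OF M ab, of x k] by (cases "x \<in> cell M") auto
          then show ?thesis by (simp only: norm_zero abs_ge_zero)
        qed
      qed
      note [measurable] = test_function_measurable[OF box_test_test_function[OF M ab]]
      show "(\<lambda>x. indicat_real (cell M) x * (q x * box_test M a b k x)) \<in> borel_measurable lborel" for k by measurable
    qed measurable
    then have "(\<lambda>k. 0) \<longlonglongrightarrow> (LINT x|lborel. indicat_real (box a b) x * q x)"
      by (simp add: z[OF box_test_test_function[OF M ab]])
    then show ?thesis using LIMSEQ_unique[OF tendsto_const] by metis
  qed
  have bI: "integrable lborel (\<lambda>x. indicat_real (box c d) x * q x)" if cd: "box c d \<subseteq> cell M" for c d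
  proof -
    obtain R where R: "box c d \<subseteq> cball 0 R" using bounded_subset_ballD[OF bounded_box, of _ _ 0] ball_subset_cball by (metis subset_trans)
    have "integrable lborel (\<lambda>x. indicat_real (box c d) x *\<^sub>R (indicat_real (cell M \<inter> cball 0 R) x * q x))"
      by (rule integrable_mult_indicator[OF _ I]) simp
    moreover have "indicat_real (box c d) x *\<^sub>R (indicat_real (cell M \<inter> cball 0 R) x * q x) = indicat_real (box c d) x * q x" for x
      using R cd by (auto simp: indicator_def)
    ultimately show ?thesis by (simp only:)
  qed
  show ?thesis
  proof (cases M)
    case Whole_Space
    have "AE x in lborel. \<forall>n::nat. x \<in> box (- (real n *\<^sub>R One)) (real n *\<^sub>R One) \<longrightarrow> q x = 0"
      unfolding AE_all_countable
    proof
      fix n :: nat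
      show "AE x in lborel. x \<in> box (- (real n *\<^sub>R One)) (real n *\<^sub>R One) \<longrightarrow> q x = 0"
        by (rule ae_zero_from_boxes[OF q bI box0]) (auto simp: cell_def Whole_Space inner_box_def)
    qed
    then show ?thesis
    proof eventually_elim
      case (elim x)
      have "x \<in> (\<Union>n::nat. box (- (real n *\<^sub>R One)) (real n *\<^sub>R One))" unfolding UN_box_eq_UNIV by simp
      then show ?case using elim by blast
    qed
  next
    case (Torus L)
    have "AE x in lborel. x \<in> box 0 (\<chi> i. L) \<longrightarrow> q x = 0"
      by (rule ae_zero_from_boxes[OF q bI box0]) (auto simp: cell_def Torus inner_box_def mem_box_cart intro: less_imp_le)
    moreover have "AE x in lborel. \<forall>i. (x :: real ^ 'n) $ i \<noteq> 0"
      unfolding AE_all_countable using AE_coordinate_nonzero by blast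
    ultimately show ?thesis
    proof eventually_elim
      case (elim x)
      show ?case
      proof
        assume "x \<in> cell M"
        then have "0 \<le> x $ i" "x $ i < L" for i by (auto simp: cell_def Torus)
        then have "x \<in> box 0 (\<chi> i. L)" using elim(2) unfolding mem_box_cart
          by (metis less_le vec_lambda_beta zero_index)
        then show "q x = 0" using elim(1) by blast
      qed
    qed
  qed
qed

section \<open>Translates of a function with a weak gradient\<close>

lemma product_integrable:
  fixes f :: "'a::euclidean_space \<Rightarrow> real" and g :: "'b::euclidean_space \<Rightarrow> real"
  assumes f: "integrable lborel f" and g: "integrable lborel g"
  shows "integrable (lborel \<Otimes>\<^sub>M lborel) (\<lambda>(x, y). f x * g y)"
proof (rule lborel_pair.Fubini_integrable)
  have [measurable]: "f \<in> borel_measurable lborel" "g \<in> borel_measurable lborel"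
    using f g by (auto intro: borel_measurable_integrable)
  show "(\<lambda>(x, y). f x * g y) \<in> borel_measurable (lborel \<Otimes>\<^sub>M lborel)" by measurable
  have "integrable lborel (\<lambda>x. \<bar>f x\<bar> * (LINT y|lborel. \<bar>g y\<bar>))" by (intro integrable_mult_left integrable_abs f)
  then show "integrable lborel (\<lambda>x. LINT y|lborel. norm (case (x, y) of (x, y) \<Rightarrow> f x * g y))" by (simp add: abs_mult)
  show "AE x in lborel. integrable lborel (\<lambda>y. case (x, y) of (x, y) \<Rightarrow> f x * g y)"
    using g by (intro AE_I2) simp
qed

text \<open>Tested against \<open>\<phi>\<close>, the increment of \<open>u0\<close> becomes the opposite increment of \<open>\<phi>\<close>, which is the
  integral of a derivative of translates of \<open>\<phi>\<close>; the weak gradient applies to each of these.\<close>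
lemma weak_gradient_translate:
  fixes u0 g :: "real ^ 'n::finite \<Rightarrow> real" and i :: 'n
  assumes M: "valid_domain M" and u[measurable]: "u0 \<in> borel_measurable borel" and m: "\<And>y. \<bar>u0 y\<bar> \<le> m" and pu: "lives_on M u0"
    and g[measurable]: "g \<in> borel_measurable borel" and pg: "lives_on M g" and gI: "integrable lborel (\<lambda>x. indicator (cell M) x * g x)"
    and wk: "\<And>\<phi>. test_function M \<phi> \<Longrightarrow> (LINT x|lborel. indicator (cell M) x * (u0 x * partial_deriv i \<phi> x)) = - (LINT x|lborel. indicator (cell M) x * (g x * \<phi> x))"
  shows "AE x in lborel. x \<in> cell M \<longrightarrow> u0 (x + h *\<^sub>R axis i 1) - u0 x = h * (LINT s|lborel. indicator {0..1} s * g (x + (s * h) *\<^sub>R axis i 1))"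
proof -
  let ?e = "axis i (1::real) :: real ^ 'n" and ?C = "\<lambda>x. indicat_real (cell M) x" and ?J = "\<lambda>s::real. indicat_real {0..1} s"
  have JI: "integrable lborel ?J" by (rule integrable_real_indicator) (simp, simp)
  \<comment> \<open>The average of g over the segment from x to x + h e, which is the candidate for
    the increment divided by h.\<close>
  define r where "r = (\<lambda>x. LINT s|lborel. ?J s * g (x + (s * h) *\<^sub>R ?e))"
  have gm2[measurable]: "(\<lambda>p. g (snd p + (fst p * h) *\<^sub>R ?e)) \<in> borel_measurable (lborel \<Otimes>\<^sub>M lborel)"
  proof -
    have "(\<lambda>p. g (snd p + (fst p * h) *\<^sub>R ?e)) \<in> borel_measurable (borel \<Otimes>\<^sub>M borel)" by measurable
    then show ?thesis by (simp cong: measurable_cong_sets sets_pair_measure_cong)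
  qed
  have rm[measurable]: "r \<in> borel_measurable borel" unfolding r_def by measurable
  have gs: "integrable lborel (\<lambda>x. ?C x * \<bar>g (x + a)\<bar>)" "(LINT x|lborel. ?C x * \<bar>g (x + a)\<bar>) = (LINT x|lborel. ?C x * \<bar>g x\<bar>)" for a
  proof -
    have "integrable lborel (\<lambda>x. ?C x * \<bar>g x\<bar>)" using integrable_abs[OF gI] by (simp add: abs_mult)
    from dom_integral_shift[OF M _ lives_on_comp[OF pg] this, of a]
    show "integrable lborel (\<lambda>x. ?C x * \<bar>g (x + a)\<bar>)" "(LINT x|lborel. ?C x * \<bar>g (x + a)\<bar>) = (LINT x|lborel. ?C x * \<bar>g x\<bar>)" by simp_all
  qed
  have FI: "integrable (lborel \<Otimes>\<^sub>M lborel) (\<lambda>(s, x). ?J s * (?C x * g (x + (s * h) *\<^sub>R ?e)))"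
  proof (rule lborel_pair.Fubini_integrable)
    show "(\<lambda>(s, x). ?J s * (?C x * g (x + (s * h) *\<^sub>R ?e))) \<in> borel_measurable (lborel \<Otimes>\<^sub>M lborel)"
      unfolding case_prod_beta' by measurable
    have "(LINT x|lborel. norm (?J s * (?C x * g (x + (s * h) *\<^sub>R ?e)))) = ?J s * (LINT x|lborel. ?C x * \<bar>g x\<bar>)" for s
      unfolding gs(2)[of "(s * h) *\<^sub>R ?e", symmetric] by (simp add: abs_mult)
    then show "integrable lborel (\<lambda>s. LINT x|lborel. norm (case (s, x) of (s, x) \<Rightarrow> ?J s * (?C x * g (x + (s * h) *\<^sub>R ?e))))"
      using JI by simp
    show "AE s in lborel. integrable lborel (\<lambda>x. case (s, x) of (s, x) \<Rightarrow> ?J s * (?C x * g (x + (s * h) *\<^sub>R ?e)))"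
      using dom_integral_shift(1)[OF M g pg gI] by (intro AE_I2) simp
  qed
  have rI: "integrable lborel (\<lambda>x. ?C x * r x)"
  proof -
    have "integrable lborel (\<lambda>x. LINT s|lborel. ?J s * (?C x * g (x + (s * h) *\<^sub>R ?e)))"
      by (rule lborel_pair.integrable_snd[OF FI])
    moreover have "(LINT s|lborel. ?J s * (?C x * g (x + (s * h) *\<^sub>R ?e))) = ?C x * r x" for x
      unfolding r_def integral_mult_right_zero[symmetric] by (simp only: mult_ac)
    ultimately show ?thesis by simp
  qed
  define q where "q = (\<lambda>x. u0 (x + h *\<^sub>R ?e) - u0 x - h * r x)"
  have "AE x in lborel. x \<in> cell M \<longrightarrow> q x = 0"
  proof (rule fundamental_lemma[OF M])
    show "q \<in> borel_measurable borel" unfolding q_def by measurable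
    fix R :: real
    have [measurable]: "cball (0 :: real ^ 'n) R \<in> sets borel" by simp
    have [measurable]: "(\<lambda>x. u0 (x + h *\<^sub>R ?e)) \<in> borel_measurable borel" by measurable
    have I1: "integrable lborel (\<lambda>x. indicat_real (cball 0 R) x *\<^sub>R (?C x * r x))" by (rule integrable_mult_indicator[OF _ rI]) simp
    have I2: "integrable lborel (\<lambda>x. indicat_real (cell M \<inter> cball 0 R) x * (u0 (x + h *\<^sub>R ?e) - u0 x))"
    proof (rule integrable_dominated)
      show "integrable lborel (\<lambda>x. (m + m) * indicat_real (cball 0 R :: (real ^ 'n) set) x)"
        by (intro integrable_mult_right integrable_real_indicator) (use emeasure_compact_finite[OF compact_cball] in simp_all)
      show "norm (indicat_real (cell M \<inter> cball 0 R) x * (u0 (x + h *\<^sub>R ?e) - u0 x)) \<le> (m + m) * indicat_real (cball 0 R) x" for x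
        using order_trans[OF abs_triangle_ineq4 add_mono[OF m[of "x + h *\<^sub>R ?e"] m[of x]]] order_trans[OF abs_ge_zero m[of x]] by (auto simp: indicator_def)
    qed measurable
    have "integrable lborel (\<lambda>x. indicat_real (cell M \<inter> cball 0 R) x * (u0 (x + h *\<^sub>R ?e) - u0 x) - h * (indicat_real (cball 0 R) x *\<^sub>R (?C x * r x)))"
      by (rule Bochner_Integration.integrable_diff[OF I2 integrable_mult_right[OF I1]])
    moreover have "indicat_real (cell M \<inter> cball 0 R) x * (u0 (x + h *\<^sub>R ?e) - u0 x) - h * (indicat_real (cball 0 R) x *\<^sub>R (?C x * r x))
       = indicat_real (cell M \<inter> cball 0 R) x * q x" for x by (auto simp: indicator_def q_def)
    ultimately show "integrable lborel (\<lambda>x. indicat_real (cell M \<inter> cball 0 R) x * q x)" by simp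
  next
    fix \<phi> :: "real ^ 'n \<Rightarrow> real" assume \<phi>: "test_function M \<phi>"
    let ?d = "partial_deriv i \<phi>"
    note \<phi>d = test_function_partial[OF \<phi>, of i]
    note [measurable] = test_function_measurable[OF \<phi>] test_function_measurable[OF \<phi>d]
    obtain c where c: "c \<ge> 0" "\<And>x. \<bar>\<phi> x\<bar> \<le> c" using test_function_bounded[OF M \<phi>] by blast
    have gb: "integrable lborel (\<lambda>x. ?C x * (g x * \<psi> x))" if [measurable]: "\<psi> \<in> borel_measurable borel" and b: "\<And>x. \<bar>\<psi> x\<bar> \<le> c" for \<psi>
    proof (rule integrable_dominated)
      show "integrable lborel (\<lambda>x. c * \<bar>?C x * g x\<bar>)" by (intro integrable_mult_right integrable_abs gI)
      show "norm (?C x * (g x * \<psi> x)) \<le> c * \<bar>?C x * g x\<bar>" for x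
        using mult_left_mono[OF b[of x] abs_ge_zero[of "?C x * g x"]] by (simp only: real_norm_def abs_mult mult_ac)
    qed measurable
    have FI\<phi>: "integrable (lborel \<Otimes>\<^sub>M lborel) (\<lambda>(s, x). ?J s * (?C x * (g (x + (s * h) *\<^sub>R ?e) * \<phi> x)))"
    proof (rule integrable_dominated)
      show "integrable (lborel \<Otimes>\<^sub>M lborel) (\<lambda>p. c * norm (case p of (s, x) \<Rightarrow> ?J s * (?C x * g (x + (s * h) *\<^sub>R ?e))))"
        by (intro integrable_mult_right integrable_norm FI)
      show "norm (case p of (s, x) \<Rightarrow> ?J s * (?C x * (g (x + (s * h) *\<^sub>R ?e) * \<phi> x))) \<le> c * norm (case p of (s, x) \<Rightarrow> ?J s * (?C x * g (x + (s * h) *\<^sub>R ?e)))" for p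
      proof (cases p)
        case (Pair s x)
        show ?thesis unfolding Pair using mult_left_mono[OF c(2)[of x] abs_ge_zero[of "?J s * (?C x * g (x + (s * h) *\<^sub>R ?e))"]]
          by (simp only: prod.case real_norm_def abs_mult mult_ac)
      qed
      show "(\<lambda>(s, x). ?J s * (?C x * (g (x + (s * h) *\<^sub>R ?e) * \<phi> x))) \<in> borel_measurable (lborel \<Otimes>\<^sub>M lborel)"
        unfolding case_prod_beta' by measurable
    qed
    have \<phi>s: "test_function M (\<lambda>x. \<phi> (x + a))" for a by (rule test_function_shift[OF \<phi>])
    have A: "integrable lborel (\<lambda>x. ?C x * (u0 (x + h *\<^sub>R ?e) * \<phi> x))"
      "(LINT x|lborel. ?C x * (u0 (x + h *\<^sub>R ?e) * \<phi> x)) = (LINT x|lborel. ?C x * (u0 x * \<phi> (x + - (h *\<^sub>R ?e))))"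
    proof -
      have I2: "integrable lborel (\<lambda>x. ?C x * (u0 x * \<phi> (x + - (h *\<^sub>R ?e))))" by (rule integrable_bounded_times_test[OF M \<phi>s u m])
      have "integrable lborel (\<lambda>x. ?C x * (u0 (x + h *\<^sub>R ?e) * \<phi> (x + h *\<^sub>R ?e + - (h *\<^sub>R ?e))))"
        "(LINT x|lborel. ?C x * (u0 (x + h *\<^sub>R ?e) * \<phi> (x + h *\<^sub>R ?e + - (h *\<^sub>R ?e)))) = (LINT x|lborel. ?C x * (u0 x * \<phi> (x + - (h *\<^sub>R ?e))))"
        by (rule dom_integral_shift[OF M _ lives_on_comp2[OF pu test_function_lives_on[OF \<phi>s]] I2], measurable)+
      then show "integrable lborel (\<lambda>x. ?C x * (u0 (x + h *\<^sub>R ?e) * \<phi> x))"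
        "(LINT x|lborel. ?C x * (u0 (x + h *\<^sub>R ?e) * \<phi> x)) = (LINT x|lborel. ?C x * (u0 x * \<phi> (x + - (h *\<^sub>R ?e))))" by simp_all
    qed
    \<comment> \<open>The fundamental theorem of calculus is applied to the smooth \<phi>, never to
      u0 or g.\<close>
    have B: "\<phi> (x + - (h *\<^sub>R ?e)) - \<phi> x = - h * (LINT s|lborel. ?J s * ?d (x + (- s * h) *\<^sub>R ?e))" for x
    proof -
      have "(LINT s|lborel. (- h * ?d (x + (- s * h) *\<^sub>R ?e)) * indicator {0..1} s) = \<phi> (x + (- 1 * h) *\<^sub>R ?e) - \<phi> (x + (- 0 * h) *\<^sub>R ?e)"
      proof (rule integral_FTC_Icc_real)
        fix s :: real
        have l: "((\<lambda>s. - s * h) has_real_derivative - h) (at s)" by (auto intro!: derivative_eq_intros)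
        have "((\<lambda>s. \<phi> (x + (- s * h) *\<^sub>R ?e)) has_real_derivative ?d (x + (- s * h) *\<^sub>R ?e) * (- h)) (at s)"
          by (rule DERIV_chain2[OF partial_deriv_line[OF test_function_differentiable[OF \<phi>]] l])
        then show "((\<lambda>s. \<phi> (x + (- s * h) *\<^sub>R ?e)) has_real_derivative - h * ?d (x + (- s * h) *\<^sub>R ?e)) (at s)" by (simp add: mult.commute)
        have "isCont ?d y" for y
          using test_function_continuous[OF \<phi>d] by (simp add: continuous_on_eq_continuous_at)
        then show "isCont (\<lambda>s. - h * ?d (x + (- s * h) *\<^sub>R ?e)) s"
          by (intro continuous_intros isCont_o2[of s "\<lambda>s. x + (- s * h) *\<^sub>R ?e" ?d])
      qed simp
      moreover have "(LINT s|lborel. (- h * ?d (x + (- s * h) *\<^sub>R ?e)) * indicator {0..1} s) = - h * (LINT s|lborel. ?J s * ?d (x + (- s * h) *\<^sub>R ?e))"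
        unfolding integral_mult_right_zero[symmetric] by (simp only: mult_ac)
      ultimately show ?thesis by simp
    qed
    have FIu: "integrable (lborel \<Otimes>\<^sub>M lborel) (\<lambda>(s, x). ?J s * (?C x * (u0 x * ?d (x + (- s * h) *\<^sub>R ?e))))"
    proof -
      obtain w where w: "integrable lborel w" "\<And>x s. \<bar>s\<bar> \<le> 1 \<Longrightarrow> \<bar>?C x * ?d (x + s *\<^sub>R (h *\<^sub>R ?e))\<bar> \<le> w x"
        using test_function_dominated[OF M \<phi>d, of "h *\<^sub>R ?e"] by blast
      show ?thesis
      proof (rule integrable_dominated)
        show "integrable (lborel \<Otimes>\<^sub>M lborel) (\<lambda>p. m * (case p of (s, x) \<Rightarrow> ?J s * w x))"
          by (rule integrable_mult_right, rule product_integrable[OF JI w(1)])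
        show "norm (case p of (s, x) \<Rightarrow> ?J s * (?C x * (u0 x * ?d (x + (- s * h) *\<^sub>R ?e)))) \<le> m * (case p of (s, x) \<Rightarrow> ?J s * w x)" for p
        proof (cases p)
          case (Pair s x)
          show ?thesis
          proof (cases "s \<in> {0..1}")
            case True
            have "\<bar>u0 x\<bar> * \<bar>?C x * ?d (x + (- s) *\<^sub>R (h *\<^sub>R ?e))\<bar> \<le> m * w x"
              by (rule mult_mono[OF m w(2)]) (use True m[of 0] in auto)
            then show ?thesis unfolding Pair using True by (simp add: abs_mult mult.left_commute[of "\<bar>u0 x\<bar>"])
          qed (simp add: Pair)
        qed
        have "(\<lambda>p. ?d (snd p + (- fst p * h) *\<^sub>R ?e)) \<in> borel_measurable (borel \<Otimes>\<^sub>M borel)" by measurable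
        then have [measurable]: "(\<lambda>p. ?d (snd p + (- fst p * h) *\<^sub>R ?e)) \<in> borel_measurable (lborel \<Otimes>\<^sub>M lborel)"
          by (simp cong: measurable_cong_sets sets_pair_measure_cong)
        show "(\<lambda>(s, x). ?J s * (?C x * (u0 x * ?d (x + (- s * h) *\<^sub>R ?e)))) \<in> borel_measurable (lborel \<Otimes>\<^sub>M lborel)"
          unfolding case_prod_beta' by measurable
      qed
    qed
    \<comment> \<open>For fixed s the derivative falls on a translated test function. After the weak
      gradient has been applied, the translation moves back to g with the opposite sign.\<close>
    have D: "(LINT x|lborel. ?C x * (u0 x * ?d (x + (- s * h) *\<^sub>R ?e))) = - (LINT x|lborel. ?C x * (g (x + (s * h) *\<^sub>R ?e) * \<phi> x))" for s
    proof -
      let ?a = "(- s * h) *\<^sub>R ?e"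
      have "(LINT x|lborel. ?C x * (u0 x * ?d (x + ?a))) = (LINT x|lborel. ?C x * (u0 x * partial_deriv i (\<lambda>x. \<phi> (x + ?a)) x))"
        unfolding partial_deriv_shift(1)[OF test_function_differentiable[OF \<phi>]] ..
      also have "\<dots> = - (LINT x|lborel. ?C x * (g x * \<phi> (x + ?a)))" by (rule wk[OF \<phi>s])
      also have "(LINT x|lborel. ?C x * (g x * \<phi> (x + ?a))) = (LINT x|lborel. ?C x * (g (x + (s * h) *\<^sub>R ?e) * \<phi> (x + (s * h) *\<^sub>R ?e + ?a)))"
        by (rule dom_integral_shift(2)[OF M _ lives_on_comp2[OF pg test_function_lives_on[OF \<phi>s]] gb, symmetric]) (measurable, use c in auto)
      finally show ?thesis by simp
    qed
    have I1: "integrable lborel (\<lambda>x. ?C x * (u0 x * \<phi> x))" by (rule integrable_bounded_times_test[OF M \<phi> u m])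
    have I2: "integrable lborel (\<lambda>x. ?C x * (u0 x * \<phi> (x + - (h *\<^sub>R ?e))))" by (rule integrable_bounded_times_test[OF M \<phi>s u m])
    have I3: "integrable lborel (\<lambda>x. ?C x * (r x * \<phi> x))"
    proof (rule integrable_dominated)
      show "integrable lborel (\<lambda>x. c * \<bar>?C x * r x\<bar>)" by (intro integrable_mult_right integrable_abs rI)
      show "norm (?C x * (r x * \<phi> x)) \<le> c * \<bar>?C x * r x\<bar>" for x
        using mult_left_mono[OF c(2)[of x] abs_ge_zero[of "?C x * r x"]] by (simp only: real_norm_def abs_mult mult_ac)
    qed measurable
    have "(LINT x|lborel. ?C x * (u0 x * \<phi> (x + - (h *\<^sub>R ?e)))) - (LINT x|lborel. ?C x * (u0 x * \<phi> x))
        = (LINT x|lborel. ?C x * (u0 x * \<phi> (x + - (h *\<^sub>R ?e))) - ?C x * (u0 x * \<phi> x))"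
      by (rule Bochner_Integration.integral_diff[OF I2 I1, symmetric])
    also have "\<dots> = (LINT x|lborel. - h * (LINT s|lborel. ?J s * (?C x * (u0 x * ?d (x + (- s * h) *\<^sub>R ?e)))))"
    proof (rule Bochner_Integration.integral_cong)
      fix x
      have "?C x * (u0 x * \<phi> (x + - (h *\<^sub>R ?e))) - ?C x * (u0 x * \<phi> x) = (?C x * u0 x) * (\<phi> (x + - (h *\<^sub>R ?e)) - \<phi> x)"
        by (simp only: right_diff_distrib mult.assoc)
      also have "\<dots> = - h * ((?C x * u0 x) * (LINT s|lborel. ?J s * ?d (x + (- s * h) *\<^sub>R ?e)))" unfolding B by (simp only: mult_ac)
      also have "(?C x * u0 x) * (LINT s|lborel. ?J s * ?d (x + (- s * h) *\<^sub>R ?e)) = (LINT s|lborel. ?J s * (?C x * (u0 x * ?d (x + (- s * h) *\<^sub>R ?e))))"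
        unfolding integral_mult_right_zero[symmetric] by (simp only: mult_ac)
      finally show "?C x * (u0 x * \<phi> (x + - (h *\<^sub>R ?e))) - ?C x * (u0 x * \<phi> x)
         = - h * (LINT s|lborel. ?J s * (?C x * (u0 x * ?d (x + (- s * h) *\<^sub>R ?e))))" .
    qed simp
    also have "\<dots> = - h * (LINT x|lborel. LINT s|lborel. ?J s * (?C x * (u0 x * ?d (x + (- s * h) *\<^sub>R ?e))))" by (rule integral_mult_right_zero)
    also have "(LINT x|lborel. LINT s|lborel. ?J s * (?C x * (u0 x * ?d (x + (- s * h) *\<^sub>R ?e))))
       = (LINT s|lborel. LINT x|lborel. ?J s * (?C x * (u0 x * ?d (x + (- s * h) *\<^sub>R ?e))))"
      by (rule lborel_pair.Fubini_integral[OF FIu])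
    also have "\<dots> = (LINT s|lborel. - (LINT x|lborel. ?J s * (?C x * (g (x + (s * h) *\<^sub>R ?e) * \<phi> x))))"
      unfolding integral_mult_right_zero D by (simp only: mult_minus_right)
    also have "\<dots> = - (LINT s|lborel. LINT x|lborel. ?J s * (?C x * (g (x + (s * h) *\<^sub>R ?e) * \<phi> x)))"
      by (rule Bochner_Integration.integral_minus)
    also have "(LINT s|lborel. LINT x|lborel. ?J s * (?C x * (g (x + (s * h) *\<^sub>R ?e) * \<phi> x)))
       = (LINT x|lborel. LINT s|lborel. ?J s * (?C x * (g (x + (s * h) *\<^sub>R ?e) * \<phi> x)))"
      by (rule lborel_pair.Fubini_integral[OF FI\<phi>, symmetric])
    also have "\<dots> = (LINT x|lborel. ?C x * (r x * \<phi> x))"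
    proof (rule Bochner_Integration.integral_cong)
      fix x
      have "(LINT s|lborel. ?J s * (?C x * (g (x + (s * h) *\<^sub>R ?e) * \<phi> x))) = (LINT s|lborel. (?C x * \<phi> x) * (?J s * g (x + (s * h) *\<^sub>R ?e)))"
        by (simp only: mult_ac)
      also have "\<dots> = (?C x * \<phi> x) * r x" unfolding r_def by (rule integral_mult_right_zero)
      finally show "(LINT s|lborel. ?J s * (?C x * (g (x + (s * h) *\<^sub>R ?e) * \<phi> x))) = ?C x * (r x * \<phi> x)" by (simp only: mult_ac)
    qed simp
    finally have E: "(LINT x|lborel. ?C x * (u0 x * \<phi> (x + - (h *\<^sub>R ?e)))) - (LINT x|lborel. ?C x * (u0 x * \<phi> x)) = h * (LINT x|lborel. ?C x * (r x * \<phi> x))"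
      by simp
    have "?C x * (q x * \<phi> x) = (?C x * (u0 (x + h *\<^sub>R ?e) * \<phi> x) - ?C x * (u0 x * \<phi> x)) - h * (?C x * (r x * \<phi> x))" for x
      unfolding q_def by (simp add: algebra_simps)
    then have "(LINT x|lborel. ?C x * (q x * \<phi> x)) = ((LINT x|lborel. ?C x * (u0 (x + h *\<^sub>R ?e) * \<phi> x)) - (LINT x|lborel. ?C x * (u0 x * \<phi> x))) - h * (LINT x|lborel. ?C x * (r x * \<phi> x))"
      using Bochner_Integration.integral_diff[OF Bochner_Integration.integrable_diff[OF A(1) I1] integrable_mult_right[OF I3, of h]]
        Bochner_Integration.integral_diff[OF A(1) I1] by (simp add: integral_mult_right_zero)
    then show "(LINT x|lborel. ?C x * (q x * \<phi> x)) = 0" unfolding A(2) E by simp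
  qed
  then show ?thesis by eventually_elim (simp add: q_def r_def)
qed

text \<open>The increment is h times an average of translates of g. Translation invariance in each
  slice gives the bound for the mean, and Cauchy-Schwarz on [0, 1], which has mass 1, the one for
  the mean square.\<close>

lemma weak_gradient_dint:
  fixes u0 g :: "real ^ 'n::finite \<Rightarrow> real" and i :: 'n
  assumes M: "valid_domain M" and u: "u0 \<in> borel_measurable borel" and m: "\<And>y. \<bar>u0 y\<bar> \<le> m" and pu: "lives_on M u0"
    and g[measurable]: "g \<in> borel_measurable borel" and pg: "lives_on M g" and gI: "integrable lborel (\<lambda>x. indicator (cell M) x * g x)"
    and wk: "\<And>\<phi>. test_function M \<phi> \<Longrightarrow> (LINT x|lborel. indicator (cell M) x * (u0 x * partial_deriv i \<phi> x)) = - (LINT x|lborel. indicator (cell M) x * (g x * \<phi> x))"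
    and h: "h \<ge> 0"
  shows "dint M (\<lambda>x. ennreal \<bar>u0 (x + h *\<^sub>R axis i 1) - u0 x\<bar>) \<le> ennreal h * dint M (\<lambda>x. ennreal \<bar>g x\<bar>)"
    and "dint M (\<lambda>x. ennreal ((u0 (x + h *\<^sub>R axis i 1) - u0 x)\<^sup>2)) \<le> ennreal (h\<^sup>2) * dint M (\<lambda>x. ennreal ((g x)\<^sup>2))"
proof -
  let ?e = "axis i (1::real) :: real ^ 'n" and ?J = "\<lambda>s::real. indicat_real {0..1} s"
  define S where "S = (\<lambda>x. \<integral>\<^sup>+s. ennreal (?J s * \<bar>g (x + (s * h) *\<^sub>R ?e)\<bar>) \<partial>lborel)"
  have gsm: "(\<lambda>s. g (x + (s * h) *\<^sub>R ?e)) \<in> borel_measurable lborel" for x by measurable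
  have tr: "AE x in lborel. x \<in> cell M \<longrightarrow> u0 (x + h *\<^sub>R ?e) - u0 x = h * (LINT s|lborel. ?J s * g (x + (s * h) *\<^sub>R ?e))"
    by (rule weak_gradient_translate[OF M u m pu g pg gI wk])
  have le: "AE x in lborel. x \<in> cell M \<longrightarrow> ennreal \<bar>u0 (x + h *\<^sub>R ?e) - u0 x\<bar> \<le> ennreal h * S x"
    using tr
  proof eventually_elim
    case (elim x)
    have "ennreal \<bar>LINT s|lborel. ?J s * g (x + (s * h) *\<^sub>R ?e)\<bar> \<le> S x"
    \<comment> \<open>Where the slice is not integrable, its integral is 0 by convention and the
      bound is trivial.\<close>
    proof (cases "integrable lborel (\<lambda>s. ?J s * g (x + (s * h) *\<^sub>R ?e))")
      case True
      then show ?thesis using ennreal_le_norm_integral[OF True] by (simp add: S_def abs_mult)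
    next
      case False
      then show ?thesis by (simp add: not_integrable_integral_eq)
    qed
    then have "ennreal h * ennreal \<bar>LINT s|lborel. ?J s * g (x + (s * h) *\<^sub>R ?e)\<bar> \<le> ennreal h * S x" by (rule mult_left_mono) simp
    then show ?case using elim h by (simp add: abs_mult ennreal_mult)
  qed
  have Sm: "(\<lambda>p. ennreal (?J (fst p) * \<bar>g (snd p + (fst p * h) *\<^sub>R ?e)\<bar>)) \<in> borel_measurable (lborel \<Otimes>\<^sub>M borel)"
    and Sm2: "(\<lambda>p. ennreal (?J (fst p) * (g (snd p + (fst p * h) *\<^sub>R ?e))\<^sup>2)) \<in> borel_measurable (lborel \<Otimes>\<^sub>M borel)"
  proof -
    have "(\<lambda>p. ennreal (?J (fst p) * \<bar>g (snd p + (fst p * h) *\<^sub>R ?e)\<bar>)) \<in> borel_measurable (borel \<Otimes>\<^sub>M borel)"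
      "(\<lambda>p. ennreal (?J (fst p) * (g (snd p + (fst p * h) *\<^sub>R ?e))\<^sup>2)) \<in> borel_measurable (borel \<Otimes>\<^sub>M borel)" by measurable
    then show "(\<lambda>p. ennreal (?J (fst p) * \<bar>g (snd p + (fst p * h) *\<^sub>R ?e)\<bar>)) \<in> borel_measurable (lborel \<Otimes>\<^sub>M borel)"
      "(\<lambda>p. ennreal (?J (fst p) * (g (snd p + (fst p * h) *\<^sub>R ?e))\<^sup>2)) \<in> borel_measurable (lborel \<Otimes>\<^sub>M borel)"
      by (simp_all cong: measurable_cong_sets sets_pair_measure_cong)
  qed
  have S_borel[measurable]: "S \<in> borel_measurable borel" unfolding S_def by measurable
  have S2_borel[measurable]: "(\<lambda>x. \<integral>\<^sup>+s. ennreal (?J s * (g (x + (s * h) *\<^sub>R ?e))\<^sup>2) \<partial>lborel) \<in> borel_measurable borel" by measurable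
  have J1: "(\<integral>\<^sup>+s. ennreal (?J s) \<partial>lborel) = 1" by (simp add: ennreal_indicator)
  have slice: "dint M (\<lambda>x. \<integral>\<^sup>+s. ennreal (?J s * \<phi> (g (x + (s * h) *\<^sub>R ?e))) \<partial>lborel) = dint M (\<lambda>x. ennreal (\<phi> (g x)))"
    if [measurable]: "\<phi> \<in> borel_measurable borel" and \<phi>0: "\<And>r. \<phi> r \<ge> 0"
      and m2: "(\<lambda>p. ennreal (?J (fst p) * \<phi> (g (snd p + (fst p * h) *\<^sub>R ?e)))) \<in> borel_measurable (lborel \<Otimes>\<^sub>M borel)" for \<phi>
  proof -
    have "dint M (\<lambda>x. \<integral>\<^sup>+s. ennreal (?J s * \<phi> (g (x + (s * h) *\<^sub>R ?e))) \<partial>lborel) = (\<integral>\<^sup>+s. dint M (\<lambda>x. ennreal (?J s * \<phi> (g (x + (s * h) *\<^sub>R ?e)))) \<partial>lborel)"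
      by (rule dint_nn_integral[OF sigma_finite_lborel m2])
    also have "\<dots> = (\<integral>\<^sup>+s. ennreal (?J s) * dint M (\<lambda>x. ennreal (\<phi> (g x))) \<partial>lborel)"
    proof (rule nn_integral_cong)
      fix s
      have "dint M (\<lambda>x. ennreal (?J s * \<phi> (g (x + (s * h) *\<^sub>R ?e)))) = ennreal (?J s) * dint M (\<lambda>x. ennreal (\<phi> (g (x + (s * h) *\<^sub>R ?e))))"
        unfolding ennreal_mult[OF indicator_pos_le \<phi>0] by (rule dint_cmult) measurable
      also have "dint M (\<lambda>x. ennreal (\<phi> (g (x + (s * h) *\<^sub>R ?e)))) = dint M (\<lambda>x. ennreal (\<phi> (g x)))"
        by (rule dint_shift[OF M _ lives_on_comp[OF pg]]) measurable
      finally show "dint M (\<lambda>x. ennreal (?J s * \<phi> (g (x + (s * h) *\<^sub>R ?e)))) = ennreal (?J s) * dint M (\<lambda>x. ennreal (\<phi> (g x)))" .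
    qed
    also have "\<dots> = dint M (\<lambda>x. ennreal (\<phi> (g x)))" by (subst nn_integral_multc) (simp_all add: J1)
    finally show ?thesis .
  qed
  have dle: "dint M f1 \<le> dint M f2" if "AE x in lborel. x \<in> cell M \<longrightarrow> f1 x \<le> f2 x" for f1 f2
    unfolding dint_def
  proof (rule nn_integral_mono_AE)
    show "AE x in lborel. f1 x * indicator (cell M) x \<le> f2 x * indicator (cell M) x"
      using that by eventually_elim (auto simp: indicator_def)
  qed
  have "dint M (\<lambda>x. ennreal \<bar>u0 (x + h *\<^sub>R ?e) - u0 x\<bar>) \<le> dint M (\<lambda>x. ennreal h * S x)" by (rule dle[OF le])
  also have "\<dots> = ennreal h * dint M S" by (rule dint_cmult) measurable
  also have "dint M S = dint M (\<lambda>x. ennreal \<bar>g x\<bar>)" unfolding S_def using slice[of abs] Sm by simp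
  finally show "dint M (\<lambda>x. ennreal \<bar>u0 (x + h *\<^sub>R ?e) - u0 x\<bar>) \<le> ennreal h * dint M (\<lambda>x. ennreal \<bar>g x\<bar>)" .
  have "dint M (\<lambda>x. ennreal ((u0 (x + h *\<^sub>R ?e) - u0 x)\<^sup>2)) \<le> dint M (\<lambda>x. ennreal (h\<^sup>2) * (\<integral>\<^sup>+s. ennreal (?J s * (g (x + (s * h) *\<^sub>R ?e))\<^sup>2) \<partial>lborel))"
  proof (rule dle)
    show "AE x in lborel. x \<in> cell M \<longrightarrow> ennreal ((u0 (x + h *\<^sub>R ?e) - u0 x)\<^sup>2) \<le> ennreal (h\<^sup>2) * (\<integral>\<^sup>+s. ennreal (?J s * (g (x + (s * h) *\<^sub>R ?e))\<^sup>2) \<partial>lborel)"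
      using le
    proof eventually_elim
      case (elim x)
      show ?case
      proof
        assume "x \<in> cell M"
        then have "(ennreal \<bar>u0 (x + h *\<^sub>R ?e) - u0 x\<bar>)\<^sup>2 \<le> (ennreal h * S x)\<^sup>2" using elim by (intro power_mono) auto
        also have "\<dots> = ennreal (h\<^sup>2) * (S x)\<^sup>2" using h by (simp add: power_mult_distrib ennreal_power)
        also have "\<dots> \<le> ennreal (h\<^sup>2) * ((\<integral>\<^sup>+s. ennreal (?J s) \<partial>lborel) * (\<integral>\<^sup>+s. ennreal (?J s * (g (x + (s * h) *\<^sub>R ?e))\<^sup>2) \<partial>lborel))"
          unfolding S_def by (intro mult_left_mono weighted_Cauchy_Schwarz gsm) auto
        finally show "ennreal ((u0 (x + h *\<^sub>R ?e) - u0 x)\<^sup>2) \<le> ennreal (h\<^sup>2) * (\<integral>\<^sup>+s. ennreal (?J s * (g (x + (s * h) *\<^sub>R ?e))\<^sup>2) \<partial>lborel)"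
          by (simp add: ennreal_power J1)
      qed
    qed
  qed
  also have "\<dots> = ennreal (h\<^sup>2) * dint M (\<lambda>x. \<integral>\<^sup>+s. ennreal (?J s * (g (x + (s * h) *\<^sub>R ?e))\<^sup>2) \<partial>lborel)"
    by (rule dint_cmult) measurable
  also have "dint M (\<lambda>x. \<integral>\<^sup>+s. ennreal (?J s * (g (x + (s * h) *\<^sub>R ?e))\<^sup>2) \<partial>lborel) = dint M (\<lambda>x. ennreal ((g x)\<^sup>2))"
    using slice[of "\<lambda>r. r\<^sup>2"] Sm2 by simp
  finally show "dint M (\<lambda>x. ennreal ((u0 (x + h *\<^sub>R ?e) - u0 x)\<^sup>2)) \<le> ennreal (h\<^sup>2) * dint M (\<lambda>x. ennreal ((g x)\<^sup>2))" .
qed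

section \<open>From solutions to mild solutions with a bounded Lipschitz flux\<close>

text \<open>Local integrability already contains measurability on the whole space, through
  restriction to growing balls.\<close>

lemma locally_integrable_measurable:
  fixes g :: "real ^ 'n::finite \<Rightarrow> 'b::euclidean_space"
  assumes "locally_integrable g"
  shows "g \<in> borel_measurable borel"
proof (rule borel_measurable_LIMSEQ_metric)
  fix k :: nat
  have "integrable lborel (\<lambda>x. indicat_real (cball 0 (real k)) x *\<^sub>R g x)"
    using assms unfolding locally_integrable_def set_integrable_def by simp
  from borel_measurable_integrable[OF this]
  show "(\<lambda>x. indicat_real (cball 0 (real k)) x *\<^sub>R g x) \<in> borel_measurable borel" by simp
next
  fix x :: "real ^ 'n"
  obtain n where n: "norm x \<le> real n" using real_arch_simple by blast
  have "eventually (\<lambda>k. indicat_real (cball 0 (real k)) x *\<^sub>R g x = g x) sequentially"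
    using eventually_ge_at_top[of n] by eventually_elim (use n in \<open>simp add: indicator_def\<close>)
  then show "(\<lambda>k. indicat_real (cball 0 (real k)) x *\<^sub>R g x) \<longlonglongrightarrow> g x" by (rule tendsto_eventually)
qed

text \<open>The estimates concern a representative defined at every point; this transfers them to
  the given solution, which agrees with it only almost everywhere.\<close>

lemma has_weak_gradient_cong_AE:
  fixes u v :: "real ^ 'n::finite \<Rightarrow> real"
  assumes wg: "has_weak_gradient M u Du" and v: "lives_on M v" "v \<in> borel_measurable borel" "AE x in lborel. v x = u x"
  shows "has_weak_gradient M v Du"
proof -
  have lu: "locally_integrable u" using wg by (simp add: has_weak_gradient_def)
  note [measurable] = v(2) locally_integrable_measurable[OF lu]
  have lv: "locally_integrable v"
    unfolding locally_integrable_def set_integrable_def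
  proof (intro allI impI)
    fix K :: "(real ^ 'n) set" assume K: "compact K"
    have [measurable]: "K \<in> sets borel" using K by (simp add: compact_imp_closed borel_closed)
    have "integrable lborel (\<lambda>x. indicat_real K x *\<^sub>R u x)"
      using lu K by (auto simp: locally_integrable_def set_integrable_def)
    then show "integrable lborel (\<lambda>x. indicat_real K x *\<^sub>R v x)"
      by (rule integrable_cong_AE_imp) (measurable, use v(3) in \<open>auto elim: eventually_mono\<close>)
  qed
  have "(LINT x|domain_measure M. v x * partial_deriv i \<phi> x) = (LINT x|domain_measure M. u x * partial_deriv i \<phi> x)"
    if \<phi>: "test_function M \<phi>" for \<phi> i
  proof -
    note [measurable] = test_function_measurable[OF test_function_partial[OF \<phi>, of i]]
    show ?thesis unfolding integral_domain
      by (rule integral_cong_AE) (measurable, use v(3) in \<open>auto elim: eventually_mono\<close>)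
  qed
  then show ?thesis using wg lv v(1) by (simp add: has_weak_gradient_def)
qed

lemma Linf_norm_AE:
  fixes g :: "real ^ 'n::finite \<Rightarrow> 'b::euclidean_space"
  assumes M: "valid_domain M" and per: "lives_on M g" and le: "Linf_norm (domain_measure M) g \<le> ereal c"
  shows "AE x in lborel. norm (g x) \<le> c"
proof (rule AE_periodic[OF M])
  show "lives_on M (\<lambda>x. norm (g x) \<le> c)" by (rule lives_on_comp[OF per])
  have "AE x in domain_measure M. ereal (norm (g x)) \<le> Linf_norm (domain_measure M) g"
    unfolding Linf_norm_def by (rule esssup_AE)
  then show "AE x in domain_measure M. norm (g x) \<le> c"
    by eventually_elim (metis ereal_less_eq(3) le order_trans)
qed

lemma dint_Lp_norm_le_1:
  fixes g :: "real ^ 'n::finite \<Rightarrow> 'b::euclidean_space"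
  assumes g: "in_Lp p (domain_measure M) g" and le: "Lp_norm p (domain_measure M) g \<le> 1" and p: "p > 0"
  shows "dint M (\<lambda>x. ennreal (norm (g x) powr p)) \<le> 1"
proof -
  let ?I = "LINT x|domain_measure M. norm (g x) powr p"
  have I0: "?I \<ge> 0" by (rule Bochner_Integration.integral_nonneg) simp
  have "?I \<le> 1"
  proof (rule ccontr)
    assume "\<not> ?I \<le> 1"
    then have "1 < ?I powr (1 / p)" using p by (intro gr_one_powr) auto
    then show False using le by (simp add: Lp_norm_def)
  qed
  moreover have "dint M (\<lambda>x. ennreal (norm (g x) powr p)) = ennreal ?I"
    unfolding nn_integral_domain[symmetric]
    by (rule nn_integral_eq_integral) (use g in \<open>auto simp: in_Lp_def\<close>)
  ultimately show ?thesis using I0 by simp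
qed

section \<open>Truncation of a locally Lipschitz flux\<close>

definition clip :: "real \<Rightarrow> real \<Rightarrow> real" where
  "clip b r = max (- b) (min b r)"

lemma clip_id: "\<bar>r\<bar> \<le> b \<Longrightarrow> clip b r = r"
  by (auto simp: clip_def)

lemma clip_bound: "b \<ge> 0 \<Longrightarrow> \<bar>clip b r\<bar> \<le> b"
  by (auto simp: clip_def)

lemma clip_diff: "\<bar>clip b r - clip b s\<bar> \<le> \<bar>r - s\<bar>"
  by (auto simp: clip_def max_def min_def)

lemma clip_measurable [measurable]: "clip b \<in> borel_measurable borel"
  unfolding clip_def by measurable

lemma locally_lipschitz_compact:
  assumes f: "locally_lipschitz f" and X: "compact X"
  obtains L where "L-lipschitz_on X f"
proof -
  have "local_lipschitz {0 :: real} X (\<lambda>_. f)"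
    by (rule local_lipschitz_subset[OF f[unfolded locally_lipschitz_def]]) auto
  from local_lipschitz_compact_implies_lipschitz[OF this X compact_sing]
  obtain L where "\<And>t. t \<in> {0 :: real} \<Longrightarrow> L-lipschitz_on X f" by auto
  then show ?thesis using that by blast
qed

text \<open>The infimum is itself an admissible constant, since each single inequality passes to it.
  Compactness makes the set of constants nonempty, without which the real infimum would have no
  meaning.\<close>

lemma lip_norm_lipschitz:
  assumes f: "locally_lipschitz f" and X: "compact X"
  shows "(lip_norm X f)-lipschitz_on X f"
proof -
  obtain L where L: "L-lipschitz_on X f" by (rule locally_lipschitz_compact[OF f X])
  have greatest: "z \<le> lip_norm X f" if "\<And>C. C-lipschitz_on X f \<Longrightarrow> z \<le> C" for z
    unfolding lip_norm_def using L that by (intro cInf_greatest) auto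
  show ?thesis
  proof (rule lipschitz_onI)
    fix x y assume xy: "x \<in> X" "y \<in> X"
    show "dist (f x) (f y) \<le> lip_norm X f * dist x y"
    proof (cases "x = y")
      case False
      have "dist (f x) (f y) / dist x y \<le> lip_norm X f"
        by (rule greatest) (use False xy in \<open>auto simp: divide_le_eq dest: lipschitz_onD\<close>)
      then show ?thesis using False by (simp add: divide_le_eq)
    qed simp
  next
    show "lip_norm X f \<ge> 0" by (rule greatest) (rule lipschitz_on_nonneg)
  qed
qed

text \<open>Clipping is 1-Lipschitz, so the truncated flux inherits L globally, and it is bounded
  because its argument ranges over a bounded interval. The factor c will be 1 / \<nu>.\<close>

lemma flux_clip:
  fixes f :: "real \<Rightarrow> real ^ 'n::finite"
  assumes f: "L-lipschitz_on {-b..b} f" and L: "L > 0" and c: "c > 0" and b: "b \<ge> 0"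
  shows "flux (\<lambda>r. c *\<^sub>R f (clip b r)) (c * L) (c * (norm (f 0) + L * b))"
proof
  have in_range: "clip b r \<in> {-b..b}" for r using clip_bound[OF b, of r] by auto
  show "c * L > 0" using c L by simp
  fix r s
  have "norm (f (clip b r) - f (clip b s)) \<le> L * \<bar>clip b r - clip b s\<bar>"
    using lipschitz_onD[OF f in_range in_range] by (simp add: dist_norm)
  also have "\<dots> \<le> L * \<bar>r - s\<bar>" using clip_diff L by (intro mult_left_mono) auto
  finally have "c * norm (f (clip b r) - f (clip b s)) \<le> c * (L * \<bar>r - s\<bar>)" using c by (intro mult_left_mono) auto
  then show "norm (c *\<^sub>R f (clip b r) - c *\<^sub>R f (clip b s)) \<le> c * L * \<bar>r - s\<bar>"
    using c by (simp add: scaleR_diff_right[symmetric] mult.assoc)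
  have "norm (f (clip b r) - f 0) \<le> L * \<bar>clip b r\<bar>"
    using lipschitz_onD[OF f in_range, of 0] b by (simp add: dist_norm)
  also have "\<dots> \<le> L * b" using clip_bound[OF b] L by (intro mult_left_mono) auto
  finally have "norm (f (clip b r)) \<le> norm (f 0) + L * b"
    using norm_triangle_ineq[of "f (clip b r) - f 0" "f 0"] by simp
  then show "norm (c *\<^sub>R f (clip b r)) \<le> c * (norm (f 0) + L * b)" using c by simp
qed

lemma lives_on_heat_op: "lives_on M g \<Longrightarrow> lives_on M (heat_op t g)"
  unfolding lives_on_def by (cases M) (simp_all flip: heat_op_translate)

lemma lives_on_duhamel: "(\<And>s. lives_on M (g s)) \<Longrightarrow> lives_on M (duhamel t g)"
  unfolding lives_on_def by (cases M) (simp_all flip: duhamel_translate)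

lemma grad_op_scaleR: "grad_op t (\<lambda>y. c *\<^sub>R g y) x = c * grad_op t g x"
  by (simp add: grad_op_def)

lemma duhamel_cong_AE:
  assumes g: "\<And>s. g s \<in> borel_measurable borel" "\<And>s. h s \<in> borel_measurable borel"
    and eq: "\<And>s. 0 < s \<Longrightarrow> s < t \<Longrightarrow> AE y in lborel. g s y = h s y"
  shows "duhamel t g x = duhamel t h x"
  unfolding duhamel_def
proof (rule Bochner_Integration.integral_cong)
  fix s
  show "indicator {0<..<t} s * grad_op (t - s) (g s) x = indicator {0<..<t} s * grad_op (t - s) (h s) x"
    by (cases "0 < s \<and> s < t") (auto simp: indicator_def intro!: grad_op_cong_AE g eq)
qed simp

text \<open>Two truncations of the flux: at an a priori bound \<open>b\<close> of the given solution, which makes the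
  theory of \<open>flux\<close> applicable, and then, by the maximum principle, at 1, so that only the
  Lipschitz constant on \<open>[-1, 1]\<close> remains.\<close>
lemma duhamel_solution_mild:
  fixes f :: "real \<Rightarrow> real ^ 'n::finite"
  assumes M: "valid_domain M" and f: "locally_lipschitz f" and L: "L-lipschitz_on {-1..1} f" "L > 0"
    and u0: "u0 \<in> borel_measurable borel" "lives_on M u0" "AE x in lborel. \<bar>u0 x\<bar> \<le> 1"
    and nu: "\<nu> > 0" and sol: "duhamel_solution M f \<nu> u0 u" and T: "T > 0"
  obtains U where "mild (\<lambda>r. (1 / \<nu>) *\<^sub>R f (clip 1 r)) (\<lambda>x. clip 1 (u0 x)) U T"
    "\<And>s. lives_on M (U s)" "\<And>t. 0 < t \<Longrightarrow> \<nu> * t < T \<Longrightarrow> AE x in lborel. u t x = U (\<nu> * t) x"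
proof -
  have cont: "continuous_on UNIV f"
    using local_lipschitz_continuous_on[OF f[unfolded locally_lipschitz_def]] by simp
  have fm[measurable]: "f \<in> borel_measurable borel" by (rule borel_measurable_continuous_onI[OF cont])
  note [measurable] = u0(1)
  \<comment> \<open>Extended by 0 to negative times, because the solution is known to be measurable
    on nonnegative times only.\<close>
  define w where "w = (\<lambda>p :: real \<times> (real ^ 'n). indicat_real ({0..} \<times> UNIV) p *\<^sub>R u (fst p) (snd p))"
  have cl: "({0..} :: real set) \<times> (UNIV :: (real ^ 'n) set) \<in> sets borel" by (intro borel_closed closed_Times) auto
  have wm[measurable]: "w \<in> borel_measurable (borel \<Otimes>\<^sub>M borel)"
    using sol cl unfolding duhamel_solution_def borel_prod w_def
    by (subst (asm) borel_measurable_restrict_space_iff) (auto simp: case_prod_beta')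
  \<comment> \<open>Time is measured in the unit in which the viscosity is 1.\<close>
  define v where "v = (\<lambda>s x. w (s / \<nu>, x))"
  have vm: "(\<lambda>p. v (fst p) (snd p)) \<in> borel_measurable (borel \<Otimes>\<^sub>M borel)"
    unfolding v_def by measurable
  note vs[measurable] = section_measurable[OF vm]
  have v_eq: "v s x = u (s / \<nu>) x" if "s \<ge> 0" for s x
    using that nu by (simp add: v_def w_def)
  have v_per: "lives_on M (v s)" for s
  proof (cases "s \<ge> 0")
    case True
    then have "v s = u (s / \<nu>)" by (auto simp: v_eq)
    moreover have "lives_on M (u (s / \<nu>))" using sol True nu by (simp add: duhamel_solution_def)
    ultimately show ?thesis by simp
  next
    case False
    then have "v s = (\<lambda>x. 0)" using nu by (auto simp: v_def w_def zero_le_divide_iff)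
    then show ?thesis by (cases M) (simp_all add: lives_on_def)
  qed
  have "T / \<nu> > 0" using T nu by simp
  then obtain B where B: "\<And>t. 0 < t \<Longrightarrow> t < T / \<nu> \<Longrightarrow> Linf_norm (domain_measure M) (u t) \<le> ereal B"
    using sol unfolding duhamel_solution_def by (metis greaterThanLessThan_iff)
  define b where "b = max B 1"
  have b: "b \<ge> 1" by (simp add: b_def)
  have vb: "AE x in lborel. \<bar>v s x\<bar> \<le> b" if s: "0 < s" "s < T" for s
  proof -
    have "Linf_norm (domain_measure M) (v s) \<le> ereal b"
    proof -
      have "Linf_norm (domain_measure M) (u (s / \<nu>)) \<le> ereal B" by (rule B) (use s nu in \<open>simp_all add: divide_strict_right_mono\<close>)
      also have "\<dots> \<le> ereal b" by (simp add: b_def)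
      also have "u (s / \<nu>) = v s" using s by (auto simp: v_eq)
      finally show ?thesis .
    qed
    from Linf_norm_AE[OF M v_per this] show ?thesis by simp
  qed
  obtain L' where L': "L'-lipschitz_on {-b..b} f" by (rule locally_lipschitz_compact[OF f compact_Icc])
  define L2 where "L2 = \<bar>L'\<bar> + 1"
  have L2: "L2-lipschitz_on {-b..b} f" "L2 > 0"
    using lipschitz_on_le[OF L', of L2] by (auto simp: L2_def)
  define Fb where "Fb = (\<lambda>r. (1 / \<nu>) *\<^sub>R f (clip b r))"
  define F1 where "F1 = (\<lambda>r. (1 / \<nu>) *\<^sub>R f (clip 1 r))"
  interpret Fb: flux Fb "(1 / \<nu>) * L2" "(1 / \<nu>) * (norm (f 0) + L2 * b)"
    unfolding Fb_def by (rule flux_clip[OF L2]) (use nu b in auto)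
  have [measurable]: "F1 \<in> borel_measurable borel" unfolding F1_def by measurable
  define u0' where "u0' = (\<lambda>x. clip 1 (u0 x))"
  have u0'm[measurable]: "u0' \<in> borel_measurable borel" unfolding u0'_def by measurable
  have u0'b: "\<bar>u0' x\<bar> \<le> 1" for x unfolding u0'_def by (rule clip_bound) simp
  have u0'_eq: "AE x in lborel. u0 x = u0' x"
    using u0(3) by eventually_elim (simp add: u0'_def clip_id)
  \<comment> \<open>The right-hand side of Duhamel's formula, evaluated at every point. It is the
    representative of v sought for, and v may be replaced by it inside the integral because
    convolutions do not see null sets.\<close>
  define U where "U = (\<lambda>t x. heat_op t u0' x - duhamel t (\<lambda>s y. Fb (v s y)) x)"
  have Fv: "(\<lambda>p. Fb (v (fst p) (snd p))) \<in> borel_measurable (borel \<Otimes>\<^sub>M borel)"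
    by (rule measurable_compose[OF vm Fb.F_measurable])
  have Um: "(\<lambda>p. U (fst p) (snd p)) \<in> borel_measurable (borel \<Otimes>\<^sub>M borel)"
    unfolding U_def by (intro borel_measurable_diff heat_op_measurable duhamel_measurable Fv) measurable
  note Us[measurable] = section_measurable[OF Um]
  have Uper: "lives_on M (U s)" for s
    unfolding U_def
    by (intro lives_on_comp2[where \<phi> = "(-)"] lives_on_heat_op lives_on_duhamel lives_on_comp[OF v_per])
       (simp add: u0'_def lives_on_comp[OF u0(2)])
  have Uv: "AE x in lborel. v s x = U s x" if s: "0 < s" "s < T" for s
  proof (rule AE_periodic[OF M])
    show "lives_on M (\<lambda>x. v s x = U s x)" by (rule lives_on_comp2[OF v_per Uper])
    \<comment> \<open>The change of the time variable contributes the factor 1 / \<nu>, which is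
      moved into the flux; the truncation at b changes nothing almost everywhere.\<close>
    have D: "(LINT q:{0..s / \<nu>}|lborel. divergence (heat_semigroup (\<nu> * (s / \<nu> - q)) (\<lambda>y. f (u q y))) x)
       = duhamel s (\<lambda>s y. Fb (v s y)) x" (is "?l = _") for x
    proof -
      let ?D = "\<lambda>q. divergence (heat_semigroup (\<nu> * (s / \<nu> - q)) (\<lambda>y. f (u q y))) x"
      have "?l = \<bar>1 / \<nu>\<bar> *\<^sub>R (LINT q|lborel. indicator {0..s / \<nu>} (0 + 1 / \<nu> * q) *\<^sub>R ?D (0 + 1 / \<nu> * q))"
        unfolding set_lebesgue_integral_def by (rule lborel_integral_real_affine) (use nu in simp)
      also have "\<dots> = (LINT q|lborel. (1 / \<nu>) * (indicator {0..s / \<nu>} (q / \<nu>) * ?D (q / \<nu>)))"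
        using nu by (simp add: integral_mult_right_zero)
      also have "\<dots> = duhamel s (\<lambda>s y. Fb (v s y)) x"
        unfolding duhamel_def
      \<comment> \<open>The closed time interval in the definition of a solution and the open one in
        \<open>duhamel\<close> differ in two instants.\<close>
      proof (rule integral_discrete_difference[where X = "{0, s}"])
        fix q :: real assume q: "q \<notin> {0, s}"
        show "(1 / \<nu>) * (indicator {0..s / \<nu>} (q / \<nu>) * ?D (q / \<nu>)) = indicator {0<..<s} q * grad_op (s - q) (\<lambda>y. Fb (v q y)) x"
        proof (cases "0 < q \<and> q < s")
          case True
          have "heat_semigroup (\<nu> * (s / \<nu> - q / \<nu>)) (\<lambda>y. f (u (q / \<nu>) y)) = heat_semigroup (s - q) (\<lambda>y. f (v q y))"
            using nu True by (simp add: right_diff_distrib v_eq)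
          also have "\<dots> = heat_semigroup (s - q) (\<lambda>y. f (clip b (v q y)))"
          proof
            fix x
            have "AE y in lborel. f (v q y) = f (clip b (v q y))"
              using vb[of q] True s by (auto elim: eventually_mono simp: clip_id)
            then show "heat_semigroup (s - q) (\<lambda>y. f (v q y)) x = heat_semigroup (s - q) (\<lambda>y. f (clip b (v q y))) x"
              using True by (subst (1 2) heat_semigroup_eq) (auto intro!: heat_op_cong_AE)
          qed
          finally have "?D (q / \<nu>) = divergence (heat_semigroup (s - q) (\<lambda>y. f (clip b (v q y)))) x" by simp
          also have "\<dots> = grad_op (s - q) (\<lambda>y. f (clip b (v q y))) x"
          proof (rule divergence_heat_semigroup)
            show "norm (f (clip b (v q y))) \<le> \<nu> * ((1 / \<nu>) * (norm (f 0) + L2 * b))" for y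
              using mult_left_mono[OF Fb.F_bounded[of "v q y"], of \<nu>] nu by (simp add: Fb_def)
          qed (use True in auto)
          also have "(1 / \<nu>) * \<dots> = grad_op (s - q) (\<lambda>y. Fb (v q y)) x"
            unfolding Fb_def by (rule grad_op_scaleR[symmetric])
          finally show ?thesis using True nu by (simp add: divide_right_mono)
        next
          case False
          then show ?thesis using q nu by (auto simp: indicator_def zero_le_divide_iff divide_le_cancel)
        qed
      qed auto
      finally show ?thesis .
    qed
    have "AE x in domain_measure M. u (s / \<nu>) x = heat_semigroup (\<nu> * (s / \<nu>)) u0 x - duhamel s (\<lambda>s y. Fb (v s y)) x"
    proof -
      have "\<forall>t\<ge>0. AE x in domain_measure M. u t x = heat_semigroup (\<nu> * t) u0 x
          - (LINT q:{0..t}|lborel. divergence (heat_semigroup (\<nu> * (t - q)) (\<lambda>y. f (u q y))) x)"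
        using sol unfolding duhamel_solution_def by blast
      moreover have "s / \<nu> \<ge> 0" using s nu by simp
      ultimately show ?thesis unfolding D[symmetric] by blast
    qed
    moreover have "heat_semigroup (\<nu> * (s / \<nu>)) u0 x = heat_op s u0' x" for x
      using s nu heat_op_cong_AE[OF u0(1) u0'm u0'_eq] by (simp add: heat_semigroup_eq)
    ultimately show "AE x in domain_measure M. v s x = U s x" using s by (simp add: v_eq U_def)
  qed
  have eq: "U t x = heat_op t u0' x - duhamel t (\<lambda>s y. Fb (U s y)) x" if "t < T" for t x
  proof -
    have "duhamel t (\<lambda>s y. Fb (v s y)) x = duhamel t (\<lambda>s y. Fb (U s y)) x"
    proof (rule duhamel_cong_AE)
      show "AE y in lborel. Fb (v s y) = Fb (U s y)" if "0 < s" "s < t" for s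
        using Uv[of s] that \<open>t < T\<close> by (auto elim: eventually_mono)
    qed measurable
    then show ?thesis by (simp add: U_def)
  qed
  have mb: "mild Fb u0' U T" unfolding mild_def using Um u0'm eq by blast
  \<comment> \<open>The maximum principle for the flux truncated at b bounds U by 1, so that the
    truncation at 1 agrees with it along U.\<close>
  have U1: "\<bar>U t x\<bar> \<le> 1" if "0 < t" "t < T" for t x by (rule Fb.mild_sup_bound[OF mb u0'b that])
  have "mild F1 u0' U T"
    unfolding mild_def
  proof (intro conjI allI impI Um u0'm)
    fix t x assume t: "0 < t" "t < T"
    have "duhamel t (\<lambda>s y. Fb (U s y)) x = duhamel t (\<lambda>s y. F1 (U s y)) x"
    proof (rule duhamel_cong_AE)
      show "AE y in lborel. Fb (U s y) = F1 (U s y)" if "0 < s" "s < t" for s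
        using U1[of s] that t b by (intro AE_I2) (simp add: Fb_def F1_def clip_id order_trans[OF U1 b])
    qed measurable
    then show "U t x = heat_op t u0' x - duhamel t (\<lambda>s y. F1 (U s y)) x" using eq[OF t(2)] by simp
  qed
  then show thesis
  proof (rule that[unfolded F1_def[symmetric] u0'_def[symmetric]])
    show "lives_on M (U s)" for s by (rule Uper)
    show "AE x in lborel. u t x = U (\<nu> * t) x" if "0 < t" "\<nu> * t < T" for t
      using Uv[of "\<nu> * t"] that nu by (simp add: v_eq)
  qed
qed

text \<open>For a step h along an axis the increments of the datum have mean at most h and mean
  square at most h^2, so both terms of \<open>mild_square_bound\<close> are multiples of h^2 and the
  quotients are bounded uniformly in h.\<close>

lemma (in flux) mild_weak_gradient:
  fixes g :: "real ^ 'n \<Rightarrow> real ^ 'n"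
  assumes D: "valid_domain D" and M: "mild F u0 U T" and m: "\<And>y. \<bar>u0 y\<bar> \<le> 1"
    and per: "\<And>s. lives_on D (U s)" and t: "0 < t" "t < T"
    and g: "has_weak_gradient D u0 g" "in_Lp 1 (domain_measure D) g" "in_Lp 2 (domain_measure D) g"
      "Lp_norm 1 (domain_measure D) g \<le> 1" "Lp_norm 2 (domain_measure D) g \<le> 1"
  shows "\<exists>Du. has_weak_gradient D (U t) Du \<and> in_Lp 2 (domain_measure D) Du \<and>
     (Lp_norm 2 (domain_measure D) Du)\<^sup>2 \<le> real CARD('n) * (4 + 24 * (heat_const TYPE('n))\<^sup>2 * K)"
proof -
  obtain L where "L \<ge> 0" and L: "\<And>x y. \<bar>U t x - U t y\<bar> \<le> L * norm (x - y)" by (rule mild_lipschitz_late[OF M m t]) (rule that)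
  show ?thesis
  proof (rule weak_gradient_from_dq[OF D])
    let ?C = "4 + 24 * (heat_const TYPE('n))\<^sup>2 * K"
    show C: "?C \<ge> 0" using K_pos by simp
    have Um: "(\<lambda>p. U (fst p) (snd p)) \<in> borel_measurable (borel \<Otimes>\<^sub>M borel)" and u0m: "u0 \<in> borel_measurable borel"
      using M by (auto simp: mild_def)
    have u0p: "lives_on D u0" and gp: "lives_on D g" and gl: "locally_integrable g" using g(1) by (auto simp: has_weak_gradient_def)
    note [measurable] = section_measurable[OF Um] locally_integrable_measurable[OF gl]
    show "U t \<in> borel_measurable borel" by measurable
    show "\<bar>U t y\<bar> \<le> 1" for y by (rule mild_sup_bound[OF M m t])
    show "lives_on D (U t)" by (rule per)
    show "\<bar>U t x - U t y\<bar> \<le> L * norm (x - y)" for x y by (rule L)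
    show "convergent (\<lambda>k. dq (U t) (axis i 1) k x)" for i x by (rule mild_dq_convergent[OF M m t])
    fix i k
    let ?h = "1 / real (Suc k)" and ?e = "axis i 1 :: real ^ 'n"
    have gim: "(\<lambda>x. g x $ i) \<in> borel_measurable borel" by measurable
    have gip: "lives_on D (\<lambda>x. g x $ i)" by (rule lives_on_comp[OF gp])
    have gI: "integrable lborel (\<lambda>x. indicator (cell D) x * g x $ i)"
      unfolding integrable_domain[symmetric]
    proof (rule integrable_dominated)
      show "integrable (domain_measure D) (\<lambda>x. norm (g x) powr 1)" using g(2) by (simp add: in_Lp_def)
      show "norm (g x $ i) \<le> norm (g x) powr 1" for x using component_le_norm_cart[of "g x" i] by simp
      show "(\<lambda>x. g x $ i) \<in> borel_measurable (domain_measure D)" by (rule measurable_domain[OF gim])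
    qed
    have wk: "(LINT x|lborel. indicator (cell D) x * (u0 x * partial_deriv i \<phi> x)) = - (LINT x|lborel. indicator (cell D) x * (g x $ i * \<phi> x))"
      if "test_function D \<phi>" for \<phi>
      using g(1) that unfolding has_weak_gradient_def integral_domain by blast
    have g1: "dint D (\<lambda>x. ennreal \<bar>g x $ i\<bar>) \<le> 1"
      by (rule order_trans[OF dint_mono dint_Lp_norm_le_1[OF g(2,4)]]) (use component_le_norm_cart in \<open>auto intro!: ennreal_leI\<close>)
    have g2: "dint D (\<lambda>x. ennreal ((g x $ i)\<^sup>2)) \<le> 1"
      by (rule order_trans[OF dint_mono dint_Lp_norm_le_1[OF g(3,5)]])
         (use component_le_norm_cart in \<open>auto intro!: ennreal_leI power2_le_iff_abs_le[THEN iffD2]\<close>)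
    note inc = weak_gradient_dint[OF D u0m m u0p gim gip gI wk, of ?h]
    have h: "?h \<ge> 0" by simp
    have i1: "dint D (\<lambda>x. ennreal \<bar>u0 (x + ?h *\<^sub>R ?e) - u0 x\<bar>) \<le> ennreal ?h"
      using order_trans[OF inc(1)[OF _ h] mult_left_mono[OF g1]] by simp
    have i2: "dint D (\<lambda>x. ennreal ((u0 (x + ?h *\<^sub>R ?e) - u0 x)\<^sup>2)) \<le> ennreal (?h\<^sup>2)"
      using order_trans[OF inc(2)[OF _ h] mult_left_mono[OF g2]] by simp
    have sq: "dint D (\<lambda>x. ennreal ((U t (x + ?h *\<^sub>R ?e) - U t x)\<^sup>2))
        \<le> ennreal (4 * ?h\<^sup>2 + 24 * heat_const TYPE('n) * heat_const TYPE('n) * K * 1 * norm (?h *\<^sub>R ?e) * ?h)"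
      by (rule mild_square_bound[OF D M m u0p per t i1 h i2]) simp
    have e: "4 * ?h\<^sup>2 + 24 * heat_const TYPE('n) * heat_const TYPE('n) * K * 1 * norm (?h *\<^sub>R ?e) * ?h = ?h\<^sup>2 * ?C"
      by (simp add: power2_eq_square algebra_simps del: of_nat_Suc)
    have "dint D (\<lambda>x. ennreal ((dq (U t) ?e k x)\<^sup>2)) = dint D (\<lambda>x. ennreal ((real (Suc k))\<^sup>2) * ennreal ((U t (x + ?h *\<^sub>R ?e) - U t x)\<^sup>2))"
      by (simp add: dq_def power_mult_distrib ennreal_mult mult.commute del: of_nat_Suc)
    also have "\<dots> = ennreal ((real (Suc k))\<^sup>2) * dint D (\<lambda>x. ennreal ((U t (x + ?h *\<^sub>R ?e) - U t x)\<^sup>2))"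
      by (rule dint_cmult) measurable
    also have "\<dots> \<le> ennreal ((real (Suc k))\<^sup>2) * ennreal (?h\<^sup>2 * ?C)"
      using sq unfolding e by (rule mult_left_mono) simp
    also have "\<dots> = ennreal ?C"
    proof -
      have "(real (Suc k))\<^sup>2 * (?h\<^sup>2 * ?C) = ?C" by (simp add: power_divide del: of_nat_Suc)
      then show ?thesis using C by (subst ennreal_mult[symmetric]) simp_all
    qed
    finally show "dint D (\<lambda>x. ennreal ((dq (U t) ?e k x)\<^sup>2)) \<le> ennreal ?C" .
  qed
qed

theorem theorem1p3:
  fixes \<Lambda> :: real
  assumes "\<Lambda> \<ge> 0"
  shows "\<exists>C0>0. \<forall>(f :: real \<Rightarrow> real ^ 'n::finite) (M :: domain)
            (u0 :: real ^ 'n \<Rightarrow> real) (Du0 :: real ^ 'n \<Rightarrow> real ^ 'n)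
            (\<nu> :: real) (u :: real \<Rightarrow> real ^ 'n \<Rightarrow> real).
     locally_lipschitz f \<longrightarrow>
     lip_norm {-1..1} f = \<Lambda> \<longrightarrow>
     (M = Whole_Space \<or> (\<exists>L\<ge>1. M = Torus L)) \<longrightarrow>
     lives_on M u0 \<longrightarrow>
     in_Linf (domain_measure M) u0 \<longrightarrow>
     has_weak_gradient M u0 Du0 \<longrightarrow>
     in_Lp 1 (domain_measure M) Du0 \<longrightarrow>
     in_Lp 2 (domain_measure M) Du0 \<longrightarrow>
     Linf_norm (domain_measure M) u0 \<le> 1 \<longrightarrow>
     Lp_norm 1 (domain_measure M) Du0 \<le> 1 \<longrightarrow>
     Lp_norm 2 (domain_measure M) Du0 \<le> 1 \<longrightarrow>
     \<nu> > 0 \<longrightarrow>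
     duhamel_solution M f \<nu> u0 u \<longrightarrow>
     (\<forall>t\<ge>0. \<exists>Du. has_weak_gradient M (u t) Du \<and>
        in_Lp 2 (domain_measure M) Du \<and>
        (Lp_norm 2 (domain_measure M) Du)\<^sup>2 \<le> C0 * (1 + inverse \<nu>))"
proof -
  let ?H2 = "(heat_const TYPE('n))\<^sup>2"
  \<comment> \<open>The summand 1 is added to \<Lambda> because the constant K of the flux has to be
    positive, also when \<Lambda> = 0.\<close>
  define C0 where "C0 = real CARD('n) * (4 + 24 * ?H2 * (\<Lambda> + 1))"
  have H2: "0 \<le> 24 * ?H2 * (\<Lambda> + 1)" using assms by simp
  have n1: "1 \<le> real CARD('n)" using zero_less_card_finite[where 'a = 'n] by linarith
  have C0: "1 \<le> C0" using mult_mono[OF n1, of 1 "4 + 24 * ?H2 * (\<Lambda> + 1)"] H2 unfolding C0_def by simp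
  have goal: "\<exists>Du. has_weak_gradient M (u t) Du \<and> in_Lp 2 (domain_measure M) Du \<and>
      (Lp_norm 2 (domain_measure M) Du)\<^sup>2 \<le> C0 * (1 + inverse \<nu>)"
    if f: "locally_lipschitz f" and lip: "lip_norm {-1..1} f = \<Lambda>" and D: "M = Whole_Space \<or> (\<exists>L\<ge>1. M = Torus L)"
      and g: "has_weak_gradient M u0 Du0" "in_Lp 1 (domain_measure M) Du0" "in_Lp 2 (domain_measure M) Du0"
        "Lp_norm 1 (domain_measure M) Du0 \<le> 1" "Lp_norm 2 (domain_measure M) Du0 \<le> 1"
      and u0: "Linf_norm (domain_measure M) u0 \<le> 1"
      and nu: "\<nu> > 0" and sol: "duhamel_solution M f \<nu> u0 u" and t: "t \<ge> 0"
    for f :: "real \<Rightarrow> real ^ 'n" and M u0 Du0 \<nu> u t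
  proof -
    have M: "valid_domain M" using D by (simp add: valid_domain_def)
    have per0: "lives_on M u0" and l0: "locally_integrable u0" using g(1) by (auto simp: has_weak_gradient_def)
    have pert: "lives_on M (u t)" using sol t by (simp add: duhamel_solution_def)
    note u0m[measurable] = locally_integrable_measurable[OF l0]
    have u0b: "AE x in lborel. \<bar>u0 x\<bar> \<le> 1"
      using Linf_norm_AE[OF M per0, of 1] u0 by (simp add: one_ereal_def)
    have utm: "u t \<in> borel_measurable borel"
    proof -
      have "(\<lambda>x. case (t, x) of (t, x) \<Rightarrow> u t x) \<in> borel_measurable borel"
      proof (rule measurable_compose[where f = "\<lambda>x. (t, x)"])
        show "(\<lambda>(t, x). u t x) \<in> borel_measurable (restrict_space borel ({0..} \<times> UNIV))"
          using sol by (simp add: duhamel_solution_def)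
        have pm: "(\<lambda>x :: real ^ 'n. (t, x)) \<in> borel \<rightarrow>\<^sub>M borel"
          unfolding borel_prod[symmetric] by measurable
        show "(\<lambda>x :: real ^ 'n. (t, x)) \<in> borel \<rightarrow>\<^sub>M restrict_space borel ({0..} \<times> UNIV)"
          using t pm by (intro measurable_restrict_space2) simp_all
      qed
      then show ?thesis by simp
    qed
    show ?thesis
    \<comment> \<open>At t = 0 the time integral is taken over a single instant, so the solution is
      the datum, whose own gradient satisfies the bound because C0 \<ge> 1.\<close>
    proof (cases "t = 0")
      case True
      have "AE x in domain_measure M. u 0 x = u0 x"
      proof -
        have "\<forall>t\<ge>0. AE x in domain_measure M. u t x = heat_semigroup (\<nu> * t) u0 x
            - (LINT q:{0..t}|lborel. divergence (heat_semigroup (\<nu> * (t - q)) (\<lambda>y. f (u q y))) x)"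
          using sol unfolding duhamel_solution_def by blast
        moreover have "(LINT q:{0..0}|lborel. divergence (heat_semigroup (\<nu> * (0 - q)) (\<lambda>y. f (u q y))) x) = 0" for x
        proof -
          have "AE q in lborel. q \<noteq> (0 :: real)" by (rule AE_lborel_singleton)
          then show ?thesis unfolding set_lebesgue_integral_def
            by (intro integral_eq_zero_AE) (auto elim!: eventually_mono)
        qed
        ultimately show ?thesis by (auto dest!: spec[of _ "0 :: real"] simp: heat_semigroup_def)
      qed
      then have "AE x in lborel. u 0 x = u0 x"
        by (rule AE_periodic[OF M lives_on_comp2[OF pert[unfolded True] per0]])
      then have wg: "has_weak_gradient M (u t) Du0"
        unfolding True by (rule has_weak_gradient_cong_AE[OF g(1) pert[unfolded True] utm[unfolded True]])
      have "0 \<le> Lp_norm 2 (domain_measure M) Du0" by (simp add: Lp_norm_def)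
      then have "(Lp_norm 2 (domain_measure M) Du0)\<^sup>2 \<le> 1" using g(5) by (simp add: power_le_one)
      also have "1 \<le> C0 * (1 + inverse \<nu>)"
        using mult_mono[OF C0, of 1 "1 + inverse \<nu>"] C0 nu by simp
      finally show ?thesis using wg g(3) by blast
    next
      case False
      then have t: "t > 0" using t by simp
      have lip1: "(\<Lambda> + 1)-lipschitz_on {-1..1} f"
        using lip_norm_lipschitz[OF f compact_Icc[of "-1" 1]] lip by (auto intro: lipschitz_on_le)
      have \<Lambda>1: "\<Lambda> + 1 > 0" using assms by simp
      \<comment> \<open>The horizon must lie beyond the rescaled time \<nu> * t, as
        \<open>mild\<close> excludes T itself; the 1 is arbitrary.\<close>
      have T: "\<nu> * t + 1 > 0" using nu t by (simp add: add_pos_pos)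
      obtain U where U: "mild (\<lambda>r. (1 / \<nu>) *\<^sub>R f (clip 1 r)) (\<lambda>x. clip 1 (u0 x)) U (\<nu> * t + 1)"
        "\<And>s. lives_on M (U s)" "\<And>s. 0 < s \<Longrightarrow> \<nu> * s < \<nu> * t + 1 \<Longrightarrow> AE x in lborel. u s x = U (\<nu> * s) x"
        using duhamel_solution_mild[OF M f lip1 \<Lambda>1 u0m per0 u0b nu sol T] by blast
      interpret flux "\<lambda>r. (1 / \<nu>) *\<^sub>R f (clip 1 r)" "(1 / \<nu>) * (\<Lambda> + 1)" "(1 / \<nu>) * (norm (f 0) + (\<Lambda> + 1) * 1)"
        by (rule flux_clip[OF lip1 \<Lambda>1]) (use nu in auto)
      have wg0: "has_weak_gradient M (\<lambda>x. clip 1 (u0 x)) Du0"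
        by (rule has_weak_gradient_cong_AE[OF g(1) lives_on_comp[OF per0]])
           (measurable, use u0b in \<open>auto elim!: eventually_mono simp: clip_id\<close>)
      have "\<exists>Du. has_weak_gradient M (U (\<nu> * t)) Du \<and> in_Lp 2 (domain_measure M) Du \<and>
          (Lp_norm 2 (domain_measure M) Du)\<^sup>2 \<le> real CARD('n) * (4 + 24 * ?H2 * ((1 / \<nu>) * (\<Lambda> + 1)))"
        by (rule mild_weak_gradient[OF M U(1) _ U(2) _ _ wg0 g(2-5)]) (use nu t in \<open>auto intro: clip_bound\<close>)
      then obtain Du where Du: "has_weak_gradient M (U (\<nu> * t)) Du" "in_Lp 2 (domain_measure M) Du"
        "(Lp_norm 2 (domain_measure M) Du)\<^sup>2 \<le> real CARD('n) * (4 + 24 * ?H2 * ((1 / \<nu>) * (\<Lambda> + 1)))" by blast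
      have "has_weak_gradient M (u t) Du"
        by (rule has_weak_gradient_cong_AE[OF Du(1) pert utm U(3)]) (use t in simp_all)
      moreover have "real CARD('n) * (4 + 24 * ?H2 * ((1 / \<nu>) * (\<Lambda> + 1))) \<le> C0 * (1 + inverse \<nu>)"
      proof -
        have "4 + 24 * ?H2 * ((1 / \<nu>) * (\<Lambda> + 1)) = 4 + (24 * ?H2 * (\<Lambda> + 1)) * inverse \<nu>" by (simp add: field_simps)
        also have "\<dots> \<le> (4 + 24 * ?H2 * (\<Lambda> + 1)) * (1 + inverse \<nu>)"
        proof -
          have "4 + X * i \<le> (4 + X) * (1 + i)" if "X \<ge> 0" "i \<ge> 0" for X i :: real
            using that by (simp add: algebra_simps)
          then show ?thesis using H2 nu by simp
        qed
        finally show ?thesis unfolding C0_def mult.assoc by (rule mult_left_mono) simp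
      qed
      ultimately show ?thesis using Du(2,3) order_trans by blast
    qed
  qed
  show ?thesis
    by (rule exI[of _ C0], intro conjI allI impI) (use C0 in simp, rule goal)
qed

end
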